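(* Let $d \in \{2,3\}$, let $\Omega \subset \mathbb{R}^d$ be a bounded Lipschitz domain, let $\mu,\lambda>0$, and let $\alpha \in (d-2,d)$. Let $K\in\mathbb{N}$, $K\ge 1$, $x_1,\dots,x_K\in\Omega$, $\mathbf{f}_1,\dots,\mathbf{f}_K\in\mathbb{R}^d$, and \[ \mathbf{f} = \sum_{k=1}^K \mathbf{f}_k\,\delta_{x_k}. \] Let $\varrho_\alpha(x) = \left(\min_{1\le k\le K}|x-x_k|\right)^\alpha$. Then there exists a unique $\mathbf{u} \in \mathbf{H}^1_0(\varrho_\alpha,\Omega)$ such that \[ \mu \int_\Omega \nabla \mathbf{u} : \nabla \mathbf{v} \, dx + (\mu + \lambda)\int_\Omega \operatorname{div} \mathbf{u} \, \operatorname{div} \mathbf{v} \, dx = \langle \mathbf{f}, \mathbf{v} \rangle \quad \text{for all } \mathbf{v} \in \mathbf{H}^1_0(\varrho_\alpha^{-1},\Omega). \]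
   Context: A weight is a nonnegative locally integrable function on $\mathbb{R}^d$; it belongs to the Muckenhoupt class $A_2$ if $\sup_B \left(\frac{1}{|B|}\int_B \omega\,dx\right)\left(\frac{1}{|B|}\int_B \omega^{-1}\,dx\right) < \infty$, the supremum being over all balls $B\subset\mathbb{R}^d$. The weight $\varrho_\alpha$ belongs to $A_2$ for $\alpha\in(-d,d)$, and $\varrho_\alpha^{-1}=\varrho_{-\alpha}$. For $\omega\in A_2$, $L^2(\omega,\Omega)$ is the Lebesgue space $L^2$ on $\Omega$ with respect to $\omega\,dx$; $H^1(\omega,\Omega) = \{ w \in L^2(\omega,\Omega) : \nabla w \in \mathbf{L}^2(\omega,\Omega)\}$ with norm $\left( \| w\|_{L^2(\omega,\Omega)}^2 + \| \nabla w \|_{\mathbf{L}^2(\omega,\Omega)}^2 \right)^{1/2}$; and $H^1_0(\omega,\Omega)$ is the closure of $C_0^\infty(\Omega)$ in $H^1(\omega,\Omega)$. Boldface denotes the spaces of vector-valued (or tensor-valued) functions with components in the scalar space; $\mathbf{H}^1_0(\omega,\Omega)$ consists of $\mathbb{R}^d$-valued functions. $\delta_x$ is the Dirac distribution supported at $x$. For $\alpha\in(d-2,d)$ the functional $\mathbf{v}\mapsto\sum_{k}\mathbf{f}_k\cdot\mathbf{v}(x_k)$, defined on smooth compactly supported $\mathbf{v}$, extends continuously to an element of the dual $(\mathbf{H}^1_0(\varrho_{-\alpha},\Omega))'$; $\langle\mathbf{f},\mathbf{v}\rangle$ denotes this duality pairing. The numbers $\mu,\lambda>0$ are the (constant) Lamé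 coefficients, and the equation is the weak form of the linear elasticity system with homogeneous Dirichlet boundary condition. *)

theory Defs
  imports "HOL-Analysis.Analysis" "HOL-Library.FuncSet"
begin

(* Functions on the domain Om are total functions on R^d whose values outside Om are irrelevant;
   elements of the function spaces are representatives, equality being equality a.e. on Om. *)

section \<open>Bounded Lipschitz domains\<close>

(* Near each boundary point, Om is the strict epigraph of a Lipschitz function in the direction e:
   the coordinates of y are its height y \<bullet> e and its projection to the hyperplane e^perp. *)
definition lipschitz_boundary :: "(real^'n) set \<Rightarrow> bool" where
  "lipschitz_boundary \<Omega> \<longleftrightarrow>
     (\<forall>p\<in>frontier \<Omega>. \<exists>r>0. \<exists>e \<gamma> L. norm e = 1 \<and> L-lipschitz_on {y. y \<bullet> e = 0} \<gamma> \<and>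
        \<Omega> \<inter> ball p r = {y \<in> ball p r. \<gamma> (y - (y \<bullet> e) *\<^sub>R e) < y \<bullet> e})"

definition bounded_lipschitz_domain :: "(real^'n) set \<Rightarrow> bool" where
  "bounded_lipschitz_domain \<Omega> \<longleftrightarrow>
     open \<Omega> \<and> connected \<Omega> \<and> \<Omega> \<noteq> {} \<and> bounded \<Omega> \<and> lipschitz_boundary \<Omega>"

section \<open>Test functions\<close>

definition partial_deriv :: "'n \<Rightarrow> (real^'n \<Rightarrow> real) \<Rightarrow> real^'n \<Rightarrow> real" where
  "partial_deriv i \<phi> x = frechet_derivative \<phi> (at x) (axis i 1)"

(* Partial derivatives of all orders exist and are totally differentiable, hence continuous. *)
definition smooth :: "(real^'n \<Rightarrow> real) \<Rightarrow> bool" where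
  "smooth \<phi> \<longleftrightarrow> (\<forall>is. foldr partial_deriv is \<phi> differentiable_on UNIV)"

definition test_functions :: "(real^'n) set \<Rightarrow> (real^'n \<Rightarrow> real) set" where
  "test_functions \<Omega> =
     {\<phi>. smooth \<phi> \<and> compact (closure {x. \<phi> x \<noteq> 0}) \<and> closure {x. \<phi> x \<noteq> 0} \<subseteq> \<Omega>}"

definition vec_test_functions :: "(real^'n) set \<Rightarrow> (real^'n \<Rightarrow> real^'n) set" where
  "vec_test_functions \<Omega> = {\<phi>. \<forall>i. (\<lambda>x. \<phi> x $ i) \<in> test_functions \<Omega>}"

section \<open>Weak derivatives\<close>

definition locally_integrable :: "(real^'n) set \<Rightarrow> (real^'n \<Rightarrow> real) \<Rightarrow> bool" where
  "locally_integrable \<Omega> w \<longleftrightarrow> (\<forall>C. compact C \<and> C \<subseteq> \<Omega> \<longrightarrow> w absolutely_integrable_on C)"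

definition has_weak_partial ::
    "(real^'n) set \<Rightarrow> 'n \<Rightarrow> (real^'n \<Rightarrow> real) \<Rightarrow> (real^'n \<Rightarrow> real) \<Rightarrow> bool" where
  "has_weak_partial \<Omega> i w g \<longleftrightarrow>
     locally_integrable \<Omega> w \<and> locally_integrable \<Omega> g \<and>
     (\<forall>\<phi>\<in>test_functions \<Omega>.
        (\<integral>x. w x * partial_deriv i \<phi> x \<partial>lebesgue_on \<Omega>) = - (\<integral>x. g x * \<phi> x \<partial>lebesgue_on \<Omega>))"

(* A representative: weak derivatives are unique up to null sets, and everything below depends
   only on the a.e. class. *)
definition weak_partial :: "(real^'n) set \<Rightarrow> 'n \<Rightarrow> (real^'n \<Rightarrow> real) \<Rightarrow> real^'n \<Rightarrow> real" where
  "weak_partial \<Omega> i w = (SOME g. has_weak_partial \<Omega> i w g)"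

definition weak_grad :: "(real^'n) set \<Rightarrow> (real^'n \<Rightarrow> real^'n) \<Rightarrow> real^'n \<Rightarrow> real^'n^'n" where
  "weak_grad \<Omega> u x = (\<chi> i j. weak_partial \<Omega> j (\<lambda>y. u y $ i) x)"

definition weak_div :: "(real^'n) set \<Rightarrow> (real^'n \<Rightarrow> real^'n) \<Rightarrow> real^'n \<Rightarrow> real" where
  "weak_div \<Omega> u x = (\<Sum>i\<in>UNIV. weak_partial \<Omega> i (\<lambda>y. u y $ i) x)"

section \<open>Weighted spaces\<close>

definition weighted_measure :: "(real^'n \<Rightarrow> real) \<Rightarrow> (real^'n) set \<Rightarrow> (real^'n) measure" where
  "weighted_measure \<omega> \<Omega> = density (lebesgue_on \<Omega>) (\<lambda>x. ennreal (\<omega> x))"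

definition L2 :: "(real^'n \<Rightarrow> real) \<Rightarrow> (real^'n) set \<Rightarrow> (real^'n \<Rightarrow> real) set" where
  "L2 \<omega> \<Omega> = {w \<in> borel_measurable (lebesgue_on \<Omega>).
                integrable (weighted_measure \<omega> \<Omega>) (\<lambda>x. (w x)\<^sup>2)}"

definition L2_sqnorm :: "(real^'n \<Rightarrow> real) \<Rightarrow> (real^'n) set \<Rightarrow> (real^'n \<Rightarrow> real) \<Rightarrow> real" where
  "L2_sqnorm \<omega> \<Omega> w = (\<integral>x. (w x)\<^sup>2 \<partial>weighted_measure \<omega> \<Omega>)"

definition H1 :: "(real^'n \<Rightarrow> real) \<Rightarrow> (real^'n) set \<Rightarrow> (real^'n \<Rightarrow> real) set" where
  "H1 \<omega> \<Omega> = {w \<in> L2 \<omega> \<Omega>. \<forall>i. \<exists>g\<in>L2 \<omega> \<Omega>. has_weak_partial \<Omega> i w g}"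

definition H1_norm :: "(real^'n \<Rightarrow> real) \<Rightarrow> (real^'n) set \<Rightarrow> (real^'n \<Rightarrow> real) \<Rightarrow> real" where
  "H1_norm \<omega> \<Omega> w =
     sqrt (L2_sqnorm \<omega> \<Omega> w + (\<Sum>i\<in>UNIV. L2_sqnorm \<omega> \<Omega> (weak_partial \<Omega> i w)))"

(* The closure of the test functions in H1; these lie in H1 whenever the weight is locally
   integrable, as every Muckenhoupt weight is. *)
definition H10 :: "(real^'n \<Rightarrow> real) \<Rightarrow> (real^'n) set \<Rightarrow> (real^'n \<Rightarrow> real) set" where
  "H10 \<omega> \<Omega> = {w \<in> H1 \<omega> \<Omega>. \<forall>\<epsilon>>0. \<exists>\<phi>\<in>test_functions \<Omega>. H1_norm \<omega> \<Omega> (\<lambda>x. w x - \<phi> x) < \<epsilon>}"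

definition vec_H10 :: "(real^'n \<Rightarrow> real) \<Rightarrow> (real^'n) set \<Rightarrow> (real^'n \<Rightarrow> real^'n) set" where
  "vec_H10 \<omega> \<Omega> = {u. \<forall>i. (\<lambda>x. u x $ i) \<in> H10 \<omega> \<Omega>}"

definition vec_H1_norm :: "(real^'n \<Rightarrow> real) \<Rightarrow> (real^'n) set \<Rightarrow> (real^'n \<Rightarrow> real^'n) \<Rightarrow> real" where
  "vec_H1_norm \<omega> \<Omega> u = sqrt (\<Sum>i\<in>UNIV. (H1_norm \<omega> \<Omega> (\<lambda>x. u x $ i))\<^sup>2)"

section \<open>Dual space and point loads\<close>

(* Functionals are normalised outside the space so that they are determined by their values on it;
   boundedness makes them respect a.e. equality. *)
definition vec_H10_dual ::
    "(real^'n \<Rightarrow> real) \<Rightarrow> (real^'n) set \<Rightarrow> ((real^'n \<Rightarrow> real^'n) \<Rightarrow> real) set" where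
  "vec_H10_dual \<omega> \<Omega> =
     {F \<in> extensional (vec_H10 \<omega> \<Omega>).
        (\<forall>u\<in>vec_H10 \<omega> \<Omega>. \<forall>v\<in>vec_H10 \<omega> \<Omega>. F (\<lambda>x. u x + v x) = F u + F v) \<and>
        (\<forall>c. \<forall>v\<in>vec_H10 \<omega> \<Omega>. F (\<lambda>x. c *\<^sub>R v x) = c * F v) \<and>
        (\<exists>C. \<forall>v\<in>vec_H10 \<omega> \<Omega>. \<bar>F v\<bar> \<le> C * vec_H1_norm \<omega> \<Omega> v)}"

(* The continuous extension of the sum of the Dirac masses f k at x k from test functions to the
   whole space. *)
definition dirac_load ::
    "(real^'n \<Rightarrow> real) \<Rightarrow> (real^'n) set \<Rightarrow> nat \<Rightarrow> (nat \<Rightarrow> real^'n) \<Rightarrow> (nat \<Rightarrow> real^'n) \<Rightarrow>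
     (real^'n \<Rightarrow> real^'n) \<Rightarrow> real" where
  "dirac_load \<omega> \<Omega> K f x =
     (THE F. F \<in> vec_H10_dual \<omega> \<Omega> \<and>
             (\<forall>\<phi>\<in>vec_test_functions \<Omega>. F \<phi> = (\<Sum>k=1..K. f k \<bullet> \<phi> (x k))))"

definition dist_weight :: "nat \<Rightarrow> (nat \<Rightarrow> real^'n) \<Rightarrow> real \<Rightarrow> real^'n \<Rightarrow> real" where
  "dist_weight K x \<alpha> y = (Min ((\<lambda>k. norm (y - x k)) ` {1..K})) powr \<alpha>"

section \<open>Weak form of the Lame system\<close>

(* The inner product of matrices is the Frobenius product. *)
definition lame_form ::
    "real \<Rightarrow> real \<Rightarrow> (real^'n) set \<Rightarrow> (real^'n \<Rightarrow> real^'n) \<Rightarrow> (real^'n \<Rightarrow> real^'n) \<Rightarrow> real" where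
  "lame_form \<mu> lam \<Omega> u v =
     \<mu> * (\<integral>y. weak_grad \<Omega> u y \<bullet> weak_grad \<Omega> v y \<partial>lebesgue_on \<Omega>) +
     (\<mu> + lam) * (\<integral>y. weak_div \<Omega> u y * weak_div \<Omega> v y \<partial>lebesgue_on \<Omega>)"

end

theory Submission
  imports Defs
begin

text \<open>
  Since $d \ge 2$, the exponent $\<alpha>$ is positive. So the weight $\<rho>$ is bounded on the domain, its inverse
  is bounded below, and $H^1_0(\<rho>^{-1}) \subseteq H^1_0 \subseteq H^1_0(\<rho>)$. Both weights are integrable because
  $\<alpha> < d$. Away from the points all three spaces look alike, so only the behaviour near the
  points is at stake, and there the problem can be treated with Kelvin's fundamental solution.

  Existence. Kelvin's matrix $E$ satisfies $|\<nabla> E| = O(|x|^{1-d})$, and $|x|^{2 - 2d + \<alpha>}$ is integrable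
  because $\<alpha> > d - 2$; so the columns of $E$, centred at the points and cut off inside the domain, lie
  in $H^1_0(\<rho>)$ (\<open>parametrix_H10_approximation\<close>). The Lame operator maps them to Dirac masses plus
  bounded functions, the latter coming from derivatives of the cutoff (\<open>lame_form_parametrix_limit\<close>).
  A function in the unweighted space with finite energy, found by minimisation
  (\<open>lame_bounded_load_solvable\<close>), removes these. The resulting function solves the equation for smooth
  test functions; its Lame form is a bounded functional on $H^1_0(\<rho>^{-1})$ that extends the load, and by
  density the only one (\<open>dirac_load_eq_lame_form\<close>). So the equation holds on the whole space.

  Uniqueness. A difference $w$ of two solutions satisfies the homogeneous equation for all test functions.
  By Weyl's lemma it is smooth near the points (\<open>lame_homogeneous_smooth\<close>). Splitting $w$ by a cutoff
  shows that it belongs to $H^1_0(\<rho>^{-1})$ as well, so that $w$ may be inserted into its own equation, and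
  coercivity gives $w = 0$ (\<open>lame_homogeneous_zero\<close>).

  Both parts rest on one computation (\<open>lame_kelvin\<close>, \<open>lame_operator_parametrix\<close>): a regularisation of $E$
  that is smooth on the whole space and that the Lame operator maps exactly to an approximate Dirac mass
  times the identity matrix. Each approximant can
  be cut off to a test function, so the spaces, which are closures of test functions, contain the limit,
  and every identity with the singular matrix is a limit of identities between smooth functions.
\<close>

section \<open>Calculus of smooth functions\<close>

text \<open>Smoothness on an open set is built up from finite orders, peeling off the innermost derivative:
  closure properties then follow by induction on the order.\<close>

fun times_differentiable_on :: "nat \<Rightarrow> (real^'n) set \<Rightarrow> (real^'n \<Rightarrow> real) \<Rightarrow> bool" where
  "times_differentiable_on 0 S f \<longleftrightarrow> f differentiable_on S"
| "times_differentiable_on (Suc n) S f \<longleftrightarrow>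
     f differentiable_on S \<and> (\<forall>i. times_differentiable_on n S (partial_deriv i f))"

definition smooth_on :: "(real^'n) set \<Rightarrow> (real^'n \<Rightarrow> real) \<Rightarrow> bool" where
  "smooth_on S f \<longleftrightarrow> (\<forall>n. times_differentiable_on n S f)"

lemma times_differentiable_on_imp_differentiable_on:
  "times_differentiable_on n S f \<Longrightarrow> f differentiable_on S"
  by (cases n) auto

lemma times_differentiable_on_Suc_imp:
  "times_differentiable_on (Suc n) S f \<Longrightarrow> times_differentiable_on n S f"
  by (induction n arbitrary: f) auto

lemma times_differentiable_on_iff_foldr:
  "times_differentiable_on n S f \<longleftrightarrow>
     (\<forall>is. length is \<le> n \<longrightarrow> foldr partial_deriv is f differentiable_on S)"
proof (induction n arbitrary: f)
  case 0
  show ?case by simp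
next
  case (Suc n)
  show ?case
  proof
    assume L: "times_differentiable_on (Suc n) S f"
    show "\<forall>is. length is \<le> Suc n \<longrightarrow> foldr partial_deriv is f differentiable_on S"
    proof (intro allI impI)
      fix "is" :: "'a list"
      assume len: "length is \<le> Suc n"
      show "foldr partial_deriv is f differentiable_on S"
      proof (cases "is" rule: rev_cases)
        case Nil
        then show ?thesis using L by simp
      next
        case (snoc js j)
        then have "length js \<le> n" using len by simp
        moreover have "times_differentiable_on n S (partial_deriv j f)" using L by simp
        ultimately show ?thesis unfolding snoc using Suc.IH by simp
      qed
    qed
  next
    assume R: "\<forall>is. length is \<le> Suc n \<longrightarrow> foldr partial_deriv is f differentiable_on S"
    have "f differentiable_on S" using R[rule_format, of "[]"] by simp
    moreover have "times_differentiable_on n S (partial_deriv i f)" for i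
      unfolding Suc.IH
    proof (intro allI impI)
      fix "is" :: "'a list"
      assume "length is \<le> n"
      then show "foldr partial_deriv is (partial_deriv i f) differentiable_on S"
        using R[rule_format, of "is @ [i]"] by simp
    qed
    ultimately show "times_differentiable_on (Suc n) S f" by simp
  qed
qed

lemma smooth_iff_smooth_on_UNIV: "smooth f \<longleftrightarrow> smooth_on UNIV f"
  unfolding smooth_def smooth_on_def times_differentiable_on_iff_foldr by auto

lemma smooth_on_imp_differentiable:
  assumes "smooth_on S f" "open S" "x \<in> S"
  shows "f differentiable (at x)"
  using assms times_differentiable_on_imp_differentiable_on[of 0 S f]
  unfolding smooth_on_def by (auto simp: differentiable_on_eq_differentiable_at)

lemma smooth_on_partial_deriv: "smooth_on S f \<Longrightarrow> smooth_on S (partial_deriv i f)"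
  unfolding smooth_on_def by (meson times_differentiable_on.simps(2))

lemma smooth_on_imp_continuous_on: "smooth_on S f \<Longrightarrow> continuous_on S f"
  unfolding smooth_on_def
  using differentiable_imp_continuous_on times_differentiable_on_imp_differentiable_on by blast

lemma times_differentiable_on_subset:
  "times_differentiable_on n S f \<Longrightarrow> T \<subseteq> S \<Longrightarrow> times_differentiable_on n T f"
  by (induction n arbitrary: f) (auto intro: differentiable_on_subset)

lemma smooth_on_subset: "smooth_on S f \<Longrightarrow> T \<subseteq> S \<Longrightarrow> smooth_on T f"
  unfolding smooth_on_def using times_differentiable_on_subset by blast

lemma times_differentiable_on_Un:
  "times_differentiable_on n S f \<Longrightarrow> times_differentiable_on n T f \<Longrightarrow> open S \<Longrightarrow> open T \<Longrightarrow>
   times_differentiable_on n (S \<union> T) f"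
  by (induction n arbitrary: f) (auto simp: differentiable_on_eq_differentiable_at open_Un)

lemma smooth_on_Un:
  "smooth_on S f \<Longrightarrow> smooth_on T f \<Longrightarrow> open S \<Longrightarrow> open T \<Longrightarrow> smooth_on (S \<union> T) f"
  unfolding smooth_on_def using times_differentiable_on_Un by blast

lemma partial_deriv_eq: "(f has_derivative D) (at x) \<Longrightarrow> partial_deriv i f x = D (axis i 1)"
  unfolding partial_deriv_def using frechet_derivative_at by metis

lemma has_derivative_frechet:
  "f differentiable (at x) \<Longrightarrow> (f has_derivative frechet_derivative f (at x)) (at x)"
  using frechet_derivative_works by blast

lemma partial_deriv_cong_open:
  assumes "f differentiable (at x)" "open S" "x \<in> S" "\<And>y. y \<in> S \<Longrightarrow> f y = g y"
  shows "partial_deriv i f x = partial_deriv i g x"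
  unfolding partial_deriv_def using frechet_derivative_transform_within_open[OF assms] by simp

lemma differentiable_on_eq_cong:
  "f differentiable_on S \<Longrightarrow> (\<And>x. x \<in> S \<Longrightarrow> f x = g x) \<Longrightarrow> g differentiable_on S"
  unfolding differentiable_on_def differentiable_def
  using has_derivative_transform[of _ S g f] by fastforce

lemma times_differentiable_on_cong:
  assumes "open S" "\<And>x. x \<in> S \<Longrightarrow> f x = g x" "times_differentiable_on n S f"
  shows "times_differentiable_on n S g"
  using assms(2,3)
proof (induction n arbitrary: f g)
  case 0
  then show ?case using differentiable_on_eq_cong[of f S g] by simp
next
  case (Suc n)
  have "g differentiable_on S" using Suc.prems differentiable_on_eq_cong[of f S g] by simp
  moreover have "times_differentiable_on n S (partial_deriv i g)" for i
  proof (rule Suc.IH)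
    show "times_differentiable_on n S (partial_deriv i f)" using Suc.prems by simp
    show "partial_deriv i f x = partial_deriv i g x" if "x \<in> S" for x
      by (rule partial_deriv_cong_open[OF _ assms(1) that])
        (use Suc.prems that assms(1) in \<open>auto simp: differentiable_on_eq_differentiable_at\<close>)
  qed
  ultimately show ?case by simp
qed

lemma smooth_on_cong:
  "open S \<Longrightarrow> (\<And>x. x \<in> S \<Longrightarrow> f x = g x) \<Longrightarrow> smooth_on S f \<Longrightarrow> smooth_on S g"
  unfolding smooth_on_def using times_differentiable_on_cong by blast

lemma partial_deriv_const: "partial_deriv i (\<lambda>x. c) = (\<lambda>x. 0)"
  by (rule ext, rule partial_deriv_eq[THEN trans]) (rule derivative_intros, simp)

lemma smooth_on_const [intro, simp]: "smooth_on S (\<lambda>x. c)"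
proof -
  have "times_differentiable_on n S (\<lambda>x. c)" for n
    by (induction n arbitrary: c) (auto simp: partial_deriv_const)
  then show ?thesis unfolding smooth_on_def by blast
qed

lemma partial_deriv_add:
  assumes "f differentiable (at x)" "g differentiable (at x)"
  shows "partial_deriv i (\<lambda>x. f x + g x) x = partial_deriv i f x + partial_deriv i g x"
  using partial_deriv_eq[OF has_derivative_add[OF assms[THEN has_derivative_frechet]]]
  unfolding partial_deriv_def by simp

lemma partial_deriv_mult:
  assumes "f differentiable (at x)" "g differentiable (at x)"
  shows "partial_deriv i (\<lambda>x. f x * g x) x = f x * partial_deriv i g x + partial_deriv i f x * g x"
  using partial_deriv_eq[OF has_derivative_mult[OF assms[THEN has_derivative_frechet]]]
  unfolding partial_deriv_def by simp

lemma partial_deriv_cmult: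
  assumes "f differentiable (at x)"
  shows "partial_deriv i (\<lambda>x. c * f x) x = c * partial_deriv i f x"
  using partial_deriv_mult[of "\<lambda>x. c" x f i] assms by (simp add: partial_deriv_const)

lemma partial_deriv_diff:
  assumes "f differentiable (at x)" "g differentiable (at x)"
  shows "partial_deriv i (\<lambda>x. f x - g x) x = partial_deriv i f x - partial_deriv i g x"
  using partial_deriv_eq[OF has_derivative_diff[OF assms[THEN has_derivative_frechet]]]
  unfolding partial_deriv_def by simp

lemma partial_deriv_sum:
  assumes "\<And>j. j \<in> J \<Longrightarrow> f j differentiable (at x)"
  shows "partial_deriv i (\<lambda>x. \<Sum>j\<in>J. f j x) x = (\<Sum>j\<in>J. partial_deriv i (f j) x)"
  using partial_deriv_eq[OF has_derivative_sum[of J f "\<lambda>j. frechet_derivative (f j) (at x)"],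
      OF assms[THEN has_derivative_frechet]]
  unfolding partial_deriv_def by simp

lemma partial_deriv_compose_real:
  assumes "(g has_real_derivative g') (at (f x))" "f differentiable (at x)"
  shows "partial_deriv i (\<lambda>x. g (f x)) x = g' * partial_deriv i f x"
proof -
  have "((\<lambda>x. g (f x)) has_derivative (\<lambda>h. g' * frechet_derivative f (at x) h)) (at x)"
    using has_derivative_compose[OF has_derivative_frechet[OF assms(2)]
        assms(1)[unfolded has_field_derivative_def]] .
  from partial_deriv_eq[OF this] show ?thesis unfolding partial_deriv_def by simp
qed

lemma partial_deriv_component: "partial_deriv i (\<lambda>x. x $ j) x = (if i = j then 1 else 0)"
proof -
  have "((\<lambda>x::real^'a. x $ j) has_derivative (\<lambda>h. h $ j)) (at x)"
    by (intro bounded_linear_imp_has_derivative bounded_linear_vec_nth)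
  from partial_deriv_eq[OF this, of i] show ?thesis by (auto simp: axis_def)
qed

lemma times_differentiable_on_add:
  assumes "open S" 
  shows "times_differentiable_on n S f \<Longrightarrow> times_differentiable_on n S g \<Longrightarrow>
      times_differentiable_on n S (\<lambda>x. f x + g x)"
proof (induction n arbitrary: f g)
  case 0
  then show ?case by (simp add: differentiable_on_add)
next
  case (Suc n)
  have "times_differentiable_on n S (partial_deriv i (\<lambda>x. f x + g x))" for i
  proof (rule times_differentiable_on_cong[OF assms(1)])
    show "times_differentiable_on n S (\<lambda>x. partial_deriv i f x + partial_deriv i g x)"
      using Suc by simp
    show "partial_deriv i f x + partial_deriv i g x = partial_deriv i (\<lambda>x. f x + g x) x"
      if "x \<in> S" for x
      by (rule partial_deriv_add[symmetric])
        (use Suc.prems that assms(1) in \<open>auto simp: differentiable_on_eq_differentiable_at\<close>)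
  qed
  then show ?case using Suc.prems by (simp add: differentiable_on_add)
qed

lemma times_differentiable_on_mult:
  assumes "open S" 
  shows "times_differentiable_on n S f \<Longrightarrow> times_differentiable_on n S g \<Longrightarrow>
      times_differentiable_on n S (\<lambda>x. f x * g x)"
proof (induction n arbitrary: f g)
  case 0
  then show ?case by (simp add: differentiable_on_mult)
next
  case (Suc n)
  have "times_differentiable_on n S (partial_deriv i (\<lambda>x. f x * g x))" for i
  proof (rule times_differentiable_on_cong[OF assms(1)])
    show "times_differentiable_on n S (\<lambda>x. f x * partial_deriv i g x + partial_deriv i f x * g x)"
      using Suc.prems
      by (intro times_differentiable_on_add[OF assms] Suc.IH)
        (auto intro: times_differentiable_on_Suc_imp[of n, simplified])
    show "f x * partial_deriv i g x + partial_deriv i f x * g x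
        = partial_deriv i (\<lambda>x. f x * g x) x" if "x \<in> S" for x
      by (rule partial_deriv_mult[symmetric])
        (use Suc.prems that assms(1) in \<open>auto simp: differentiable_on_eq_differentiable_at\<close>)
  qed
  then show ?case using Suc.prems by (simp add: differentiable_on_mult)
qed

lemma smooth_on_add:
  "open S \<Longrightarrow> smooth_on S f \<Longrightarrow> smooth_on S g \<Longrightarrow> smooth_on S (\<lambda>x. f x + g x)"
  unfolding smooth_on_def using times_differentiable_on_add by blast

lemma smooth_on_mult:
  "open S \<Longrightarrow> smooth_on S f \<Longrightarrow> smooth_on S g \<Longrightarrow> smooth_on S (\<lambda>x. f x * g x)"
  unfolding smooth_on_def using times_differentiable_on_mult by blast

lemma smooth_on_cmult: "open S \<Longrightarrow> smooth_on S f \<Longrightarrow> smooth_on S (\<lambda>x. c * f x)"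
  by (intro smooth_on_mult smooth_on_const)

lemma smooth_on_diff:
  assumes "open S" "smooth_on S f" "smooth_on S g"
  shows "smooth_on S (\<lambda>x. f x - g x)"
  using smooth_on_add[OF assms(1,2) smooth_on_cmult[OF assms(1,3), of "-1"]] by simp

lemma smooth_on_sum:
  "open S \<Longrightarrow> (\<And>j. j \<in> J \<Longrightarrow> smooth_on S (f j)) \<Longrightarrow> smooth_on S (\<lambda>x. \<Sum>j\<in>J. f j x)"
  by (induction J rule: infinite_finite_induct) (auto intro: smooth_on_add)

lemma smooth_on_prod:
  "open S \<Longrightarrow> (\<And>j. j \<in> J \<Longrightarrow> smooth_on S (f j)) \<Longrightarrow> smooth_on S (\<lambda>x. \<Prod>j\<in>J. f j x)"
  by (induction J rule: infinite_finite_induct) (auto intro: smooth_on_mult)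

lemma smooth_on_component: "smooth_on S (\<lambda>x. x $ j)"
proof -
  have "times_differentiable_on n S (\<lambda>x. x $ j)" for n
  proof (cases n)
    case 0
    then show ?thesis
      by (auto intro!: linear_imp_differentiable_on bounded_linear.linear bounded_linear_vec_nth)
  next
    case (Suc m)
    have "partial_deriv i (\<lambda>x. x $ j) = (\<lambda>x. if i = j then 1 else 0)" for i :: 'a
      by (rule ext) (rule partial_deriv_component)
    then show ?thesis unfolding Suc using smooth_on_const[unfolded smooth_on_def]
      by (auto intro!: linear_imp_differentiable_on bounded_linear.linear bounded_linear_vec_nth)
  qed
  then show ?thesis unfolding smooth_on_def by blast
qed

text \<open>The witness is the whole sequence of derivatives: induction on the order then needs no fact about
  derivatives of derivatives.\<close>
definition smooth_real_on :: "real set \<Rightarrow> (real \<Rightarrow> real) \<Rightarrow> bool" where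
  "smooth_real_on T g \<longleftrightarrow>
     (\<exists>G. G 0 = g \<and> (\<forall>m::nat. \<forall>t\<in>T. (G m has_real_derivative G (Suc m) t) (at t)))"

lemma smooth_on_compose:
  assumes "open S" "smooth_real_on T g" "smooth_on S f" "\<And>x. x \<in> S \<Longrightarrow> f x \<in> T"
  shows "smooth_on S (\<lambda>x. g (f x))"
proof -
  obtain G where G0: "G 0 = g"
    and G: "\<And>m t. t \<in> T \<Longrightarrow> (G m has_real_derivative G (Suc m) t) (at t)"
    using assms(2) unfolding smooth_real_on_def by blast
  have D: "(\<lambda>x. G m (f x)) differentiable_on S" for m
  proof -
    have "(\<lambda>x. G m (f x)) differentiable (at x)" if "x \<in> S" for x
      using has_derivative_compose[OF has_derivative_frechet
          [OF smooth_on_imp_differentiable[OF assms(3,1) that]]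
          G[OF assms(4)[OF that], of m, unfolded has_field_derivative_def]]
      unfolding differentiable_def by blast
    then show ?thesis using assms(1) by (auto simp: differentiable_on_eq_differentiable_at)
  qed
  have "times_differentiable_on n S (\<lambda>x. G m (f x))" for n m
  proof (induction n arbitrary: m)
    case 0
    then show ?case using D by simp
  next
    case (Suc n)
    have "times_differentiable_on n S (partial_deriv i (\<lambda>x. G m (f x)))" for i
    proof (rule times_differentiable_on_cong[OF assms(1)])
      show "times_differentiable_on n S (\<lambda>x. G (Suc m) (f x) * partial_deriv i f x)"
        using smooth_on_partial_deriv[OF assms(3)] unfolding smooth_on_def
        by (intro times_differentiable_on_mult[OF assms(1)] Suc.IH) blast
      show "G (Suc m) (f x) * partial_deriv i f x = partial_deriv i (\<lambda>x. G m (f x)) x"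
        if "x \<in> S" for x
        by (rule partial_deriv_compose_real[OF G, symmetric])
          (use assms that smooth_on_imp_differentiable in auto)
    qed
    then show ?case using D by simp
  qed
  then show ?thesis unfolding smooth_on_def G0[symmetric] by blast
qed

lemma smooth_real_on_powr: "smooth_real_on {0<..} (\<lambda>t. t powr a)"
  unfolding smooth_real_on_def
proof (intro exI conjI allI ballI)
  let ?G = "\<lambda>m t. (\<Prod>k<m. a - real k) * t powr (a - real m)"
  show "?G 0 = (\<lambda>t. t powr a)" by simp
  fix m t assume "t \<in> {0::real<..}"
  then show "(?G m has_real_derivative ?G (Suc m) t) (at t)"
    by (auto intro!: derivative_eq_intros simp: algebra_simps)
qed

lemma smooth_real_on_Suc:
  assumes "\<And>t. t \<in> T \<Longrightarrow> (g has_real_derivative h t) (at t)" "smooth_real_on T h"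
  shows "smooth_real_on T g"
proof -
  obtain G where "G 0 = h" "\<And>m t. t \<in> T \<Longrightarrow> (G m has_real_derivative G (Suc m) t) (at t)"
    using assms(2) unfolding smooth_real_on_def by blast
  then show ?thesis
    unfolding smooth_real_on_def using assms(1)
    by (intro exI[of _ "\<lambda>m. case m of 0 \<Rightarrow> g | Suc k \<Rightarrow> G k"]) (auto split: nat.splits)
qed

lemma smooth_real_on_cmult:
  assumes "smooth_real_on T g"
  shows "smooth_real_on T (\<lambda>t. c * g t)"
proof -
  obtain G where "G 0 = g" "\<And>m t. t \<in> T \<Longrightarrow> (G m has_real_derivative G (Suc m) t) (at t)"
    using assms unfolding smooth_real_on_def by blast
  then show ?thesis
    unfolding smooth_real_on_def
    by (intro exI[of _ "\<lambda>m t. c * G m t"]) (auto intro!: DERIV_cmult)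
qed

section \<open>Cutoff functions\<close>

text \<open>All derivatives vanish at 0, which is what makes functions with compact support that are smooth in
  the sense of iterated partial derivatives available.\<close>
definition flat_exp :: "real \<Rightarrow> real" where
  "flat_exp t = (if t > 0 then exp (- inverse t) else 0)"

lemma poly_div_exp_tendsto_0: "((\<lambda>s::real. poly p s * exp (- s)) \<longlongrightarrow> 0) at_top"
proof -
  have "((\<lambda>s::real. s ^ k * poly p s * exp (- s)) \<longlongrightarrow> 0) at_top" for k
  proof (induction p arbitrary: k)
    case 0
    show ?case by simp
  next
    case (pCons a p)
    have "((\<lambda>s::real. a * (s ^ k / exp s) + s ^ Suc k * poly p s * exp (- s)) \<longlongrightarrow> a * 0 + 0) at_top"
      by (intro tendsto_intros tendsto_power_div_exp_0 pCons.IH)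
    then show ?case by (simp add: exp_minus field_simps)
  qed
  from this[of 0] show ?thesis by simp
qed

lemma smooth_real_on_flat_exp: "smooth_real_on UNIV flat_exp"
proof -
  define P :: "nat \<Rightarrow> real poly" where "P = rec_nat 1 (\<lambda>_ p. [:0, 0, 1:] * (p - pderiv p))"
  have P0: "P 0 = 1" and PS: "P (Suc m) = [:0, 0, 1:] * (P m - pderiv (P m))" for m
    unfolding P_def by auto
  let ?G = "\<lambda>m t. if t > 0 then poly (P m) (inverse t) * exp (- inverse t) else 0"
  have pos: "(?G m has_real_derivative ?G (Suc m) t) (at t)" if "t > 0" for m t
  proof -
    have "((\<lambda>t. poly (P m) (inverse t) * exp (- inverse t)) has_real_derivative ?G (Suc m) t) (at t)"
      using that
      by (auto intro!: derivative_eq_intros simp: PS algebra_simps power2_eq_square)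
    then show ?thesis
      by (rule has_field_derivative_transform_within_open[where S = "{0<..}"]) (use that in auto)
  qed
  have neg: "(?G m has_real_derivative ?G (Suc m) t) (at t)" if "t < 0" for m t
  proof -
    have "((\<lambda>t. 0) has_real_derivative ?G (Suc m) t) (at t)"
      using that by auto
    then show ?thesis
      by (rule has_field_derivative_transform_within_open[where S = "{..<0}"]) (use that in auto)
  qed
  have zero: "(?G m has_real_derivative ?G (Suc m) 0) (at 0)" for m
  proof -
    have "((\<lambda>h. (?G m (0 + h) - ?G m 0) / h) \<longlongrightarrow> 0) (at 0)"
    proof (rule filterlim_split_at)
      show "((\<lambda>h. (?G m (0 + h) - ?G m 0) / h) \<longlongrightarrow> 0) (at_left 0)"
        by (rule tendsto_eventually) (auto simp: eventually_at_filter)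
      have "((\<lambda>h. poly ([:0, 1:] * P m) (inverse h) * exp (- inverse h)) \<longlongrightarrow> 0) (at_right 0)"
        by (rule filterlim_compose[OF poly_div_exp_tendsto_0 filterlim_inverse_at_top_right])
      then show "((\<lambda>h. (?G m (0 + h) - ?G m 0) / h) \<longlongrightarrow> 0) (at_right 0)"
        by (rule Lim_transform_eventually) (auto simp: eventually_at_filter field_simps)
    qed
    then show ?thesis by (simp add: DERIV_def)
  qed
  have "(?G m has_real_derivative ?G (Suc m) t) (at t)" for m t
    using pos[of t m] neg[of t m] zero[of m] by (cases t "0::real" rule: linorder_cases) auto
  moreover have "?G 0 = flat_exp" by (auto simp: P0 flat_exp_def)
  ultimately show ?thesis unfolding smooth_real_on_def by (intro exI[of _ ?G]) blast
qed

definition smooth_step :: "real \<Rightarrow> real" where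
  "smooth_step t = flat_exp t * (flat_exp t + flat_exp (1 - t)) powr - 1"

lemma flat_exp_sum_pos: "flat_exp t + flat_exp (1 - t) > 0"
  by (auto simp: flat_exp_def add_pos_pos)

lemma smooth_step_eq: "smooth_step t = flat_exp t / (flat_exp t + flat_exp (1 - t))"
  using flat_exp_sum_pos[of t] by (simp add: smooth_step_def powr_minus_divide)

lemma smooth_step_eq_0: "t \<le> 0 \<Longrightarrow> smooth_step t = 0"
  by (simp add: smooth_step_eq flat_exp_def)

lemma smooth_step_eq_1: "t \<ge> 1 \<Longrightarrow> smooth_step t = 1"
  by (simp add: smooth_step_eq flat_exp_def)

lemma smooth_step_bounds: "0 \<le> smooth_step t" "smooth_step t \<le> 1"
  by (auto simp: smooth_step_eq flat_exp_def field_simps add_pos_pos)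

lemma smooth_on_smooth_step:
  assumes "open S" "smooth_on S f"
  shows "smooth_on S (\<lambda>x. smooth_step (f x))"
  unfolding smooth_step_def
  by (intro smooth_on_mult smooth_on_compose[OF _ smooth_real_on_flat_exp]
      smooth_on_compose[OF _ smooth_real_on_powr] smooth_on_add smooth_on_diff assms smooth_on_const)
    (auto simp: flat_exp_sum_pos)

lemma norm_power2_eq_sum: "(norm (x::real^'n))\<^sup>2 = (\<Sum>i\<in>UNIV. (x $ i)\<^sup>2)"
  by (simp add: norm_vec_def L2_set_def sum_nonneg)

lemma smooth_on_norm_power2_diff: "open S \<Longrightarrow> smooth_on S (\<lambda>x::real^'n. (norm (x - a))\<^sup>2)"
  unfolding norm_power2_eq_sum unfolding power2_eq_square vector_minus_component
  by (intro smooth_on_sum smooth_on_mult smooth_on_diff smooth_on_component smooth_on_const)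

text \<open>The divisor makes the argument of the step equal to 1 on the sphere of radius \<^term>\<open>r / 2\<close>, so that
  the cutoff is constant inside it and vanishes outside the ball of radius \<^term>\<open>r\<close>.\<close>
definition cutoff :: "real \<Rightarrow> real^'n \<Rightarrow> real^'n \<Rightarrow> real" where
  "cutoff r a x = smooth_step ((r\<^sup>2 - (norm (x - a))\<^sup>2) / (3/4 * r\<^sup>2))"

lemma smooth_on_cutoff: "open S \<Longrightarrow> smooth_on S (cutoff r a)"
  unfolding cutoff_def[abs_def] divide_inverse
  by (intro smooth_on_smooth_step smooth_on_mult smooth_on_diff smooth_on_norm_power2_diff
      smooth_on_const)

lemma cutoff_eq_1: "r > 0 \<Longrightarrow> norm (x - a) \<le> r / 2 \<Longrightarrow> cutoff r a x = 1"
  unfolding cutoff_def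
  using power_mono[of "norm (x - a)" "r/2" 2]
  by (intro smooth_step_eq_1) (auto simp: field_simps)

lemma cutoff_eq_0: "r > 0 \<Longrightarrow> norm (x - a) \<ge> r \<Longrightarrow> cutoff r a x = 0"
  unfolding cutoff_def
  using power_mono[of r "norm (x - a)" 2]
  by (intro smooth_step_eq_0) (auto simp: field_simps)

lemma cutoff_bounds: "0 \<le> cutoff r a x" "cutoff r a x \<le> 1"
  unfolding cutoff_def by (rule smooth_step_bounds)+

section \<open>Test functions\<close>

lemma test_functionsI:
  assumes "smooth_on UNIV \<phi>" "compact C" "C \<subseteq> \<Omega>" "\<And>x. x \<notin> C \<Longrightarrow> \<phi> x = 0"
  shows "\<phi> \<in> test_functions \<Omega>"
proof -
  have "closure {x. \<phi> x \<noteq> 0} \<subseteq> C"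
    using assms by (intro closure_minimal compact_imp_closed) auto
  moreover from this have "compact (closure {x. \<phi> x \<noteq> 0})"
    using assms(2) closed_closure compact_Int_closed by (metis Int_absorb1)
  ultimately show ?thesis
    using assms unfolding test_functions_def smooth_iff_smooth_on_UNIV by auto
qed

lemma test_functionsE:
  assumes "\<phi> \<in> test_functions \<Omega>"
  obtains C where "compact C" "C \<subseteq> \<Omega>" "\<And>x. x \<notin> C \<Longrightarrow> \<phi> x = 0"
proof (rule that)
  show "compact (closure {x. \<phi> x \<noteq> 0})" "closure {x. \<phi> x \<noteq> 0} \<subseteq> \<Omega>"
    using assms unfolding test_functions_def by auto
  show "\<phi> x = 0" if "x \<notin> closure {x. \<phi> x \<noteq> 0}" for x
    using that closure_subset[of "{x. \<phi> x \<noteq> 0}"] by auto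
qed

lemma test_functions_smooth_on:
  "\<phi> \<in> test_functions \<Omega> \<Longrightarrow> smooth_on S \<phi>"
  unfolding test_functions_def smooth_iff_smooth_on_UNIV
  using smooth_on_subset[of UNIV] by blast

lemma test_functions_mono: "\<Omega> \<subseteq> \<Omega>' \<Longrightarrow> test_functions \<Omega> \<subseteq> test_functions \<Omega>'"
  unfolding test_functions_def by auto

lemma test_functions_differentiable: "\<phi> \<in> test_functions \<Omega> \<Longrightarrow> \<phi> differentiable (at x)"
  using smooth_on_imp_differentiable[OF test_functions_smooth_on, of \<phi> \<Omega> UNIV] by simp

lemma test_functions_continuous_on: "\<phi> \<in> test_functions \<Omega> \<Longrightarrow> continuous_on S \<phi>"
  using smooth_on_imp_continuous_on test_functions_smooth_on by blast

lemma test_functions_zero_outside: "\<phi> \<in> test_functions \<Omega> \<Longrightarrow> x \<notin> \<Omega> \<Longrightarrow> \<phi> x = 0"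
  by (meson subsetD test_functionsE)

lemma partial_deriv_zero_outside:
  assumes "\<And>x. x \<notin> C \<Longrightarrow> \<phi> x = 0" "closed C" "x \<notin> C"
  shows "partial_deriv i \<phi> x = 0"
proof -
  have "partial_deriv i (\<lambda>x. 0) x = partial_deriv i \<phi> x"
    by (rule partial_deriv_cong_open[where S = "- C"]) (use assms in auto)
  then show ?thesis by (simp add: partial_deriv_const)
qed

lemma test_functions_partial_deriv:
  assumes "\<phi> \<in> test_functions \<Omega>"
  shows "partial_deriv i \<phi> \<in> test_functions \<Omega>"
proof -
  obtain C where C: "compact C" "C \<subseteq> \<Omega>" "\<And>x. x \<notin> C \<Longrightarrow> \<phi> x = 0"
    using test_functionsE[OF assms] by blast
  show ?thesis
  proof (rule test_functionsI[OF _ C(1,2)])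
    show "smooth_on UNIV (partial_deriv i \<phi>)"
      by (rule smooth_on_partial_deriv[OF test_functions_smooth_on[OF assms]])
    show "partial_deriv i \<phi> x = 0" if "x \<notin> C" for x
      by (rule partial_deriv_zero_outside[OF C(3) compact_imp_closed[OF C(1)] that])
  qed
qed

lemma test_functions_mult:
  assumes "smooth_on UNIV g" "\<phi> \<in> test_functions \<Omega>"
  shows "(\<lambda>x. g x * \<phi> x) \<in> test_functions \<Omega>"
proof -
  obtain C where C: "compact C" "C \<subseteq> \<Omega>" "\<And>x. x \<notin> C \<Longrightarrow> \<phi> x = 0"
    using test_functionsE[OF assms(2)] by blast
  show ?thesis
    by (rule test_functionsI[OF smooth_on_mult[OF open_UNIV assms(1)
            test_functions_smooth_on[OF assms(2)]] C(1,2)]) (use C in auto)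
qed

lemma test_functions_cmult: "\<phi> \<in> test_functions \<Omega> \<Longrightarrow> (\<lambda>x. c * \<phi> x) \<in> test_functions \<Omega>"
  by (rule test_functions_mult[OF smooth_on_const])

lemma test_functions_add:
  assumes "\<phi> \<in> test_functions \<Omega>" "\<psi> \<in> test_functions \<Omega>"
  shows "(\<lambda>x. \<phi> x + \<psi> x) \<in> test_functions \<Omega>"
proof -
  obtain C where C: "compact C" "C \<subseteq> \<Omega>" "\<And>x. x \<notin> C \<Longrightarrow> \<phi> x = 0"
    using test_functionsE[OF assms(1)] by blast
  obtain D where D: "compact D" "D \<subseteq> \<Omega>" "\<And>x. x \<notin> D \<Longrightarrow> \<psi> x = 0"
    using test_functionsE[OF assms(2)] by blast
  show ?thesis
    by (rule test_functionsI[OF smooth_on_add[OF open_UNIV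
            assms[THEN test_functions_smooth_on]], where C = "C \<union> D"]) (use C D in auto)
qed

lemma test_functions_diff:
  "\<phi> \<in> test_functions \<Omega> \<Longrightarrow> \<psi> \<in> test_functions \<Omega> \<Longrightarrow> (\<lambda>x. \<phi> x - \<psi> x) \<in> test_functions \<Omega>"
  using test_functions_add[of \<phi> \<Omega> "\<lambda>x. (-1) * \<psi> x"] test_functions_cmult[of \<psi> \<Omega> "-1"] by simp

lemma test_functions_zero: "(\<lambda>x. 0) \<in> test_functions \<Omega>"
  by (rule test_functionsI[where C = "{}"]) auto

lemma test_functions_bounded:
  assumes "\<phi> \<in> test_functions \<Omega>"
  obtains B where "B > 0" "\<And>x. \<bar>\<phi> x\<bar> \<le> B"
proof -
  obtain C where C: "compact C" "C \<subseteq> \<Omega>" "\<And>x. x \<notin> C \<Longrightarrow> \<phi> x = 0"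
    using test_functionsE[OF assms] by blast
  have "bounded (\<phi> ` C)"
    using C(1) test_functions_continuous_on[OF assms]
    by (intro compact_imp_bounded compact_continuous_image)
  then obtain B where "B > 0" "\<And>x. x \<in> C \<Longrightarrow> \<bar>\<phi> x\<bar> \<le> B"
    unfolding bounded_pos by auto
  then show ?thesis using C(3) by (intro that[of B]) (force+)
qed

lemma frechet_derivative_shift:
  assumes "f differentiable (at (x - a))"
  shows "((\<lambda>x. f (x - a)) has_derivative frechet_derivative f (at (x - a))) (at x)"
proof -
  have "((\<lambda>x. x - a) has_derivative (\<lambda>h. h)) (at x)"
    by (auto intro!: derivative_eq_intros)
  from has_derivative_compose[OF this has_derivative_frechet[OF assms]] show ?thesis .
qed

lemma partial_deriv_shift:
  assumes "f differentiable (at (x - a))"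
  shows "partial_deriv i (\<lambda>x. f (x - a)) x = partial_deriv i f (x - a)"
  using partial_deriv_eq[OF frechet_derivative_shift[OF assms]] unfolding partial_deriv_def .

lemma smooth_on_shift:
  assumes "smooth_on UNIV f"
  shows "smooth_on UNIV (\<lambda>x. f (x - a))"
proof -
  have "times_differentiable_on n UNIV f \<Longrightarrow> times_differentiable_on n UNIV (\<lambda>x. f (x - a))" for n
  proof (induction n arbitrary: f)
    case 0
    then show ?case
      using frechet_derivative_shift[of f _ a]
      by (auto simp: differentiable_on_eq_differentiable_at differentiable_def)
  next
    case (Suc n)
    have d: "f differentiable (at x)" for x
      using Suc.prems by (auto simp: differentiable_on_eq_differentiable_at)
    have "(\<lambda>x. f (x - a)) differentiable_on UNIV"
      using frechet_derivative_shift[OF d]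
      by (auto simp: differentiable_on_eq_differentiable_at differentiable_def)
    moreover have "partial_deriv i (\<lambda>x. f (x - a)) = (\<lambda>x. partial_deriv i f (x - a))" for i
      by (rule ext) (rule partial_deriv_shift[OF d])
    ultimately show ?case using Suc by simp
  qed
  then show ?thesis using assms unfolding smooth_on_def by blast
qed

section \<open>Integrals of test functions\<close>

lemma integral_lborel_shift:
  fixes f :: "real^'n \<Rightarrow> real"
  assumes "f \<in> borel_measurable borel"
  shows "(\<integral>x. f (x + a) \<partial>lborel) = (\<integral>x. f x \<partial>lborel)"
proof -
  have "(\<integral>x. f x \<partial>lborel) = (\<integral>x. f x \<partial>distr lborel borel ((+) a))"
    by (simp add: lborel_distr_plus)
  also have "\<dots> = (\<integral>x. f (a + x) \<partial>lborel)"
    by (rule integral_distr) (use assms in auto)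
  finally show ?thesis by (simp add: add.commute)
qed

lemma integrable_lborel_shift:
  fixes f :: "real^'n \<Rightarrow> real"
  assumes "integrable lborel f"
  shows "integrable lborel (\<lambda>x. f (x + a))"
proof -
  have "integrable (distr lborel borel ((+) a)) f"
    using assms by (simp add: lborel_distr_plus)
  then have "integrable lborel (\<lambda>x. f (a + x))"
    by (subst (asm) integrable_distr_eq) (use assms in auto)
  then show ?thesis by (simp add: add.commute)
qed

lemma test_functions_borel: "\<phi> \<in> test_functions \<Omega> \<Longrightarrow> \<phi> \<in> borel_measurable borel"
  by (intro borel_measurable_continuous_onI test_functions_continuous_on)

lemma test_functions_integrable:
  assumes "\<phi> \<in> test_functions \<Omega>"
  shows "integrable lborel \<phi>"
proof -
  obtain C where C: "compact C" "C \<subseteq> \<Omega>" "\<And>x. x \<notin> C \<Longrightarrow> \<phi> x = 0"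
    using test_functionsE[OF assms] by blast
  have "integrable lborel (\<lambda>x. indicator C x *\<^sub>R \<phi> x)"
    by (rule borel_integrable_compact[OF C(1) test_functions_continuous_on[OF assms]])
  moreover have "(\<lambda>x. indicator C x *\<^sub>R \<phi> x) = \<phi>"
    using C(3) by (auto simp: indicator_def fun_eq_iff)
  ultimately show ?thesis by simp
qed

lemma has_real_derivative_along_axis:
  fixes \<phi> :: "real^'n \<Rightarrow> real"
  assumes "\<phi> differentiable (at (x + s *\<^sub>R axis i 1))"
  shows "((\<lambda>s. \<phi> (x + s *\<^sub>R axis i 1)) has_real_derivative partial_deriv i \<phi> (x + s *\<^sub>R axis i 1)) (at s)"
proof -
  let ?y = "x + s *\<^sub>R axis i 1"
  have D: "(\<phi> has_derivative frechet_derivative \<phi> (at ?y)) (at ?y)"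
    by (rule has_derivative_frechet[OF assms])
  have "((\<lambda>s. x + s *\<^sub>R axis i (1::real)) has_derivative (\<lambda>h. h *\<^sub>R axis i 1)) (at s)"
    by (auto intro!: derivative_eq_intros)
  from has_derivative_compose[OF this D]
  have "((\<lambda>s. \<phi> (x + s *\<^sub>R axis i 1)) has_derivative
      (\<lambda>h. frechet_derivative \<phi> (at ?y) (h *\<^sub>R axis i 1))) (at s)" .
  moreover have "frechet_derivative \<phi> (at ?y) (h *\<^sub>R axis i 1) = partial_deriv i \<phi> ?y * h" for h
    using linear_scale[OF has_derivative_linear[OF D]] unfolding partial_deriv_def by simp
  ultimately show ?thesis unfolding has_field_derivative_def by simp
qed

text \<open>Translation invariance makes every difference quotient integrate to zero; dominated
  convergence then passes this to the derivative.\<close>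
lemma integral_partial_deriv_eq_0:
  fixes \<phi> :: "real^'n \<Rightarrow> real"
  assumes \<phi>: "\<phi> \<in> test_functions \<Omega>"
  shows "(\<integral>x. partial_deriv i \<phi> x \<partial>lborel) = 0"
proof -
  define e :: "real^'n" where "e = axis i 1"
  define h :: "nat \<Rightarrow> real" where "h n = inverse (real (Suc n))" for n
  have h: "0 < h n" "h n \<le> 1" for n by (auto simp: h_def field_simps)
  have h0: "h \<longlonglongrightarrow> 0" unfolding h_def by (rule LIMSEQ_inverse_real_of_nat)
  obtain C where C: "compact C" "C \<subseteq> \<Omega>" "\<And>x. x \<notin> C \<Longrightarrow> \<phi> x = 0"
    using test_functionsE[OF \<phi>] by blast
  obtain R where R: "\<And>x. x \<in> C \<Longrightarrow> norm x \<le> R"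
    using compact_imp_bounded[OF C(1)] unfolding bounded_iff by blast
  obtain B where B: "B > 0" "\<And>x. \<bar>partial_deriv i \<phi> x\<bar> \<le> B"
    using test_functions_bounded[OF test_functions_partial_deriv[OF \<phi>]] by blast
  let ?q = "\<lambda>n x. (\<phi> (x + h n *\<^sub>R e) - \<phi> x) / h n"
  note [measurable] = test_functions_borel[OF \<phi>] test_functions_borel[OF test_functions_partial_deriv[OF \<phi>]]
  have norm_e: "norm e = 1" by (simp add: e_def)
  have der: "((\<lambda>s. \<phi> (x + s *\<^sub>R e)) has_real_derivative partial_deriv i \<phi> (x + s *\<^sub>R e)) (at s)" for x s
    unfolding e_def by (rule has_real_derivative_along_axis[OF test_functions_differentiable[OF \<phi>]])
  have "(\<lambda>n. \<integral>x. ?q n x \<partial>lborel) \<longlonglongrightarrow> (\<integral>x. partial_deriv i \<phi> x \<partial>lborel)"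
  proof (rule integral_dominated_convergence[where w = "\<lambda>x. indicator (cball 0 (R + 1)) x *\<^sub>R B"])
    show "integrable lborel (\<lambda>x. indicator (cball (0::real^'n) (R + 1)) x *\<^sub>R B)"
      by (rule borel_integrable_compact) auto
    show "AE x in lborel. (\<lambda>n. ?q n x) \<longlonglongrightarrow> partial_deriv i \<phi> x"
    proof (rule AE_I2)
      fix x
      have "((\<lambda>t. (\<phi> (x + t *\<^sub>R e) - \<phi> x) / t) \<longlongrightarrow> partial_deriv i \<phi> x) (at 0)"
        using der[of x 0] by (simp add: DERIV_def)
      moreover have "filterlim h (at 0) sequentially"
        unfolding filterlim_at using h0 h(1) by (auto simp: less_imp_neq[OF h(1), symmetric] eventually_sequentially)
      ultimately show "(\<lambda>n. ?q n x) \<longlonglongrightarrow> partial_deriv i \<phi> x"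
        by (rule filterlim_compose)
    qed
    show "AE x in lborel. norm (?q n x) \<le> indicator (cball 0 (R + 1)) x *\<^sub>R B" for n
    proof (rule AE_I2)
      fix x
      show "norm (?q n x) \<le> indicator (cball 0 (R + 1)) x *\<^sub>R B"
      proof (cases "x \<in> cball 0 (R + 1)")
        case True
        obtain z where z: "\<phi> (x + h n *\<^sub>R e) - \<phi> (x + 0 *\<^sub>R e)
            = (h n - 0) * partial_deriv i \<phi> (x + z *\<^sub>R e)"
          using MVT2[of 0 "h n" "\<lambda>s. \<phi> (x + s *\<^sub>R e)" "\<lambda>s. partial_deriv i \<phi> (x + s *\<^sub>R e)"]
            h(1) der by blast
        then have "?q n x = partial_deriv i \<phi> (x + z *\<^sub>R e)"
          using h(1)[of n] by simp
        then show ?thesis using B True by simp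
      next
        case False
        then have n: "norm x > R + 1" by simp
        then have "x \<notin> C" using R[of x] by linarith
        moreover have "x + h n *\<^sub>R e \<notin> C"
        proof
          assume "x + h n *\<^sub>R e \<in> C"
          then have "norm (x + h n *\<^sub>R e) \<le> R" by (rule R)
          moreover have "norm x \<le> norm (x + h n *\<^sub>R e) + norm (h n *\<^sub>R e)"
            using norm_triangle_ineq4[of "x + h n *\<^sub>R e" "h n *\<^sub>R e"] by simp
          moreover have "norm (h n *\<^sub>R e) \<le> 1" using h[of n] norm_e by simp
          ultimately show False using n by linarith
        qed
        ultimately show ?thesis using C(3) False by simp
      qed
    qed
  qed measurable
  moreover have "(\<integral>x. ?q n x \<partial>lborel) = 0" for n
    using integrable_lborel_shift[OF test_functions_integrable[OF \<phi>], of "h n *\<^sub>R e"]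
      test_functions_integrable[OF \<phi>] integral_lborel_shift[OF test_functions_borel[OF \<phi>], of "h n *\<^sub>R e"]
    by simp
  ultimately show ?thesis
    by (simp only: LIMSEQ_const_iff)
qed

section \<open>The fundamental lemma of the calculus of variations\<close>

text \<open>The positive and the negative part define finite measures that agree on boxes, and boxes are a
  generator of the Borel sets that is closed under intersection.\<close>
lemma AE_zero_if_box_integrals_zero:
  fixes f :: "real^'n \<Rightarrow> real"
  assumes f: "integrable lborel f"
    and zero: "\<And>a b. (\<integral>x. f x * indicator (box a b) x \<partial>lborel) = 0"
  shows "AE x in lborel. f x = 0"
proof -
  let ?D = "\<lambda>f. density lborel (\<lambda>x. ennreal (f x))"
  have [measurable]: "f \<in> borel_measurable borel" using f by auto
  have fin: "(\<integral>\<^sup>+x. ennreal (f x) \<partial>lborel) < \<infinity>" "(\<integral>\<^sup>+x. ennreal (- f x) \<partial>lborel) < \<infinity>"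
    using f unfolding real_integrable_def by (simp_all add: less_top)
  have em: "emeasure (?D g) A = (\<integral>\<^sup>+x. ennreal (g x * indicator A x) \<partial>lborel)"
    if "g \<in> borel_measurable borel" "A \<in> sets borel" for g A
    using that by (subst emeasure_density) (auto intro!: nn_integral_cong simp: indicator_def)
  have "?D f = ?D (\<lambda>x. - f x)"
  proof (rule measure_eqI_generator_eq)
    let ?E = "range (\<lambda>(a, b). box a b::(real^'n) set)"
    show "Int_stable ?E"
      by (auto simp: Int_stable_def box_Int_box)
    show "?E \<subseteq> Pow UNIV" "sets (?D f) = sigma_sets UNIV ?E" "sets (?D (\<lambda>x. - f x)) = sigma_sets UNIV ?E"
      by (simp_all add: borel_eq_box)
    let ?A = "\<lambda>n::nat. box (- (real n *\<^sub>R One)) (real n *\<^sub>R One) :: (real^'n) set"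
    show "range ?A \<subseteq> ?E" "(\<Union>i. ?A i) = UNIV"
      unfolding UN_box_eq_UNIV by auto
    show "emeasure (?D f) (?A i) \<noteq> \<infinity>" for i
    proof -
      have "emeasure (?D f) (?A i) \<le> (\<integral>\<^sup>+x. ennreal (f x) \<partial>lborel)"
        by (subst em) (auto intro!: nn_integral_mono simp: indicator_def)
      then show ?thesis using fin(1) by (auto simp: top_unique)
    qed
    show "emeasure (?D f) X = emeasure (?D (\<lambda>x. - f x)) X" if X: "X \<in> ?E" for X
    proof -
      obtain a b where ab: "X = box a b" using X by auto
      let ?g = "\<lambda>x. f x * indicator (box a b) x"
      have gi: "integrable lborel ?g"
        using integrable_mult_indicator[OF _ f, of "box a b"] by (simp add: mult.commute)
      then have gfin: "(\<integral>\<^sup>+x. ennreal (?g x) \<partial>lborel) \<noteq> \<infinity>" "(\<integral>\<^sup>+x. ennreal (- ?g x) \<partial>lborel) \<noteq> \<infinity>"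
        unfolding real_integrable_def by auto
      have "enn2real (\<integral>\<^sup>+x. ennreal (?g x) \<partial>lborel) = enn2real (\<integral>\<^sup>+x. ennreal (- ?g x) \<partial>lborel)"
        using zero[of a b] unfolding real_lebesgue_integral_def[OF gi] by simp
      then have "(\<integral>\<^sup>+x. ennreal (?g x) \<partial>lborel) = (\<integral>\<^sup>+x. ennreal (- ?g x) \<partial>lborel)"
        using gfin[unfolded infinity_ennreal_def less_top, THEN ennreal_enn2real] by metis
      then show ?thesis by (simp add: em ab)
    qed
  qed
  then have "AE x in lborel. ennreal (f x) = ennreal (- f x)"
    by (intro sigma_finite_measure.density_unique[OF sigma_finite_lborel]) simp_all
  then show ?thesis
  proof (eventually_elim)
    case (elim x)
    show ?case
    proof (cases "f x \<ge> 0")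
      case True
      then have "ennreal (- f x) = 0" by (intro ennreal_neg) simp
      then have "ennreal (f x) = 0" using elim by simp
      then show ?thesis using True by simp
    next
      case False
      then have "ennreal (f x) = 0" by (intro ennreal_neg) simp
      then have "ennreal (- f x) = 0" using elim by simp
      then show ?thesis using False by simp
    qed
  qed
qed

text \<open>Test functions that increase to the indicator of the box.\<close>
definition box_cutoff :: "nat \<Rightarrow> real^'n \<Rightarrow> real^'n \<Rightarrow> real^'n \<Rightarrow> real" where
  "box_cutoff n a b x = (\<Prod>i\<in>UNIV. smooth_step (real n * (x $ i - a $ i)) * smooth_step (real n * (b $ i - x $ i)))"

lemma smooth_on_box_cutoff: "smooth_on UNIV (box_cutoff n a b)"
  unfolding box_cutoff_def[abs_def]
  by (intro smooth_on_prod smooth_on_mult smooth_on_smooth_step smooth_on_diff smooth_on_component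
      smooth_on_const open_UNIV)

lemma box_cutoff_eq_0: "x \<notin> box a b \<Longrightarrow> box_cutoff n a b x = 0"
proof -
  assume "x \<notin> box a b"
  then obtain i where "x $ i \<le> a $ i \<or> b $ i \<le> x $ i"
    unfolding mem_box_cart by (auto simp: not_less)
  then have "smooth_step (real n * (x $ i - a $ i)) * smooth_step (real n * (b $ i - x $ i)) = 0"
    by (auto simp: smooth_step_eq_0 mult_nonneg_nonpos)
  then show ?thesis unfolding box_cutoff_def by (intro prod_zero) auto
qed

lemma box_cutoff_bounds: "\<bar>box_cutoff n a b x\<bar> \<le> 1"
  unfolding box_cutoff_def abs_prod
  using smooth_step_bounds by (intro prod_le_1) (auto simp: abs_mult mult_le_one)

lemma box_cutoff_tendsto: "(\<lambda>n. box_cutoff n a b x) \<longlonglongrightarrow> indicator (box a b) x"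
proof (cases "x \<in> box a b")
  case True
  have pos: "\<forall>\<^sub>F n in sequentially. smooth_step (real n * c) = 1" if "c > 0" for c
  proof -
    have "filterlim (\<lambda>n. real n * c) at_top sequentially"
      using filterlim_tendsto_pos_mult_at_top[OF tendsto_const[of c] that filterlim_real_sequentially]
      by (simp add: mult.commute)
    then have "\<forall>\<^sub>F n in sequentially. real n * c \<ge> 1" by (simp add: filterlim_at_top)
    then show ?thesis by eventually_elim (rule smooth_step_eq_1)
  qed
  have "\<forall>\<^sub>F n in sequentially. \<forall>i. smooth_step (real n * (x $ i - a $ i)) * smooth_step (real n * (b $ i - x $ i)) = 1"
    unfolding eventually_all_finite
  proof (rule eventually_all_finite)
    fix i
    have "x $ i - a $ i > 0" "b $ i - x $ i > 0" using True unfolding mem_box_cart by auto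
    from this[THEN pos]
    show "\<forall>\<^sub>F n in sequentially. smooth_step (real n * (x $ i - a $ i)) * smooth_step (real n * (b $ i - x $ i)) = 1"
      by eventually_elim simp
  qed
  then have "\<forall>\<^sub>F n in sequentially. box_cutoff n a b x = indicator (box a b) x"
    by eventually_elim (use True in \<open>simp add: box_cutoff_def\<close>)
  then show ?thesis by (rule tendsto_eventually)
next
  case False
  then show ?thesis by (simp add: box_cutoff_eq_0)
qed

lemma box_cutoff_test_function:
  assumes "box a b \<subseteq> cbox c d" "cbox c d \<subseteq> \<Omega>"
  shows "box_cutoff n a b \<in> test_functions \<Omega>"
  by (rule test_functionsI[OF smooth_on_box_cutoff, of "cbox c d"])
    (use assms in \<open>auto intro!: box_cutoff_eq_0\<close>)

lemma integral_lebesgue_on: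
  fixes f :: "real^'n \<Rightarrow> real"
  assumes "\<Omega> \<in> sets lebesgue"
  shows "(\<integral>x. f x \<partial>lebesgue_on \<Omega>) = (\<integral>x. indicator \<Omega> x * f x \<partial>lebesgue)"
  using assms by (subst integral_restrict_space) auto

lemma integrable_lebesgue_on:
  fixes f :: "real^'n \<Rightarrow> real"
  assumes "\<Omega> \<in> sets lebesgue"
  shows "integrable (lebesgue_on \<Omega>) f \<longleftrightarrow> integrable lebesgue (\<lambda>x. indicator \<Omega> x * f x)"
  using assms by (subst integrable_restrict_space) auto

lemma AE_lebesgue_on:
  fixes \<Omega> :: "(real^'n) set"
  assumes "\<Omega> \<in> sets lebesgue"
  shows "(AE x in lebesgue_on \<Omega>. P x) \<longleftrightarrow> (AE x in lebesgue. x \<in> \<Omega> \<longrightarrow> P x)"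
  using assms by (subst AE_restrict_space_iff) auto

text \<open>Testing with smooth approximations of the indicators of boxes shows that the integral over every small
  box vanishes.\<close>
lemma fundamental_lemma:
  fixes \<Omega> :: "(real^'n) set"
  assumes \<Omega>: "open \<Omega>" and g: "locally_integrable \<Omega> g"
    and zero: "\<And>\<phi>. \<phi> \<in> test_functions \<Omega> \<Longrightarrow> (\<integral>x. g x * \<phi> x \<partial>lebesgue_on \<Omega>) = 0"
  shows "AE x in lebesgue_on \<Omega>. g x = 0"
proof -
  have local: "AE x in lebesgue. x \<in> cbox c d \<longrightarrow> g x = 0" if cd: "cbox c d \<subseteq> \<Omega>" for c d
  proof -
    have gi: "integrable lebesgue (\<lambda>x. indicator (cbox c d) x * g x)"
      using g cd unfolding locally_integrable_def set_integrable_def by auto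
    then have "(\<lambda>x. indicator (cbox c d) x * g x) \<in> borel_measurable lebesgue" by auto
    from completion_ex_borel_measurable_real[OF this]
    obtain g' where g'[measurable]: "g' \<in> borel_measurable lborel"
      and ae: "AE x in lborel. indicator (cbox c d) x * g x = g' x" by blast
    note ae' = AE_completion[OF ae]
    have g'l: "g' \<in> borel_measurable lebesgue" using g' by (intro measurable_completion)
    have g'i: "integrable lborel g'"
      using gi integrable_cong_AE[OF _ g'l ae'] integrable_completion[OF g'] by auto
    have "AE x in lborel. g' x = 0"
    proof (rule AE_zero_if_box_integrals_zero[OF g'i])
      fix a b :: "real^'n"
      obtain a' b' where ab': "box a b \<inter> box c d = box a' b'"
        using box_Int_box[of a b c d] by blast
      have sub: "box a' b' \<subseteq> cbox c d" using ab' box_subset_cbox by blast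
      have "(\<lambda>n. \<integral>x. g' x * box_cutoff n a' b' x \<partial>lborel) \<longlonglongrightarrow> (\<integral>x. g' x * indicator (box a' b') x \<partial>lborel)"
      proof (rule integral_dominated_convergence[where w = "\<lambda>x. \<bar>g' x\<bar>"])
        have [measurable]: "box_cutoff n a' b' \<in> borel_measurable borel" for n
          by (intro borel_measurable_continuous_onI smooth_on_imp_continuous_on smooth_on_box_cutoff)
        show "(\<lambda>x. g' x * box_cutoff n a' b' x) \<in> borel_measurable lborel" for n by measurable
        show "AE x in lborel. norm (g' x * box_cutoff n a' b' x) \<le> \<bar>g' x\<bar>" for n
        proof (rule AE_I2)
          fix x
          show "norm (g' x * box_cutoff n a' b' x) \<le> \<bar>g' x\<bar>"
            using mult_left_mono[OF box_cutoff_bounds[of n a' b' x] abs_ge_zero[of "g' x"]]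
            unfolding real_norm_def abs_mult by linarith
        qed
        show "AE x in lborel. (\<lambda>n. g' x * box_cutoff n a' b' x) \<longlonglongrightarrow> g' x * indicator (box a' b') x"
          by (intro AE_I2 tendsto_intros box_cutoff_tendsto)
        show "integrable lborel (\<lambda>x. \<bar>g' x\<bar>)" using g'i by auto
      qed measurable
      moreover have "(\<integral>x. g' x * box_cutoff n a' b' x \<partial>lborel) = 0" for n
      proof -
        have T: "box_cutoff n a' b' \<in> test_functions \<Omega>"
          by (rule box_cutoff_test_function[OF sub cd])
        have m: "(\<lambda>x. g' x * box_cutoff n a' b' x) \<in> borel_measurable lborel"
          using test_functions_borel[OF T] by measurable
        have "(\<integral>x. g' x * box_cutoff n a' b' x \<partial>lborel) = (\<integral>x. g' x * box_cutoff n a' b' x \<partial>lebesgue)"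
          by (rule integral_completion[symmetric, OF m])
        also have "\<dots> = (\<integral>x. indicator \<Omega> x * (g x * box_cutoff n a' b' x) \<partial>lebesgue)"
        proof (rule integral_cong_AE)
          show "AE x in lebesgue. g' x * box_cutoff n a' b' x = indicator \<Omega> x * (g x * box_cutoff n a' b' x)"
            using ae'
          proof eventually_elim
            case (elim x)
            show ?case
            proof (cases "x \<in> box a' b'")
              case True
              then have "x \<in> cbox c d" "x \<in> \<Omega>" using sub cd by auto
              then show ?thesis using elim by simp
            qed (simp add: box_cutoff_eq_0)
          qed
          then show "(\<lambda>x. indicator \<Omega> x * (g x * box_cutoff n a' b' x)) \<in> borel_measurable lebesgue"
            by (rule borel_measurable_AE[OF measurable_completion[OF m]])
          show "(\<lambda>x. g' x * box_cutoff n a' b' x) \<in> borel_measurable lebesgue"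
            by (rule measurable_completion[OF m])
        qed
        also have "\<dots> = (\<integral>x. g x * box_cutoff n a' b' x \<partial>lebesgue_on \<Omega>)"
          by (rule integral_lebesgue_on[symmetric]) (use \<Omega> in auto)
        also have "\<dots> = 0" by (rule zero[OF T])
        finally show ?thesis .
      qed
      ultimately have z: "(\<integral>x. g' x * indicator (box a' b') x \<partial>lborel) = 0"
        by (simp only: LIMSEQ_const_iff)
      have bd: "AE x in lborel. x \<notin> cbox c d - box c d"
        using AE_not_in[OF negligible_frontier_interval[of c d, unfolded negligible_iff_null_sets]]
        unfolding AE_completion_iff .
      have "(\<integral>x. g' x * indicator (box a b) x \<partial>lborel) = (\<integral>x. g' x * indicator (box a' b') x \<partial>lborel)"
      proof (rule integral_cong_AE)
        show "AE x in lborel. g' x * indicator (box a b) x = g' x * indicator (box a' b') x"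
          using bd ae
        proof eventually_elim
          case (elim x)
          have "x \<in> box a' b' \<longleftrightarrow> x \<in> box a b \<and> x \<in> box c d" using ab' by blast
          then show ?case using elim by (auto simp: indicator_def split: if_splits)
        qed
      qed auto
      then show "(\<integral>x. g' x * indicator (box a b) x \<partial>lborel) = 0" using z by simp
    qed
    then have "AE x in lborel. indicator (cbox c d) x * g x = 0"
      using ae by eventually_elim simp
    then have "AE x in lebesgue. indicator (cbox c d) x * g x = 0"
      by (rule AE_completion)
    then show ?thesis by eventually_elim (auto simp: indicator_def)
  qed
  obtain D where D: "countable D" "D \<subseteq> Pow \<Omega>" "\<And>X. X \<in> D \<Longrightarrow> \<exists>a b. X = cbox a b" "\<Union>D = \<Omega>"
    using open_countable_Union_open_cbox[OF \<Omega>] by metis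
  have "AE x in lebesgue. \<forall>X\<in>D. x \<in> X \<longrightarrow> g x = 0"
    unfolding AE_ball_countable[OF D(1)]
  proof
    fix X assume "X \<in> D"
    then obtain a b where "X = cbox a b" "X \<subseteq> \<Omega>" using D by blast
    then show "AE x in lebesgue. x \<in> X \<longrightarrow> g x = 0" using local by blast
  qed
  then have "AE x in lebesgue. x \<in> \<Omega> \<longrightarrow> g x = 0"
    by eventually_elim (use D in blast)
  then show ?thesis using \<Omega> by (simp add: AE_lebesgue_on)
qed

section \<open>Weak derivatives\<close>

lemma integrable_mult_test_function:
  assumes w: "locally_integrable \<Omega> w" and \<Omega>: "open \<Omega>" and \<phi>: "\<phi> \<in> test_functions \<Omega>"
  shows "integrable (lebesgue_on \<Omega>) (\<lambda>x. w x * \<phi> x)"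
proof -
  obtain C where C: "compact C" "C \<subseteq> \<Omega>" "\<And>x. x \<notin> C \<Longrightarrow> \<phi> x = 0"
    using test_functionsE[OF \<phi>] by blast
  obtain B where B: "B > 0" "\<And>x. \<bar>\<phi> x\<bar> \<le> B" using test_functions_bounded[OF \<phi>] by blast
  have i: "integrable lebesgue (\<lambda>x. indicator C x * w x)"
    using w C unfolding locally_integrable_def set_integrable_def by auto
  have "integrable lebesgue (\<lambda>x. (indicator C x * w x) * \<phi> x)"
  proof (rule Bochner_Integration.integrable_bound[OF integrable_mult_left[where c = B, OF i]])
    show "(\<lambda>x. (indicator C x * w x) * \<phi> x) \<in> borel_measurable lebesgue"
      by (rule borel_measurable_times[OF borel_measurable_integrable[OF i]])
        (use test_functions_borel[OF \<phi>] in \<open>simp add: measurable_completion\<close>)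
    show "AE x in lebesgue. norm ((indicator C x * w x) * \<phi> x) \<le> norm ((indicator C x * w x) * B)"
      using B by (intro AE_I2) (simp add: abs_mult mult_left_mono)
  qed
  moreover have "(\<lambda>x. (indicator C x * w x) * \<phi> x) = (\<lambda>x. indicator \<Omega> x * (w x * \<phi> x))"
    using C by (auto simp: indicator_def fun_eq_iff)
  ultimately show ?thesis using \<Omega> by (simp add: integrable_lebesgue_on)
qed

lemma locally_integrable_diff:
  "locally_integrable \<Omega> v \<Longrightarrow> locally_integrable \<Omega> w \<Longrightarrow> locally_integrable \<Omega> (\<lambda>x. v x - w x)"
  unfolding locally_integrable_def by (auto intro: set_integral_diff(1))

text \<open>This is why the choice in \<^const>\<open>weak_partial\<close> is immaterial.\<close>
lemma has_weak_partial_unique: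
  assumes "open \<Omega>" "has_weak_partial \<Omega> i w g" "has_weak_partial \<Omega> i w g'"
  shows "AE x in lebesgue_on \<Omega>. g x = g' x"
proof -
  have li: "locally_integrable \<Omega> g" "locally_integrable \<Omega> g'"
    using assms unfolding has_weak_partial_def by auto
  have "AE x in lebesgue_on \<Omega>. g x - g' x = 0"
  proof (rule fundamental_lemma[OF assms(1) locally_integrable_diff[OF li]])
    fix \<phi> assume \<phi>: "\<phi> \<in> test_functions \<Omega>"
    have "(\<integral>x. g x * \<phi> x \<partial>lebesgue_on \<Omega>) = (\<integral>x. g' x * \<phi> x \<partial>lebesgue_on \<Omega>)"
      using assms \<phi> unfolding has_weak_partial_def by fastforce
    then show "(\<integral>x. (g x - g' x) * \<phi> x \<partial>lebesgue_on \<Omega>) = 0"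
      using integrable_mult_test_function[OF li(1) assms(1) \<phi>]
        integrable_mult_test_function[OF li(2) assms(1) \<phi>]
      by (simp add: left_diff_distrib)
  qed
  then show ?thesis by simp
qed

lemma weak_partial_AE_eq:
  assumes "open \<Omega>" "has_weak_partial \<Omega> i w g"
  shows "AE x in lebesgue_on \<Omega>. weak_partial \<Omega> i w x = g x"
proof -
  have "has_weak_partial \<Omega> i w (weak_partial \<Omega> i w)"
    unfolding weak_partial_def using assms(2) by (rule someI[of "has_weak_partial \<Omega> i w"])
  from has_weak_partial_unique[OF assms(1) this assms(2)] show ?thesis .
qed

lemma integral_lebesgue_on_test_function:
  assumes "open \<Omega>" "\<phi> \<in> test_functions \<Omega>"
  shows "(\<integral>x. \<phi> x \<partial>lebesgue_on \<Omega>) = (\<integral>x. \<phi> x \<partial>lborel)"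
proof -
  have "(\<lambda>x. indicator \<Omega> x * \<phi> x) = \<phi>"
    using test_functions_zero_outside[OF assms(2)] by (auto simp: indicator_def fun_eq_iff)
  then have "(\<integral>x. \<phi> x \<partial>lebesgue_on \<Omega>) = (\<integral>x. \<phi> x \<partial>lebesgue)"
    using assms(1) by (simp add: integral_lebesgue_on)
  also have "\<dots> = (\<integral>x. \<phi> x \<partial>lborel)"
    using test_functions_borel[OF assms(2)] by (intro integral_completion) auto
  finally show ?thesis .
qed

lemma continuous_on_imp_locally_integrable:
  assumes "continuous_on UNIV w"
  shows "locally_integrable \<Omega> w"
  unfolding locally_integrable_def
proof (intro allI impI)
  fix C assume C: "compact C \<and> C \<subseteq> \<Omega>"
  have "integrable lborel (\<lambda>x. indicator C x *\<^sub>R w x)"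
    using C assms continuous_on_subset by (intro borel_integrable_compact) auto
  then show "w absolutely_integrable_on C"
    unfolding set_integrable_def by (subst integrable_completion) auto
qed

lemma integration_by_parts_test_functions:
  assumes "open \<Omega>" "smooth_on UNIV w" "\<phi> \<in> test_functions \<Omega>"
  shows "(\<integral>x. w x * partial_deriv i \<phi> x \<partial>lebesgue_on \<Omega>) = - (\<integral>x. partial_deriv i w x * \<phi> x \<partial>lebesgue_on \<Omega>)"
proof -
  have T: "(\<lambda>x. w x * \<phi> x) \<in> test_functions \<Omega>" by (rule test_functions_mult[OF assms(2,3)])
  have T1: "(\<lambda>x. w x * partial_deriv i \<phi> x) \<in> test_functions \<Omega>"
    by (rule test_functions_mult[OF assms(2) test_functions_partial_deriv[OF assms(3)]])
  have T2: "(\<lambda>x. partial_deriv i w x * \<phi> x) \<in> test_functions \<Omega>"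
    by (rule test_functions_mult[OF smooth_on_partial_deriv[OF assms(2)] assms(3)])
  have "partial_deriv i (\<lambda>x. w x * \<phi> x) = (\<lambda>x. w x * partial_deriv i \<phi> x + partial_deriv i w x * \<phi> x)"
    by (rule ext, rule partial_deriv_mult)
      (use assms smooth_on_imp_differentiable test_functions_differentiable in auto)
  then have "0 = (\<integral>x. w x * partial_deriv i \<phi> x + partial_deriv i w x * \<phi> x \<partial>lborel)"
    using integral_partial_deriv_eq_0[OF T, of i] by simp
  also have "\<dots> = (\<integral>x. w x * partial_deriv i \<phi> x \<partial>lborel) + (\<integral>x. partial_deriv i w x * \<phi> x \<partial>lborel)"
    by (rule Bochner_Integration.integral_add[OF test_functions_integrable[OF T1] test_functions_integrable[OF T2]])
  finally show ?thesis
    using integral_lebesgue_on_test_function[OF assms(1) T1] integral_lebesgue_on_test_function[OF assms(1) T2]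
    by simp
qed

lemma has_weak_partial_smooth:
  assumes "open \<Omega>" "smooth_on UNIV w"
  shows "has_weak_partial \<Omega> i w (partial_deriv i w)"
  unfolding has_weak_partial_def
  using integration_by_parts_test_functions[OF assms] assms(2)
    continuous_on_imp_locally_integrable smooth_on_imp_continuous_on smooth_on_partial_deriv
  by blast

section \<open>Weighted Lebesgue spaces\<close>

text \<open>On a bounded domain a Muckenhoupt weight and its inverse are integrable. The former puts bounded
  functions into \<^term>\<open>L2 \<omega> \<Omega>\<close>, the latter makes its elements integrable.\<close>
definition integrable_weight :: "(real^'n) set \<Rightarrow> (real^'n \<Rightarrow> real) \<Rightarrow> bool" where
  "integrable_weight \<Omega> \<omega> \<longleftrightarrow> open \<Omega> \<and> (\<forall>x. 0 \<le> \<omega> x) \<and> (AE x in lebesgue_on \<Omega>. 0 < \<omega> x) \<and>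
     integrable (lebesgue_on \<Omega>) \<omega> \<and> integrable (lebesgue_on \<Omega>) (\<lambda>x. inverse (\<omega> x))"

lemma integrable_weight_inverse:
  assumes "integrable_weight \<Omega> \<omega>"
  shows "integrable_weight \<Omega> (\<lambda>x. inverse (\<omega> x))"
proof -
  have "AE x in lebesgue_on \<Omega>. 0 < inverse (\<omega> x)"
    using assms unfolding integrable_weight_def by auto
  then show ?thesis using assms unfolding integrable_weight_def by auto
qed

lemma integrable_weight_measurable:
  "integrable_weight \<Omega> \<omega> \<Longrightarrow> \<omega> \<in> borel_measurable (lebesgue_on \<Omega>)"
  unfolding integrable_weight_def by auto

lemma integrable_weight_nonneg: "integrable_weight \<Omega> \<omega> \<Longrightarrow> 0 \<le> \<omega> x"
  unfolding integrable_weight_def by auto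

lemma integrable_weight_open: "integrable_weight \<Omega> \<omega> \<Longrightarrow> open \<Omega>"
  unfolding integrable_weight_def by auto

lemma L2_iff:
  assumes "integrable_weight \<Omega> \<omega>"
  shows "w \<in> L2 \<omega> \<Omega> \<longleftrightarrow>
     w \<in> borel_measurable (lebesgue_on \<Omega>) \<and> integrable (lebesgue_on \<Omega>) (\<lambda>x. \<omega> x * (w x)\<^sup>2)"
  using integrable_weight_measurable[OF assms] integrable_weight_nonneg[OF assms]
  unfolding L2_def weighted_measure_def by (auto simp: integrable_density)

lemma L2_measurable: "w \<in> L2 \<omega> \<Omega> \<Longrightarrow> w \<in> borel_measurable (lebesgue_on \<Omega>)"
  unfolding L2_def by simp

lemma L2_sqnorm_eq:
  assumes "integrable_weight \<Omega> \<omega>" "w \<in> borel_measurable (lebesgue_on \<Omega>)"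
  shows "L2_sqnorm \<omega> \<Omega> w = (\<integral>x. \<omega> x * (w x)\<^sup>2 \<partial>lebesgue_on \<Omega>)"
  using integrable_weight_measurable[OF assms(1)] integrable_weight_nonneg[OF assms(1)] assms(2)
  unfolding L2_sqnorm_def weighted_measure_def by (subst integral_density) auto

lemma L2_sqnorm_nonneg: "0 \<le> L2_sqnorm \<omega> \<Omega> w"
  unfolding L2_sqnorm_def by (rule Bochner_Integration.integral_nonneg) simp

lemma borel_measurable_lebesgue_on_cong_AE:
  fixes f g :: "real^'n \<Rightarrow> real"
  assumes "open \<Omega>" "f \<in> borel_measurable (lebesgue_on \<Omega>)" "AE x in lebesgue_on \<Omega>. f x = g x"
  shows "g \<in> borel_measurable (lebesgue_on \<Omega>)"
proof -
  have "(\<lambda>x. if x \<in> \<Omega> then f x else 0) \<in> borel_measurable lebesgue"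
    using assms by (subst borel_measurable_if) auto
  moreover have "AE x in lebesgue. (if x \<in> \<Omega> then f x else 0) = (if x \<in> \<Omega> then g x else 0)"
    using assms(1,3) by (auto simp: AE_lebesgue_on elim!: eventually_mono)
  ultimately have "(\<lambda>x. if x \<in> \<Omega> then g x else 0) \<in> borel_measurable lebesgue"
    by (rule borel_measurable_AE)
  then show ?thesis using assms by (subst (asm) borel_measurable_if) auto
qed

lemma L2_cong_AE:
  assumes W: "integrable_weight \<Omega> \<omega>" and w: "w \<in> L2 \<omega> \<Omega>" and eq: "AE x in lebesgue_on \<Omega>. w x = v x"
  shows "v \<in> L2 \<omega> \<Omega>" "L2_sqnorm \<omega> \<Omega> v = L2_sqnorm \<omega> \<Omega> w"
proof -
  have m: "w \<in> borel_measurable (lebesgue_on \<Omega>)" "v \<in> borel_measurable (lebesgue_on \<Omega>)"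
    using borel_measurable_lebesgue_on_cong_AE[OF integrable_weight_open[OF W] _ eq] L2_measurable[OF w] by auto
  have eq2: "AE x in lebesgue_on \<Omega>. \<omega> x * (w x)\<^sup>2 = \<omega> x * (v x)\<^sup>2"
    using eq by eventually_elim simp
  note [measurable] = m integrable_weight_measurable[OF W]
  have "integrable (lebesgue_on \<Omega>) (\<lambda>x. \<omega> x * (w x)\<^sup>2) \<longleftrightarrow> integrable (lebesgue_on \<Omega>) (\<lambda>x. \<omega> x * (v x)\<^sup>2)"
    by (rule integrable_cong_AE[OF _ _ eq2]) measurable
  then show "v \<in> L2 \<omega> \<Omega>" using w m by (simp add: L2_iff[OF W])
  have "(\<integral>x. \<omega> x * (w x)\<^sup>2 \<partial>lebesgue_on \<Omega>) = (\<integral>x. \<omega> x * (v x)\<^sup>2 \<partial>lebesgue_on \<Omega>)"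
    by (rule integral_cong_AE[OF _ _ eq2]) measurable
  then show "L2_sqnorm \<omega> \<Omega> v = L2_sqnorm \<omega> \<Omega> w"
    by (simp add: L2_sqnorm_eq[OF W m(1)] L2_sqnorm_eq[OF W m(2)])
qed

lemma L2_dominated:
  assumes W: "integrable_weight \<Omega> \<omega>" and m: "w \<in> borel_measurable (lebesgue_on \<Omega>)"
    and h: "integrable (lebesgue_on \<Omega>) h" and bd: "AE x in lebesgue_on \<Omega>. \<omega> x * (w x)\<^sup>2 \<le> h x"
  shows "w \<in> L2 \<omega> \<Omega>" "L2_sqnorm \<omega> \<Omega> w \<le> (\<integral>x. h x \<partial>lebesgue_on \<Omega>)"
proof -
  note [measurable] = m integrable_weight_measurable[OF W]
  have i: "integrable (lebesgue_on \<Omega>) (\<lambda>x. \<omega> x * (w x)\<^sup>2)"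
  proof (rule Bochner_Integration.integrable_bound[OF h])
    show "AE x in lebesgue_on \<Omega>. norm (\<omega> x * (w x)\<^sup>2) \<le> norm (h x)"
      using bd by eventually_elim (use integrable_weight_nonneg[OF W] in \<open>simp add: abs_mult\<close>)
  qed measurable
  then show "w \<in> L2 \<omega> \<Omega>" using m by (simp add: L2_iff[OF W])
  show "L2_sqnorm \<omega> \<Omega> w \<le> (\<integral>x. h x \<partial>lebesgue_on \<Omega>)"
    unfolding L2_sqnorm_eq[OF W m] by (rule integral_mono_AE[OF i h bd])
qed

lemma power2_sum_le: "(a + b)\<^sup>2 \<le> 2 * a\<^sup>2 + 2 * (b::real)\<^sup>2"
  using zero_le_power2[of "a - b"] by (simp add: power2_eq_square algebra_simps)

lemma L2_add:
  assumes W: "integrable_weight \<Omega> \<omega>" and v: "v \<in> L2 \<omega> \<Omega>" and w: "w \<in> L2 \<omega> \<Omega>"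
  shows "(\<lambda>x. v x + w x) \<in> L2 \<omega> \<Omega>"
    "L2_sqnorm \<omega> \<Omega> (\<lambda>x. v x + w x) \<le> 2 * L2_sqnorm \<omega> \<Omega> v + 2 * L2_sqnorm \<omega> \<Omega> w"
proof -
  have i: "integrable (lebesgue_on \<Omega>) (\<lambda>x. \<omega> x * (v x)\<^sup>2)" "integrable (lebesgue_on \<Omega>) (\<lambda>x. \<omega> x * (w x)\<^sup>2)"
    using v w by (auto simp: L2_iff[OF W])
  have m: "(\<lambda>x. v x + w x) \<in> borel_measurable (lebesgue_on \<Omega>)"
    using L2_measurable[OF v] L2_measurable[OF w] by measurable
  have bd: "AE x in lebesgue_on \<Omega>. \<omega> x * (v x + w x)\<^sup>2 \<le> 2 * (\<omega> x * (v x)\<^sup>2) + 2 * (\<omega> x * (w x)\<^sup>2)"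
    using mult_left_mono[OF power2_sum_le integrable_weight_nonneg[OF W]]
    by (auto simp: algebra_simps)
  note * = L2_dominated[OF W m _ bd]
  show "(\<lambda>x. v x + w x) \<in> L2 \<omega> \<Omega>" using i by (intro *) auto
  have "L2_sqnorm \<omega> \<Omega> (\<lambda>x. v x + w x) \<le> (\<integral>x. 2 * (\<omega> x * (v x)\<^sup>2) + 2 * (\<omega> x * (w x)\<^sup>2) \<partial>lebesgue_on \<Omega>)"
    using i by (intro *) auto
  then show "L2_sqnorm \<omega> \<Omega> (\<lambda>x. v x + w x) \<le> 2 * L2_sqnorm \<omega> \<Omega> v + 2 * L2_sqnorm \<omega> \<Omega> w"
    using i by (simp add: L2_sqnorm_eq[OF W L2_measurable[OF v]] L2_sqnorm_eq[OF W L2_measurable[OF w]])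
qed

text \<open>For a constant factor this is scaling or an inclusion between two weighted spaces; in general the
  factor may compensate for a weight that is not controlled by the other one.\<close>
lemma L2_mult_comparison:
  assumes W: "integrable_weight \<Omega> \<omega>" and W': "integrable_weight \<Omega> \<omega>'" and w: "w \<in> L2 \<omega> \<Omega>"
    and g: "g \<in> borel_measurable (lebesgue_on \<Omega>)"
    and bd: "AE x in lebesgue_on \<Omega>. \<omega>' x * (g x)\<^sup>2 \<le> C * \<omega> x"
  shows "(\<lambda>x. g x * w x) \<in> L2 \<omega>' \<Omega>" "L2_sqnorm \<omega>' \<Omega> (\<lambda>x. g x * w x) \<le> C * L2_sqnorm \<omega> \<Omega> w"
proof -
  have i: "integrable (lebesgue_on \<Omega>) (\<lambda>x. \<omega> x * (w x)\<^sup>2)"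
    using w by (auto simp: L2_iff[OF W])
  have m: "(\<lambda>x. g x * w x) \<in> borel_measurable (lebesgue_on \<Omega>)"
    using L2_measurable[OF w] g by measurable
  have bd: "AE x in lebesgue_on \<Omega>. \<omega>' x * (g x * w x)\<^sup>2 \<le> C * (\<omega> x * (w x)\<^sup>2)"
    using bd
  proof eventually_elim
    case (elim x)
    then show ?case using mult_right_mono[OF elim zero_le_power2[of "w x"]]
      by (simp add: power_mult_distrib mult_ac)
  qed
  note * = L2_dominated[OF W' m _ bd]
  show "(\<lambda>x. g x * w x) \<in> L2 \<omega>' \<Omega>" using i by (intro *) auto
  have "L2_sqnorm \<omega>' \<Omega> (\<lambda>x. g x * w x) \<le> (\<integral>x. C * (\<omega> x * (w x)\<^sup>2) \<partial>lebesgue_on \<Omega>)"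
    using i by (intro *) auto
  then show "L2_sqnorm \<omega>' \<Omega> (\<lambda>x. g x * w x) \<le> C * L2_sqnorm \<omega> \<Omega> w"
    using i by (simp add: L2_sqnorm_eq[OF W L2_measurable[OF w]])
qed

lemma L2_cmult:
  assumes W: "integrable_weight \<Omega> \<omega>" and w: "w \<in> L2 \<omega> \<Omega>"
  shows "(\<lambda>x. c * w x) \<in> L2 \<omega> \<Omega>" "L2_sqnorm \<omega> \<Omega> (\<lambda>x. c * w x) \<le> c\<^sup>2 * L2_sqnorm \<omega> \<Omega> w"
proof -
  have "AE x in lebesgue_on \<Omega>. \<omega> x * c\<^sup>2 \<le> c\<^sup>2 * \<omega> x"
    by (simp only: mult.commute order_refl) simp
  from L2_mult_comparison[OF W W w _ this]
  show "(\<lambda>x. c * w x) \<in> L2 \<omega> \<Omega>" "L2_sqnorm \<omega> \<Omega> (\<lambda>x. c * w x) \<le> c\<^sup>2 * L2_sqnorm \<omega> \<Omega> w"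
    by simp_all
qed

lemma L2_diff:
  assumes W: "integrable_weight \<Omega> \<omega>" and v: "v \<in> L2 \<omega> \<Omega>" and w: "w \<in> L2 \<omega> \<Omega>"
  shows "(\<lambda>x. v x - w x) \<in> L2 \<omega> \<Omega>"
  using L2_add[OF W v L2_cmult(1)[OF W w, of "-1"]] by simp

lemma L2_zero: "integrable_weight \<Omega> \<omega> \<Longrightarrow> (\<lambda>x. 0) \<in> L2 \<omega> \<Omega>"
  by (simp add: L2_iff)

lemma L2_sum:
  "integrable_weight \<Omega> \<omega> \<Longrightarrow> (\<And>j. j \<in> J \<Longrightarrow> f j \<in> L2 \<omega> \<Omega>) \<Longrightarrow> (\<lambda>x. \<Sum>j\<in>J. f j x) \<in> L2 \<omega> \<Omega>"
  by (induction J rule: infinite_finite_induct) (auto intro: L2_add L2_zero)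

lemma L2_bounded:
  assumes W: "integrable_weight \<Omega> \<omega>" and m: "g \<in> borel_measurable (lebesgue_on \<Omega>)"
    and bd: "\<And>x. \<bar>g x\<bar> \<le> B"
  shows "g \<in> L2 \<omega> \<Omega>"
proof (rule L2_dominated[OF W m])
  show "integrable (lebesgue_on \<Omega>) (\<lambda>x. B\<^sup>2 * \<omega> x)"
    using W unfolding integrable_weight_def by auto
  have "(g x)\<^sup>2 \<le> B\<^sup>2" for x using bd[of x] abs_le_square_iff[of "g x" B] by simp
  then show "AE x in lebesgue_on \<Omega>. \<omega> x * (g x)\<^sup>2 \<le> B\<^sup>2 * \<omega> x"
    unfolding mult.commute[of "\<omega> _"] by (intro AE_I2 mult_right_mono integrable_weight_nonneg[OF W])
qed

lemma continuous_measurable_lebesgue_on: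
  fixes g :: "real^'n \<Rightarrow> real"
  assumes "continuous_on UNIV g"
  shows "g \<in> borel_measurable (lebesgue_on \<Omega>)"
  by (intro measurable_restrict_space1 measurable_completion)
    (use assms borel_measurable_continuous_onI in auto)

lemma test_functions_measurable:
  "\<phi> \<in> test_functions \<Omega>' \<Longrightarrow> \<phi> \<in> borel_measurable (lebesgue_on \<Omega>)"
  by (intro continuous_measurable_lebesgue_on test_functions_continuous_on)

lemma L2_test_function:
  assumes "integrable_weight \<Omega> \<omega>" "\<phi> \<in> test_functions \<Omega>'"
  shows "\<phi> \<in> L2 \<omega> \<Omega>"
  using test_functions_bounded[OF assms(2)] L2_bounded[OF assms(1) test_functions_measurable[OF assms(2)]] by metis

lemma Cauchy_Schwarz_integral:
  fixes f g :: "'a \<Rightarrow> real"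
  assumes [measurable]: "f \<in> borel_measurable M" "g \<in> borel_measurable M"
    and f: "integrable M (\<lambda>x. (f x)\<^sup>2)" and g: "integrable M (\<lambda>x. (g x)\<^sup>2)"
  shows "integrable M (\<lambda>x. f x * g x)"
    "\<bar>\<integral>x. f x * g x \<partial>M\<bar> \<le> sqrt (\<integral>x. (f x)\<^sup>2 \<partial>M) * sqrt (\<integral>x. (g x)\<^sup>2 \<partial>M)"
proof -
  show i: "integrable M (\<lambda>x. f x * g x)"
  proof (rule Bochner_Integration.integrable_bound[OF Bochner_Integration.integrable_add[OF f g]])
    show "AE x in M. norm (f x * g x) \<le> norm ((f x)\<^sup>2 + (g x)\<^sup>2)"
    proof (rule AE_I2)
      fix x
      have "2 * (\<bar>f x\<bar> * \<bar>g x\<bar>) \<le> (f x)\<^sup>2 + (g x)\<^sup>2"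
        using zero_le_power2[of "\<bar>f x\<bar> - \<bar>g x\<bar>"] by (simp add: power2_diff)
      moreover have "0 \<le> \<bar>f x\<bar> * \<bar>g x\<bar>" by simp
      ultimately have "\<bar>f x\<bar> * \<bar>g x\<bar> \<le> (f x)\<^sup>2 + (g x)\<^sup>2" by linarith
      then show "norm (f x * g x) \<le> norm ((f x)\<^sup>2 + (g x)\<^sup>2)" by (simp add: abs_mult)
    qed
  qed measurable
  define A B C where "A = (\<integral>x. (f x)\<^sup>2 \<partial>M)" and "B = (\<integral>x. (g x)\<^sup>2 \<partial>M)" and "C = (\<integral>x. f x * g x \<partial>M)"
  have AB: "A \<ge> 0" "B \<ge> 0" by (auto simp: A_def B_def)
  have q: "0 \<le> A + 2 * t * C + t\<^sup>2 * B" for t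
  proof -
    have "0 \<le> (\<integral>x. (f x + t * g x)\<^sup>2 \<partial>M)" by simp
    also have "(\<lambda>x. (f x + t * g x)\<^sup>2) = (\<lambda>x. (f x)\<^sup>2 + (2 * t) * (f x * g x) + t\<^sup>2 * (g x)\<^sup>2)"
      by (auto simp: power2_eq_square algebra_simps)
    also have "(\<integral>x. (f x)\<^sup>2 + (2 * t) * (f x * g x) + t\<^sup>2 * (g x)\<^sup>2 \<partial>M) = A + 2 * t * C + t\<^sup>2 * B"
      unfolding A_def B_def C_def using f g i by simp
    finally show ?thesis .
  qed
  have "C\<^sup>2 \<le> A * B"
  proof (cases "B = 0")
    case True
    have "C = 0"
    proof (rule ccontr)
      assume "C \<noteq> 0"
      then have "2 * (- (A + 1) / (2 * C)) * C = - (A + 1)" by simp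
      then show False using q[of "- (A + 1) / (2 * C)"] unfolding True by linarith
    qed
    then show ?thesis using AB by simp
  next
    case False
    then have "B > 0" using AB by simp
    then show ?thesis using q[of "- C / B"] by (simp add: field_simps power2_eq_square)
  qed
  then have "sqrt (C\<^sup>2) \<le> sqrt (A * B)" by (rule real_sqrt_le_mono)
  then show "\<bar>C\<bar> \<le> sqrt A * sqrt B" by (simp add: real_sqrt_mult)
qed

text \<open>The spaces with a weight and with its inverse are in duality without any weight in the pairing.\<close>
lemma L2_pairing:
  assumes W: "integrable_weight \<Omega> \<omega>" and f: "f \<in> L2 \<omega> \<Omega>" and g: "g \<in> L2 (\<lambda>x. inverse (\<omega> x)) \<Omega>"
  shows "integrable (lebesgue_on \<Omega>) (\<lambda>x. f x * g x)"
    "\<bar>\<integral>x. f x * g x \<partial>lebesgue_on \<Omega>\<bar> \<le> sqrt (L2_sqnorm \<omega> \<Omega> f) * sqrt (L2_sqnorm (\<lambda>x. inverse (\<omega> x)) \<Omega> g)"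
proof -
  let ?F = "\<lambda>x. sqrt (\<omega> x) * f x" and ?G = "\<lambda>x. sqrt (inverse (\<omega> x)) * g x"
  note W' = integrable_weight_inverse[OF W]
  note [measurable] = L2_measurable[OF f] L2_measurable[OF g] integrable_weight_measurable[OF W]
  have sq: "(?F x)\<^sup>2 = \<omega> x * (f x)\<^sup>2" "(?G x)\<^sup>2 = inverse (\<omega> x) * (g x)\<^sup>2" for x
    using integrable_weight_nonneg[OF W, of x] by (simp_all add: power_mult_distrib)
  have i: "integrable (lebesgue_on \<Omega>) (\<lambda>x. (?F x)\<^sup>2)" "integrable (lebesgue_on \<Omega>) (\<lambda>x. (?G x)\<^sup>2)"
    unfolding sq using f g by (auto simp: L2_iff[OF W] L2_iff[OF W'])
  have "AE x in lebesgue_on \<Omega>. 0 < \<omega> x" using W unfolding integrable_weight_def by simp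
  then have eq: "AE x in lebesgue_on \<Omega>. ?F x * ?G x = f x * g x"
    by eventually_elim (simp add: real_sqrt_inverse)
  have mF: "?F \<in> borel_measurable (lebesgue_on \<Omega>)" and mG: "?G \<in> borel_measurable (lebesgue_on \<Omega>)"
    by measurable
  note CS = Cauchy_Schwarz_integral[OF mF mG i]
  show "integrable (lebesgue_on \<Omega>) (\<lambda>x. f x * g x)"
    using CS(1) by (subst integrable_cong_AE[OF _ _ eq, symmetric]) auto
  have "(\<integral>x. f x * g x \<partial>lebesgue_on \<Omega>) = (\<integral>x. ?F x * ?G x \<partial>lebesgue_on \<Omega>)"
    by (rule integral_cong_AE[OF _ _ eq, symmetric]) auto
  then show "\<bar>\<integral>x. f x * g x \<partial>lebesgue_on \<Omega>\<bar> \<le> sqrt (L2_sqnorm \<omega> \<Omega> f) * sqrt (L2_sqnorm (\<lambda>x. inverse (\<omega> x)) \<Omega> g)"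
    using CS(2) unfolding sq by (simp add: L2_sqnorm_eq[OF W L2_measurable[OF f]] L2_sqnorm_eq[OF W' L2_measurable[OF g]])
qed

lemma L2_pairing_tendsto:
  assumes W: "integrable_weight \<Omega> \<omega>" and f: "f \<in> L2 \<omega> \<Omega>" and fn: "\<And>n. F n \<in> L2 \<omega> \<Omega>"
    and g: "g \<in> L2 (\<lambda>x. inverse (\<omega> x)) \<Omega>"
    and lim: "(\<lambda>n. L2_sqnorm \<omega> \<Omega> (\<lambda>x. f x - F n x)) \<longlonglongrightarrow> 0"
  shows "(\<lambda>n. \<integral>x. F n x * g x \<partial>lebesgue_on \<Omega>) \<longlonglongrightarrow> (\<integral>x. f x * g x \<partial>lebesgue_on \<Omega>)"
proof -
  let ?I = "\<lambda>h. \<integral>x. h x * g x \<partial>lebesgue_on \<Omega>" and ?s = "sqrt (L2_sqnorm (\<lambda>x. inverse (\<omega> x)) \<Omega> g)"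
  have "\<bar>?I (F n) - ?I f\<bar> \<le> sqrt (L2_sqnorm \<omega> \<Omega> (\<lambda>x. f x - F n x)) * ?s" for n
  proof -
    have "?I f - ?I (F n) = ?I (\<lambda>x. f x - F n x)"
      using L2_pairing(1)[OF W f g] L2_pairing(1)[OF W fn g] by (simp add: left_diff_distrib)
    then show ?thesis using L2_pairing(2)[OF W L2_diff[OF W f fn] g] by (simp add: abs_minus_commute)
  qed
  moreover have "(\<lambda>n. sqrt (L2_sqnorm \<omega> \<Omega> (\<lambda>x. f x - F n x)) * ?s) \<longlonglongrightarrow> sqrt 0 * ?s"
    by (intro tendsto_intros lim)
  ultimately have "(\<lambda>n. ?I (F n) - ?I f) \<longlonglongrightarrow> 0"
    by (intro Lim_null_comparison[of "\<lambda>n. ?I (F n) - ?I f"]) (auto intro!: always_eventually)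
  then show ?thesis by (simp add: LIM_zero_iff)
qed

lemma L2_imp_integrable:
  assumes W: "integrable_weight \<Omega> \<omega>" and f: "f \<in> L2 \<omega> \<Omega>"
  shows "integrable (lebesgue_on \<Omega>) f"
  using L2_pairing(1)[OF W f L2_bounded[OF integrable_weight_inverse[OF W], of "\<lambda>x. 1" 1]] by simp

lemma integrable_imp_locally_integrable:
  assumes "open \<Omega>" "integrable (lebesgue_on \<Omega>) w"
  shows "locally_integrable \<Omega> w"
  unfolding locally_integrable_def
proof (intro allI impI)
  fix C assume C: "compact C \<and> C \<subseteq> \<Omega>"
  have "set_integrable lebesgue \<Omega> w"
    using assms unfolding set_integrable_def by (simp add: integrable_lebesgue_on)
  then show "w absolutely_integrable_on C"
    by (rule set_integrable_subset) (use C in \<open>auto simp: compact_imp_closed\<close>)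
qed

section \<open>Weighted Sobolev spaces with zero boundary values\<close>

text \<open>Convergence of test functions to a function and of their gradients to a vector field; this
  describes \<^term>\<open>H10 \<omega> \<Omega>\<close> without mentioning weak derivatives.\<close>
definition H10_approximation :: "(real^'n \<Rightarrow> real) \<Rightarrow> (real^'n) set \<Rightarrow> (real^'n \<Rightarrow> real) \<Rightarrow>
    ('n \<Rightarrow> real^'n \<Rightarrow> real) \<Rightarrow> (nat \<Rightarrow> real^'n \<Rightarrow> real) \<Rightarrow> bool" where
  "H10_approximation \<omega> \<Omega> w g \<phi> \<longleftrightarrow>
     w \<in> L2 \<omega> \<Omega> \<and> (\<forall>i. g i \<in> L2 \<omega> \<Omega>) \<and> (\<forall>n. \<phi> n \<in> test_functions \<Omega>) \<and>
     (\<lambda>n. L2_sqnorm \<omega> \<Omega> (\<lambda>x. w x - \<phi> n x)) \<longlonglongrightarrow> 0 \<and>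
     (\<forall>i. (\<lambda>n. L2_sqnorm \<omega> \<Omega> (\<lambda>x. g i x - partial_deriv i (\<phi> n) x)) \<longlonglongrightarrow> 0)"

lemma has_weak_partial_test_function:
  "open \<Omega> \<Longrightarrow> \<phi> \<in> test_functions \<Omega>' \<Longrightarrow> has_weak_partial \<Omega> i \<phi> (partial_deriv i \<phi>)"
  by (intro has_weak_partial_smooth test_functions_smooth_on)

lemma has_weak_partial_diff_test_function:
  assumes \<Omega>: "open \<Omega>" and w: "has_weak_partial \<Omega> i w g" and \<phi>: "\<phi> \<in> test_functions \<Omega>"
  shows "has_weak_partial \<Omega> i (\<lambda>x. w x - \<phi> x) (\<lambda>x. g x - partial_deriv i \<phi> x)"
proof -
  note p = has_weak_partial_test_function[OF \<Omega> \<phi>, of i]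
  have li: "locally_integrable \<Omega> w" "locally_integrable \<Omega> g" "locally_integrable \<Omega> \<phi>"
    "locally_integrable \<Omega> (partial_deriv i \<phi>)"
    using w p unfolding has_weak_partial_def by auto
  show ?thesis
    unfolding has_weak_partial_def
  proof (intro conjI ballI locally_integrable_diff li)
    fix \<psi> assume \<psi>: "\<psi> \<in> test_functions \<Omega>"
    note d\<psi> = test_functions_partial_deriv[OF \<psi>, of i]
    show "(\<integral>x. (w x - \<phi> x) * partial_deriv i \<psi> x \<partial>lebesgue_on \<Omega>) = - (\<integral>x. (g x - partial_deriv i \<phi> x) * \<psi> x \<partial>lebesgue_on \<Omega>)"
      using w p \<psi> unfolding has_weak_partial_def
      by (simp add: left_diff_distrib integrable_mult_test_function li \<Omega> \<psi> d\<psi>)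
  qed
qed

text \<open>Limits of gradients are weak gradients, because testing is continuous by duality of the two weights.\<close>
lemma H10_approximation_has_weak_partial:
  assumes W: "integrable_weight \<Omega> \<omega>" and a: "H10_approximation \<omega> \<Omega> w g \<phi>"
  shows "has_weak_partial \<Omega> i w (g i)"
proof -
  note \<Omega> = integrable_weight_open[OF W]
  have w: "w \<in> L2 \<omega> \<Omega>" and g: "g i \<in> L2 \<omega> \<Omega>" and \<phi>: "\<And>n. \<phi> n \<in> test_functions \<Omega>"
    using a unfolding H10_approximation_def by auto
  show ?thesis
    unfolding has_weak_partial_def
  proof (intro conjI ballI integrable_imp_locally_integrable[OF \<Omega>] L2_imp_integrable[OF W] w g)
    fix \<psi> assume \<psi>: "\<psi> \<in> test_functions \<Omega>"
    note d\<psi> = test_functions_partial_deriv[OF \<psi>, of i] and d\<phi> = test_functions_partial_deriv[OF \<phi>, of i]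
    have l1: "(\<lambda>n. \<integral>x. \<phi> n x * partial_deriv i \<psi> x \<partial>lebesgue_on \<Omega>) \<longlonglongrightarrow> (\<integral>x. w x * partial_deriv i \<psi> x \<partial>lebesgue_on \<Omega>)"
      by (rule L2_pairing_tendsto[OF W w L2_test_function[OF W \<phi>] L2_test_function[OF integrable_weight_inverse[OF W] d\<psi>]])
        (use a in \<open>simp add: H10_approximation_def\<close>)
    have l2: "(\<lambda>n. \<integral>x. partial_deriv i (\<phi> n) x * \<psi> x \<partial>lebesgue_on \<Omega>) \<longlonglongrightarrow> (\<integral>x. g i x * \<psi> x \<partial>lebesgue_on \<Omega>)"
      by (rule L2_pairing_tendsto[OF W g L2_test_function[OF W d\<phi>] L2_test_function[OF integrable_weight_inverse[OF W] \<psi>]])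
        (use a in \<open>simp add: H10_approximation_def\<close>)
    have "(\<integral>x. \<phi> n x * partial_deriv i \<psi> x \<partial>lebesgue_on \<Omega>) = - (\<integral>x. partial_deriv i (\<phi> n) x * \<psi> x \<partial>lebesgue_on \<Omega>)" for n
      by (rule integration_by_parts_test_functions[OF \<Omega> test_functions_smooth_on[OF \<phi>] \<psi>])
    then show "(\<integral>x. w x * partial_deriv i \<psi> x \<partial>lebesgue_on \<Omega>) = - (\<integral>x. g i x * \<psi> x \<partial>lebesgue_on \<Omega>)"
      using LIMSEQ_unique[OF l1] tendsto_minus[OF l2] by simp
  qed
qed

lemma H1_norm_diff_test_function:
  assumes W: "integrable_weight \<Omega> \<omega>" and w: "w \<in> L2 \<omega> \<Omega>" and g: "\<And>i. g i \<in> L2 \<omega> \<Omega>"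
    and p: "\<And>i. has_weak_partial \<Omega> i w (g i)" and \<phi>: "\<phi> \<in> test_functions \<Omega>"
  shows "H1_norm \<omega> \<Omega> (\<lambda>x. w x - \<phi> x) =
    sqrt (L2_sqnorm \<omega> \<Omega> (\<lambda>x. w x - \<phi> x) + (\<Sum>i\<in>UNIV. L2_sqnorm \<omega> \<Omega> (\<lambda>x. g i x - partial_deriv i \<phi> x)))"
proof -
  note \<Omega> = integrable_weight_open[OF W]
  have "L2_sqnorm \<omega> \<Omega> (weak_partial \<Omega> i (\<lambda>x. w x - \<phi> x)) = L2_sqnorm \<omega> \<Omega> (\<lambda>x. g i x - partial_deriv i \<phi> x)" for i
    using weak_partial_AE_eq[OF \<Omega> has_weak_partial_diff_test_function[OF \<Omega> p \<phi>], of i]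
    by (intro L2_cong_AE(2)[OF W L2_diff[OF W g L2_test_function[OF W test_functions_partial_deriv[OF \<phi>]]]])
      (auto elim!: eventually_mono)
  then show ?thesis unfolding H1_norm_def by simp
qed

text \<open>Together with the converse below: membership in \<^const>\<open>H10\<close> may be checked on approximants.\<close>
lemma H10_approximation_imp_H10:
  assumes W: "integrable_weight \<Omega> \<omega>" and a: "H10_approximation \<omega> \<Omega> w g \<phi>"
  shows "w \<in> H10 \<omega> \<Omega>"
proof -
  have w: "w \<in> L2 \<omega> \<Omega>" and g: "\<And>i. g i \<in> L2 \<omega> \<Omega>" and \<phi>: "\<And>n. \<phi> n \<in> test_functions \<Omega>"
    using a unfolding H10_approximation_def by auto
  note p = H10_approximation_has_weak_partial[OF W a]
  have "(\<lambda>n. sqrt (L2_sqnorm \<omega> \<Omega> (\<lambda>x. w x - \<phi> n x) + (\<Sum>i\<in>UNIV. L2_sqnorm \<omega> \<Omega> (\<lambda>x. g i x - partial_deriv i (\<phi> n) x))))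
      \<longlonglongrightarrow> sqrt (0 + (\<Sum>i\<in>(UNIV::'a set). 0))"
    using a unfolding H10_approximation_def by (intro tendsto_intros) auto
  then have lim: "(\<lambda>n. H1_norm \<omega> \<Omega> (\<lambda>x. w x - \<phi> n x)) \<longlonglongrightarrow> 0"
    using H1_norm_diff_test_function[OF W w g p \<phi>] by simp
  have "\<exists>\<phi>\<in>test_functions \<Omega>. H1_norm \<omega> \<Omega> (\<lambda>x. w x - \<phi> x) < \<epsilon>" if "\<epsilon> > 0" for \<epsilon>
    using order_tendstoD(2)[OF lim that] \<phi> by (auto simp: eventually_sequentially)
  then show ?thesis unfolding H10_def H1_def using w g p by auto
qed

lemma H10_imp_L2:
  assumes "w \<in> H10 \<omega> \<Omega>"
  shows "w \<in> L2 \<omega> \<Omega>"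
  using assms unfolding H10_def H1_def by auto

lemma H10_has_weak_partial:
  assumes W: "integrable_weight \<Omega> \<omega>" and w: "w \<in> H10 \<omega> \<Omega>"
  shows "has_weak_partial \<Omega> i w (weak_partial \<Omega> i w)" "weak_partial \<Omega> i w \<in> L2 \<omega> \<Omega>"
proof -
  obtain g where g: "g \<in> L2 \<omega> \<Omega>" "has_weak_partial \<Omega> i w g"
    using w unfolding H10_def H1_def by auto
  show "has_weak_partial \<Omega> i w (weak_partial \<Omega> i w)"
    unfolding weak_partial_def using g(2) by (rule someI[of "has_weak_partial \<Omega> i w"])
  have "AE x in lebesgue_on \<Omega>. g x = weak_partial \<Omega> i w x"
    using weak_partial_AE_eq[OF integrable_weight_open[OF W] g(2)] by (auto elim!: eventually_mono)
  then show "weak_partial \<Omega> i w \<in> L2 \<omega> \<Omega>"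
    by (rule L2_cong_AE(1)[OF W g(1)])
qed

lemma H10_imp_H10_approximation:
  assumes W: "integrable_weight \<Omega> \<omega>" and w: "w \<in> H10 \<omega> \<Omega>"
  obtains \<phi> where "H10_approximation \<omega> \<Omega> w (\<lambda>i. weak_partial \<Omega> i w) \<phi>"
    "(\<lambda>n. H1_norm \<omega> \<Omega> (\<lambda>x. w x - \<phi> n x)) \<longlonglongrightarrow> 0"
proof -
  let ?g = "\<lambda>i. weak_partial \<Omega> i w"
  note p = H10_has_weak_partial[OF W w] and L = H10_imp_L2[OF w]
  have "\<exists>\<phi>\<in>test_functions \<Omega>. H1_norm \<omega> \<Omega> (\<lambda>x. w x - \<phi> x) < inverse (real (Suc n))" for n
    using w unfolding H10_def by auto
  then obtain \<phi> where \<phi>: "\<And>n. \<phi> n \<in> test_functions \<Omega>"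
    and lt: "\<And>n. H1_norm \<omega> \<Omega> (\<lambda>x. w x - \<phi> n x) < inverse (real (Suc n))"
    by metis
  have nn: "0 \<le> H1_norm \<omega> \<Omega> v" for v
    unfolding H1_norm_def by (intro real_sqrt_ge_zero add_nonneg_nonneg sum_nonneg L2_sqnorm_nonneg)
  have lim: "(\<lambda>n. H1_norm \<omega> \<Omega> (\<lambda>x. w x - \<phi> n x)) \<longlonglongrightarrow> 0"
    by (rule tendsto_sandwich[OF _ _ tendsto_const LIMSEQ_inverse_real_of_nat])
      (use nn lt in \<open>auto intro!: always_eventually simp: less_imp_le\<close>)
  have lim2: "(\<lambda>n. (H1_norm \<omega> \<Omega> (\<lambda>x. w x - \<phi> n x))\<^sup>2) \<longlonglongrightarrow> 0"
    using tendsto_power[OF lim, of 2] by simp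
  have sq: "(H1_norm \<omega> \<Omega> (\<lambda>x. w x - \<phi> n x))\<^sup>2 =
      L2_sqnorm \<omega> \<Omega> (\<lambda>x. w x - \<phi> n x) + (\<Sum>i\<in>UNIV. L2_sqnorm \<omega> \<Omega> (\<lambda>x. ?g i x - partial_deriv i (\<phi> n) x))" for n
    unfolding H1_norm_diff_test_function[OF W L p(2) p(1) \<phi>]
    by (intro real_sqrt_pow2 add_nonneg_nonneg sum_nonneg L2_sqnorm_nonneg)
  have "(\<lambda>n. L2_sqnorm \<omega> \<Omega> (\<lambda>x. w x - \<phi> n x)) \<longlonglongrightarrow> 0"
    by (rule tendsto_sandwich[OF _ _ tendsto_const lim2])
      (auto intro!: always_eventually L2_sqnorm_nonneg sum_nonneg simp: sq)
  moreover have "(\<lambda>n. L2_sqnorm \<omega> \<Omega> (\<lambda>x. ?g i x - partial_deriv i (\<phi> n) x)) \<longlonglongrightarrow> 0" for i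
  proof (rule tendsto_sandwich[OF _ _ tendsto_const lim2])
    have "L2_sqnorm \<omega> \<Omega> (\<lambda>x. ?g i x - partial_deriv i (\<phi> n) x) \<le> (\<Sum>i\<in>UNIV. L2_sqnorm \<omega> \<Omega> (\<lambda>x. ?g i x - partial_deriv i (\<phi> n) x))" for n
      by (rule member_le_sum) (auto intro: L2_sqnorm_nonneg)
    then show "\<forall>\<^sub>F n in sequentially. L2_sqnorm \<omega> \<Omega> (\<lambda>x. ?g i x - partial_deriv i (\<phi> n) x) \<le> (H1_norm \<omega> \<Omega> (\<lambda>x. w x - \<phi> n x))\<^sup>2"
      unfolding sq using L2_sqnorm_nonneg by (auto intro!: always_eventually add_increasing)
  qed (auto intro!: always_eventually L2_sqnorm_nonneg)
  ultimately show ?thesis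
    using that[OF _ lim] L p(2) \<phi> unfolding H10_approximation_def by blast
qed

lemma H10_weak_partial_AE:
  assumes "integrable_weight \<Omega> \<omega>" "H10_approximation \<omega> \<Omega> w g \<phi>"
  shows "AE x in lebesgue_on \<Omega>. weak_partial \<Omega> i w x = g i x"
  by (rule weak_partial_AE_eq[OF integrable_weight_open[OF assms(1)] H10_approximation_has_weak_partial[OF assms]])

lemma sqnorm_tendsto_add:
  assumes W: "integrable_weight \<Omega> \<omega>" and L: "\<And>n. F n \<in> L2 \<omega> \<Omega>" "\<And>n. G n \<in> L2 \<omega> \<Omega>"
    and lim: "(\<lambda>n. L2_sqnorm \<omega> \<Omega> (F n)) \<longlonglongrightarrow> 0" "(\<lambda>n. L2_sqnorm \<omega> \<Omega> (G n)) \<longlonglongrightarrow> 0"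
    and eq: "\<And>n x. H n x = F n x + G n x"
  shows "(\<lambda>n. L2_sqnorm \<omega> \<Omega> (H n)) \<longlonglongrightarrow> 0"
proof (rule tendsto_sandwich[OF _ _ tendsto_const])
  show "(\<lambda>n. 2 * L2_sqnorm \<omega> \<Omega> (F n) + 2 * L2_sqnorm \<omega> \<Omega> (G n)) \<longlonglongrightarrow> 0"
    using tendsto_add[OF tendsto_mult_left[OF lim(1), of 2] tendsto_mult_left[OF lim(2), of 2]] by simp
  have "H n = (\<lambda>x. F n x + G n x)" for n using eq by auto
  then show "\<forall>\<^sub>F n in sequentially. L2_sqnorm \<omega> \<Omega> (H n) \<le> 2 * L2_sqnorm \<omega> \<Omega> (F n) + 2 * L2_sqnorm \<omega> \<Omega> (G n)"
    using L2_add(2)[OF W L] by auto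
qed (auto intro!: always_eventually L2_sqnorm_nonneg)

lemma sqnorm_tendsto_mult:
  assumes W: "integrable_weight \<Omega> \<omega>" and W': "integrable_weight \<Omega> \<omega>'" and L: "\<And>n. F n \<in> L2 \<omega> \<Omega>"
    and g: "g \<in> borel_measurable (lebesgue_on \<Omega>)"
    and bd: "AE x in lebesgue_on \<Omega>. \<omega>' x * (g x)\<^sup>2 \<le> C * \<omega> x"
    and lim: "(\<lambda>n. L2_sqnorm \<omega> \<Omega> (F n)) \<longlonglongrightarrow> 0"
    and eq: "\<And>n x. H n x = g x * F n x"
  shows "(\<lambda>n. L2_sqnorm \<omega>' \<Omega> (H n)) \<longlonglongrightarrow> 0"
proof (rule tendsto_sandwich[OF _ _ tendsto_const])
  show "(\<lambda>n. C * L2_sqnorm \<omega> \<Omega> (F n)) \<longlonglongrightarrow> 0"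
    using tendsto_mult_left[OF lim, of C] by simp
  have "H n = (\<lambda>x. g x * F n x)" for n using eq by auto
  then show "\<forall>\<^sub>F n in sequentially. L2_sqnorm \<omega>' \<Omega> (H n) \<le> C * L2_sqnorm \<omega> \<Omega> (F n)"
    using L2_mult_comparison(2)[OF W W' L g bd] by auto
qed (auto intro!: always_eventually L2_sqnorm_nonneg)

lemma H10_approximation_add:
  assumes W: "integrable_weight \<Omega> \<omega>"
    and u: "H10_approximation \<omega> \<Omega> u g \<phi>" and v: "H10_approximation \<omega> \<Omega> v h \<psi>"
  shows "H10_approximation \<omega> \<Omega> (\<lambda>x. u x + v x) (\<lambda>i x. g i x + h i x) (\<lambda>n x. \<phi> n x + \<psi> n x)"
proof -
  have Lu: "u \<in> L2 \<omega> \<Omega>" "\<And>i. g i \<in> L2 \<omega> \<Omega>" and \<phi>: "\<And>n. \<phi> n \<in> test_functions \<Omega>"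
    and Lv: "v \<in> L2 \<omega> \<Omega>" "\<And>i. h i \<in> L2 \<omega> \<Omega>" and \<psi>: "\<And>n. \<psi> n \<in> test_functions \<Omega>"
    using u v unfolding H10_approximation_def by auto
  note T = L2_test_function[OF W \<phi>] L2_test_function[OF W \<psi>]
    L2_test_function[OF W test_functions_partial_deriv[OF \<phi>]] L2_test_function[OF W test_functions_partial_deriv[OF \<psi>]]
  show ?thesis
    unfolding H10_approximation_def
  proof (intro conjI allI L2_add[OF W] Lu Lv test_functions_add \<phi> \<psi>)
    show "(\<lambda>n. L2_sqnorm \<omega> \<Omega> (\<lambda>x. u x + v x - (\<phi> n x + \<psi> n x))) \<longlonglongrightarrow> 0"
      by (rule sqnorm_tendsto_add[OF W, where F = "\<lambda>n x. u x - \<phi> n x" and G = "\<lambda>n x. v x - \<psi> n x"])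
        (use u v in \<open>auto intro!: L2_diff[OF W] Lu Lv T simp: H10_approximation_def\<close>)
    show "(\<lambda>n. L2_sqnorm \<omega> \<Omega> (\<lambda>x. g i x + h i x - partial_deriv i (\<lambda>x. \<phi> n x + \<psi> n x) x)) \<longlonglongrightarrow> 0" for i
      by (rule sqnorm_tendsto_add[OF W, where F = "\<lambda>n x. g i x - partial_deriv i (\<phi> n) x" and G = "\<lambda>n x. h i x - partial_deriv i (\<psi> n) x"])
        (use u v in \<open>auto intro!: L2_diff[OF W] Lu Lv T
          simp: H10_approximation_def partial_deriv_add test_functions_differentiable[OF \<phi>] test_functions_differentiable[OF \<psi>]\<close>)
  qed
qed

text \<open>Multiplication by a smooth function that vanishes where the second weight is not controlled by
  the first moves between the two spaces.\<close>
lemma H10_approximation_mult: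
  assumes W: "integrable_weight \<Omega> \<omega>" and W': "integrable_weight \<Omega> \<omega>'"
    and u: "H10_approximation \<omega> \<Omega> u g \<phi>" and \<eta>: "smooth_on UNIV \<eta>"
    and b0: "AE x in lebesgue_on \<Omega>. \<omega>' x * (\<eta> x)\<^sup>2 \<le> C * \<omega> x"
    and b1: "\<And>i. AE x in lebesgue_on \<Omega>. \<omega>' x * (partial_deriv i \<eta> x)\<^sup>2 \<le> C * \<omega> x"
  shows "H10_approximation \<omega>' \<Omega> (\<lambda>x. \<eta> x * u x) (\<lambda>i x. \<eta> x * g i x + partial_deriv i \<eta> x * u x) (\<lambda>n x. \<eta> x * \<phi> n x)"
proof -
  have Lu: "u \<in> L2 \<omega> \<Omega>" "\<And>i. g i \<in> L2 \<omega> \<Omega>" and \<phi>: "\<And>n. \<phi> n \<in> test_functions \<Omega>"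
    using u unfolding H10_approximation_def by auto
  have m0: "\<eta> \<in> borel_measurable (lebesgue_on \<Omega>)" and m1: "\<And>i. partial_deriv i \<eta> \<in> borel_measurable (lebesgue_on \<Omega>)"
    by (intro continuous_measurable_lebesgue_on smooth_on_imp_continuous_on \<eta> smooth_on_partial_deriv)+
  note M0 = L2_mult_comparison(1)[OF W W' _ m0 b0] and M1 = L2_mult_comparison(1)[OF W W' _ m1 b1]
  note T0 = L2_test_function[OF W \<phi>] and T1 = L2_test_function[OF W test_functions_partial_deriv[OF \<phi>]]
  note D0 = L2_diff[OF W Lu(1) T0] and D1 = L2_diff[OF W Lu(2) T1]
  show ?thesis
    unfolding H10_approximation_def
  proof (intro conjI allI L2_add[OF W'] M0 M1 Lu test_functions_mult \<eta> \<phi>)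
    show "(\<lambda>n. L2_sqnorm \<omega>' \<Omega> (\<lambda>x. \<eta> x * u x - \<eta> x * \<phi> n x)) \<longlonglongrightarrow> 0"
      by (rule sqnorm_tendsto_mult[OF W W' _ m0 b0, where F = "\<lambda>n x. u x - \<phi> n x"], rule D0)
        (use u in \<open>auto simp: H10_approximation_def algebra_simps\<close>)
    show "(\<lambda>n. L2_sqnorm \<omega>' \<Omega> (\<lambda>x. \<eta> x * g i x + partial_deriv i \<eta> x * u x - partial_deriv i (\<lambda>x. \<eta> x * \<phi> n x) x)) \<longlonglongrightarrow> 0" for i
    proof (rule sqnorm_tendsto_add[OF W', where F = "\<lambda>n x. \<eta> x * (g i x - partial_deriv i (\<phi> n) x)"
          and G = "\<lambda>n x. partial_deriv i \<eta> x * (u x - \<phi> n x)"])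
      show "(\<lambda>x. \<eta> x * (g i x - partial_deriv i (\<phi> n) x)) \<in> L2 \<omega>' \<Omega>" for n by (rule M0[OF D1])
      show "(\<lambda>x. partial_deriv i \<eta> x * (u x - \<phi> n x)) \<in> L2 \<omega>' \<Omega>" for n by (rule M1[OF D0])
      show "(\<lambda>n. L2_sqnorm \<omega>' \<Omega> (\<lambda>x. \<eta> x * (g i x - partial_deriv i (\<phi> n) x))) \<longlonglongrightarrow> 0"
        by (rule sqnorm_tendsto_mult[OF W W' _ m0 b0, where F = "\<lambda>n x. g i x - partial_deriv i (\<phi> n) x"], rule D1) (use u in \<open>auto simp: H10_approximation_def\<close>)
      show "(\<lambda>n. L2_sqnorm \<omega>' \<Omega> (\<lambda>x. partial_deriv i \<eta> x * (u x - \<phi> n x))) \<longlonglongrightarrow> 0"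
        by (rule sqnorm_tendsto_mult[OF W W' _ m1 b1, where F = "\<lambda>n x. u x - \<phi> n x"], rule D0) (use u in \<open>auto simp: H10_approximation_def\<close>)
      show "\<eta> x * g i x + partial_deriv i \<eta> x * u x - partial_deriv i (\<lambda>x. \<eta> x * \<phi> n x) x =
          \<eta> x * (g i x - partial_deriv i (\<phi> n) x) + partial_deriv i \<eta> x * (u x - \<phi> n x)" for n x
        by (subst partial_deriv_mult)
          (auto intro!: smooth_on_imp_differentiable[OF \<eta>] test_functions_differentiable[OF \<phi>] simp: algebra_simps)
    qed
  qed
qed

lemma H10_approximation_cmult:
  assumes W: "integrable_weight \<Omega> \<omega>" and u: "H10_approximation \<omega> \<Omega> u g \<phi>"
  shows "H10_approximation \<omega> \<Omega> (\<lambda>x. c * u x) (\<lambda>i x. c * g i x) (\<lambda>n x. c * \<phi> n x)"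
  using H10_approximation_mult[OF W W u smooth_on_const, of c "c\<^sup>2"] integrable_weight_nonneg[OF W]
  by (simp add: partial_deriv_const mult.commute)

lemma H10_approximation_test_function:
  assumes "integrable_weight \<Omega> \<omega>" "\<phi> \<in> test_functions \<Omega>"
  shows "H10_approximation \<omega> \<Omega> \<phi> (\<lambda>i. partial_deriv i \<phi>) (\<lambda>n. \<phi>)"
  using assms by (auto simp: H10_approximation_def L2_sqnorm_def intro!: L2_test_function test_functions_partial_deriv)

lemma H10_approximation_cong_AE:
  assumes W: "integrable_weight \<Omega> \<omega>" and u: "H10_approximation \<omega> \<Omega> u g \<phi>"
    and eq: "AE x in lebesgue_on \<Omega>. u x = u' x"
  shows "H10_approximation \<omega> \<Omega> u' g \<phi>"
proof -
  have Lu: "u \<in> L2 \<omega> \<Omega>" "\<And>i. g i \<in> L2 \<omega> \<Omega>" and \<phi>: "\<And>n. \<phi> n \<in> test_functions \<Omega>"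
    using u unfolding H10_approximation_def by auto
  have "L2_sqnorm \<omega> \<Omega> (\<lambda>x. u' x - \<phi> n x) = L2_sqnorm \<omega> \<Omega> (\<lambda>x. u x - \<phi> n x)" for n
    by (rule L2_cong_AE(2)[OF W L2_diff[OF W Lu(1) L2_test_function[OF W \<phi>]]])
      (use eq in \<open>auto elim!: eventually_mono\<close>)
  then show ?thesis
    using u L2_cong_AE(1)[OF W Lu(1) eq] unfolding H10_approximation_def by simp
qed

lemma test_functions_subset_H10:
  "integrable_weight \<Omega> \<omega> \<Longrightarrow> test_functions \<Omega> \<subseteq> H10 \<omega> \<Omega>"
  using H10_approximation_imp_H10 H10_approximation_test_function by blast

section \<open>Powers of the distance as weights\<close>

text \<open>A nonnegative function that is dominated on balls exhausting the space is integrable if the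
  corresponding series converges.\<close>
lemma integrable_if_ball_cover:
  fixes f :: "real^'n \<Rightarrow> real"
  assumes f: "f \<in> borel_measurable borel" "\<And>x. 0 \<le> f x" and c: "\<And>n. 0 \<le> c n" "\<And>n. 0 \<le> r n"
    and cover: "\<And>x. f x = 0 \<or> (\<exists>n::nat. norm x < r n \<and> f x \<le> c n)"
    and sum: "summable (\<lambda>n. c n * r n ^ CARD('n))"
  shows "integrable lborel f"
proof (rule integrableI_nonneg)
  let ?h = "\<lambda>n x. c n * indicator (ball 0 (r n)) (x::real^'n)"
  let ?V = "unit_ball_vol (real CARD('n))"
  have int: "(\<integral>\<^sup>+x. ennreal (?h n x) \<partial>lborel) = ennreal (?V * (c n * r n ^ CARD('n)))" for n
  proof -
    have "(\<integral>\<^sup>+x. ennreal (?h n x) \<partial>lborel) = (\<integral>\<^sup>+x. ennreal (c n) * indicator (ball 0 (r n)) (x::real^'n) \<partial>lborel)"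
      by (intro nn_integral_cong) (simp add: indicator_def)
    also have "\<dots> = ennreal (c n) * ennreal (?V * r n ^ CARD('n))"
      using c(2)[of n] by (simp add: nn_integral_cmult_indicator emeasure_ball)
    also have "\<dots> = ennreal (c n * (?V * r n ^ CARD('n)))"
      by (rule ennreal_mult'[symmetric]) (rule c(1))
    finally show ?thesis by (simp add: mult_ac)
  qed
  have le: "ennreal (f x) \<le> (\<Sum>n. ennreal (?h n x))" for x
  proof (cases "f x = 0")
    case False
    then obtain n where n: "norm x < r n" "f x \<le> c n" using cover[of x] by auto
    then have "f x \<le> ?h n x" by (simp add: indicator_def)
    then have "ennreal (f x) \<le> ennreal (?h n x)" by (rule ennreal_leI)
    also have "\<dots> \<le> (\<Sum>n. ennreal (?h n x))"
    proof -
      have "(\<Sum>k\<in>{n}. ennreal (?h k x)) \<le> (\<Sum>n. ennreal (?h n x))"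
        by (rule sum_le_suminf[OF summableI]) auto
      moreover have "(\<Sum>k\<in>{n}. ennreal (?h k x)) = ennreal (?h n x)"
        by (subst sum.insert) (simp_all only: finite.emptyI empty_iff sum.empty add_0_right not_False_eq_True)
      ultimately show ?thesis by (simp only:)
    qed
    finally show ?thesis .
  qed simp
  have "(\<integral>\<^sup>+x. ennreal (f x) \<partial>lborel) \<le> (\<integral>\<^sup>+x. (\<Sum>n. ennreal (?h n x)) \<partial>lborel)"
    by (rule nn_integral_mono) (rule le)
  also have "\<dots> = (\<Sum>n. \<integral>\<^sup>+x. ennreal (?h n x) \<partial>lborel)"
    by (rule nn_integral_suminf)
      (intro measurable_compose[OF _ measurable_ennreal] borel_measurable_times borel_measurable_const
        borel_measurable_indicator, simp)
  also have "\<dots> = (\<Sum>n. ennreal (?V * (c n * r n ^ CARD('n))))"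
    by (simp only: int)
  also have "\<dots> < \<infinity>"
    using c sum by (subst suminf_ennreal2) (auto intro!: summable_mult)
  finally show "(\<integral>\<^sup>+x. ennreal (f x) \<partial>lborel) < \<infinity>" .
qed (use f in auto)

text \<open>On the shell where the norm lies between $R 2^{-n-1}$ and $R 2^{-n}$ the function is at most a
  constant times $2^{n \<beta>}$, while the ball has measure of order $2^{-n d}$.\<close>
lemma integrable_norm_powr_ball:
  fixes a :: "real^'n"
  assumes \<beta>: "0 \<le> \<beta>" "\<beta> < real CARD('n)" and R: "R > 0"
  shows "integrable lborel (\<lambda>x. indicator (ball a R) x * norm (x - a) powr (- \<beta>))"
proof -
  define d where "d = CARD('n)"
  define r where "r n = R / 2 ^ n" for n :: nat
  have r: "r n > 0" for n using R by (simp add: r_def)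
  let ?f = "\<lambda>x. indicator (ball 0 R) x * norm (x::real^'n) powr (- \<beta>)"
  define q where "q = 2 powr (\<beta> - real d)"
  have q: "0 \<le> q" "q < 1" using \<beta> unfolding q_def d_def by (auto simp: powr_less_one)
  have "integrable lborel ?f"
  proof (rule integrable_if_ball_cover[where c = "\<lambda>n. r (Suc n) powr (- \<beta>)" and r = r])
    show "?f \<in> borel_measurable borel"
      by (intro borel_measurable_times borel_measurable_indicator powr_real_measurable) simp_all
    show "0 \<le> ?f x" "0 \<le> r (Suc n) powr (- \<beta>)" "0 \<le> r n" for x n using r[of n] by auto
    have "r (Suc n) powr (- \<beta>) * r n ^ d = ((R / 2) powr (- \<beta>) * R ^ d) * q ^ n" for n
    proof -
      have rn: "r (Suc n) = (R / 2) * 2 powr (- real n)"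
        by (simp add: r_def powr_minus powr_realpow field_simps)
      have "r (Suc n) powr (- \<beta>) = (R / 2) powr (- \<beta>) * 2 powr (real n * \<beta>)"
        using R by (subst rn, subst powr_mult) (auto simp: powr_powr)
      moreover have "r n ^ d = R ^ d * 2 powr (- (real n * real d))"
        by (simp add: r_def powr_minus power_divide powr_realpow field_simps flip: power_mult of_nat_mult)
      moreover have "q ^ n = 2 powr (real n * \<beta>) * 2 powr (- (real n * real d))"
      proof -
        have "q ^ n = q powr real n" unfolding q_def by (simp only: powr_realpow powr_gt_zero)
        also have "\<dots> = 2 powr ((\<beta> - real d) * real n)" unfolding q_def by (rule powr_powr)
        also have "(\<beta> - real d) * real n = real n * \<beta> + - (real n * real d)" by (simp add: algebra_simps)
        finally show ?thesis unfolding powr_add .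
      qed
      ultimately show ?thesis by simp
    qed
    then have "(\<lambda>n. r (Suc n) powr (- \<beta>) * r n ^ CARD('n)) = (\<lambda>n. ((R / 2) powr (- \<beta>) * R ^ d) * q ^ n)"
      unfolding d_def by (intro ext)
    then show "summable (\<lambda>n. r (Suc n) powr (- \<beta>) * r n ^ CARD('n))"
      using q by (simp only:) (intro summable_mult summable_geometric, simp)
    show "?f x = 0 \<or> (\<exists>n. norm x < r n \<and> ?f x \<le> r (Suc n) powr (- \<beta>))" for x
    proof (cases "x \<in> ball 0 R \<and> x \<noteq> 0")
      case True
      have "(\<lambda>n. R / 2 ^ Suc n) \<longlonglongrightarrow> 0"
        using LIMSEQ_Suc[OF LIMSEQ_divide_realpow_zero[of 2 R]] by simp
      from order_tendstoD(2)[OF this, of "norm x"] have "\<forall>\<^sub>F n in sequentially. r (Suc n) < norm x"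
        using True unfolding r_def by simp
      then have "\<exists>n. r (Suc n) < norm x" by (simp only: eventually_sequentially) blast
      then have ex: "\<exists>n. r (Suc n) \<le> norm x" by (auto intro: less_imp_le)
      define n where "n = (LEAST n. r (Suc n) \<le> norm x)"
      have n1: "r (Suc n) \<le> norm x" unfolding n_def by (rule LeastI_ex[OF ex])
      have n2: "norm x < r n"
      proof (cases n)
        case 0
        then show ?thesis using True by (simp add: r_def)
      next
        case (Suc m)
        then show ?thesis using not_less_Least[of m "\<lambda>n. r (Suc n) \<le> norm x"] unfolding n_def by auto
      qed
      have "norm x powr (- \<beta>) \<le> r (Suc n) powr (- \<beta>)"
        by (rule powr_mono2') (use n1 r[of "Suc n"] \<beta> in auto)
      then have "?f x \<le> r (Suc n) powr (- \<beta>)" using True by (simp add: indicator_def)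
      then show ?thesis using n2 by blast
    qed auto
  qed
  from integrable_lborel_shift[OF this, of "- a"]
  have "integrable lborel (\<lambda>x. indicator (ball 0 R) (x - a) * norm (x - a) powr (- \<beta>))" by simp
  moreover have "indicator (ball 0 R) (x - a) = (indicator (ball a R) x :: real)" for x
    by (auto simp: indicator_def dist_norm norm_minus_commute)
  ultimately show ?thesis by simp
qed

lemma integrable_lebesgue_on_lborel:
  fixes f :: "real^'n \<Rightarrow> real"
  assumes "open \<Omega>" "integrable lborel f"
  shows "integrable (lebesgue_on \<Omega>) f"
proof -
  have i: "integrable lborel (\<lambda>x. indicator \<Omega> x * f x)"
    using integrable_mult_indicator[of \<Omega> lborel f] assms by simp
  then have "integrable lebesgue (\<lambda>x. indicator \<Omega> x * f x)"
    by (subst integrable_completion) auto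
  then show ?thesis using assms(1) by (subst integrable_lebesgue_on) auto
qed

lemma integrable_norm_powr:
  fixes a :: "real^'n"
  assumes \<beta>: "0 \<le> \<beta>" "\<beta> < real CARD('n)" and \<Omega>: "open \<Omega>" "bounded \<Omega>"
  shows "integrable (lebesgue_on \<Omega>) (\<lambda>x. norm (x - a) powr (- \<beta>))"
proof -
  obtain R where R: "R > 0" "\<Omega> \<subseteq> ball a R"
    using bounded_subset_ballD[OF \<Omega>(2)] by blast
  have "integrable (lebesgue_on \<Omega>) (\<lambda>x. indicator (ball a R) x * norm (x - a) powr (- \<beta>))"
    by (rule integrable_lebesgue_on_lborel[OF \<Omega>(1) integrable_norm_powr_ball[OF \<beta> R(1)]])
  moreover have "indicator (ball a R) x * norm (x - a) powr (- \<beta>) = norm (x - a) powr (- \<beta>)"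
    if "x \<in> space (lebesgue_on \<Omega>)" for x
    using that R(2) by (auto simp: indicator_def)
  ultimately show ?thesis
    by (subst Bochner_Integration.integrable_cong[OF refl]) auto
qed

lemma integrable_lebesgue_on_const:
  fixes \<Omega> :: "(real^'n) set"
  assumes \<Omega>: "open \<Omega>" "bounded \<Omega>"
  shows "integrable (lebesgue_on \<Omega>) (\<lambda>x. c :: real)"
proof -
  have "emeasure lebesgue \<Omega> < \<infinity>"
    using emeasure_bounded_finite[OF \<Omega>(2)] \<Omega>(1) by (simp add: emeasure_completion)
  then have "finite_measure (lebesgue_on \<Omega>)"
    using \<Omega> by (intro finite_measureI) (simp add: emeasure_restrict_space)
  then show ?thesis by (rule finite_measure.integrable_const)
qed

lemma integrable_weight_one:
  assumes "open \<Omega>" "bounded \<Omega>"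
  shows "integrable_weight \<Omega> (\<lambda>x. 1)"
  unfolding integrable_weight_def using integrable_lebesgue_on_const[OF assms] assms by auto

lemma dist_weight_le:
  assumes "0 < \<alpha>" "k \<in> {1..K}"
  shows "dist_weight K x \<alpha> y \<le> norm (y - x k) powr \<alpha>"
  unfolding dist_weight_def
  using assms by (intro powr_mono2 Min_le) (auto simp: Min_ge_iff)

lemma dist_weight_ge:
  assumes "0 < \<alpha>" "K \<ge> 1" "0 \<le> \<delta>" "\<And>k. k \<in> {1..K} \<Longrightarrow> \<delta> \<le> norm (y - x k)"
  shows "\<delta> powr \<alpha> \<le> dist_weight K x \<alpha> y"
  unfolding dist_weight_def
  using assms by (intro powr_mono2) (auto simp: Min_ge_iff)

lemma inverse_dist_weight_le:
  assumes "K \<ge> 1"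
  shows "inverse (dist_weight K x \<alpha> y) \<le> (\<Sum>k\<in>{1..K}. norm (y - x k) powr (- \<alpha>))"
proof -
  have "Min ((\<lambda>k. norm (y - x k)) ` {1..K}) \<in> (\<lambda>k. norm (y - x k)) ` {1..K}"
    using assms by (intro Min_in) auto
  then obtain k where k: "k \<in> {1..K}" "Min ((\<lambda>k. norm (y - x k)) ` {1..K}) = norm (y - x k)" by auto
  have "inverse (dist_weight K x \<alpha> y) = norm (y - x k) powr (- \<alpha>)"
    unfolding dist_weight_def k(2) by (simp add: powr_minus)
  also have "\<dots> \<le> (\<Sum>k\<in>{1..K}. norm (y - x k) powr (- \<alpha>))"
    by (rule member_le_sum) (use k in auto)
  finally show ?thesis .
qed

lemma dist_weight_measurable: "dist_weight K x \<alpha> \<in> borel_measurable borel"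
  unfolding dist_weight_def[abs_def] by measurable

lemma AE_lebesgue_on_finite_complement:
  assumes "open \<Omega>" "finite S"
  shows "AE y in lebesgue_on \<Omega>. y \<notin> (S :: (real^'n) set)"
proof -
  have "S \<in> null_sets lborel" using assms(2) by (intro finite_imp_null_set_lborel)
  then have "AE y in lborel. y \<notin> S" by (rule AE_not_in)
  then have "AE y in lebesgue. y \<notin> S" by (rule AE_completion)
  then show ?thesis using assms(1) by (auto simp: AE_lebesgue_on elim!: eventually_mono)
qed

lemma dist_weight_bounded:
  assumes "bounded \<Omega>" "0 < \<alpha>" "K \<ge> 1"
  obtains B where "B > 0" "\<And>y. y \<in> \<Omega> \<Longrightarrow> dist_weight K x \<alpha> y \<le> B"
proof -
  obtain R where R: "R > 0" "\<Omega> \<subseteq> ball (x 1) R"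
    using bounded_subset_ballD[OF assms(1)] by blast
  have "dist_weight K x \<alpha> y \<le> R powr \<alpha>" if "y \<in> \<Omega>" for y
  proof -
    have "dist_weight K x \<alpha> y \<le> norm (y - x 1) powr \<alpha>"
      by (rule dist_weight_le) (use assms in auto)
    also have "\<dots> \<le> R powr \<alpha>"
      using that R assms by (intro powr_mono2) (auto simp: dist_norm norm_minus_commute dest!: subsetD)
    finally show ?thesis .
  qed
  then show ?thesis using R by (intro that[of "R powr \<alpha>"]) auto
qed

lemma integrable_weight_dist_weight:
  fixes x :: "nat \<Rightarrow> real^'n"
  assumes \<Omega>: "open \<Omega>" "bounded \<Omega>" and \<alpha>: "0 < \<alpha>" "\<alpha> < real CARD('n)" and K: "K \<ge> 1"
  shows "integrable_weight \<Omega> (dist_weight K x \<alpha>)"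
proof -
  have m: "dist_weight K x \<alpha> \<in> borel_measurable (lebesgue_on \<Omega>)"
    using dist_weight_measurable[of K x \<alpha>]
    by (intro measurable_restrict_space1 measurable_completion) auto
  have nn: "0 \<le> dist_weight K x \<alpha> y" for y by (simp add: dist_weight_def)
  obtain B where B: "B > 0" "\<And>y. y \<in> \<Omega> \<Longrightarrow> dist_weight K x \<alpha> y \<le> B"
    using dist_weight_bounded[OF \<Omega>(2) \<alpha>(1) K] by blast
  have i: "integrable (lebesgue_on \<Omega>) (dist_weight K x \<alpha>)"
    by (rule Bochner_Integration.integrable_bound[OF integrable_lebesgue_on_const[OF \<Omega>, of B] m])
      (rule AE_I2, use B nn in simp)
  have i': "integrable (lebesgue_on \<Omega>) (\<lambda>y. inverse (dist_weight K x \<alpha> y))"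
  proof (rule Bochner_Integration.integrable_bound)
    show "integrable (lebesgue_on \<Omega>) (\<lambda>y. \<Sum>k\<in>{1..K}. norm (y - x k) powr (- \<alpha>))"
      using \<alpha> \<Omega> by (intro Bochner_Integration.integrable_sum integrable_norm_powr) auto
    show "AE y in lebesgue_on \<Omega>. norm (inverse (dist_weight K x \<alpha> y)) \<le> norm (\<Sum>k\<in>{1..K}. norm (y - x k) powr (- \<alpha>))"
      using inverse_dist_weight_le[OF K, of x \<alpha>] nn by (intro AE_I2) (simp add: sum_nonneg)
    show "(\<lambda>y. inverse (dist_weight K x \<alpha> y)) \<in> borel_measurable (lebesgue_on \<Omega>)"
      using m by measurable
  qed
  have "AE y in lebesgue_on \<Omega>. y \<notin> x ` {1..K}"
    by (rule AE_lebesgue_on_finite_complement[OF \<Omega>(1)]) auto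
  then have "AE y in lebesgue_on \<Omega>. 0 < dist_weight K x \<alpha> y"
  proof eventually_elim
    case (elim y)
    have "0 < Min ((\<lambda>k. norm (y - x k)) ` {1..K})"
      using elim K by (subst Min_gr_iff) auto
    then show ?case by (simp add: dist_weight_def)
  qed
  then show ?thesis unfolding integrable_weight_def using \<Omega> nn i i' by auto
qed

lemma H10_approximation_mono:
  assumes W: "integrable_weight \<Omega> \<omega>" and W': "integrable_weight \<Omega> \<omega>'"
    and u: "H10_approximation \<omega> \<Omega> u g \<phi>" and C: "C \<ge> 0" and le: "AE x in lebesgue_on \<Omega>. \<omega>' x \<le> C * \<omega> x"
  shows "H10_approximation \<omega>' \<Omega> u g \<phi>"
  using H10_approximation_mult[OF W W' u smooth_on_const, of 1 C] le integrable_weight_nonneg[OF W] C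
  by (simp add: partial_deriv_const)

section \<open>The Poincare inequality\<close>

text \<open>The partial derivative of $x_i \<phi>^2$ in direction $i$ integrates to zero, so that the integral of
  $\<phi>^2$ is that of $- 2 x_i \<phi>$ times the partial derivative of $\<phi>$.\<close>
lemma Poincare_test_function:
  assumes \<Omega>: "open \<Omega>" "bounded \<Omega>" and R: "\<And>x. x \<in> \<Omega> \<Longrightarrow> norm x \<le> R" and \<phi>: "\<phi> \<in> test_functions \<Omega>"
  shows "L2_sqnorm (\<lambda>x. 1) \<Omega> \<phi> \<le> 4 * R\<^sup>2 * L2_sqnorm (\<lambda>x. 1) \<Omega> (partial_deriv i \<phi>)"
proof -
  note W = integrable_weight_one[OF \<Omega>]
  let ?p = "partial_deriv i \<phi>" and ?I = "\<lambda>f. \<integral>x. f x \<partial>lebesgue_on \<Omega>"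
  note p = test_functions_partial_deriv[OF \<phi>, of i]
  have sq: "L2_sqnorm (\<lambda>x. 1) \<Omega> f = ?I (\<lambda>x. (f x)\<^sup>2)" if "f \<in> test_functions \<Omega>" for f
    using L2_sqnorm_eq[OF W test_functions_measurable[OF that]] by simp
  have xs: "smooth_on UNIV (\<lambda>x. x $ i * \<phi> x)"
    by (intro smooth_on_mult smooth_on_component test_functions_smooth_on[OF \<phi>] open_UNIV)
  note f = test_functions_mult[OF xs \<phi>]
  have T1: "(\<lambda>x. \<phi> x * \<phi> x) \<in> test_functions \<Omega>"
    by (rule test_functions_mult[OF test_functions_smooth_on[OF \<phi>] \<phi>])
  have T2: "(\<lambda>x. (x $ i * \<phi> x) * ?p x) \<in> test_functions \<Omega>"
    by (rule test_functions_mult[OF xs p])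
  have "partial_deriv i (\<lambda>x. x $ i * \<phi> x * \<phi> x) x = \<phi> x * \<phi> x + 2 * ((x $ i * \<phi> x) * ?p x)" for x
    using smooth_on_imp_differentiable[OF xs] test_functions_differentiable[OF \<phi>, of x]
      smooth_on_imp_differentiable[OF smooth_on_component, of UNIV x i]
    by (simp add: partial_deriv_mult partial_deriv_component algebra_simps)
  then have "(\<integral>x. \<phi> x * \<phi> x + 2 * ((x $ i * \<phi> x) * ?p x) \<partial>lborel) = 0"
    using integral_partial_deriv_eq_0[OF f, of i] by simp
  then have "(\<integral>x. \<phi> x * \<phi> x \<partial>lborel) = - 2 * (\<integral>x. (x $ i * \<phi> x) * ?p x \<partial>lborel)"
    using test_functions_integrable[OF T1] test_functions_integrable[OF T2] by simp
  then have eq: "?I (\<lambda>x. (\<phi> x)\<^sup>2) = - 2 * ?I (\<lambda>x. (x $ i * \<phi> x) * ?p x)"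
    using integral_lebesgue_on_test_function[OF \<Omega>(1) T1] integral_lebesgue_on_test_function[OF \<Omega>(1) T2]
    by (simp add: power2_eq_square)
  have mx: "(\<lambda>x. x $ i * \<phi> x) \<in> borel_measurable (lebesgue_on \<Omega>)"
    by (rule continuous_measurable_lebesgue_on[OF smooth_on_imp_continuous_on[OF xs]])
  have bx: "AE x in lebesgue_on \<Omega>. 1 * (x $ i)\<^sup>2 \<le> R\<^sup>2 * 1"
  proof (rule AE_I2)
    fix x assume "x \<in> space (lebesgue_on \<Omega>)"
    then have "\<bar>x $ i\<bar> \<le> \<bar>R\<bar>" using R[of x] component_le_norm_cart[of x i] by auto
    then show "1 * (x $ i)\<^sup>2 \<le> R\<^sup>2 * 1" using abs_le_square_iff by auto
  qed
  have mc: "(\<lambda>x. x $ i) \<in> borel_measurable (lebesgue_on \<Omega>)"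
    by (rule continuous_measurable_lebesgue_on[OF smooth_on_imp_continuous_on[OF smooth_on_component]])
  note M = L2_mult_comparison[OF W W L2_test_function[OF W \<phi>] mc bx]
  define A B where "A = sqrt (?I (\<lambda>x. (\<phi> x)\<^sup>2))" and "B = sqrt (?I (\<lambda>x. (?p x)\<^sup>2))"
  have AB: "0 \<le> A" "0 \<le> B" by (auto simp: A_def B_def)
  have R0: "0 \<le> \<bar>R\<bar>" by simp
  have sA: "A\<^sup>2 = ?I (\<lambda>x. (\<phi> x)\<^sup>2)" and sB: "B\<^sup>2 = ?I (\<lambda>x. (?p x)\<^sup>2)"
    by (auto simp: A_def B_def)
  have "\<bar>?I (\<lambda>x. (x $ i * \<phi> x) * ?p x)\<bar> \<le> sqrt (L2_sqnorm (\<lambda>x. 1) \<Omega> (\<lambda>x. x $ i * \<phi> x)) * sqrt (L2_sqnorm (\<lambda>x. 1) \<Omega> ?p)"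
    using L2_pairing(2)[OF W M(1), of ?p] L2_test_function[OF W p] by simp
  also have "\<dots> \<le> sqrt (R\<^sup>2 * A\<^sup>2) * B"
    using M(2) unfolding sq[OF \<phi>] sq[OF p] sA B_def by (intro mult_right_mono real_sqrt_le_mono) auto
  also have "\<dots> = \<bar>R\<bar> * A * B"
    using AB by (simp add: real_sqrt_mult)
  finally have "A\<^sup>2 \<le> 2 * \<bar>R\<bar> * A * B" using eq sA by linarith
  then have "A * A \<le> A * (2 * \<bar>R\<bar> * B)" by (simp add: power2_eq_square mult_ac)
  then have "A \<le> 2 * \<bar>R\<bar> * B"
    using AB by (cases "A = 0") (auto simp: mult_le_cancel_left)
  then have "A\<^sup>2 \<le> (2 * \<bar>R\<bar> * B)\<^sup>2" using AB(1) by (rule power_mono)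
  then show ?thesis unfolding sq[OF \<phi>] sq[OF p] sA[symmetric] sB[symmetric]
    by (simp add: power_mult_distrib)
qed

section \<open>Completeness\<close>

text \<open>A subsequence with summable increments converges almost everywhere, because increments that are small
  in the weighted norm are small in the integral norm; Fatou bounds the distance to the limit.\<close>
lemma L2_complete:
  assumes W: "integrable_weight \<Omega> \<omega>" and F: "\<And>n. F n \<in> L2 \<omega> \<Omega>"
    and Cauchy: "\<And>e. e > 0 \<Longrightarrow> \<exists>N. \<forall>m\<ge>N. \<forall>n\<ge>N. L2_sqnorm \<omega> \<Omega> (\<lambda>x. F m x - F n x) \<le> e"
  shows "\<exists>f. f \<in> L2 \<omega> \<Omega> \<and> (\<lambda>n. L2_sqnorm \<omega> \<Omega> (\<lambda>x. f x - F n x)) \<longlonglongrightarrow> 0"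
proof -
  let ?M = "lebesgue_on \<Omega>" and ?s = "\<lambda>m n. L2_sqnorm \<omega> \<Omega> (\<lambda>x. F m x - F n x)"
  note [measurable] = L2_measurable[OF F] integrable_weight_measurable[OF W]
  obtain N where N: "\<And>k m n. N k \<le> m \<Longrightarrow> N k \<le> n \<Longrightarrow> ?s m n \<le> (1/4) ^ k"
  proof -
    have "\<forall>k. \<exists>N. \<forall>m\<ge>N. \<forall>n\<ge>N. ?s m n \<le> (1/4) ^ k" using Cauchy by simp
    then obtain N where "\<forall>k. \<forall>m\<ge>N k. \<forall>n\<ge>N k. ?s m n \<le> (1/4) ^ k" by (rule choice[THEN exE])
    then show ?thesis using that by blast
  qed
  \<comment> \<open>A subsequence whose increments have norms bounded by a geometric series.\<close>
  define r where "r k = (\<Sum>j\<le>k. N j)" for k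
  have rN: "N k \<le> r k" and r_Suc: "r k \<le> r (Suc k)" for k
    unfolding r_def by (auto intro: member_le_sum)
  let ?d = "\<lambda>k x. F (r (Suc k)) x - F (r k) x"
  define c where "c = sqrt (L2_sqnorm (\<lambda>x. inverse (\<omega> x)) \<Omega> (\<lambda>x. 1))"
  have d1: "integrable ?M (\<lambda>x. \<bar>?d k x\<bar>)" "(\<integral>x. \<bar>?d k x\<bar> \<partial>?M) \<le> c * (1/2) ^ k" for k
  proof -
    have "?d k \<in> L2 \<omega> \<Omega>" by (rule L2_diff[OF W F F])
    then have d: "(\<lambda>x. \<bar>?d k x\<bar>) \<in> L2 \<omega> \<Omega>" and eq: "L2_sqnorm \<omega> \<Omega> (\<lambda>x. \<bar>?d k x\<bar>) = ?s (r (Suc k)) (r k)"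
      by (auto simp: L2_iff[OF W] L2_sqnorm_def)
    have one: "(\<lambda>x. 1) \<in> L2 (\<lambda>x. inverse (\<omega> x)) \<Omega>"
      by (rule L2_bounded[OF integrable_weight_inverse[OF W], of _ 1]) auto
    note P = L2_pairing[OF W d one]
    show "integrable ?M (\<lambda>x. \<bar>?d k x\<bar>)" using P(1) by simp
    have "sqrt (?s (r (Suc k)) (r k)) \<le> sqrt ((1/4) ^ k)"
      using N[of k "r (Suc k)" "r k"] rN[of k] r_Suc[of k] by (intro real_sqrt_le_mono) auto
    also have "\<dots> = (1/2) ^ k" by (simp add: real_sqrt_power real_sqrt_divide)
    finally have "sqrt (?s (r (Suc k)) (r k)) * c \<le> (1/2) ^ k * c"
      by (intro mult_right_mono) (auto simp: c_def L2_sqnorm_nonneg)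
    then show "(\<integral>x. \<bar>?d k x\<bar> \<partial>?M) \<le> c * (1/2) ^ k"
      using P(2) eq unfolding c_def by (simp add: mult.commute)
  qed
  have c0: "c \<ge> 0" by (simp add: c_def L2_sqnorm_nonneg)
  have "(\<integral>\<^sup>+x. (\<Sum>k. ennreal \<bar>?d k x\<bar>) \<partial>?M) = (\<Sum>k. \<integral>\<^sup>+x. ennreal \<bar>?d k x\<bar> \<partial>?M)"
    by (rule nn_integral_suminf) measurable
  also have "\<dots> = (\<Sum>k. ennreal (\<integral>x. \<bar>?d k x\<bar> \<partial>?M))"
    using d1(1) by (intro suminf_cong nn_integral_eq_integral) auto
  also have "\<dots> \<le> (\<Sum>k. ennreal (c * (1/2) ^ k))"
    using d1(2) by (intro suminf_le ennreal_leI) auto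
  also have "\<dots> < \<infinity>"
    using c0 by (subst suminf_ennreal2) (auto intro!: summable_mult summable_geometric)
  finally have "(\<integral>\<^sup>+x. (\<Sum>k. ennreal \<bar>?d k x\<bar>) \<partial>?M) \<noteq> \<infinity>" by simp
  then have "AE x in ?M. (\<Sum>k. ennreal \<bar>?d k x\<bar>) \<noteq> \<infinity>"
    by (intro nn_integral_PInf_AE) measurable
  then have conv: "AE x in ?M. convergent (\<lambda>k. F (r k) x)"
  proof eventually_elim
    case (elim x)
    then have "summable (\<lambda>k. \<bar>?d k x\<bar>)" by (intro summable_suminf_not_top) auto
    then have "summable (\<lambda>k. ?d k x)" by (rule summable_rabs_cancel)
    then have "convergent (\<lambda>n. \<Sum>k<n. ?d k x)" by (simp add: summable_iff_convergent)
    then have "convergent (\<lambda>n. F (r n) x - F (r 0) x)"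
      using sum_lessThan_telescope[of "\<lambda>k. F (r k) x"] by simp
    from convergent_add[OF this convergent_const[of "F (r 0) x"]] show ?case by simp
  qed
  define f where "f x = lim (\<lambda>k. F (r k) x)" for x
  have m[measurable]: "f \<in> borel_measurable ?M"
    unfolding f_def[abs_def] by measurable
  have lim: "AE x in ?M. (\<lambda>k. F (r k) x) \<longlonglongrightarrow> f x"
    using conv by eventually_elim (simp add: f_def convergent_LIMSEQ_iff)
  have Fatou: "integrable ?M (\<lambda>x. \<omega> x * (f x - F n x)\<^sup>2)" "(\<integral>x. \<omega> x * (f x - F n x)\<^sup>2 \<partial>?M) \<le> (1/4) ^ k"
    if n: "n \<ge> N k" for n k
  proof -
    have "(\<integral>\<^sup>+x. ennreal (\<omega> x * (f x - F n x)\<^sup>2) \<partial>?M) = (\<integral>\<^sup>+x. liminf (\<lambda>j. ennreal (\<omega> x * (F (r j) x - F n x)\<^sup>2)) \<partial>?M)"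
    proof (rule nn_integral_cong_AE)
      show "AE x in ?M. ennreal (\<omega> x * (f x - F n x)\<^sup>2) = liminf (\<lambda>j. ennreal (\<omega> x * (F (r j) x - F n x)\<^sup>2))"
        using lim
      proof eventually_elim
        case (elim x)
        then have "(\<lambda>j. ennreal (\<omega> x * (F (r j) x - F n x)\<^sup>2)) \<longlonglongrightarrow> ennreal (\<omega> x * (f x - F n x)\<^sup>2)"
          by (intro tendsto_intros)
        then show ?case using lim_imp_Liminf[OF sequentially_bot] by metis
      qed
    qed
    also have "\<dots> \<le> liminf (\<lambda>j. \<integral>\<^sup>+x. ennreal (\<omega> x * (F (r j) x - F n x)\<^sup>2) \<partial>?M)"
      by (rule nn_integral_liminf) measurable
    also have "\<dots> \<le> ennreal ((1/4) ^ k)"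
    proof (rule Liminf_le)
      show "\<forall>\<^sub>F j in sequentially. (\<integral>\<^sup>+x. ennreal (\<omega> x * (F (r j) x - F n x)\<^sup>2) \<partial>?M) \<le> ennreal ((1/4) ^ k)"
        using eventually_ge_at_top[of k]
      proof eventually_elim
        case (elim j)
        have "r k \<le> r j" unfolding r_def using elim by (intro sum_mono2) auto
        then have "N k \<le> r j" using rN[of k] by linarith
        have L: "(\<lambda>x. F (r j) x - F n x) \<in> L2 \<omega> \<Omega>" by (rule L2_diff[OF W F F])
        have "(\<integral>\<^sup>+x. ennreal (\<omega> x * (F (r j) x - F n x)\<^sup>2) \<partial>?M) = ennreal (?s (r j) n)"
          using L integrable_weight_nonneg[OF W]
          by (subst nn_integral_eq_integral) (auto simp: L2_iff[OF W] L2_sqnorm_eq[OF W])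
        also have "\<dots> \<le> ennreal ((1/4) ^ k)"
          by (rule ennreal_leI[OF N[OF \<open>N k \<le> r j\<close> n]])
        finally show ?case .
      qed
    qed simp
    finally have le: "(\<integral>\<^sup>+x. ennreal (\<omega> x * (f x - F n x)\<^sup>2) \<partial>?M) \<le> ennreal ((1/4) ^ k)" .
    show i: "integrable ?M (\<lambda>x. \<omega> x * (f x - F n x)\<^sup>2)"
      by (rule integrableI_nonneg)
        (use le integrable_weight_nonneg[OF W] in \<open>auto simp: less_top[symmetric] top_unique intro: le_less_trans\<close>)
    show "(\<integral>x. \<omega> x * (f x - F n x)\<^sup>2 \<partial>?M) \<le> (1/4) ^ k"
      using le integrable_weight_nonneg[OF W] by (subst (asm) nn_integral_eq_integral[OF i]) auto
  qed
  have fL: "f \<in> L2 \<omega> \<Omega>"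
  proof -
    have "(\<lambda>x. f x - F (N 0) x) \<in> L2 \<omega> \<Omega>"
      using Fatou(1)[of 0 "N 0"] by (simp add: L2_iff[OF W])
    from L2_add(1)[OF W this F[of "N 0"]] show ?thesis by simp
  qed
  have "(\<lambda>n. L2_sqnorm \<omega> \<Omega> (\<lambda>x. f x - F n x)) \<longlonglongrightarrow> 0"
  proof (rule LIMSEQ_I)
    fix e :: real assume "e > 0"
    then obtain k where k: "(1/4::real) ^ k < e"
      using real_arch_pow_inv[of e "1/4"] by auto
    have "norm (L2_sqnorm \<omega> \<Omega> (\<lambda>x. f x - F n x) - 0) < e" if "n \<ge> N k" for n
      using Fatou(2)[OF that] k L2_sqnorm_nonneg[of \<omega> \<Omega> "\<lambda>x. f x - F n x"]
      by (simp add: L2_sqnorm_eq[OF W])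
    then show "\<exists>no. \<forall>n\<ge>no. norm (L2_sqnorm \<omega> \<Omega> (\<lambda>x. f x - F n x) - 0) < e" by blast
  qed
  then show ?thesis using fL by (intro exI conjI)
qed

section \<open>Minimising sequences\<close>

text \<open>The Riesz representation theorem for a space that is not complete: \<^term>\<open>lin c u v\<close> plays
  $c u + v$. A minimising sequence of $a(u,u) - 2 l(u)$ is a Cauchy sequence by the parallelogram law, and
  its limit would be the representing vector.\<close>
lemma Riesz_sequence:
  fixes a :: "'v \<Rightarrow> 'v \<Rightarrow> real" and l :: "'v \<Rightarrow> real" and lin :: "real \<Rightarrow> 'v \<Rightarrow> 'v \<Rightarrow> 'v"
  assumes lin: "\<And>c u v. u \<in> V \<Longrightarrow> v \<in> V \<Longrightarrow> lin c u v \<in> V"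
    and a_lin: "\<And>c u v w. u \<in> V \<Longrightarrow> v \<in> V \<Longrightarrow> w \<in> V \<Longrightarrow> a (lin c u v) w = c * a u w + a v w"
    and a_sym: "\<And>u v. u \<in> V \<Longrightarrow> v \<in> V \<Longrightarrow> a u v = a v u"
    and a_pos: "\<And>u. u \<in> V \<Longrightarrow> 0 \<le> a u u"
    and l_lin: "\<And>c u v. u \<in> V \<Longrightarrow> v \<in> V \<Longrightarrow> l (lin c u v) = c * l u + l v"
    and l_bound: "\<And>u. u \<in> V \<Longrightarrow> \<bar>l u\<bar> \<le> C * sqrt (a u u)"
    and ne: "V \<noteq> {}"
  obtains u where "\<And>n::nat. u n \<in> V"
    "\<And>e. e > 0 \<Longrightarrow> \<exists>N. \<forall>m\<ge>N. \<forall>n\<ge>N. a (lin (-1) (u n) (u m)) (lin (-1) (u n) (u m)) \<le> e"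
    "\<And>v. v \<in> V \<Longrightarrow> (\<lambda>n. a (u n) v) \<longlonglongrightarrow> l v"
proof -
  define J where "J u = a u u - 2 * l u" for u
  have lb: "- (C\<^sup>2) \<le> J u" if "u \<in> V" for u
  proof -
    have "2 * l u \<le> 2 * (C * sqrt (a u u))" using l_bound[OF that] by linarith
    also have "\<dots> \<le> C\<^sup>2 + (sqrt (a u u))\<^sup>2"
      using zero_le_power2[of "C - sqrt (a u u)"] unfolding power2_diff by linarith
    finally show ?thesis using a_pos[OF that] unfolding J_def by simp
  qed
  have a_lin2: "a w (lin c u v) = c * a w u + a w v" if "u \<in> V" "v \<in> V" "w \<in> V" for c u v w
  proof -
    have "a w (lin c u v) = a (lin c u v) w" by (rule a_sym[OF that(3) lin[OF that(1,2)]])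
    also have "\<dots> = c * a u w + a v w" by (rule a_lin[OF that])
    finally show ?thesis by (simp only: a_sym[OF that(1,3)] a_sym[OF that(2,3)])
  qed
  have expand: "a (lin c u v) (lin c u v) = c\<^sup>2 * a u u + 2 * c * a u v + a v v" if "u \<in> V" "v \<in> V" for c u v
    unfolding a_lin[OF that lin[OF that]] a_lin2[OF that that(1)] a_lin2[OF that that(2)] a_sym[OF that(2,1)]
    by (simp add: power2_eq_square algebra_simps)
  have bdd: "bdd_below (J ` V)" using lb by (auto intro!: bdd_belowI)
  define m where "m = Inf (J ` V)"
  have m: "m \<le> J u" if "u \<in> V" for u
    unfolding m_def using bdd that by (intro cInf_lower) auto
  have "\<exists>u\<in>V. J u < m + inverse (real (Suc n))" for n
    using cInf_lessD[of "J ` V" "m + inverse (real (Suc n))"] ne unfolding m_def by auto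
  then obtain u where u: "\<And>n. u n \<in> V" and Ju: "\<And>n. J (u n) < m + inverse (real (Suc n))" by metis
  show ?thesis
  proof (rule that[OF u])
    fix e :: real assume "e > 0"
    then obtain N where N: "inverse (real (Suc N)) < e / 4"
      using reals_Archimedean[of "e/4"] by auto
    have "a (lin (-1) (u n) (u m')) (lin (-1) (u n) (u m')) \<le> e" if mn: "m' \<ge> N" "n \<ge> N" for m' n
    proof -
      let ?x = "u n" and ?y = "u m'"
      let ?d = "lin (-1) ?x ?y"
      let ?h = "lin (1/2) ?d ?x"
      have dV: "?d \<in> V" and hV: "?h \<in> V" using u lin by auto
      have "a ?d ?d = 2 * J ?x + 2 * J ?y - 4 * J ?h"
        unfolding J_def expand[OF u u] expand[OF dV u] l_lin[OF u u] l_lin[OF dV u] a_lin[OF u u u] a_sym[OF u[of m'] u[of n]]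
        by (simp add: power2_eq_square algebra_simps)
      also have "\<dots> \<le> 2 * inverse (real (Suc n)) + 2 * inverse (real (Suc m'))"
        using Ju[of n] Ju[of m'] m[OF hV] by linarith
      also have "\<dots> \<le> 2 * inverse (real (Suc N)) + 2 * inverse (real (Suc N))"
        using mn by (intro add_mono mult_left_mono le_imp_inverse_le) auto
      also have "\<dots> \<le> e" using N by linarith
      finally show ?thesis .
    qed
    then show "\<exists>N. \<forall>m\<ge>N. \<forall>n\<ge>N. a (lin (-1) (u n) (u m)) (lin (-1) (u n) (u m)) \<le> e" by blast
  next
    fix v assume v: "v \<in> V"
    define A where "A = a v v + 1"
    have A: "A > 0" using a_pos[OF v] by (simp add: A_def)
    have bound: "(a (u n) v - l v)\<^sup>2 \<le> A * inverse (real (Suc n))" for n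
    proof -
      define q where "q = a (u n) v - l v"
      define t where "t = - q / A"
      have "m \<le> J (lin t v (u n))" by (rule m) (use lin u v in auto)
      also have "\<dots> = t\<^sup>2 * (A - 1) + 2 * t * q + J (u n)"
        unfolding J_def q_def A_def expand[OF v u] l_lin[OF v u] a_sym[OF v u] by (simp add: algebra_simps)
      also have "\<dots> \<le> t\<^sup>2 * A + 2 * t * q + (m + inverse (real (Suc n)))"
        using Ju[of n] zero_le_power2[of t] unfolding right_diff_distrib mult_1_right by linarith
      also have "t\<^sup>2 * A + 2 * t * q = - (q\<^sup>2 / A)"
        using A unfolding t_def by (simp add: field_simps power2_eq_square)
      finally have "q\<^sup>2 / A \<le> inverse (real (Suc n))" by linarith
      then show ?thesis using A unfolding q_def by (simp add: pos_divide_le_eq mult.commute)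
    qed
    have "(\<lambda>n. A * inverse (real (Suc n))) \<longlonglongrightarrow> A * 0"
      by (intro tendsto_intros LIMSEQ_inverse_real_of_nat)
    then have lim: "(\<lambda>n. A * inverse (real (Suc n))) \<longlonglongrightarrow> 0" by simp
    have "(\<lambda>n. (a (u n) v - l v)\<^sup>2) \<longlonglongrightarrow> 0"
      by (rule tendsto_sandwich[OF _ _ tendsto_const lim]) (simp_all only: bound zero_le_power2 eventually_True)
    from tendsto_real_sqrt[OF this] have "(\<lambda>n. \<bar>a (u n) v - l v\<bar>) \<longlonglongrightarrow> 0" by simp
    then have "(\<lambda>n. a (u n) v - l v) \<longlonglongrightarrow> 0" by (rule tendsto_rabs_zero_cancel)
    then show "(\<lambda>n. a (u n) v) \<longlonglongrightarrow> l v" by (simp add: LIM_zero_iff)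
  qed
qed

section \<open>The Lame form\<close>

text \<open>The index order of the gradient is that of \<^const>\<open>weak_grad\<close>: component first, direction second.\<close>
definition vec_H10_approximation :: "(real^'n \<Rightarrow> real) \<Rightarrow> (real^'n) set \<Rightarrow> (real^'n \<Rightarrow> real^'n) \<Rightarrow>
    ('n \<Rightarrow> 'n \<Rightarrow> real^'n \<Rightarrow> real) \<Rightarrow> (nat \<Rightarrow> real^'n \<Rightarrow> real^'n) \<Rightarrow> bool" where
  "vec_H10_approximation \<omega> \<Omega> u G \<Phi> \<longleftrightarrow>
     (\<forall>i. H10_approximation \<omega> \<Omega> (\<lambda>x. u x $ i) (G i) (\<lambda>n x. \<Phi> n x $ i))"

lemma vec_H10_approximationD:
  assumes "vec_H10_approximation \<omega> \<Omega> u G \<Phi>"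
  shows "(\<lambda>x. u x $ i) \<in> L2 \<omega> \<Omega>" "G i j \<in> L2 \<omega> \<Omega>" "(\<lambda>x. \<Phi> n x $ i) \<in> test_functions \<Omega>"
    "\<Phi> n \<in> vec_test_functions \<Omega>"
    "(\<lambda>n. L2_sqnorm \<omega> \<Omega> (\<lambda>x. u x $ i - \<Phi> n x $ i)) \<longlonglongrightarrow> 0"
    "(\<lambda>n. L2_sqnorm \<omega> \<Omega> (\<lambda>x. G i j x - partial_deriv j (\<lambda>x. \<Phi> n x $ i) x)) \<longlonglongrightarrow> 0"
  using assms unfolding vec_H10_approximation_def H10_approximation_def vec_test_functions_def by auto

lemma vec_H10_approximation_imp_vec_H10:
  "integrable_weight \<Omega> \<omega> \<Longrightarrow> vec_H10_approximation \<omega> \<Omega> u G \<Phi> \<Longrightarrow> u \<in> vec_H10 \<omega> \<Omega>"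
  unfolding vec_H10_def vec_H10_approximation_def using H10_approximation_imp_H10 by blast

lemma vec_H10_imp_approximation:
  assumes W: "integrable_weight \<Omega> \<omega>" and u: "u \<in> vec_H10 \<omega> \<Omega>"
  obtains \<Phi> where "vec_H10_approximation \<omega> \<Omega> u (\<lambda>i j. weak_partial \<Omega> j (\<lambda>x. u x $ i)) \<Phi>"
    "\<And>i. (\<lambda>n. H1_norm \<omega> \<Omega> (\<lambda>x. u x $ i - \<Phi> n x $ i)) \<longlonglongrightarrow> 0"
proof -
  have "\<forall>i. \<exists>\<phi>. H10_approximation \<omega> \<Omega> (\<lambda>x. u x $ i) (\<lambda>j. weak_partial \<Omega> j (\<lambda>x. u x $ i)) \<phi> \<and>
      (\<lambda>n. H1_norm \<omega> \<Omega> (\<lambda>x. u x $ i - \<phi> n x)) \<longlonglongrightarrow> 0"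
  proof
    fix i
    have "(\<lambda>x. u x $ i) \<in> H10 \<omega> \<Omega>" using u unfolding vec_H10_def by simp
    then obtain \<phi> where "H10_approximation \<omega> \<Omega> (\<lambda>x. u x $ i) (\<lambda>j. weak_partial \<Omega> j (\<lambda>x. u x $ i)) \<phi>"
      "(\<lambda>n. H1_norm \<omega> \<Omega> (\<lambda>x. u x $ i - \<phi> n x)) \<longlonglongrightarrow> 0"
      by (rule H10_imp_H10_approximation[OF W])
    then show "\<exists>\<phi>. H10_approximation \<omega> \<Omega> (\<lambda>x. u x $ i) (\<lambda>j. weak_partial \<Omega> j (\<lambda>x. u x $ i)) \<phi> \<and>
      (\<lambda>n. H1_norm \<omega> \<Omega> (\<lambda>x. u x $ i - \<phi> n x)) \<longlonglongrightarrow> 0" by (intro exI conjI)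
  qed
  then obtain \<phi> where \<phi>: "\<And>i. H10_approximation \<omega> \<Omega> (\<lambda>x. u x $ i) (\<lambda>j. weak_partial \<Omega> j (\<lambda>x. u x $ i)) (\<phi> i)"
    "\<And>i. (\<lambda>n. H1_norm \<omega> \<Omega> (\<lambda>x. u x $ i - \<phi> i n x)) \<longlonglongrightarrow> 0"
    using that by (auto dest!: choice)
  show ?thesis
    by (rule that[of "\<lambda>n x. \<chi> i. \<phi> i n x"]) (use \<phi> in \<open>simp_all add: vec_H10_approximation_def\<close>)
qed

lemma vec_H10_approximation_add:
  "integrable_weight \<Omega> \<omega> \<Longrightarrow> vec_H10_approximation \<omega> \<Omega> u G \<Phi> \<Longrightarrow> vec_H10_approximation \<omega> \<Omega> v H \<Psi> \<Longrightarrow>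
   vec_H10_approximation \<omega> \<Omega> (\<lambda>x. u x + v x) (\<lambda>i j x. G i j x + H i j x) (\<lambda>n x. \<Phi> n x + \<Psi> n x)"
  unfolding vec_H10_approximation_def by (auto dest: H10_approximation_add)

lemma vec_H10_approximation_scaleR:
  "integrable_weight \<Omega> \<omega> \<Longrightarrow> vec_H10_approximation \<omega> \<Omega> u G \<Phi> \<Longrightarrow>
   vec_H10_approximation \<omega> \<Omega> (\<lambda>x. c *\<^sub>R u x) (\<lambda>i j x. c * G i j x) (\<lambda>n x. c *\<^sub>R \<Phi> n x)"
  unfolding vec_H10_approximation_def by (auto dest: H10_approximation_cmult[where c = c])

lemma vec_H10_approximation_test:
  "integrable_weight \<Omega> \<omega> \<Longrightarrow> \<phi> \<in> vec_test_functions \<Omega> \<Longrightarrow>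
   vec_H10_approximation \<omega> \<Omega> \<phi> (\<lambda>i j. partial_deriv j (\<lambda>x. \<phi> x $ i)) (\<lambda>n. \<phi>)"
  unfolding vec_H10_approximation_def vec_test_functions_def
  by (auto intro: H10_approximation_test_function)

lemma vec_H10_approximation_mono:
  "integrable_weight \<Omega> \<omega> \<Longrightarrow> integrable_weight \<Omega> \<omega>' \<Longrightarrow> vec_H10_approximation \<omega> \<Omega> u G \<Phi> \<Longrightarrow> C \<ge> 0 \<Longrightarrow>
   AE x in lebesgue_on \<Omega>. \<omega>' x \<le> C * \<omega> x \<Longrightarrow> vec_H10_approximation \<omega>' \<Omega> u G \<Phi>"
  unfolding vec_H10_approximation_def using H10_approximation_mono by blast

lemma vec_H10_add_scaleR:
  assumes W: "integrable_weight \<Omega> \<omega>" and u: "u \<in> vec_H10 \<omega> \<Omega>" and v: "v \<in> vec_H10 \<omega> \<Omega>"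
  shows "(\<lambda>x. c *\<^sub>R u x + v x) \<in> vec_H10 \<omega> \<Omega>"
proof -
  obtain \<Phi> where \<Phi>: "vec_H10_approximation \<omega> \<Omega> u (\<lambda>i j. weak_partial \<Omega> j (\<lambda>x. u x $ i)) \<Phi>"
    using vec_H10_imp_approximation[OF W u] by blast
  obtain \<Psi> where \<Psi>: "vec_H10_approximation \<omega> \<Omega> v (\<lambda>i j. weak_partial \<Omega> j (\<lambda>x. v x $ i)) \<Psi>"
    using vec_H10_imp_approximation[OF W v] by blast
  show ?thesis
    by (rule vec_H10_approximation_imp_vec_H10[OF W vec_H10_approximation_add[OF W vec_H10_approximation_scaleR[OF W \<Phi>] \<Psi>]])
qed

text \<open>The Lame form as a function of the gradients: this is where bilinearity and continuity are visible,
  since weak gradients are determined only up to null sets.\<close>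
definition lame_pairing :: "real \<Rightarrow> real \<Rightarrow> (real^'n) set \<Rightarrow> ('n \<Rightarrow> 'n \<Rightarrow> real^'n \<Rightarrow> real) \<Rightarrow>
    ('n \<Rightarrow> 'n \<Rightarrow> real^'n \<Rightarrow> real) \<Rightarrow> real" where
  "lame_pairing \<mu> lam \<Omega> G H =
     \<mu> * (\<Sum>i\<in>UNIV. \<Sum>j\<in>UNIV. \<integral>x. G i j x * H i j x \<partial>lebesgue_on \<Omega>) +
     (\<mu> + lam) * (\<Sum>i\<in>UNIV. \<Sum>j\<in>UNIV. \<integral>x. G i i x * H j j x \<partial>lebesgue_on \<Omega>)"

lemma lame_form_eq_pairing:
  assumes W: "integrable_weight \<Omega> \<omega>" and u: "vec_H10_approximation \<omega> \<Omega> u G \<Phi>"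
    and v: "vec_H10_approximation (\<lambda>x. inverse (\<omega> x)) \<Omega> v H \<Psi>"
  shows "lame_form \<mu> lam \<Omega> u v = lame_pairing \<mu> lam \<Omega> G H"
proof -
  note W' = integrable_weight_inverse[OF W] and \<Omega> = integrable_weight_open[OF W]
  let ?M = "lebesgue_on \<Omega>"
  have eqG: "AE x in ?M. \<forall>i j. weak_partial \<Omega> j (\<lambda>x. u x $ i) x = G i j x"
  proof -
    have "AE x in ?M. weak_partial \<Omega> j (\<lambda>x. u x $ i) x = G i j x" for i j
      using u H10_weak_partial_AE[OF W] unfolding vec_H10_approximation_def by blast
    then show ?thesis by (simp add: AE_all_countable)
  qed
  have eqH: "AE x in ?M. \<forall>i j. weak_partial \<Omega> j (\<lambda>x. v x $ i) x = H i j x"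
  proof -
    have "AE x in ?M. weak_partial \<Omega> j (\<lambda>x. v x $ i) x = H i j x" for i j
      using v H10_weak_partial_AE[OF W'] unfolding vec_H10_approximation_def by blast
    then show ?thesis by (simp add: AE_all_countable)
  qed
  have i: "integrable ?M (\<lambda>x. G i j x * H k l x)" for i j k l
    by (rule L2_pairing(1)[OF W vec_H10_approximationD(2)[OF u] vec_H10_approximationD(2)[OF v]])
  have mG: "G i j \<in> borel_measurable ?M" and mH: "H i j \<in> borel_measurable ?M" for i j
    using vec_H10_approximationD(2)[OF u] vec_H10_approximationD(2)[OF v] L2_measurable by blast+
  have m1: "(\<lambda>x. \<Sum>i\<in>UNIV. \<Sum>j\<in>UNIV. G i j x * H i j x) \<in> borel_measurable ?M"
    and m2: "(\<lambda>x. \<Sum>i\<in>UNIV. \<Sum>j\<in>UNIV. G i i x * H j j x) \<in> borel_measurable ?M"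
    by (intro borel_measurable_sum borel_measurable_times mG mH)+
  have e1: "AE x in ?M. (\<Sum>i\<in>UNIV. \<Sum>j\<in>UNIV. G i j x * H i j x) = weak_grad \<Omega> u x \<bullet> weak_grad \<Omega> v x"
    using eqG eqH by eventually_elim (simp add: weak_grad_def inner_vec_def)
  have e2: "AE x in ?M. (\<Sum>i\<in>UNIV. \<Sum>j\<in>UNIV. G i i x * H j j x) = weak_div \<Omega> u x * weak_div \<Omega> v x"
    using eqG eqH by eventually_elim (simp add: weak_div_def sum_product)
  have "(\<integral>x. weak_grad \<Omega> u x \<bullet> weak_grad \<Omega> v x \<partial>?M) = (\<integral>x. (\<Sum>i\<in>UNIV. \<Sum>j\<in>UNIV. G i j x * H i j x) \<partial>?M)"
    by (rule integral_cong_AE[OF _ m1, OF borel_measurable_lebesgue_on_cong_AE[OF \<Omega> m1 e1]])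
      (use e1 in \<open>auto elim!: eventually_mono\<close>)
  moreover have "(\<integral>x. weak_div \<Omega> u x * weak_div \<Omega> v x \<partial>?M) = (\<integral>x. (\<Sum>i\<in>UNIV. \<Sum>j\<in>UNIV. G i i x * H j j x) \<partial>?M)"
    by (rule integral_cong_AE[OF _ m2, OF borel_measurable_lebesgue_on_cong_AE[OF \<Omega> m2 e2]])
      (use e2 in \<open>auto elim!: eventually_mono\<close>)
  ultimately show ?thesis
    unfolding lame_form_def lame_pairing_def using i by simp
qed

lemma lame_pairing_sym: "lame_pairing \<mu> lam \<Omega> G H = lame_pairing \<mu> lam \<Omega> H G"
proof -
  have "(\<Sum>i\<in>UNIV. \<Sum>j\<in>UNIV. \<integral>x. G i i x * H j j x \<partial>lebesgue_on \<Omega>)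
      = (\<Sum>i\<in>UNIV. \<Sum>j\<in>UNIV. \<integral>x. H i i x * G j j x \<partial>lebesgue_on \<Omega>)"
    by (subst sum.swap) (simp add: mult.commute)
  then show ?thesis unfolding lame_pairing_def by (simp add: mult.commute[of "H _ _ _"])
qed

lemma lame_pairing_lin:
  assumes W: "integrable_weight \<Omega> \<omega>" and L: "\<And>i j. G i j \<in> L2 \<omega> \<Omega>" "\<And>i j. G' i j \<in> L2 \<omega> \<Omega>"
    and H: "\<And>i j. H i j \<in> L2 (\<lambda>x. inverse (\<omega> x)) \<Omega>"
  shows "lame_pairing \<mu> lam \<Omega> (\<lambda>i j x. c * G i j x + G' i j x) H =
     c * lame_pairing \<mu> lam \<Omega> G H + lame_pairing \<mu> lam \<Omega> G' H"
proof -
  note P = L2_pairing(1)[OF W L(1) H] L2_pairing(1)[OF W L(2) H]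
  have "(\<integral>x. (c * G i j x + G' i j x) * H k l x \<partial>lebesgue_on \<Omega>) =
      c * (\<integral>x. G i j x * H k l x \<partial>lebesgue_on \<Omega>) + (\<integral>x. G' i j x * H k l x \<partial>lebesgue_on \<Omega>)" for i j k l
    using P by (simp add: distrib_right mult.assoc)
  then show ?thesis unfolding lame_pairing_def
    by (simp add: sum.distrib sum_distrib_left algebra_simps)
qed

lemma lame_pairing_tendsto:
  assumes W: "integrable_weight \<Omega> \<omega>" and G: "\<And>i j. G i j \<in> L2 \<omega> \<Omega>" and Gn: "\<And>n i j. F n i j \<in> L2 \<omega> \<Omega>"
    and H: "\<And>i j. H i j \<in> L2 (\<lambda>x. inverse (\<omega> x)) \<Omega>"
    and lim: "\<And>i j. (\<lambda>n. L2_sqnorm \<omega> \<Omega> (\<lambda>x. G i j x - F n i j x)) \<longlonglongrightarrow> 0"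
  shows "(\<lambda>n. lame_pairing \<mu> lam \<Omega> (F n) H) \<longlonglongrightarrow> lame_pairing \<mu> lam \<Omega> G H"
  unfolding lame_pairing_def
  by (intro tendsto_intros L2_pairing_tendsto[OF W G Gn H lim])

lemma lame_pairing_bound:
  assumes W: "integrable_weight \<Omega> \<omega>" and G: "\<And>i j. G i j \<in> L2 \<omega> \<Omega>"
  shows "\<exists>C\<ge>0. \<forall>H N. (\<forall>i j. H i j \<in> L2 (\<lambda>x. inverse (\<omega> x)) \<Omega> \<and> sqrt (L2_sqnorm (\<lambda>x. inverse (\<omega> x)) \<Omega> (H i j)) \<le> N)
     \<longrightarrow> \<bar>lame_pairing \<mu> lam \<Omega> G H\<bar> \<le> C * N"
proof -
  let ?s = "\<lambda>i j. sqrt (L2_sqnorm \<omega> \<Omega> (G i j))"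
  define A where "A = (\<Sum>i\<in>UNIV. \<Sum>j\<in>UNIV. ?s i j)"
  define B where "B = (\<Sum>i\<in>UNIV. \<Sum>j\<in>(UNIV::'a set). ?s i i)"
  have AB: "0 \<le> A" "0 \<le> B" unfolding A_def B_def by (auto intro!: sum_nonneg simp: L2_sqnorm_nonneg)
  show ?thesis
  proof (intro exI[of _ "\<bar>\<mu>\<bar> * A + \<bar>\<mu> + lam\<bar> * B"] conjI allI impI)
    show "0 \<le> \<bar>\<mu>\<bar> * A + \<bar>\<mu> + lam\<bar> * B" using AB by simp
    fix H :: "'a \<Rightarrow> 'a \<Rightarrow> real^'a \<Rightarrow> real" and N
    assume H: "\<forall>i j. H i j \<in> L2 (\<lambda>x. inverse (\<omega> x)) \<Omega> \<and> sqrt (L2_sqnorm (\<lambda>x. inverse (\<omega> x)) \<Omega> (H i j)) \<le> N"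
    have b: "\<bar>\<integral>x. G i j x * H k l x \<partial>lebesgue_on \<Omega>\<bar> \<le> ?s i j * N" for i j k l
      by (rule order_trans[OF L2_pairing(2)[OF W G]]) (use H in \<open>auto intro!: mult_left_mono simp: L2_sqnorm_nonneg\<close>)
    have 1: "\<bar>\<Sum>i\<in>UNIV. \<Sum>j\<in>UNIV. \<integral>x. G i j x * H i j x \<partial>lebesgue_on \<Omega>\<bar> \<le> A * N"
      unfolding A_def sum_distrib_right
      by (rule order_trans[OF sum_abs], rule sum_mono, rule order_trans[OF sum_abs], rule sum_mono) (rule b)
    have 2: "\<bar>\<Sum>i\<in>UNIV. \<Sum>j\<in>UNIV. \<integral>x. G i i x * H j j x \<partial>lebesgue_on \<Omega>\<bar> \<le> B * N"
      unfolding B_def sum_distrib_right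
      by (rule order_trans[OF sum_abs], rule sum_mono, rule order_trans[OF sum_abs], rule sum_mono) (rule b)
    have "\<bar>lame_pairing \<mu> lam \<Omega> G H\<bar> \<le> \<bar>\<mu>\<bar> * (A * N) + \<bar>\<mu> + lam\<bar> * (B * N)"
      unfolding lame_pairing_def
      by (rule order_trans[OF abs_triangle_ineq]) (intro add_mono; simp only: abs_mult; intro mult_left_mono 1 2 abs_ge_zero)
    then show "\<bar>lame_pairing \<mu> lam \<Omega> G H\<bar> \<le> (\<bar>\<mu>\<bar> * A + \<bar>\<mu> + lam\<bar> * B) * N"
      by (simp add: algebra_simps)
  qed
qed

section \<open>The load as a functional\<close>

lemma vec_H1_norm_bounds:
  "sqrt (L2_sqnorm \<omega> \<Omega> (weak_partial \<Omega> j (\<lambda>x. v x $ i))) \<le> vec_H1_norm \<omega> \<Omega> v"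
proof -
  have "L2_sqnorm \<omega> \<Omega> (weak_partial \<Omega> j (\<lambda>x. v x $ i)) \<le> (\<Sum>j\<in>UNIV. L2_sqnorm \<omega> \<Omega> (weak_partial \<Omega> j (\<lambda>x. v x $ i)))"
    by (rule member_le_sum) (auto intro: L2_sqnorm_nonneg)
  also have "\<dots> \<le> (H1_norm \<omega> \<Omega> (\<lambda>x. v x $ i))\<^sup>2"
    unfolding H1_norm_def
    by (subst real_sqrt_pow2) (auto intro!: add_nonneg_nonneg sum_nonneg L2_sqnorm_nonneg)
  also have "\<dots> \<le> (\<Sum>i\<in>UNIV. (H1_norm \<omega> \<Omega> (\<lambda>x. v x $ i))\<^sup>2)"
    by (rule member_le_sum) auto
  finally show ?thesis unfolding vec_H1_norm_def by (rule real_sqrt_le_mono)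
qed

text \<open>Test functions are dense and functionals in the dual are continuous.\<close>
lemma vec_H10_dual_unique:
  assumes W: "integrable_weight \<Omega> \<omega>" and F: "F \<in> vec_H10_dual \<omega> \<Omega>" and F': "F' \<in> vec_H10_dual \<omega> \<Omega>"
    and eq: "\<And>\<phi>. \<phi> \<in> vec_test_functions \<Omega> \<Longrightarrow> F \<phi> = F' \<phi>"
  shows "F = F'"
proof (rule extensionalityI[of _ "vec_H10 \<omega> \<Omega>"])
  show "F \<in> extensional (vec_H10 \<omega> \<Omega>)" "F' \<in> extensional (vec_H10 \<omega> \<Omega>)"
    using F F' unfolding vec_H10_dual_def by auto
  fix v assume v: "v \<in> vec_H10 \<omega> \<Omega>"
  obtain \<Phi> where \<Phi>: "vec_H10_approximation \<omega> \<Omega> v (\<lambda>i j. weak_partial \<Omega> j (\<lambda>x. v x $ i)) \<Phi>"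
    and lim: "\<And>i. (\<lambda>n. H1_norm \<omega> \<Omega> (\<lambda>x. v x $ i - \<Phi> n x $ i)) \<longlonglongrightarrow> 0"
    using vec_H10_imp_approximation[OF W v] by blast
  have t: "\<Phi> n \<in> vec_test_functions \<Omega>" for n by (rule vec_H10_approximationD(4)[OF \<Phi>])
  then have tH: "\<Phi> n \<in> vec_H10 \<omega> \<Omega>" for n
    using vec_H10_approximation_imp_vec_H10[OF W vec_H10_approximation_test[OF W]] by blast
  have "(\<lambda>n. vec_H1_norm \<omega> \<Omega> (\<lambda>x. v x - \<Phi> n x)) \<longlonglongrightarrow> sqrt (\<Sum>i\<in>(UNIV::'a set). 0\<^sup>2)"
    unfolding vec_H1_norm_def vector_minus_component by (intro tendsto_intros lim)
  then have lim0: "(\<lambda>n. vec_H1_norm \<omega> \<Omega> (\<lambda>x. v x - \<Phi> n x)) \<longlonglongrightarrow> 0" by simp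
  have conv: "(\<lambda>n. F (\<Phi> n)) \<longlonglongrightarrow> F v" if F: "F \<in> vec_H10_dual \<omega> \<Omega>" for F
  proof -
    obtain C where C: "\<And>v. v \<in> vec_H10 \<omega> \<Omega> \<Longrightarrow> \<bar>F v\<bar> \<le> C * vec_H1_norm \<omega> \<Omega> v"
      and add: "\<And>u v. u \<in> vec_H10 \<omega> \<Omega> \<Longrightarrow> v \<in> vec_H10 \<omega> \<Omega> \<Longrightarrow> F (\<lambda>x. u x + v x) = F u + F v"
      using F unfolding vec_H10_dual_def by blast
    have "\<bar>F (\<Phi> n) - F v\<bar> \<le> C * vec_H1_norm \<omega> \<Omega> (\<lambda>x. v x - \<Phi> n x)" for n
    proof -
      have d: "(\<lambda>x. v x - \<Phi> n x) \<in> vec_H10 \<omega> \<Omega>"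
        using vec_H10_add_scaleR[OF W tH v, of "-1"] by simp
      have "F v = F (\<lambda>x. v x - \<Phi> n x) + F (\<Phi> n)"
        using add[OF d tH[of n]] by simp
      then show ?thesis using C[OF d] by linarith
    qed
    moreover have "(\<lambda>n. C * vec_H1_norm \<omega> \<Omega> (\<lambda>x. v x - \<Phi> n x)) \<longlonglongrightarrow> 0"
      using tendsto_mult_left[OF lim0, of C] by simp
    ultimately have "(\<lambda>n. F (\<Phi> n) - F v) \<longlonglongrightarrow> 0"
      by (intro Lim_null_comparison[of "\<lambda>n. F (\<Phi> n) - F v"]) (auto intro!: always_eventually)
    then show ?thesis by (simp add: LIM_zero_iff)
  qed
  have "(\<lambda>n. F (\<Phi> n)) \<longlonglongrightarrow> F' v" using conv[OF F'] eq[OF t] by simp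
  from LIMSEQ_unique[OF conv[OF F] this] show "F v = F' v" .
qed

text \<open>A function in the space with the inverse weight whose Lame form with every test function is the
  load represents the load on the whole space; so the load is well defined as soon as one weak
  solution is found.\<close>
lemma dirac_load_eq_lame_form:
  assumes W: "integrable_weight \<Omega> \<omega>" and u: "vec_H10_approximation \<omega> \<Omega> u G \<Phi>"
    and test: "\<And>\<phi>. \<phi> \<in> vec_test_functions \<Omega> \<Longrightarrow> lame_form \<mu> lam \<Omega> u \<phi> = (\<Sum>k=1..K. f k \<bullet> \<phi> (x k))"
    and v: "v \<in> vec_H10 (\<lambda>y. inverse (\<omega> y)) \<Omega>"
  shows "dirac_load (\<lambda>y. inverse (\<omega> y)) \<Omega> K f x v = lame_form \<mu> lam \<Omega> u v"
proof -
  let ?\<omega>' = "\<lambda>y. inverse (\<omega> y)"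
  let ?H = "vec_H10 ?\<omega>' \<Omega>" and ?D = "\<lambda>v i j. weak_partial \<Omega> j (\<lambda>x. v x $ i)"
  note W' = integrable_weight_inverse[OF W]
  define F where "F = restrict (lame_form \<mu> lam \<Omega> u) ?H"
  have rep: "lame_form \<mu> lam \<Omega> u v = lame_pairing \<mu> lam \<Omega> G (?D v)" if v: "v \<in> ?H" for v
  proof -
    obtain \<Psi> where "vec_H10_approximation ?\<omega>' \<Omega> v (?D v) \<Psi>"
      using vec_H10_imp_approximation[OF W' v] by blast
    from lame_form_eq_pairing[OF W u this] show ?thesis .
  qed
  have L: "?D v i j \<in> L2 ?\<omega>' \<Omega>" if "v \<in> ?H" for v i j
    using that H10_has_weak_partial(2)[OF W'] unfolding vec_H10_def by blast
  note LG = vec_H10_approximationD(2)[OF u]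
  have lin: "lame_form \<mu> lam \<Omega> u (\<lambda>x. c *\<^sub>R v x + w x) = c * lame_form \<mu> lam \<Omega> u v + lame_form \<mu> lam \<Omega> u w"
    if v: "v \<in> ?H" and w: "w \<in> ?H" for c v w
  proof -
    obtain \<Psi> where \<Psi>: "vec_H10_approximation ?\<omega>' \<Omega> v (?D v) \<Psi>"
      using vec_H10_imp_approximation[OF W' v] by blast
    obtain \<Theta> where \<Theta>: "vec_H10_approximation ?\<omega>' \<Omega> w (?D w) \<Theta>"
      using vec_H10_imp_approximation[OF W' w] by blast
    have "lame_form \<mu> lam \<Omega> u (\<lambda>x. c *\<^sub>R v x + w x) = lame_pairing \<mu> lam \<Omega> G (\<lambda>i j x. c * ?D v i j x + ?D w i j x)"
      by (rule lame_form_eq_pairing[OF W u vec_H10_approximation_add[OF W' vec_H10_approximation_scaleR[OF W' \<Psi>] \<Theta>]])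
    also have "\<dots> = c * lame_pairing \<mu> lam \<Omega> G (?D v) + lame_pairing \<mu> lam \<Omega> G (?D w)"
      unfolding lame_pairing_sym[of \<mu> lam \<Omega> G]
      by (rule lame_pairing_lin[OF W' L[OF v] L[OF w]]) (simp add: LG)
    finally show ?thesis by (simp only: rep[OF v] rep[OF w])
  qed
  have FD: "F \<in> vec_H10_dual ?\<omega>' \<Omega>"
    unfolding vec_H10_dual_def mem_Collect_eq
  proof (intro conjI ballI allI CollectI)
    show "F \<in> extensional ?H" by (simp add: F_def)
    show "F (\<lambda>x. v x + w x) = F v + F w" if vw: "v \<in> ?H" "w \<in> ?H" for v w
      using lin[OF vw, of 1] vec_H10_add_scaleR[OF W' vw, of 1] vw by (simp add: F_def)
    have zH: "(\<lambda>x. 0) \<in> ?H"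
      unfolding vec_H10_def using test_functions_subset_H10[OF W'] test_functions_zero by auto
    have z: "lame_form \<mu> lam \<Omega> u (\<lambda>x. 0) = 0"
      using lin[OF zH zH, of 1] by simp
    show "F (\<lambda>x. c *\<^sub>R v x) = c * F v" if v: "v \<in> ?H" for c v
      using lin[OF v zH, of c] vec_H10_add_scaleR[OF W' v zH, of c] v z by (simp add: F_def)
    obtain C where C: "\<And>H N. (\<And>i j. H i j \<in> L2 ?\<omega>' \<Omega> \<and> sqrt (L2_sqnorm ?\<omega>' \<Omega> (H i j)) \<le> N) \<Longrightarrow> \<bar>lame_pairing \<mu> lam \<Omega> G H\<bar> \<le> C * N"
      using lame_pairing_bound[OF W, where G = G and \<mu> = \<mu> and lam = lam, OF LG] by blast
    have "\<bar>F v\<bar> \<le> C * vec_H1_norm ?\<omega>' \<Omega> v" if v: "v \<in> ?H" for v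
    proof -
      have "\<bar>lame_pairing \<mu> lam \<Omega> G (?D v)\<bar> \<le> C * vec_H1_norm ?\<omega>' \<Omega> v"
        by (rule C) (intro conjI L[OF v] vec_H1_norm_bounds)
      then show ?thesis using v by (simp add: F_def rep)
    qed
    then show "\<exists>C. \<forall>v\<in>?H. \<bar>F v\<bar> \<le> C * vec_H1_norm ?\<omega>' \<Omega> v" by blast
  qed
  have Ft: "F \<phi> = (\<Sum>k=1..K. f k \<bullet> \<phi> (x k))" if "\<phi> \<in> vec_test_functions \<Omega>" for \<phi>
    using test[OF that] vec_H10_approximation_imp_vec_H10[OF W' vec_H10_approximation_test[OF W' that]]
    by (simp add: F_def)
  have "dirac_load ?\<omega>' \<Omega> K f x = F"
    unfolding dirac_load_def
  proof (rule the_equality)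
    show "F \<in> vec_H10_dual ?\<omega>' \<Omega> \<and> (\<forall>\<phi>\<in>vec_test_functions \<Omega>. F \<phi> = (\<Sum>k=1..K. f k \<bullet> \<phi> (x k)))"
      using FD Ft by blast
    fix F' assume "F' \<in> vec_H10_dual ?\<omega>' \<Omega> \<and> (\<forall>\<phi>\<in>vec_test_functions \<Omega>. F' \<phi> = (\<Sum>k=1..K. f k \<bullet> \<phi> (x k)))"
    then show "F' = F"
      using vec_H10_dual_unique[OF W' _ FD] Ft by simp
  qed
  then show ?thesis using v by (simp add: F_def)
qed

section \<open>Bounded loads\<close>

definition lame_operator :: "real \<Rightarrow> real \<Rightarrow> (real^'n \<Rightarrow> real^'n) \<Rightarrow> 'n \<Rightarrow> real^'n \<Rightarrow> real" where
  "lame_operator \<mu> lam \<phi> i x =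
     \<mu> * (\<Sum>k\<in>UNIV. partial_deriv k (partial_deriv k (\<lambda>y. \<phi> y $ i)) x) +
     (\<mu> + lam) * (\<Sum>k\<in>UNIV. partial_deriv i (partial_deriv k (\<lambda>y. \<phi> y $ k)) x)"

text \<open>All derivatives are moved to the test function; only first weak derivatives of the solution are used.\<close>
lemma lame_form_test_function:
  assumes W: "integrable_weight \<Omega> \<omega>" and u: "vec_H10_approximation \<omega> \<Omega> u G \<Phi>"
    and \<phi>: "\<phi> \<in> vec_test_functions \<Omega>"
  shows "lame_form \<mu> lam \<Omega> u \<phi> = - (\<Sum>i\<in>UNIV. \<integral>x. u x $ i * lame_operator \<mu> lam \<phi> i x \<partial>lebesgue_on \<Omega>)"
proof -
  note W' = integrable_weight_inverse[OF W] and \<Omega> = integrable_weight_open[OF W]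
  let ?p = "\<lambda>j i. partial_deriv j (\<lambda>x. \<phi> x $ i)"
  have t: "(\<lambda>x. \<phi> x $ i) \<in> test_functions \<Omega>" for i using \<phi> unfolding vec_test_functions_def by auto
  have tt: "partial_deriv k (?p j i) \<in> test_functions \<Omega>" for i j k
    by (intro test_functions_partial_deriv t)
  have ibp: "(\<integral>x. G i j x * ?p k l x \<partial>lebesgue_on \<Omega>) = - (\<integral>x. u x $ i * partial_deriv j (?p k l) x \<partial>lebesgue_on \<Omega>)" for i j k l
    using H10_approximation_has_weak_partial[OF W, of "\<lambda>x. u x $ i" "G i" _ j] u test_functions_partial_deriv[OF t, of k l]
    unfolding vec_H10_approximation_def has_weak_partial_def by fastforce
  have i: "integrable (lebesgue_on \<Omega>) (\<lambda>x. u x $ i * partial_deriv j (?p k l) x)" for i j k l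
    by (rule L2_pairing(1)[OF W vec_H10_approximationD(1)[OF u] L2_test_function[OF W' tt]])
  have "lame_form \<mu> lam \<Omega> u \<phi> = lame_pairing \<mu> lam \<Omega> G (\<lambda>i j. ?p j i)"
    by (rule lame_form_eq_pairing[OF W u vec_H10_approximation_test[OF W' \<phi>]])
  also have "\<dots> = - (\<Sum>i\<in>UNIV. \<mu> * (\<Sum>j\<in>UNIV. \<integral>x. u x $ i * partial_deriv j (?p j i) x \<partial>lebesgue_on \<Omega>) +
      (\<mu> + lam) * (\<Sum>j\<in>UNIV. \<integral>x. u x $ i * partial_deriv i (?p j j) x \<partial>lebesgue_on \<Omega>))"
    unfolding lame_pairing_def ibp by (simp add: sum_negf sum.distrib sum_distrib_left)
  also have "\<dots> = - (\<Sum>i\<in>UNIV. \<integral>x. u x $ i * lame_operator \<mu> lam \<phi> i x \<partial>lebesgue_on \<Omega>)"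
  proof -
    have "(\<integral>x. u x $ i * lame_operator \<mu> lam \<phi> i x \<partial>lebesgue_on \<Omega>) =
       (\<integral>x. \<mu> * (\<Sum>j\<in>UNIV. u x $ i * partial_deriv j (?p j i) x) +
      (\<mu> + lam) * (\<Sum>j\<in>UNIV. u x $ i * partial_deriv i (?p j j) x) \<partial>lebesgue_on \<Omega>)" for i
      unfolding lame_operator_def by (simp add: algebra_simps sum_distrib_left)
    then show ?thesis using i by simp
  qed
  finally show ?thesis .
qed

text \<open>The Frobenius product of full gradients makes the form coercive on its own; the divergence term is a
  square.\<close>
lemma lame_energy_ge:
  assumes \<Omega>: "open \<Omega>" "bounded \<Omega>" and \<mu>: "\<mu> > 0" "\<mu> + lam \<ge> 0" and G: "\<And>i j. G i j \<in> L2 (\<lambda>x. 1) \<Omega>"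
  shows "\<mu> * L2_sqnorm (\<lambda>x. 1) \<Omega> (G k l) \<le> lame_pairing \<mu> lam \<Omega> G G"
proof -
  note W = integrable_weight_one[OF \<Omega>]
  have sq: "L2_sqnorm (\<lambda>x. 1) \<Omega> (G i j) = (\<integral>x. G i j x * G i j x \<partial>lebesgue_on \<Omega>)" for i j
    using L2_sqnorm_eq[OF W L2_measurable[OF G]] by (simp add: power2_eq_square)
  have i: "integrable (lebesgue_on \<Omega>) (\<lambda>x. G i j x * G k l x)" for i j k l
    using L2_pairing(1)[OF W G] G by simp
  have "0 \<le> (\<integral>x. (\<Sum>i\<in>UNIV. G i i x) * (\<Sum>i\<in>UNIV. G i i x) \<partial>lebesgue_on \<Omega>)" by simp
  also have "\<dots> = (\<Sum>i\<in>UNIV. \<Sum>j\<in>UNIV. \<integral>x. G i i x * G j j x \<partial>lebesgue_on \<Omega>)"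
    unfolding sum_product using i by simp
  finally have div: "0 \<le> (\<mu> + lam) * (\<Sum>i\<in>UNIV. \<Sum>j\<in>UNIV. \<integral>x. G i i x * G j j x \<partial>lebesgue_on \<Omega>)"
    using \<mu>(2) by simp
  have "L2_sqnorm (\<lambda>x. 1) \<Omega> (G k l) \<le> (\<Sum>j\<in>UNIV. L2_sqnorm (\<lambda>x. 1) \<Omega> (G k j))"
    by (rule member_le_sum) (auto intro: L2_sqnorm_nonneg)
  also have "\<dots> \<le> (\<Sum>i\<in>UNIV. \<Sum>j\<in>UNIV. L2_sqnorm (\<lambda>x. 1) \<Omega> (G i j))"
    by (rule member_le_sum) (auto intro!: sum_nonneg L2_sqnorm_nonneg)
  finally have "\<mu> * L2_sqnorm (\<lambda>x. 1) \<Omega> (G k l) \<le> \<mu> * (\<Sum>i\<in>UNIV. \<Sum>j\<in>UNIV. L2_sqnorm (\<lambda>x. 1) \<Omega> (G i j))"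
    using \<mu>(1) by simp
  then show ?thesis unfolding lame_pairing_def sq using div by linarith
qed

text \<open>Test functions with the Lame form are a space as in \<open>Riesz_sequence\<close>. By the Poincare inequality a
  Cauchy sequence for the form is one in the Sobolev norm, and its limit solves the equation.\<close>
lemma lame_bounded_load_solvable:
  fixes \<Omega> :: "(real^'n) set" and g :: "'n \<Rightarrow> real^'n \<Rightarrow> real"
  assumes \<Omega>: "open \<Omega>" "bounded \<Omega>" and \<mu>: "\<mu> > 0" "\<mu> + lam \<ge> 0" and g: "\<And>i. g i \<in> L2 (\<lambda>x. 1) \<Omega>"
  obtains z G \<Phi> where "vec_H10_approximation (\<lambda>x. 1) \<Omega> z G \<Phi>"
    "\<And>\<phi>. \<phi> \<in> vec_test_functions \<Omega> \<Longrightarrow> lame_form \<mu> lam \<Omega> z \<phi> = (\<Sum>i\<in>UNIV. \<integral>x. g i x * \<phi> x $ i \<partial>lebesgue_on \<Omega>)"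
proof -
  note W = integrable_weight_one[OF \<Omega>]
  let ?V = "vec_test_functions \<Omega>" and ?D = "\<lambda>u i j. partial_deriv j (\<lambda>x. u x $ i)"
  let ?n = "L2_sqnorm (\<lambda>x::real^'n. 1) \<Omega>"
  define a where "a u v = lame_pairing \<mu> lam \<Omega> (?D u) (?D v)" for u v
  define l where "l u = (\<Sum>i\<in>UNIV. \<integral>x. g i x * u x $ i \<partial>lebesgue_on \<Omega>)" for u :: "real^'n \<Rightarrow> real^'n"
  define lin where "lin c u v = (\<lambda>x. c *\<^sub>R u x + v x)" for c and u v :: "real^'n \<Rightarrow> real^'n"
  have t: "(\<lambda>x. u x $ i) \<in> test_functions \<Omega>" if "u \<in> ?V" for u i using that unfolding vec_test_functions_def by auto
  have L: "(\<lambda>x. u x $ i) \<in> L2 (\<lambda>x. 1) \<Omega>" "?D u i j \<in> L2 (\<lambda>x. 1) \<Omega>" if "u \<in> ?V" for u i j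
    by (rule L2_test_function[OF W t[OF that]], rule L2_test_function[OF W test_functions_partial_deriv[OF t[OF that]]])
  have Dlin: "?D (lin c u v) = (\<lambda>i j x. c * ?D u i j x + ?D v i j x)" if "u \<in> ?V" "v \<in> ?V" for c u v
    unfolding lin_def using test_functions_differentiable[OF t[OF that(1)]] test_functions_differentiable[OF t[OF that(2)]]
    by (intro ext) (simp add: partial_deriv_add partial_deriv_cmult)
  obtain R where R: "\<And>x. x \<in> \<Omega> \<Longrightarrow> norm x \<le> R" using \<Omega>(2) unfolding bounded_iff by blast
  have energy: "?n (?D u i j) \<le> a u u / \<mu>" if "u \<in> ?V" for u i j
    using lame_energy_ge[OF \<Omega> \<mu>, of "?D u" i j] L(2)[OF that] \<mu>(1) unfolding a_def
    by (simp add: pos_le_divide_eq mult.commute)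
  have Poin: "?n (\<lambda>x. u x $ i) \<le> 4 * R\<^sup>2 / \<mu> * a u u" if u: "u \<in> ?V" for u i
  proof -
    have "?n (\<lambda>x. u x $ i) \<le> 4 * R\<^sup>2 * ?n (?D u i i)"
      by (rule Poincare_test_function[OF \<Omega> R t[OF u]])
    also have "\<dots> \<le> 4 * R\<^sup>2 * (a u u / \<mu>)" by (intro mult_left_mono energy u) auto
    finally show ?thesis by simp
  qed
  define C where "C = (\<Sum>i\<in>UNIV. sqrt (?n (g i))) * sqrt (4 * R\<^sup>2 / \<mu>)"
  obtain u where uV: "\<And>n::nat. u n \<in> ?V"
    and Cauchy: "\<And>e. e > 0 \<Longrightarrow> \<exists>N. \<forall>m\<ge>N. \<forall>n\<ge>N. a (lin (-1) (u n) (u m)) (lin (-1) (u n) (u m)) \<le> e"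
    and conv: "\<And>v. v \<in> ?V \<Longrightarrow> (\<lambda>n. a (u n) v) \<longlonglongrightarrow> l v"
  proof (rule Riesz_sequence[where V = ?V and lin = lin and a = a and l = l and C = C])
    fix u :: "nat \<Rightarrow> real^'n \<Rightarrow> real^'n"
    assume "\<And>n. u n \<in> ?V" "\<And>e. e > 0 \<Longrightarrow> \<exists>N. \<forall>m\<ge>N. \<forall>n\<ge>N. a (lin (-1) (u n) (u m)) (lin (-1) (u n) (u m)) \<le> e"
      "\<And>v. v \<in> ?V \<Longrightarrow> (\<lambda>n. a (u n) v) \<longlonglongrightarrow> l v"
    then show thesis by (rule that)
  next
    show "lin c v w \<in> ?V" if "v \<in> ?V" "w \<in> ?V" for c v w
      using that unfolding lin_def vec_test_functions_def by (auto intro!: test_functions_add test_functions_cmult)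
    show "a (lin c v w) z = c * a v z + a w z" if "v \<in> ?V" "w \<in> ?V" "z \<in> ?V" for c v w z
      unfolding a_def Dlin[OF that(1,2)]
      by (rule lame_pairing_lin[OF W]) (use L(2) that in auto)
    show "a v w = a w v" for v w unfolding a_def by (rule lame_pairing_sym)
    show nn: "0 \<le> a v v" if "v \<in> ?V" for v
      using order_trans[OF L2_sqnorm_nonneg energy[OF that]] \<mu>(1) by (simp add: zero_le_divide_iff)
    have i: "integrable (lebesgue_on \<Omega>) (\<lambda>x. g i x * v x $ i)" if "v \<in> ?V" for v i
      using L2_pairing(1)[OF W g] L(1)[OF that] by simp
    show "l (lin c v w) = c * l v + l w" if "v \<in> ?V" "w \<in> ?V" for c v w
    proof -
      have "(\<integral>x. g k x * lin c v w x $ k \<partial>lebesgue_on \<Omega>) = (\<integral>x. c * (g k x * v x $ k) + g k x * w x $ k \<partial>lebesgue_on \<Omega>)" for k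
        unfolding lin_def by (simp add: algebra_simps)
      then show ?thesis
        unfolding l_def using i[OF that(1)] i[OF that(2)] by (simp add: sum.distrib sum_distrib_left)
    qed
    show "\<bar>l v\<bar> \<le> C * sqrt (a v v)" if v: "v \<in> ?V" for v
    proof -
      have "\<bar>l v\<bar> \<le> (\<Sum>i\<in>UNIV. \<bar>\<integral>x. g i x * v x $ i \<partial>lebesgue_on \<Omega>\<bar>)" unfolding l_def by (rule sum_abs)
      also have "\<dots> \<le> (\<Sum>i\<in>UNIV. sqrt (?n (g i)) * (sqrt (4 * R\<^sup>2 / \<mu>) * sqrt (a v v)))"
      proof (rule sum_mono)
        fix i
        have "\<bar>\<integral>x. g i x * v x $ i \<partial>lebesgue_on \<Omega>\<bar> \<le> sqrt (?n (g i)) * sqrt (?n (\<lambda>x. v x $ i))"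
          using L2_pairing(2)[OF W g, of "\<lambda>x. v x $ i"] L(1)[OF v] by simp
        also have "\<dots> \<le> sqrt (?n (g i)) * sqrt (4 * R\<^sup>2 / \<mu> * a v v)"
          by (intro mult_left_mono real_sqrt_le_mono Poin[OF v]) (auto simp: L2_sqnorm_nonneg)
        finally show "\<bar>\<integral>x. g i x * v x $ i \<partial>lebesgue_on \<Omega>\<bar> \<le> sqrt (?n (g i)) * (sqrt (4 * R\<^sup>2 / \<mu>) * sqrt (a v v))"
          by (simp only: real_sqrt_mult)
      qed
      also have "\<dots> = C * sqrt (a v v)" unfolding C_def by (simp only: sum_distrib_right mult.assoc)
      finally show ?thesis .
    qed
    have "(\<lambda>x. 0) \<in> ?V" unfolding vec_test_functions_def using test_functions_zero by simp
    then show "?V \<noteq> {}" by blast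
  qed
  have linV: "lin (-1) (u n) (u m) \<in> ?V" for n m
    using uV unfolding lin_def vec_test_functions_def by (auto intro!: test_functions_diff)
  have small: "\<exists>N. \<forall>m\<ge>N. \<forall>n\<ge>N. ?n (\<lambda>x. w m x - w n x) \<le> e"
    if e: "e > 0" and c: "c > 0" and le: "\<And>m n. ?n (\<lambda>x. w m x - w n x) \<le> c * a (lin (-1) (u n) (u m)) (lin (-1) (u n) (u m))"
    for e c and w :: "nat \<Rightarrow> real^'n \<Rightarrow> real"
  proof -
    obtain N where N: "\<And>m n. m \<ge> N \<Longrightarrow> n \<ge> N \<Longrightarrow> a (lin (-1) (u n) (u m)) (lin (-1) (u n) (u m)) \<le> e / c"
      using Cauchy[OF divide_pos_pos[OF e c]] by auto
    have "?n (\<lambda>x. w m x - w n x) \<le> e" if "m \<ge> N" "n \<ge> N" for m n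
      using order_trans[OF le[of m n] mult_left_mono[OF N[OF that] less_imp_le[OF c]]] c by simp
    then show ?thesis by blast
  qed
  have "\<exists>f. f \<in> L2 (\<lambda>x. 1) \<Omega> \<and> (\<lambda>n. ?n (\<lambda>x. f x - u n x $ i)) \<longlonglongrightarrow> 0" for i
  proof (rule L2_complete[OF W, of "\<lambda>n x. u n x $ i"])
    show "(\<lambda>x. u n x $ i) \<in> L2 (\<lambda>x. 1) \<Omega>" for n by (rule L(1)[OF uV])
    show "\<exists>N. \<forall>m\<ge>N. \<forall>n\<ge>N. ?n (\<lambda>x. u m x $ i - u n x $ i) \<le> e" if "e > 0" for e
    proof (rule small[OF that, of "4 * R\<^sup>2 / \<mu> + 1"])
      show "0 < 4 * R\<^sup>2 / \<mu> + 1" using \<mu>(1) by (simp add: add_nonneg_pos)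
      fix m n
      have "?n (\<lambda>x. u m x $ i - u n x $ i) \<le> 4 * R\<^sup>2 / \<mu> * a (lin (-1) (u n) (u m)) (lin (-1) (u n) (u m))"
        using Poin[OF linV[of n m], of i] by (simp add: lin_def)
      moreover have "0 \<le> a (lin (-1) (u n) (u m)) (lin (-1) (u n) (u m))"
        using order_trans[OF L2_sqnorm_nonneg energy[OF linV[of n m]]] \<mu>(1) by (simp add: zero_le_divide_iff)
      ultimately show "?n (\<lambda>x. u m x $ i - u n x $ i) \<le> (4 * R\<^sup>2 / \<mu> + 1) * a (lin (-1) (u n) (u m)) (lin (-1) (u n) (u m))"
        by (simp add: distrib_right)
    qed
  qed
  then have "\<forall>i. \<exists>f. f \<in> L2 (\<lambda>x. 1) \<Omega> \<and> (\<lambda>n. ?n (\<lambda>x. f x - u n x $ i)) \<longlonglongrightarrow> 0" by (rule allI)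
  then obtain z where "\<forall>i. z i \<in> L2 (\<lambda>x. 1) \<Omega> \<and> (\<lambda>n. ?n (\<lambda>x. z i x - u n x $ i)) \<longlonglongrightarrow> 0"
    by (rule choice[THEN exE])
  then have z: "\<And>i. z i \<in> L2 (\<lambda>x. 1) \<Omega>" "\<And>i. (\<lambda>n. ?n (\<lambda>x. z i x - u n x $ i)) \<longlonglongrightarrow> 0" by simp_all
  have Dn: "partial_deriv j (\<lambda>x. lin (-1) (u n) (u m) x $ i) = (\<lambda>x. ?D (u m) i j x - ?D (u n) i j x)" for n m i j
    using test_functions_differentiable[OF t[OF uV]] by (intro ext) (simp add: lin_def partial_deriv_diff)
  have "\<exists>f. f \<in> L2 (\<lambda>x. 1) \<Omega> \<and> (\<lambda>n. ?n (\<lambda>x. f x - ?D (u n) i j x)) \<longlonglongrightarrow> 0" for i j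
  proof (rule L2_complete[OF W, of "\<lambda>n. ?D (u n) i j"])
    show "?D (u n) i j \<in> L2 (\<lambda>x. 1) \<Omega>" for n by (rule L(2)[OF uV])
    show "\<exists>N. \<forall>m\<ge>N. \<forall>n\<ge>N. ?n (\<lambda>x. ?D (u m) i j x - ?D (u n) i j x) \<le> e" if "e > 0" for e
    proof (rule small[OF that, of "1 / \<mu>"])
      show "0 < 1 / \<mu>" using \<mu>(1) by simp
      show "?n (\<lambda>x. ?D (u m) i j x - ?D (u n) i j x) \<le> 1 / \<mu> * a (lin (-1) (u n) (u m)) (lin (-1) (u n) (u m))" for m n
        using energy[OF linV[of n m], of j i] unfolding Dn by simp
    qed
  qed
  then have "\<forall>p. \<exists>f. f \<in> L2 (\<lambda>x. 1) \<Omega> \<and> (\<lambda>n. ?n (\<lambda>x. f x - ?D (u n) (fst p) (snd p) x)) \<longlonglongrightarrow> 0" by (rule allI)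
  then obtain G' where "\<forall>p. G' p \<in> L2 (\<lambda>x. 1) \<Omega> \<and> (\<lambda>n. ?n (\<lambda>x. G' p x - ?D (u n) (fst p) (snd p) x)) \<longlonglongrightarrow> 0"
    by (rule choice[THEN exE])
  note G' = this[rule_format, THEN conjunct1] this[rule_format, THEN conjunct2]
  define G where "G i j = G' (i, j)" for i j
  have G: "\<And>i j. G i j \<in> L2 (\<lambda>x. 1) \<Omega>" "\<And>i j. (\<lambda>n. ?n (\<lambda>x. G i j x - ?D (u n) i j x)) \<longlonglongrightarrow> 0"
    using G'(1) G'(2)[of "(_, _)"] unfolding G_def by simp_all
  have app: "vec_H10_approximation (\<lambda>x. 1) \<Omega> (\<lambda>x. \<chi> i. z i x) G u"
    unfolding vec_H10_approximation_def H10_approximation_def using z G t[OF uV] by simp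
  show ?thesis
  proof (rule that[OF app])
    fix \<phi> assume \<phi>: "\<phi> \<in> ?V"
    have "lame_form \<mu> lam \<Omega> (\<lambda>x. \<chi> i. z i x) \<phi> = lame_pairing \<mu> lam \<Omega> G (?D \<phi>)"
      using lame_form_eq_pairing[OF W app, of \<phi> "?D \<phi>" "\<lambda>n. \<phi>"] vec_H10_approximation_test[OF W \<phi>] by simp
    moreover have "(\<lambda>n. a (u n) \<phi>) \<longlonglongrightarrow> lame_pairing \<mu> lam \<Omega> G (?D \<phi>)"
      unfolding a_def by (rule lame_pairing_tendsto[OF W G(1) L(2)[OF uV] _ G(2)]) (use L(2)[OF \<phi>] in simp)
    ultimately show "lame_form \<mu> lam \<Omega> (\<lambda>x. \<chi> i. z i x) \<phi> = (\<Sum>i\<in>UNIV. \<integral>x. g i x * \<phi> x $ i \<partial>lebesgue_on \<Omega>)"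
      using LIMSEQ_unique[OF conv[OF \<phi>]] unfolding l_def by simp
  qed
qed

lemma lame_form_self_zero:
  assumes \<Omega>: "open \<Omega>" "bounded \<Omega>" and \<mu>: "\<mu> > 0" "\<mu> + lam \<ge> 0"
    and u: "vec_H10_approximation (\<lambda>x. 1) \<Omega> u G \<Phi>" and zero: "lame_form \<mu> lam \<Omega> u u = 0"
  shows "AE x in lebesgue_on \<Omega>. u x = 0"
proof -
  note W = integrable_weight_one[OF \<Omega>]
  let ?n = "L2_sqnorm (\<lambda>x::real^'a. 1) \<Omega>"
  obtain R where R: "\<And>x. x \<in> \<Omega> \<Longrightarrow> norm x \<le> R" using \<Omega>(2) unfolding bounded_iff by blast
  note LG = vec_H10_approximationD(2)[OF u] and Lu = vec_H10_approximationD(1)[OF u]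
    and t = vec_H10_approximationD(3)[OF u]
  have "lame_pairing \<mu> lam \<Omega> G G = 0"
    using zero lame_form_eq_pairing[OF W u, of u G \<Phi>] u by simp
  then have G0: "?n (G i j) = 0" for i j
    using lame_energy_ge[OF \<Omega> \<mu>, where G = G and k = i and l = j, OF LG] \<mu>(1) L2_sqnorm_nonneg[of "\<lambda>x. 1" \<Omega> "G i j"]
    by (simp add: mult_le_0_iff)
  have u0: "?n (\<lambda>x. u x $ i) \<le> 0" for i
  proof (rule tendsto_lowerbound)
    let ?d = "\<lambda>n. ?n (\<lambda>x. u x $ i - \<Phi> n x $ i)"
    let ?e = "\<lambda>n. ?n (\<lambda>x. G i i x - partial_deriv i (\<lambda>x. \<Phi> n x $ i) x)"
    have "(\<lambda>n. 2 * ?d n + 2 * (4 * R\<^sup>2 * (2 * ?e n))) \<longlonglongrightarrow> 2 * 0 + 2 * (4 * R\<^sup>2 * (2 * 0))"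
      by (intro tendsto_intros vec_H10_approximationD(5,6)[OF u])
    then show "(\<lambda>n. 2 * ?d n + 2 * (4 * R\<^sup>2 * (2 * ?e n))) \<longlonglongrightarrow> 0" by simp
    have "?n (\<lambda>x. u x $ i) \<le> 2 * ?d n + 2 * (4 * R\<^sup>2 * (2 * ?e n))" for n
    proof -
      note tn = L2_test_function[OF W t[of n i]]
        and pn = L2_test_function[OF W test_functions_partial_deriv[OF t[of n i]], of i]
      have "?n (\<lambda>x. u x $ i) \<le> 2 * ?d n + 2 * ?n (\<lambda>x. \<Phi> n x $ i)"
        using L2_add(2)[OF W L2_diff[OF W Lu[of i] tn] tn] by simp
      moreover have "?n (\<lambda>x. \<Phi> n x $ i) \<le> 4 * R\<^sup>2 * ?n (partial_deriv i (\<lambda>x. \<Phi> n x $ i))"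
        by (rule Poincare_test_function[OF \<Omega> R t])
      moreover have "?n (partial_deriv i (\<lambda>x. \<Phi> n x $ i)) \<le> 2 * ?e n"
      proof -
        have "?n (\<lambda>x. (-1) * (G i i x - partial_deriv i (\<lambda>x. \<Phi> n x $ i) x)) \<le> (-1)\<^sup>2 * ?e n"
          by (rule L2_cmult(2)[OF W L2_diff[OF W LG pn]])
        then show ?thesis
          using L2_add(2)[OF W LG[of i i] L2_cmult(1)[OF W L2_diff[OF W LG[of i i] pn], of "-1"]] G0[of i i] by simp
      qed
      then have "4 * R\<^sup>2 * ?n (partial_deriv i (\<lambda>x. \<Phi> n x $ i)) \<le> 4 * R\<^sup>2 * (2 * ?e n)"
        by (intro mult_left_mono) auto
      ultimately show ?thesis by linarith
    qed
    then show "\<forall>\<^sub>F n in sequentially. ?n (\<lambda>x. u x $ i) \<le> 2 * ?d n + 2 * (4 * R\<^sup>2 * (2 * ?e n))" by simp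
  qed simp
  have "AE x in lebesgue_on \<Omega>. u x $ i = 0" for i
  proof -
    have int: "integrable (lebesgue_on \<Omega>) (\<lambda>x. (u x $ i)\<^sup>2)"
      using Lu[of i] by (simp add: L2_iff[OF W])
    have "(\<integral>x. (u x $ i)\<^sup>2 \<partial>lebesgue_on \<Omega>) = 0"
      using u0[of i] L2_sqnorm_nonneg[of "\<lambda>x. 1" \<Omega> "\<lambda>x. u x $ i"] by (simp add: L2_sqnorm_eq[OF W L2_measurable[OF Lu]] order_antisym)
    then have "AE x in lebesgue_on \<Omega>. (u x $ i)\<^sup>2 = 0"
      using integral_nonneg_eq_0_iff_AE[OF int] by simp
    then show ?thesis by simp
  qed
  then have "AE x in lebesgue_on \<Omega>. \<forall>i. u x $ i = 0" by (simp add: AE_all_countable)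
  then show ?thesis by (simp add: vec_eq_iff)
qed

section \<open>The regularised Kelvin matrix\<close>

text \<open>A derivative at a point in relational form, so that derivatives of explicit expressions can be
  computed by applying rules.\<close>
definition has_partial :: "'n \<Rightarrow> (real^'n \<Rightarrow> real) \<Rightarrow> real^'n \<Rightarrow> real \<Rightarrow> bool" where
  "has_partial i f x c \<longleftrightarrow> f differentiable (at x) \<and> partial_deriv i f x = c"

lemma has_partial_eq: "has_partial i f x c \<Longrightarrow> c = c' \<Longrightarrow> has_partial i f x c'"
  by simp

lemma has_partial_const: "has_partial i (\<lambda>x. c) x 0"
  unfolding has_partial_def by (simp add: partial_deriv_const)

lemma has_partial_component: "has_partial i (\<lambda>x. x $ j) x (if i = j then 1 else 0)"
  unfolding has_partial_def
  using smooth_on_imp_differentiable[OF smooth_on_component, of UNIV x j] by (simp add: partial_deriv_component)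

lemma has_partial_add:
  "has_partial i f x a \<Longrightarrow> has_partial i g x b \<Longrightarrow> has_partial i (\<lambda>x. f x + g x) x (a + b)"
  unfolding has_partial_def by (auto simp: partial_deriv_add)

lemma has_partial_mult:
  "has_partial i f x a \<Longrightarrow> has_partial i g x b \<Longrightarrow> has_partial i (\<lambda>x. f x * g x) x (f x * b + a * g x)"
  unfolding has_partial_def by (auto simp: partial_deriv_mult)

lemma has_partial_sum:
  "finite J \<Longrightarrow> (\<And>j. j \<in> J \<Longrightarrow> has_partial i (f j) x (a j)) \<Longrightarrow> has_partial i (\<lambda>x. \<Sum>j\<in>J. f j x) x (\<Sum>j\<in>J. a j)"
  unfolding has_partial_def by (auto simp: partial_deriv_sum intro!: differentiable_sum)

lemma has_partial_compose:
  assumes "(g has_real_derivative g') (at (f x))" "has_partial i f x a"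
  shows "has_partial i (\<lambda>x. g (f x)) x (g' * a)"
proof -
  have d: "f differentiable (at x)" and a: "partial_deriv i f x = a"
    using assms(2) unfolding has_partial_def by auto
  have "(\<lambda>x. g (f x)) differentiable (at x)"
    using has_derivative_compose[OF has_derivative_frechet[OF d] assms(1)[unfolded has_field_derivative_def]]
    unfolding differentiable_def by blast
  then show ?thesis
    unfolding has_partial_def using partial_deriv_compose_real[OF assms(1) d] a by simp
qed

lemma smooth_on_has_partial:
  "smooth_on S f \<Longrightarrow> open S \<Longrightarrow> x \<in> S \<Longrightarrow> has_partial i f x (partial_deriv i f x)"
  unfolding has_partial_def using smooth_on_imp_differentiable by blast

definition kdelta :: "'n \<Rightarrow> 'n \<Rightarrow> real" where
  "kdelta i j = (if i = j then 1 else 0)"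

lemma kdelta_same [simp]: "kdelta i i = 1"
  by (simp add: kdelta_def)

lemma sum_kdelta [simp]: "(\<Sum>k\<in>UNIV. kdelta k i * f k) = f (i::'n::finite)"
  by (simp add: kdelta_def if_distrib[of "\<lambda>c. c * _"] cong: if_cong)

definition reg_sq :: "real \<Rightarrow> real^'n \<Rightarrow> real" where
  "reg_sq \<epsilon> x = (norm x)\<^sup>2 + \<epsilon>\<^sup>2"

text \<open>The powers of the regularised squared distance that occur in derivatives of the Kelvin matrix; the
  index counts how often the exponent $-d/2$ has been lowered.\<close>
definition reg_pow :: "nat \<Rightarrow> real \<Rightarrow> real^'n \<Rightarrow> real" where
  "reg_pow m \<epsilon> x = reg_sq \<epsilon> x powr (- (real CARD('n) / 2) - real m)"

text \<open>The antiderivative of $- t^{-d/2} / 2$; as a function of the squared distance it is the Newton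
  potential up to a constant factor.\<close>
definition newton_profile :: "nat \<Rightarrow> real \<Rightarrow> real" where
  "newton_profile d t = (if d = 2 then - (ln t / 2) else t powr (1 - real d / 2) / (real d - 2))"

text \<open>For \<^term>\<open>\<epsilon> = (0::real)\<close> and \<^term>\<open>\<kappa> = (\<mu> + lam) / (2 * \<mu> + lam)\<close> this is a multiple of
  Kelvin's fundamental solution.  The regularisation is the one obtained from the Galerkin potential
  $\<Delta> g - \<kappa> \<nabla> \<nabla> g$ by replacing $|x|^2$ with $|x|^2 + \<epsilon>^2$ in the biharmonic
  function $g$, up to a constant factor and an additive constant; this is where the term with $\epsilon^2$ comes from, and why the Lame operator maps it
  to an exact multiple of the identity matrix.\<close>
definition kelvin :: "real \<Rightarrow> real \<Rightarrow> 'n \<Rightarrow> 'n \<Rightarrow> real^'n \<Rightarrow> real" where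
  "kelvin \<kappa> \<epsilon> i j x =
     kdelta i j * ((2 - \<kappa>) * newton_profile CARD('n) (reg_sq \<epsilon> x) + \<epsilon>\<^sup>2 * reg_pow 0 \<epsilon> x) +
     \<kappa> * (x $ i * x $ j * reg_pow 0 \<epsilon> x)"

definition kelvin_deriv :: "real \<Rightarrow> real \<Rightarrow> 'n \<Rightarrow> 'n \<Rightarrow> 'n \<Rightarrow> real^'n \<Rightarrow> real" where
  "kelvin_deriv \<kappa> \<epsilon> k i j x =
     kdelta i j * (x $ k * (- (2 - \<kappa>) * reg_pow 0 \<epsilon> x + (- real CARD('n) * \<epsilon>\<^sup>2) * reg_pow 1 \<epsilon> x)) +
     \<kappa> * ((kdelta k i * x $ j + kdelta k j * x $ i) * reg_pow 0 \<epsilon> x) +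
     (- \<kappa> * real CARD('n)) * (x $ i * (x $ j * (x $ k * reg_pow 1 \<epsilon> x)))"

lemma reg_sq_eq_sum: "reg_sq \<epsilon> x = (\<Sum>i\<in>UNIV. x $ i * x $ i) + \<epsilon>\<^sup>2"
  unfolding reg_sq_def norm_power2_eq_sum by (simp add: power2_eq_square)

lemma reg_sq_pos: "\<epsilon> \<noteq> 0 \<or> x \<noteq> 0 \<Longrightarrow> reg_sq \<epsilon> x > 0"
  unfolding reg_sq_def by (auto simp: add_pos_nonneg add_nonneg_pos)

lemma reg_pow_Suc: "reg_sq \<epsilon> x > 0 \<Longrightarrow> reg_sq \<epsilon> x * reg_pow (Suc m) \<epsilon> x = reg_pow m \<epsilon> x"
proof -
  assume s: "reg_sq \<epsilon> x > 0"
  have "reg_sq \<epsilon> x * reg_pow (Suc m) \<epsilon> x = reg_sq \<epsilon> x powr 1 * reg_sq \<epsilon> x powr (- (real CARD('a) / 2) - real (Suc m))"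
    unfolding reg_pow_def using s by simp
  also have "\<dots> = reg_pow m \<epsilon> x" unfolding reg_pow_def powr_add[symmetric] by simp
  finally show ?thesis .
qed

lemma reg_pow_nonneg: "0 \<le> reg_pow m \<epsilon> x"
  unfolding reg_pow_def by simp

lemma has_partial_reg_sq: "has_partial k (reg_sq \<epsilon>) x (2 * x $ k)"
proof -
  have "has_partial k (\<lambda>x. (\<Sum>i\<in>UNIV. x $ i * x $ i) + \<epsilon>\<^sup>2) x
      ((\<Sum>i\<in>UNIV. x $ i * (if k = i then 1 else 0) + (if k = i then 1 else 0) * x $ i) + 0)"
    by (intro has_partial_add has_partial_sum has_partial_mult has_partial_component has_partial_const) simp_all
  moreover have "(\<Sum>i\<in>UNIV. x $ i * (if k = i then 1 else 0) + (if k = i then 1 else 0) * x $ i) + 0 = 2 * x $ k"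
    by (simp add: sum.distrib if_distrib[of "\<lambda>c. _ * c"] if_distrib[of "\<lambda>c. c * _"] cong: if_cong)
  ultimately show ?thesis unfolding reg_sq_eq_sum[abs_def] by simp
qed

lemma has_partial_reg_pow:
  fixes x :: "real^'n"
  assumes "reg_sq \<epsilon> x > 0"
  shows "has_partial k (reg_pow m \<epsilon>) x (- (real CARD('n) + 2 * real m) * (x $ k * reg_pow (Suc m) \<epsilon> x))"
proof -
  let ?a = "- (real CARD('n) / 2) - real m"
  have "((\<lambda>t. t powr ?a) has_real_derivative ?a * reg_sq \<epsilon> x powr (?a - 1)) (at (reg_sq \<epsilon> x))"
    using assms by (auto intro!: derivative_eq_intros)
  from has_partial_compose[OF this has_partial_reg_sq, of k]
  have "has_partial k (reg_pow m \<epsilon>) x (?a * reg_sq \<epsilon> x powr (?a - 1) * (2 * x $ k))"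
    unfolding reg_pow_def[abs_def] .
  moreover have "?a - 1 = - (real CARD('n) / 2) - real (Suc m)" by simp
  ultimately show ?thesis unfolding reg_pow_def by (elim has_partial_eq) (simp add: algebra_simps)
qed

lemma has_real_derivative_newton_profile:
  assumes "t > 0"
  shows "(newton_profile d has_real_derivative - (t powr (- (real d / 2)) / 2)) (at t)"
proof (cases "d = 2")
  case True
  have "((\<lambda>t. - (ln t / 2)) has_real_derivative - (t powr (- (real d / 2)) / 2)) (at t)"
    using assms True by (auto intro!: derivative_eq_intros simp: powr_minus_divide)
  then show ?thesis using True unfolding newton_profile_def[abs_def] by simp
next
  case False
  have nz: "real d - 2 \<noteq> 0" using False by auto
  have "((\<lambda>t. t powr (1 - real d / 2) / (real d - 2)) has_real_derivative - (t powr (- (real d / 2)) / 2)) (at t)"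
  proof (rule DERIV_cong[OF DERIV_cdivide])
    show "((\<lambda>t. t powr (1 - real d / 2)) has_real_derivative (1 - real d / 2) * t powr (- (real d / 2))) (at t)"
      using assms by (auto intro!: derivative_eq_intros)
    have "(1 - real d / 2) / (real d - 2) = - 1 / 2" using nz by (simp add: field_simps)
    then show "(1 - real d / 2) * t powr (- (real d / 2)) / (real d - 2) = - (t powr (- (real d / 2)) / 2)"
      unfolding times_divide_eq_left[symmetric] by simp
  qed
  then show ?thesis using False unfolding newton_profile_def[abs_def] by simp
qed

lemma has_partial_newton:
  fixes x :: "real^'n"
  assumes "reg_sq \<epsilon> x > 0"
  shows "has_partial k (\<lambda>x. newton_profile CARD('n) (reg_sq \<epsilon> x)) x (- (x $ k * reg_pow 0 \<epsilon> x))"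
  using has_partial_compose[OF has_real_derivative_newton_profile[OF assms, of "CARD('n)"] has_partial_reg_sq[of k]]
  by (elim has_partial_eq) (simp add: reg_pow_def)

lemma has_partial_kelvin:
  fixes x :: "real^'n"
  assumes s: "reg_sq \<epsilon> x > 0"
  shows "has_partial k (kelvin \<kappa> \<epsilon> i j) x (kelvin_deriv \<kappa> \<epsilon> k i j x)"
  unfolding kelvin_def[abs_def]
  by (rule has_partial_eq,
      (rule has_partial_add has_partial_mult has_partial_const has_partial_newton[OF s]
        has_partial_reg_pow[OF s] has_partial_component)+)
    (simp add: kelvin_deriv_def kdelta_def algebra_simps)

definition kelvin_deriv2 :: "real \<Rightarrow> real \<Rightarrow> 'n \<Rightarrow> 'n \<Rightarrow> 'n \<Rightarrow> 'n \<Rightarrow> real^'n \<Rightarrow> real" where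
  "kelvin_deriv2 \<kappa> \<epsilon> l k i j x = (let d = real CARD('n) in
     kdelta i j * (kdelta k l * (- (2 - \<kappa>) * reg_pow 0 \<epsilon> x - d * \<epsilon>\<^sup>2 * reg_pow 1 \<epsilon> x) +
       x $ k * x $ l * ((2 - \<kappa>) * d * reg_pow 1 \<epsilon> x + d * (d + 2) * \<epsilon>\<^sup>2 * reg_pow 2 \<epsilon> x)) +
     \<kappa> * ((kdelta k i * kdelta l j + kdelta k j * kdelta l i) * reg_pow 0 \<epsilon> x -
       d * (kdelta k i * x $ j + kdelta k j * x $ i) * x $ l * reg_pow 1 \<epsilon> x) -
     \<kappa> * d * ((kdelta l i * x $ j * x $ k + kdelta l j * x $ i * x $ k + kdelta k l * x $ i * x $ j) * reg_pow 1 \<epsilon> x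
       - (d + 2) * x $ i * x $ j * x $ k * x $ l * reg_pow 2 \<epsilon> x))"

lemma has_partial_kelvin_deriv:
  fixes x :: "real^'n"
  assumes s: "reg_sq \<epsilon> x > 0"
  shows "has_partial l (kelvin_deriv \<kappa> \<epsilon> k i j) x (kelvin_deriv2 \<kappa> \<epsilon> l k i j x)"
proof -
  have *: "(if l = k then 1 else 0) = kdelta k l" "(if l = i then 1 else 0) = kdelta l i" "(if l = j then 1 else 0) = kdelta l j"
    by (auto simp: kdelta_def)
  have S: "Suc (Suc 0) = 2" "Suc 1 = 2" by simp_all
  show ?thesis
    unfolding kelvin_deriv_def[abs_def]
    by (rule has_partial_eq,
      (rule has_partial_add has_partial_mult has_partial_const
        has_partial_reg_pow[OF s] has_partial_component)+)
      (simp add: * S kelvin_deriv2_def Let_def algebra_simps)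
qed

text \<open>With this value of \<^term>\<open>\<kappa>\<close> the terms with $x_i x_j$ from the Laplacian and from the gradient of
  the divergence cancel, as do those of order $|x|^{-d}$ on the diagonal.\<close>
lemma lame_kelvin:
  fixes x :: "real^'n"
  assumes s: "reg_sq \<epsilon> x > 0" and \<kappa>: "\<kappa> = (\<mu> + lam) / (2 * \<mu> + lam)" and \<mu>: "2 * \<mu> + lam > 0"
  shows "\<mu> * (\<Sum>k\<in>UNIV. kelvin_deriv2 \<kappa> \<epsilon> k k i j x) + (\<mu> + lam) * (\<Sum>k\<in>UNIV. kelvin_deriv2 \<kappa> \<epsilon> i k k j x)
    = - (\<mu> * real CARD('n) * (real CARD('n) + 2)) * (kdelta i j * (\<epsilon> ^ 4 * reg_pow 2 \<epsilon> x))"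
proof -
  define d where "d = real CARD('n)"
  define P0 P1 P2 where "P0 = reg_pow 0 \<epsilon> x" and "P1 = reg_pow 1 \<epsilon> x" and "P2 = reg_pow 2 \<epsilon> x"
  define e where "e = \<epsilon>\<^sup>2"
  define R where "R = (\<Sum>k\<in>UNIV. x $ k * x $ k)"
  have R: "R = reg_sq \<epsilon> x - e" unfolding R_def reg_sq_eq_sum e_def by simp
  have P: "R * P1 = P0 - e * P1" "R * P2 = P1 - e * P2"
    using reg_pow_Suc[OF s, of 0] reg_pow_Suc[OF s, of 1] unfolding R P0_def P1_def P2_def
    by (simp_all add: left_diff_distrib numeral_2_eq_2)
  have ks: "kdelta i k = kdelta k i" for i k :: 'n by (simp add: kdelta_def)
  let ?X = "x $ i * x $ j" and ?D = "kdelta i j"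
  have lap: "(\<Sum>k\<in>UNIV. kelvin_deriv2 \<kappa> \<epsilon> k k i j x) =
      ?D * (2 * \<kappa> * P0 + \<kappa> * d * e * P1 - d * (d + 2) * e\<^sup>2 * P2) - ?X * \<kappa> * (2 * d * P1 + d * (d + 2) * e * P2)"
  proof -
    have "(\<Sum>k\<in>UNIV. kelvin_deriv2 \<kappa> \<epsilon> k k i j x) =
      (\<Sum>k\<in>(UNIV::'n set). ?D * (- (2 - \<kappa>) * P0 - d * e * P1) - \<kappa> * d * ?X * P1) +
      (\<Sum>k\<in>UNIV. (x $ k * x $ k) * (?D * ((2 - \<kappa>) * d * P1 + d * (d + 2) * e * P2) + \<kappa> * d * (d + 2) * ?X * P2)) +
      (\<Sum>k\<in>UNIV. kdelta k i * (kdelta k j * (2 * \<kappa> * P0))) +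
      (\<Sum>k\<in>UNIV. kdelta k i * (- 2 * \<kappa> * d * x $ j * x $ k * P1)) +
      (\<Sum>k\<in>UNIV. kdelta k j * (- 2 * \<kappa> * d * x $ i * x $ k * P1))"
      unfolding sum.distrib[symmetric]
      by (rule sum.cong) (simp_all add: kelvin_deriv2_def Let_def P0_def P1_def P2_def d_def e_def algebra_simps)
    also have "\<dots> = d * (?D * (- (2 - \<kappa>) * P0 - d * e * P1) - \<kappa> * d * ?X * P1) +
       R * (?D * ((2 - \<kappa>) * d * P1 + d * (d + 2) * e * P2) + \<kappa> * d * (d + 2) * ?X * P2) +
       ?D * (2 * \<kappa> * P0) - 4 * \<kappa> * d * ?X * P1"
      by (simp only: sum_kdelta sum_distrib_right[symmetric] R_def[symmetric]) (simp add: d_def algebra_simps)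
    also have "\<dots> = d * (?D * (- (2 - \<kappa>) * P0 - d * e * P1) - \<kappa> * d * ?X * P1) +
       (?D * ((2 - \<kappa>) * d * (R * P1) + d * (d + 2) * e * (R * P2)) + \<kappa> * d * (d + 2) * ?X * (R * P2)) +
       ?D * (2 * \<kappa> * P0) - 4 * \<kappa> * d * ?X * P1"
      by (simp add: algebra_simps)
    finally show ?thesis unfolding P by (simp add: algebra_simps power2_eq_square)
  qed
  have gdiv: "(\<Sum>k\<in>UNIV. kelvin_deriv2 \<kappa> \<epsilon> i k k j x) =
     - (1 - \<kappa>) * (?D * (2 * P0 + d * e * P1) - ?X * (2 * d * P1 + d * (d + 2) * e * P2))"
  proof -
    have "(\<Sum>k\<in>UNIV. kelvin_deriv2 \<kappa> \<epsilon> i k k j x) =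
      (\<Sum>k\<in>(UNIV::'n set). \<kappa> * ?D * P0 - \<kappa> * d * ?X * P1 - \<kappa> * d * ?D * 0) +
      (\<Sum>k\<in>UNIV. (x $ k * x $ k) * (- \<kappa> * d * ?D * P1 + \<kappa> * d * (d + 2) * ?X * P2)) +
      (\<Sum>k\<in>UNIV. kdelta k j * (kdelta k i * (- (2 - \<kappa>) * P0 - d * e * P1 + \<kappa> * P0))) +
      (\<Sum>k\<in>UNIV. kdelta k j * (x $ k * x $ i * ((2 - \<kappa>) * d * P1 + d * (d + 2) * e * P2 - \<kappa> * d * P1))) +
      (\<Sum>k\<in>UNIV. kdelta k i * (- 2 * \<kappa> * d * x $ j * x $ k * P1))"
      unfolding sum.distrib[symmetric]
      by (rule sum.cong) (simp_all add: kelvin_deriv2_def Let_def P0_def P1_def P2_def d_def e_def ks[of i] algebra_simps)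
    also have "\<dots> = d * (\<kappa> * ?D * P0 - \<kappa> * d * ?X * P1) + R * (- \<kappa> * d * ?D * P1 + \<kappa> * d * (d + 2) * ?X * P2) +
       ?D * (- (2 - \<kappa>) * P0 - d * e * P1 + \<kappa> * P0) + ?X * ((2 - \<kappa>) * d * P1 + d * (d + 2) * e * P2 - \<kappa> * d * P1)
       - 2 * \<kappa> * d * ?X * P1"
      by (simp only: sum_kdelta sum_distrib_right[symmetric] R_def[symmetric]) (simp add: d_def ks[of j] algebra_simps)
    also have "\<dots> = d * (\<kappa> * ?D * P0 - \<kappa> * d * ?X * P1) + (- \<kappa> * d * ?D * (R * P1) + \<kappa> * d * (d + 2) * ?X * (R * P2)) +
       ?D * (- (2 - \<kappa>) * P0 - d * e * P1 + \<kappa> * P0) + ?X * ((2 - \<kappa>) * d * P1 + d * (d + 2) * e * P2 - \<kappa> * d * P1)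
       - 2 * \<kappa> * d * ?X * P1"
      by (simp add: algebra_simps)
    finally show ?thesis unfolding P by (simp add: algebra_simps)
  qed
  have k1: "(\<mu> + lam) * (1 - \<kappa>) = \<mu> * \<kappa>"
    unfolding \<kappa> using \<mu> by (simp add: field_simps)
  have "\<mu> * (\<Sum>k\<in>UNIV. kelvin_deriv2 \<kappa> \<epsilon> k k i j x) + (\<mu> + lam) * (\<Sum>k\<in>UNIV. kelvin_deriv2 \<kappa> \<epsilon> i k k j x) =
     \<mu> * (?D * (2 * \<kappa> * P0 + \<kappa> * d * e * P1 - d * (d + 2) * e\<^sup>2 * P2) - ?X * \<kappa> * (2 * d * P1 + d * (d + 2) * e * P2))
     - ((\<mu> + lam) * (1 - \<kappa>)) * (?D * (2 * P0 + d * e * P1) - ?X * (2 * d * P1 + d * (d + 2) * e * P2))"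
    unfolding lap gdiv by (simp add: algebra_simps)
  also have "\<dots> = - (\<mu> * d * (d + 2)) * (?D * (e\<^sup>2 * P2))"
    unfolding k1 by (simp add: algebra_simps)
  also have "e\<^sup>2 = \<epsilon> ^ 4" unfolding e_def by (simp add: power_mult[symmetric])
  finally show ?thesis unfolding d_def P2_def .
qed

lemma smooth_on_reg_sq: "open S \<Longrightarrow> smooth_on S (reg_sq \<epsilon>)"
  using smooth_on_add[OF _ smooth_on_norm_power2_diff[of S 0] smooth_on_const, of "\<epsilon>\<^sup>2"]
  unfolding reg_sq_def[abs_def] by simp

lemma smooth_on_reg_pow:
  assumes "open S" "\<And>x. x \<in> S \<Longrightarrow> reg_sq \<epsilon> x > 0"
  shows "smooth_on S (reg_pow m \<epsilon>)"
  unfolding reg_pow_def[abs_def]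
  by (rule smooth_on_compose[OF assms(1) smooth_real_on_powr smooth_on_reg_sq[OF assms(1)]]) (use assms in auto)

lemma smooth_real_on_newton_profile: "smooth_real_on {0<..} (newton_profile d)"
proof (rule smooth_real_on_Suc)
  show "(newton_profile d has_real_derivative (- 1/2) * t powr (- (real d / 2))) (at t)" if "t \<in> {0<..}" for t
    using has_real_derivative_newton_profile[of t d] that by simp
  show "smooth_real_on {0<..} (\<lambda>t. (- 1/2) * t powr (- (real d / 2)))"
    by (rule smooth_real_on_cmult[OF smooth_real_on_powr])
qed

lemma smooth_on_kelvin:
  assumes "open S" "\<And>x. x \<in> S \<Longrightarrow> reg_sq \<epsilon> x > 0"
  shows "smooth_on S (kelvin \<kappa> \<epsilon> i j)"
  unfolding kelvin_def[abs_def]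
  by (intro smooth_on_add smooth_on_mult smooth_on_const smooth_on_component smooth_on_reg_pow assms
      smooth_on_compose[OF assms(1) smooth_real_on_newton_profile smooth_on_reg_sq[OF assms(1)]])
    (use assms in auto)

lemma partial_deriv_kelvin:
  "reg_sq \<epsilon> x > 0 \<Longrightarrow> partial_deriv k (kelvin \<kappa> \<epsilon> i j) x = kelvin_deriv \<kappa> \<epsilon> k i j x"
  using has_partial_kelvin[of \<epsilon> x k \<kappa> i j] unfolding has_partial_def by simp

lemma smooth_on_kelvin_deriv:
  assumes "open S" "\<And>x. x \<in> S \<Longrightarrow> reg_sq \<epsilon> x > 0"
  shows "smooth_on S (kelvin_deriv \<kappa> \<epsilon> k i j)"
  by (rule smooth_on_cong[OF assms(1) _ smooth_on_partial_deriv[OF smooth_on_kelvin[OF assms, of \<kappa> i j], of k]])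
    (simp_all add: assms partial_deriv_kelvin)

section \<open>The parametrix\<close>

text \<open>A column of the Kelvin matrix with compact support: still a fundamental solution up to a smooth
  kernel, and an admissible test function when regularised.\<close>
definition parametrix :: "real \<Rightarrow> real \<Rightarrow> real \<Rightarrow> 'n \<Rightarrow> real^'n \<Rightarrow> real^'n" where
  "parametrix \<kappa> r \<epsilon> j x = (\<chi> i. cutoff r 0 x * kelvin \<kappa> \<epsilon> i j x)"

text \<open>What the Lame operator leaves besides the cut off approximation of the Dirac mass: the terms in
  which the cutoff is differentiated.\<close>
definition parametrix_error :: "real \<Rightarrow> real \<Rightarrow> real \<Rightarrow> real \<Rightarrow> real \<Rightarrow> 'n \<Rightarrow> 'n \<Rightarrow> real^'n \<Rightarrow> real" where
  "parametrix_error \<mu> lam \<kappa> r \<epsilon> i j x =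
     \<mu> * (\<Sum>k\<in>UNIV. partial_deriv k (partial_deriv k (cutoff r 0)) x * kelvin \<kappa> \<epsilon> i j x +
        2 * (partial_deriv k (cutoff r 0) x * kelvin_deriv \<kappa> \<epsilon> k i j x)) +
     (\<mu> + lam) * (\<Sum>k\<in>UNIV. partial_deriv i (partial_deriv k (cutoff r 0)) x * kelvin \<kappa> \<epsilon> k j x +
        (partial_deriv k (cutoff r 0) x * kelvin_deriv \<kappa> \<epsilon> i k j x +
         partial_deriv i (cutoff r 0) x * kelvin_deriv \<kappa> \<epsilon> k k j x))"

lemma has_partial2_cutoff_kelvin:
  fixes x :: "real^'n"
  assumes \<epsilon>: "\<epsilon> \<noteq> 0"
  shows "partial_deriv k (\<lambda>x. cutoff r 0 x * kelvin \<kappa> \<epsilon> i j x) =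
      (\<lambda>x. cutoff r 0 x * kelvin_deriv \<kappa> \<epsilon> k i j x + partial_deriv k (cutoff r 0) x * kelvin \<kappa> \<epsilon> i j x)"
    "partial_deriv l (partial_deriv k (\<lambda>x. cutoff r 0 x * kelvin \<kappa> \<epsilon> i j x)) x =
      (cutoff r 0 x * kelvin_deriv2 \<kappa> \<epsilon> l k i j x + partial_deriv l (cutoff r 0) x * kelvin_deriv \<kappa> \<epsilon> k i j x) +
      (partial_deriv k (cutoff r 0) x * kelvin_deriv \<kappa> \<epsilon> l i j x +
       partial_deriv l (partial_deriv k (cutoff r 0)) x * kelvin \<kappa> \<epsilon> i j x)"
proof -
  have s: "reg_sq \<epsilon> x > 0" for x :: "real^'n" using \<epsilon> by (simp add: reg_sq_pos)
  have c: "has_partial l (cutoff r 0) x (partial_deriv l (cutoff r 0) x)" for l and x :: "real^'n"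
    by (rule smooth_on_has_partial[OF smooth_on_cutoff[OF open_UNIV]]) auto
  have c2: "has_partial l (partial_deriv k (cutoff r 0)) x (partial_deriv l (partial_deriv k (cutoff r 0)) x)" for l k and x :: "real^'n"
    by (rule smooth_on_has_partial[OF smooth_on_partial_deriv[OF smooth_on_cutoff[OF open_UNIV]]]) auto
  show 1: "partial_deriv k (\<lambda>x. cutoff r 0 x * kelvin \<kappa> \<epsilon> i j x) =
      (\<lambda>x. cutoff r 0 x * kelvin_deriv \<kappa> \<epsilon> k i j x + partial_deriv k (cutoff r 0) x * kelvin \<kappa> \<epsilon> i j x)"
    using has_partial_mult[OF c has_partial_kelvin[OF s]] unfolding has_partial_def by auto
  show "partial_deriv l (partial_deriv k (\<lambda>x. cutoff r 0 x * kelvin \<kappa> \<epsilon> i j x)) x =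
      (cutoff r 0 x * kelvin_deriv2 \<kappa> \<epsilon> l k i j x + partial_deriv l (cutoff r 0) x * kelvin_deriv \<kappa> \<epsilon> k i j x) +
      (partial_deriv k (cutoff r 0) x * kelvin_deriv \<kappa> \<epsilon> l i j x +
       partial_deriv l (partial_deriv k (cutoff r 0)) x * kelvin \<kappa> \<epsilon> i j x)"
    unfolding 1
    using has_partial_add[OF has_partial_mult[OF c[of l x] has_partial_kelvin_deriv[OF s, of l \<kappa> k i j]]
        has_partial_mult[OF c2[of l k x] has_partial_kelvin[OF s, of l \<kappa> i j]]]
    unfolding has_partial_def by simp
qed

lemma lame_operator_parametrix:
  fixes x :: "real^'n"
  assumes \<epsilon>: "\<epsilon> \<noteq> 0" and \<kappa>: "\<kappa> = (\<mu> + lam) / (2 * \<mu> + lam)" and \<mu>: "2 * \<mu> + lam > 0"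
  shows "lame_operator \<mu> lam (parametrix \<kappa> r \<epsilon> j) i x =
     parametrix_error \<mu> lam \<kappa> r \<epsilon> i j x
     - (\<mu> * real CARD('n) * (real CARD('n) + 2)) * (kdelta i j * (cutoff r 0 x * (\<epsilon> ^ 4 * reg_pow 2 \<epsilon> x)))"
proof -
  have s: "reg_sq \<epsilon> x > 0" using \<epsilon> by (simp add: reg_sq_pos)
  let ?z = "cutoff r 0 x"
  have "lame_operator \<mu> lam (parametrix \<kappa> r \<epsilon> j) i x = parametrix_error \<mu> lam \<kappa> r \<epsilon> i j x +
     ?z * (\<mu> * (\<Sum>k\<in>UNIV. kelvin_deriv2 \<kappa> \<epsilon> k k i j x) + (\<mu> + lam) * (\<Sum>k\<in>UNIV. kelvin_deriv2 \<kappa> \<epsilon> i k k j x))"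
    unfolding lame_operator_def parametrix_def parametrix_error_def vec_lambda_beta has_partial2_cutoff_kelvin(2)[OF \<epsilon>]
    by (simp add: sum.distrib sum_distrib_left algebra_simps)
  then show ?thesis unfolding lame_kelvin[OF s \<kappa> \<mu>] by (simp add: algebra_simps)
qed

section \<open>The singularity of the Kelvin matrix\<close>

lemma newton_profile_bound:
  assumes d: "d \<ge> 2" and T: "T > 0"
  obtains C where "C \<ge> 0" "\<And>t. 0 < t \<Longrightarrow> t \<le> T \<Longrightarrow> \<bar>newton_profile d t\<bar> \<le> C * t powr ((1 - real d) / 2)"
proof (cases "d = 2")
  case True
  have "\<bar>newton_profile d t\<bar> \<le> (T * sqrt T + 2) * t powr ((1 - real d) / 2)" if t: "0 < t" "t \<le> T" for t
  proof -
    have p: "t powr ((1 - real d) / 2) = inverse (sqrt t)"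
      using t True by (simp add: powr_minus powr_half_sqrt)
    have "\<bar>ln t\<bar> \<le> (T * sqrt T + 2) * inverse (sqrt t)"
    proof (cases "t \<ge> 1")
      case True
      have "ln t \<le> t" using t ln_less_self[of t] by linarith
      moreover have "t * sqrt t \<le> T * sqrt T" using t by (intro mult_mono) auto
      ultimately have "ln t * sqrt t \<le> T * sqrt T + 2"
        using mult_right_mono[of "ln t" t "sqrt t"] real_sqrt_ge_zero[of t] t by linarith
      then show ?thesis using True t by (simp add: divide_inverse[symmetric] pos_le_divide_eq)
    next
      case False
      have "- ln t = 2 * ln (inverse (sqrt t))" using t by (simp add: ln_sqrt ln_inverse)
      also have "\<dots> \<le> 2 * inverse (sqrt t)"
        using ln_less_self[of "inverse (sqrt t)"] t by (intro mult_left_mono less_imp_le) simp_all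
      also have "\<dots> \<le> (T * sqrt T + 2) * inverse (sqrt t)"
        using T t by (intro mult_right_mono) auto
      finally show ?thesis using False t by simp
    qed
    then show ?thesis using True p by (simp add: newton_profile_def)
  qed
  then show ?thesis using T by (intro that[of "T * sqrt T + 2"]) auto
next
  case False
  then have d3: "d \<ge> 3" using d by simp
  have "\<bar>newton_profile d t\<bar> \<le> sqrt T * t powr ((1 - real d) / 2)" if t: "0 < t" "t \<le> T" for t
  proof -
    have "t powr (1 - real d / 2) = t powr (1/2) * t powr ((1 - real d) / 2)"
      unfolding powr_add[symmetric] by (simp add: field_simps)
    also have "\<dots> \<le> sqrt T * t powr ((1 - real d) / 2)"
      using t by (intro mult_right_mono) (auto simp: powr_half_sqrt)
    finally have "t powr (1 - real d / 2) \<le> sqrt T * t powr ((1 - real d) / 2)" .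
    moreover have "t powr (1 - real d / 2) / (real d - 2) \<le> t powr (1 - real d / 2) / 1"
      using d3 by (intro divide_left_mono) auto
    ultimately show ?thesis using False d3 by (simp add: newton_profile_def)
  qed
  then show ?thesis using T by (intro that[of "sqrt T"]) auto
qed

text \<open>Uniformly in the regularisation the entries are $O(|x|^{1-d})$ like their derivatives. For the entries
  themselves this is not sharp, but it covers the logarithm in two dimensions.\<close>
lemma kelvin_bound:
  assumes d: "CARD('n) \<ge> 2" and r: "r > 0"
  obtains C where "C \<ge> 0"
    "\<And>\<epsilon> i j (x::real^'n). 0 \<le> \<epsilon> \<Longrightarrow> \<epsilon> \<le> 1 \<Longrightarrow> x \<noteq> 0 \<Longrightarrow> norm x \<le> r \<Longrightarrow>
       \<bar>kelvin \<kappa> \<epsilon> i j x\<bar> \<le> C * norm x powr (1 - real CARD('n))"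
    "\<And>\<epsilon> k i j (x::real^'n). 0 \<le> \<epsilon> \<Longrightarrow> \<epsilon> \<le> 1 \<Longrightarrow> x \<noteq> 0 \<Longrightarrow> norm x \<le> r \<Longrightarrow>
       \<bar>kelvin_deriv \<kappa> \<epsilon> k i j x\<bar> \<le> C * norm x powr (1 - real CARD('n))"
proof -
  define d where "d = real CARD('n)"
  define T where "T = r\<^sup>2 + 1"
  have T: "T > 0" unfolding T_def by (simp add: add_nonneg_pos)
  obtain C0 where C0: "C0 \<ge> 0"
    "\<And>t. 0 < t \<Longrightarrow> t \<le> T \<Longrightarrow> \<bar>newton_profile CARD('n) t\<bar> \<le> C0 * t powr ((1 - d) / 2)"
    using newton_profile_bound[OF d T] unfolding d_def by metis
  define C1 where "C1 = \<bar>2 - \<kappa>\<bar> * C0 + sqrt T + \<bar>\<kappa>\<bar> * r"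
  define C2 where "C2 = \<bar>2 - \<kappa>\<bar> + d + 2 * \<bar>\<kappa>\<bar> + \<bar>\<kappa>\<bar> * d"
  have d0: "d \<ge> 2" using assms(1) unfolding d_def by simp
  have C12: "C1 \<ge> 0" "C2 \<ge> 0" using C0 r d0 T unfolding C1_def C2_def by auto
  have main: "\<bar>kelvin \<kappa> \<epsilon> i j x\<bar> \<le> C1 * norm x powr (1 - d) \<and> \<bar>kelvin_deriv \<kappa> \<epsilon> k i j x\<bar> \<le> C2 * norm x powr (1 - d)"
    if \<epsilon>: "0 \<le> \<epsilon>" "\<epsilon> \<le> 1" and x: "x \<noteq> 0" "norm x \<le> r" for \<epsilon> k i j and x :: "real^'n"
  proof -
    define s where "s = reg_sq \<epsilon> x"
    define N where "N = norm x powr (1 - d)"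
    define p0 p1 where "p0 = reg_pow 0 \<epsilon> x" and "p1 = reg_pow 1 \<epsilon> x"
    have s0: "s > 0" unfolding s_def using x by (simp add: reg_sq_pos)
    have e1: "\<epsilon>\<^sup>2 \<le> 1" using \<epsilon> by (simp add: power_le_one)
    have sT: "s \<le> T" unfolding s_def reg_sq_def T_def using x e1 by (intro add_mono power_mono) auto
    have sx: "(norm x)\<^sup>2 \<le> s" "\<epsilon>\<^sup>2 \<le> s" unfolding s_def reg_sq_def by auto
    have p: "0 \<le> p0" "0 \<le> p1" "s * p1 = p0" unfolding p0_def p1_def s_def
      using reg_pow_Suc[of \<epsilon> x 0] s0 by (auto simp: reg_pow_nonneg s_def)
    have sN: "s powr ((1 - d) / 2) \<le> N"
    proof -
      have "s powr ((1 - d) / 2) \<le> ((norm x)\<^sup>2) powr ((1 - d) / 2)"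
        using d0 x sx by (intro powr_mono2') auto
      also have "(norm x)\<^sup>2 = norm x powr 2" using x by (simp add: powr_numeral)
      also have "(norm x powr 2) powr ((1 - d) / 2) = N" unfolding N_def powr_powr by (simp add: diff_divide_distrib)
      finally show ?thesis .
    qed
    have xs: "norm x \<le> sqrt s" using sx(1) by (rule real_le_rsqrt)
    have half: "sqrt s * p0 = s powr ((1 - d) / 2)"
    proof -
      have "sqrt s * p0 = s powr (1/2) * s powr (- (d / 2) - 0)"
        unfolding p0_def reg_pow_def s_def[symmetric] d_def using s0 by (simp add: powr_half_sqrt)
      then show ?thesis unfolding powr_add[symmetric] by (simp add: field_simps)
    qed
    have xp0: "norm x * p0 \<le> N"
      using mult_right_mono[OF xs p(1)] half sN by linarith
    have ep0: "\<epsilon>\<^sup>2 * p0 \<le> sqrt T * N"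
    proof -
      have "\<epsilon>\<^sup>2 * p0 \<le> s * p0" using sx(2) p(1) by (rule mult_right_mono)
      also have "\<dots> = sqrt s * (sqrt s * p0)" using s0 by (simp add: mult.assoc[symmetric])
      also have "\<dots> \<le> sqrt T * N" using sT sN half s0 T
        by (intro mult_mono) (auto simp: N_def)
      finally show ?thesis .
    qed
    have ep1: "\<epsilon>\<^sup>2 * p1 \<le> p0" using mult_right_mono[OF sx(2) p(2)] p(3) by simp
    have xc: "\<bar>x $ i\<bar> \<le> norm x" for i by (rule component_le_norm_cart)
    have xx: "\<bar>x $ i * x $ j\<bar> \<le> (norm x)\<^sup>2" for i j
      unfolding abs_mult power2_eq_square by (intro mult_mono xc) auto
    have xxp0: "\<bar>x $ i * x $ j * p0\<bar> \<le> r * N"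
    proof -
      have "\<bar>x $ i * x $ j * p0\<bar> \<le> (norm x)\<^sup>2 * p0"
        unfolding abs_mult[of _ p0] using xx[of i j] p(1) by (simp add: mult_right_mono)
      also have "\<dots> = norm x * (norm x * p0)" by (simp add: power2_eq_square)
      also have "\<dots> \<le> r * N" using x xp0 r p(1) by (intro mult_mono) auto
      finally show ?thesis .
    qed
    have N0: "0 \<le> N" by (simp add: N_def)
    have kd: "\<bar>kdelta i j\<bar> \<le> 1" for i j :: 'n by (simp add: kdelta_def)
    have "\<bar>kelvin \<kappa> \<epsilon> i j x\<bar> \<le> \<bar>kdelta i j\<bar> * \<bar>(2 - \<kappa>) * newton_profile CARD('n) s + \<epsilon>\<^sup>2 * p0\<bar> + \<bar>\<kappa>\<bar> * \<bar>x $ i * x $ j * p0\<bar>"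
      unfolding kelvin_def p0_def s_def by (rule order_trans[OF abs_triangle_ineq]) (simp add: abs_mult)
    also have "\<dots> \<le> 1 * (\<bar>2 - \<kappa>\<bar> * (C0 * N) + sqrt T * N) + \<bar>\<kappa>\<bar> * (r * N)"
    proof (intro add_mono mult_mono kd)
      have "\<bar>newton_profile CARD('n) s\<bar> \<le> C0 * N"
        using C0(2)[OF s0 sT] mult_left_mono[OF sN C0(1)] by linarith
      then have "\<bar>(2 - \<kappa>) * newton_profile CARD('n) s\<bar> \<le> \<bar>2 - \<kappa>\<bar> * (C0 * N)"
        unfolding abs_mult by (rule mult_left_mono) simp
      moreover have "\<bar>\<epsilon>\<^sup>2 * p0\<bar> \<le> sqrt T * N" using ep0 p(1) by simp
      ultimately show "\<bar>(2 - \<kappa>) * newton_profile CARD('n) s + \<epsilon>\<^sup>2 * p0\<bar> \<le> \<bar>2 - \<kappa>\<bar> * (C0 * N) + sqrt T * N"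
        by linarith
    qed (use xxp0 in auto)
    also have "\<dots> = C1 * N" unfolding C1_def by (simp add: algebra_simps)
    finally have 1: "\<bar>kelvin \<kappa> \<epsilon> i j x\<bar> \<le> C1 * N" .
    have t1: "\<bar>kdelta i j * (x $ k * (- (2 - \<kappa>) * p0 + (- d * \<epsilon>\<^sup>2) * p1))\<bar> \<le> (\<bar>2 - \<kappa>\<bar> + d) * N"
    proof -
      have "\<bar>- (2 - \<kappa>) * p0 + (- d * \<epsilon>\<^sup>2) * p1\<bar> \<le> \<bar>- (2 - \<kappa>) * p0\<bar> + \<bar>(- d * \<epsilon>\<^sup>2) * p1\<bar>" by (rule abs_triangle_ineq)
      also have "\<bar>- (2 - \<kappa>) * p0\<bar> = \<bar>2 - \<kappa>\<bar> * p0" using p(1) by (simp add: abs_mult abs_minus_commute)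
      also have "\<bar>(- d * \<epsilon>\<^sup>2) * p1\<bar> = d * (\<epsilon>\<^sup>2 * p1)" using p(2) d0 by (simp add: abs_mult)
      also have "\<bar>2 - \<kappa>\<bar> * p0 + d * (\<epsilon>\<^sup>2 * p1) \<le> \<bar>2 - \<kappa>\<bar> * p0 + d * p0"
        using ep1 d0 by (intro add_left_mono mult_left_mono) auto
      finally have a: "\<bar>- (2 - \<kappa>) * p0 + (- d * \<epsilon>\<^sup>2) * p1\<bar> \<le> (\<bar>2 - \<kappa>\<bar> + d) * p0" by (simp add: distrib_right)
      have "\<bar>kdelta i j * (x $ k * (- (2 - \<kappa>) * p0 + (- d * \<epsilon>\<^sup>2) * p1))\<bar> \<le> 1 * (norm x * ((\<bar>2 - \<kappa>\<bar> + d) * p0))"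
        unfolding abs_mult[of "kdelta i j"] abs_mult[of "x $ k"] by (intro mult_mono kd xc a) auto
      also have "\<dots> = (\<bar>2 - \<kappa>\<bar> + d) * (norm x * p0)" by simp
      also have "\<dots> \<le> (\<bar>2 - \<kappa>\<bar> + d) * N" using xp0 d0 by (intro mult_left_mono) auto
      finally show ?thesis .
    qed
    have t2: "\<bar>\<kappa> * ((kdelta k i * x $ j + kdelta k j * x $ i) * p0)\<bar> \<le> 2 * \<bar>\<kappa>\<bar> * N"
    proof -
      have "\<bar>kdelta k i * x $ j\<bar> \<le> 1 * norm x" "\<bar>kdelta k j * x $ i\<bar> \<le> 1 * norm x"
        unfolding abs_mult by (intro mult_mono kd xc; simp)+
      then have "\<bar>kdelta k i * x $ j + kdelta k j * x $ i\<bar> \<le> 2 * norm x" by linarith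
      then have "\<bar>(kdelta k i * x $ j + kdelta k j * x $ i) * p0\<bar> \<le> 2 * norm x * p0"
        unfolding abs_mult[of _ p0] using p(1) by (simp add: mult_right_mono)
      also have "\<dots> \<le> 2 * N" using xp0 by simp
      finally have "\<bar>\<kappa>\<bar> * \<bar>(kdelta k i * x $ j + kdelta k j * x $ i) * p0\<bar> \<le> \<bar>\<kappa>\<bar> * (2 * N)"
        by (rule mult_left_mono) simp
      then show ?thesis unfolding abs_mult[of \<kappa>] by simp
    qed
    have t3: "\<bar>(- \<kappa> * d) * (x $ i * (x $ j * (x $ k * p1)))\<bar> \<le> \<bar>\<kappa>\<bar> * d * N"
    proof -
      have "\<bar>x $ i * (x $ j * (x $ k * p1))\<bar> = \<bar>x $ i * x $ j\<bar> * (\<bar>x $ k\<bar> * p1)"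
        using p(2) by (simp add: abs_mult)
      also have "\<dots> \<le> s * (norm x * p1)"
        using xx[of i j] sx(1) xc p(2) s0 by (intro mult_mono) (auto intro: mult_right_mono)
      also have "\<dots> = norm x * p0" using p(3) by (simp add: mult_ac)
      also have "\<dots> \<le> N" by (rule xp0)
      finally have "\<bar>x $ i * (x $ j * (x $ k * p1))\<bar> \<le> N" .
      then have "\<bar>- \<kappa> * d\<bar> * \<bar>x $ i * (x $ j * (x $ k * p1))\<bar> \<le> \<bar>- \<kappa> * d\<bar> * N" by (intro mult_left_mono) auto
      moreover have "\<bar>- \<kappa> * d\<bar> = \<bar>\<kappa>\<bar> * d" using d0 by (simp add: abs_mult)
      ultimately show ?thesis unfolding abs_mult[of "- \<kappa> * d"] by simp
    qed
    have eq: "kelvin_deriv \<kappa> \<epsilon> k i j x = kdelta i j * (x $ k * (- (2 - \<kappa>) * p0 + (- d * \<epsilon>\<^sup>2) * p1)) +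
        \<kappa> * ((kdelta k i * x $ j + kdelta k j * x $ i) * p0) + (- \<kappa> * d) * (x $ i * (x $ j * (x $ k * p1)))"
      unfolding kelvin_deriv_def p0_def p1_def d_def ..
    have "\<bar>kelvin_deriv \<kappa> \<epsilon> k i j x\<bar> \<le> (\<bar>2 - \<kappa>\<bar> + d) * N + 2 * \<bar>\<kappa>\<bar> * N + \<bar>\<kappa>\<bar> * d * N"
      unfolding eq using t1 t2 t3 by linarith
    then have "\<bar>kelvin_deriv \<kappa> \<epsilon> k i j x\<bar> \<le> C2 * N" unfolding C2_def by (simp add: algebra_simps)
    with 1 show ?thesis unfolding N_def by simp
  qed
  show ?thesis
  proof (rule that[of "C1 + C2"])
    show "C1 + C2 \<ge> 0" using C12 by simp
    have le: "C1 * norm x powr (1 - d) \<le> (C1 + C2) * norm x powr (1 - d)" "C2 * norm x powr (1 - d) \<le> (C1 + C2) * norm x powr (1 - d)" for x :: "real^'n"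
      using C12 by (intro mult_right_mono; simp)+
    show "\<bar>kelvin \<kappa> \<epsilon> i j x\<bar> \<le> (C1 + C2) * norm x powr (1 - real CARD('n))"
      if "0 \<le> \<epsilon>" "\<epsilon> \<le> 1" "x \<noteq> 0" "norm x \<le> r" for \<epsilon> i j and x :: "real^'n"
      using order_trans[OF conjunct1[OF main[OF that]] le(1)] unfolding d_def .
    show "\<bar>kelvin_deriv \<kappa> \<epsilon> k i j x\<bar> \<le> (C1 + C2) * norm x powr (1 - real CARD('n))"
      if "0 \<le> \<epsilon>" "\<epsilon> \<le> 1" "x \<noteq> 0" "norm x \<le> r" for \<epsilon> k i j and x :: "real^'n"
      using order_trans[OF conjunct2[OF main[OF that]] le(2)] unfolding d_def .
  qed
qed

lemma tendsto_reg_sq: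
  "e \<longlonglongrightarrow> 0 \<Longrightarrow> (\<lambda>n. reg_sq (e n) x) \<longlonglongrightarrow> reg_sq 0 x"
  unfolding reg_sq_def by (intro tendsto_intros)

lemma tendsto_reg_pow:
  assumes "e \<longlonglongrightarrow> 0" "x \<noteq> 0"
  shows "(\<lambda>n. reg_pow m (e n) x) \<longlonglongrightarrow> reg_pow m 0 x"
  unfolding reg_pow_def
  using reg_sq_pos[of 0 x] assms(2) by (intro tendsto_powr tendsto_reg_sq[OF assms(1)] tendsto_const) auto

lemma tendsto_kelvin:
  assumes e: "e \<longlonglongrightarrow> 0" and x: "x \<noteq> 0"
  shows "(\<lambda>n. kelvin \<kappa> (e n) i j x) \<longlonglongrightarrow> kelvin \<kappa> 0 i j x"
proof -
  have "isCont (newton_profile CARD('a)) (reg_sq 0 x)"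
    using has_real_derivative_newton_profile[OF reg_sq_pos, of 0 x] x by (blast intro: DERIV_isCont)
  then have "(\<lambda>n. newton_profile CARD('a) (reg_sq (e n) x)) \<longlonglongrightarrow> newton_profile CARD('a) (reg_sq 0 x)"
    by (rule isCont_tendsto_compose[OF _ tendsto_reg_sq[OF e]])
  then show ?thesis
    unfolding kelvin_def by (intro tendsto_intros tendsto_reg_pow e x)
qed

lemma tendsto_kelvin_deriv:
  assumes e: "e \<longlonglongrightarrow> 0" and x: "x \<noteq> 0"
  shows "(\<lambda>n. kelvin_deriv \<kappa> (e n) k i j x) \<longlonglongrightarrow> kelvin_deriv \<kappa> 0 k i j x"
  unfolding kelvin_deriv_def by (intro tendsto_intros tendsto_reg_pow e x)

lemma cutoff_test_function:
  assumes "r > 0" "cball a r \<subseteq> \<Omega>"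
  shows "cutoff r a \<in> test_functions \<Omega>"
  by (rule test_functionsI[OF smooth_on_cutoff[OF open_UNIV] compact_cball assms(2)])
    (auto intro!: cutoff_eq_0 assms simp: dist_norm norm_minus_commute)

lemma partial_deriv_locally_const:
  assumes "open S" "x \<in> S" "\<And>y. y \<in> S \<Longrightarrow> f y = c"
  shows "partial_deriv i f x = 0"
proof -
  have "partial_deriv i (\<lambda>x. c) x = partial_deriv i f x"
    by (rule partial_deriv_cong_open[OF _ assms(1,2)]) (use assms(3) in auto)
  then show ?thesis by (simp add: partial_deriv_const)
qed

lemma cutoff_derivs_zero:
  assumes r: "r > 0" and x: "norm x < r / 2 \<or> norm x > r"
  shows "partial_deriv k (cutoff r 0) x = 0" "partial_deriv i (partial_deriv k (cutoff r 0)) x = 0"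
proof -
  obtain S c where S: "open S" "x \<in> S" "\<And>y. y \<in> S \<Longrightarrow> cutoff r 0 y = c"
  proof (cases "norm x < r / 2")
    case True
    show ?thesis
      by (rule that[of "ball 0 (r / 2)" 1]) (use True r in \<open>auto intro: cutoff_eq_1\<close>)
  next
    case False
    show ?thesis
      by (rule that[of "- cball 0 r" 0]) (use False x r in \<open>auto intro: cutoff_eq_0\<close>)
  qed
  have 1: "partial_deriv k (cutoff r 0) y = 0" if "y \<in> S" for y
    by (rule partial_deriv_locally_const[OF S(1) that S(3)])
  then show "partial_deriv k (cutoff r 0) x = 0" using S by blast
  show "partial_deriv i (partial_deriv k (cutoff r 0)) x = 0"
    by (rule partial_deriv_locally_const[OF S(1,2) 1])
qed

lemma parametrix_error_zero:
  "r > 0 \<Longrightarrow> norm x < r / 2 \<or> norm x > r \<Longrightarrow> parametrix_error \<mu> lam \<kappa> r \<epsilon> i j x = 0"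
  unfolding parametrix_error_def by (simp add: cutoff_derivs_zero)

lemma smooth_on_parametrix_error:
  assumes S: "open S" "\<And>x. x \<in> S \<Longrightarrow> reg_sq \<epsilon> x > 0"
  shows "smooth_on S (parametrix_error \<mu> lam \<kappa> r \<epsilon> i j)"
  unfolding parametrix_error_def[abs_def]
  by (intro smooth_on_add smooth_on_mult smooth_on_sum smooth_on_const smooth_on_kelvin smooth_on_kelvin_deriv
      smooth_on_partial_deriv smooth_on_cutoff S)

text \<open>Near the origin the error vanishes, elsewhere it is built from smooth functions; this holds for
  \<^term>\<open>\<epsilon> = (0::real)\<close> too.\<close>
lemma smooth_on_parametrix_error_UNIV:
  assumes r: "r > 0"
  shows "smooth_on UNIV (parametrix_error \<mu> lam \<kappa> r \<epsilon> i (j::'n::finite))"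
proof -
  have "smooth_on (ball 0 (r / 2) \<union> - {0}) (parametrix_error \<mu> lam \<kappa> r \<epsilon> i j)"
  proof (rule smooth_on_Un)
    show "smooth_on (ball 0 (r / 2)) (parametrix_error \<mu> lam \<kappa> r \<epsilon> i j)"
      by (rule smooth_on_cong[OF _ _ smooth_on_const[of _ 0]]) (use r in \<open>auto simp: parametrix_error_zero\<close>)
    show "smooth_on (- {0}) (parametrix_error \<mu> lam \<kappa> r \<epsilon> i j)"
      by (rule smooth_on_parametrix_error) (auto simp: reg_sq_pos)
  qed auto
  moreover have "ball 0 (r / 2) \<union> - {0} = (UNIV :: (real^'n) set)" using r by auto
  ultimately show ?thesis by simp
qed

lemma tendsto_parametrix_error:
  assumes r: "r > 0" and e: "e \<longlonglongrightarrow> 0"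
  shows "(\<lambda>n. parametrix_error \<mu> lam \<kappa> r (e n) i j x) \<longlonglongrightarrow> parametrix_error \<mu> lam \<kappa> r 0 i j x"
proof (cases "x = 0")
  case True
  then show ?thesis using r by (simp add: parametrix_error_zero)
next
  case False
  then show ?thesis unfolding parametrix_error_def
    by (intro tendsto_intros tendsto_kelvin tendsto_kelvin_deriv e)
qed

text \<open>The derivatives of the cutoff live on a shell, away from the singularity.\<close>
lemma parametrix_error_bound:
  assumes d: "CARD('n) \<ge> 2" and r: "r > 0"
  obtains B where "B \<ge> 0" "\<And>\<epsilon> i j (x::real^'n). 0 \<le> \<epsilon> \<Longrightarrow> \<epsilon> \<le> 1 \<Longrightarrow> \<bar>parametrix_error \<mu> lam \<kappa> r \<epsilon> i j x\<bar> \<le> B"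
proof -
  obtain C where C: "C \<ge> 0"
    "\<And>\<epsilon> i j (x::real^'n). 0 \<le> \<epsilon> \<Longrightarrow> \<epsilon> \<le> 1 \<Longrightarrow> x \<noteq> 0 \<Longrightarrow> norm x \<le> r \<Longrightarrow>
       \<bar>kelvin \<kappa> \<epsilon> i j x\<bar> \<le> C * norm x powr (1 - real CARD('n))"
    "\<And>\<epsilon> k i j (x::real^'n). 0 \<le> \<epsilon> \<Longrightarrow> \<epsilon> \<le> 1 \<Longrightarrow> x \<noteq> 0 \<Longrightarrow> norm x \<le> r \<Longrightarrow>
       \<bar>kelvin_deriv \<kappa> \<epsilon> k i j x\<bar> \<le> C * norm x powr (1 - real CARD('n))"
    using kelvin_bound[OF d r, of \<kappa>] by metis
  let ?z = "cutoff r (0::real^'n)"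
  have z: "?z \<in> test_functions UNIV" by (rule cutoff_test_function[OF r]) simp
  have "\<exists>B. \<forall>x. \<bar>partial_deriv k ?z x\<bar> \<le> B" for k
    using test_functions_bounded[OF test_functions_partial_deriv[OF z]] by metis
  then obtain b1 where b1: "\<And>k x. \<bar>partial_deriv k ?z x\<bar> \<le> b1 k" by metis
  have "\<exists>B. \<forall>x. \<bar>partial_deriv l (partial_deriv k ?z) x\<bar> \<le> B" for k l
    using test_functions_bounded[OF test_functions_partial_deriv[OF test_functions_partial_deriv[OF z]]] by metis
  then obtain b2 where b2: "\<And>l k x. \<bar>partial_deriv l (partial_deriv k ?z) x\<bar> \<le> b2 l k" by metis
  define M where "M = C * (r / 2) powr (1 - real CARD('n))"
  define b where "b i = \<bar>\<mu>\<bar> * (\<Sum>k\<in>UNIV. b2 k k * M + 2 * (b1 k * M)) + \<bar>\<mu> + lam\<bar> * (\<Sum>k\<in>UNIV. b2 i k * M + (b1 k * M + b1 i * M))" for i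
  have M0: "M \<ge> 0" using C(1) by (simp add: M_def)
  have b10: "0 \<le> b1 k" for k using order_trans[OF abs_ge_zero b1] .
  have b20: "0 \<le> b2 l k" for l k using order_trans[OF abs_ge_zero b2] .
  have b0: "0 \<le> b i" for i unfolding b_def using M0 b10 b20
    by (intro add_nonneg_nonneg mult_nonneg_nonneg sum_nonneg) auto
  have main: "\<bar>parametrix_error \<mu> lam \<kappa> r \<epsilon> i j x\<bar> \<le> b i" if \<epsilon>: "0 \<le> \<epsilon>" "\<epsilon> \<le> 1" for \<epsilon> i j and x :: "real^'n"
  proof (cases "norm x < r / 2 \<or> norm x > r")
    case True
    then show ?thesis using parametrix_error_zero[OF r True] b0 by simp
  next
    case False
    then have x: "x \<noteq> 0" "norm x \<le> r" "r / 2 \<le> norm x" using r by auto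
    have "norm x powr (1 - real CARD('n)) \<le> (r / 2) powr (1 - real CARD('n))"
      using x r d by (intro powr_mono2') auto
    then have le: "C * norm x powr (1 - real CARD('n)) \<le> M" unfolding M_def using C(1) by (rule mult_left_mono)
    have K: "\<bar>kelvin \<kappa> \<epsilon> i j x\<bar> \<le> M" for i j using order_trans[OF C(2)[OF \<epsilon> x(1,2)] le] .
    have K': "\<bar>kelvin_deriv \<kappa> \<epsilon> k i j x\<bar> \<le> M" for k i j using order_trans[OF C(3)[OF \<epsilon> x(1,2)] le] .
    note m = mult_mono[OF b1 K' b10 abs_ge_zero] mult_mono[OF b2 K b20 abs_ge_zero]
    have 1: "\<bar>\<Sum>k\<in>UNIV. partial_deriv k (partial_deriv k ?z) x * kelvin \<kappa> \<epsilon> i j x +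
        2 * (partial_deriv k ?z x * kelvin_deriv \<kappa> \<epsilon> k i j x)\<bar> \<le> (\<Sum>k\<in>UNIV. b2 k k * M + 2 * (b1 k * M))"
    proof (rule order_trans[OF sum_abs], rule sum_mono)
      fix k
      have "\<bar>partial_deriv k (partial_deriv k ?z) x * kelvin \<kappa> \<epsilon> i j x\<bar> \<le> b2 k k * M"
        "\<bar>partial_deriv k ?z x * kelvin_deriv \<kappa> \<epsilon> k i j x\<bar> \<le> b1 k * M"
        unfolding abs_mult by (rule m)+
      then show "\<bar>partial_deriv k (partial_deriv k ?z) x * kelvin \<kappa> \<epsilon> i j x +
        2 * (partial_deriv k ?z x * kelvin_deriv \<kappa> \<epsilon> k i j x)\<bar> \<le> b2 k k * M + 2 * (b1 k * M)" by linarith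
    qed
    have 2: "\<bar>\<Sum>k\<in>UNIV. partial_deriv i (partial_deriv k ?z) x * kelvin \<kappa> \<epsilon> k j x +
        (partial_deriv k ?z x * kelvin_deriv \<kappa> \<epsilon> i k j x + partial_deriv i ?z x * kelvin_deriv \<kappa> \<epsilon> k k j x)\<bar>
        \<le> (\<Sum>k\<in>UNIV. b2 i k * M + (b1 k * M + b1 i * M))"
    proof (rule order_trans[OF sum_abs], rule sum_mono)
      fix k
      have "\<bar>partial_deriv i (partial_deriv k ?z) x * kelvin \<kappa> \<epsilon> k j x\<bar> \<le> b2 i k * M"
        "\<bar>partial_deriv k ?z x * kelvin_deriv \<kappa> \<epsilon> i k j x\<bar> \<le> b1 k * M"
        "\<bar>partial_deriv i ?z x * kelvin_deriv \<kappa> \<epsilon> k k j x\<bar> \<le> b1 i * M"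
        unfolding abs_mult by (rule m)+
      then show "\<bar>partial_deriv i (partial_deriv k ?z) x * kelvin \<kappa> \<epsilon> k j x +
        (partial_deriv k ?z x * kelvin_deriv \<kappa> \<epsilon> i k j x + partial_deriv i ?z x * kelvin_deriv \<kappa> \<epsilon> k k j x)\<bar>
        \<le> b2 i k * M + (b1 k * M + b1 i * M)" by linarith
    qed
    show ?thesis unfolding parametrix_error_def b_def
      by (rule order_trans[OF abs_triangle_ineq]) (intro add_mono; simp only: abs_mult; intro mult_left_mono 1 2 abs_ge_zero)
  qed
  show ?thesis
  proof (rule that[of "\<Sum>i\<in>UNIV. b i"])
    show "0 \<le> (\<Sum>i\<in>UNIV. b i)" using b0 by (simp add: sum_nonneg)
    show "\<bar>parametrix_error \<mu> lam \<kappa> r \<epsilon> i j x\<bar> \<le> (\<Sum>i\<in>UNIV. b i)" if "0 \<le> \<epsilon>" "\<epsilon> \<le> 1" for \<epsilon> i j and x :: "real^'n"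
      using main[OF that, of i j x] member_le_sum[of i UNIV b] b0 by fastforce
  qed
qed

section \<open>Approximation of the Dirac mass\<close>

lemma reg_pow_measurable: "reg_pow m \<epsilon> \<in> borel_measurable borel"
  unfolding reg_pow_def[abs_def] reg_sq_def[abs_def]
  by (intro powr_real_measurable borel_measurable_add borel_measurable_power borel_measurable_norm) simp_all

text \<open>On the ball of radius $2^{n+1}$ minus that of radius $2^n$ the function decays like $2^{-n(d+4)}$.\<close>
lemma integrable_reg_pow_2: "integrable lborel (reg_pow 2 1 :: real^'n \<Rightarrow> real)"
proof (rule integrable_if_ball_cover[OF reg_pow_measurable reg_pow_nonneg])
  define d where "d = CARD('n)"
  let ?c = "\<lambda>n::nat. 2 powr (- (real n * (real d + 4)))" and ?r = "\<lambda>n. 2 ^ Suc n :: real"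
  show "0 \<le> ?c n" "0 \<le> ?r n" for n by auto
  have "?c n * ?r n ^ d = 2 ^ d * (1/16) ^ n" for n
  proof -
    have "(2::real) powr (real n * real d) = (2 ^ n) ^ d"
      using powr_realpow[of 2 "n * d"] by (simp add: power_mult)
    then have "?r n ^ d = 2 ^ d * 2 powr (real n * real d)" by (simp add: power_mult_distrib)
    moreover have "?c n = 2 powr (- (real n * real d)) * 2 powr (- (4 * real n))"
      unfolding powr_add[symmetric] by (simp add: algebra_simps)
    moreover have "2 powr (- (4 * real n)) = (1/16::real) ^ n"
    proof -
      have "(2::real) powr (4 * real n) = 16 ^ n"
        using powr_realpow[of 2 "4 * n"] by (simp add: power_mult)
      then show ?thesis by (simp only: powr_minus_divide power_one_over)
    qed
    ultimately show ?thesis by (simp add: powr_minus)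
  qed
  then have "(\<lambda>n. ?c n * ?r n ^ CARD('n)) = (\<lambda>n. 2 ^ d * (1/16) ^ n)" unfolding d_def by (intro ext)
  then show "summable (\<lambda>n. ?c n * ?r n ^ CARD('n))"
    by (simp only:) (intro summable_mult summable_geometric, simp)
  fix x :: "real^'n"
  have ex: "\<exists>n. norm x < ?r n"
  proof -
    obtain n where "norm x < 2 ^ n" using real_arch_pow[of 2 "norm x"] by auto
    then have "norm x < ?r n" using norm_ge_zero[of x] unfolding power_Suc by linarith
    then show ?thesis ..
  qed
  define n where "n = (LEAST n. norm x < ?r n)"
  have n1: "norm x < ?r n" unfolding n_def by (rule LeastI_ex[OF ex])
  have "reg_pow 2 1 x \<le> ?c n"
  proof -
    have "(2 ^ n)\<^sup>2 \<le> reg_sq 1 x"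
    proof (cases n)
      case 0
      then show ?thesis by (simp add: reg_sq_def)
    next
      case (Suc k)
      then have "2 ^ n \<le> norm x" using not_less_Least[of k "\<lambda>n. norm x < ?r n"] unfolding n_def by auto
      then have "(2 ^ n)\<^sup>2 \<le> (norm x)\<^sup>2" by (intro power_mono) auto
      then show ?thesis unfolding reg_sq_def one_power2 by linarith
    qed
    then have "reg_pow 2 1 x \<le> ((2 ^ n)\<^sup>2) powr (- (real d / 2) - real 2)"
      unfolding reg_pow_def d_def by (intro powr_mono2') auto
    also have "((2::real) ^ n)\<^sup>2 = 2 powr (2 * real n)"
      using powr_realpow[of 2 "n * 2"] unfolding power_mult by (simp add: mult.commute)
    also have "(2 powr (2 * real n)) powr (- (real d / 2) - real 2) = ?c n"
      unfolding powr_powr by (simp add: algebra_simps)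
    finally show ?thesis .
  qed
  then show "reg_pow 2 1 x = 0 \<or> (\<exists>n. norm x < ?r n \<and> reg_pow 2 1 x \<le> ?c n)" using n1 by blast
qed

text \<open>The common total mass of the approximate Dirac masses; being positive, it can be divided by.\<close>
definition dirac_mass :: "'n::finite itself \<Rightarrow> real" where
  "dirac_mass (T :: 'n itself) = integral\<^sup>L lborel (reg_pow 2 1 :: real^'n \<Rightarrow> real)"

lemma dirac_mass_pos: "dirac_mass TYPE('n::finite) > 0"
proof -
  have "dirac_mass TYPE('n) \<noteq> 0"
  proof
    assume "dirac_mass TYPE('n) = 0"
    then have "AE x in lborel :: (real^'n) measure. reg_pow 2 1 x = 0"
      unfolding dirac_mass_def using integral_nonneg_eq_0_iff_AE[OF integrable_reg_pow_2] reg_pow_nonneg by auto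
    moreover have "reg_pow 2 1 x \<noteq> 0" for x :: "real^'n"
      using reg_sq_pos[of 1 x] by (simp add: reg_pow_def)
    ultimately have "AE x in lborel :: (real^'n) measure. False" by simp
    then show False using AE_iff_measurable[of "UNIV :: (real^'n) set" lborel "\<lambda>_. False"] by simp
  qed
  moreover have "dirac_mass TYPE('n) \<ge> 0" unfolding dirac_mass_def by (simp add: reg_pow_nonneg)
  ultimately show ?thesis by simp
qed

lemma integral_lborel_scale:
  fixes f :: "real^'n \<Rightarrow> real"
  assumes c: "c > 0" and f: "f \<in> borel_measurable borel"
  shows "(\<integral>x. f x \<partial>lborel) = c ^ CARD('n) * (\<integral>x. f (c *\<^sub>R x) \<partial>lborel)"
proof -
  have "(\<integral>x. f x \<partial>lborel) = (\<integral>x. f x \<partial>density (distr lborel borel (\<lambda>x. 0 + c *\<^sub>R x)) (\<lambda>_. ennreal (\<bar>c\<bar> ^ CARD('n))))"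
    using lborel_affine[of c "0::real^'n"] c by simp
  also have "\<dots> = (\<integral>x. \<bar>c\<bar> ^ CARD('n) * f x \<partial>distr lborel borel (\<lambda>x. 0 + c *\<^sub>R x))"
    using f by (subst integral_density) auto
  also have "\<dots> = (\<integral>x. \<bar>c\<bar> ^ CARD('n) * f (0 + c *\<^sub>R x) \<partial>lborel)"
    by (rule integral_distr) (use f in auto)
  finally show ?thesis using c by simp
qed

lemma reg_pow_scale:
  fixes x :: "real^'n"
  assumes e: "e > 0"
  shows "e ^ CARD('n) * (e ^ 4 * reg_pow 2 e (e *\<^sub>R x)) = reg_pow 2 1 x"
proof -
  have "reg_sq e (e *\<^sub>R x) = e\<^sup>2 * reg_sq 1 x"
    by (simp add: reg_sq_def power_mult_distrib algebra_simps)
  then have "reg_pow 2 e (e *\<^sub>R x) = (e\<^sup>2) powr (- (real CARD('n) / 2) - 2) * reg_pow 2 1 x"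
    unfolding reg_pow_def using reg_sq_pos[of 1 x] by (simp add: powr_mult)
  also have "(e\<^sup>2) powr (- (real CARD('n) / 2) - 2) = e powr (- (real CARD('n) + 4))"
  proof -
    have "e\<^sup>2 = e powr 2" using e by (simp add: powr_numeral)
    then show ?thesis by (simp only: powr_powr) (simp add: algebra_simps)
  qed
  finally have "e ^ CARD('n) * (e ^ 4 * reg_pow 2 e (e *\<^sub>R x)) =
      (e powr real CARD('n) * (e powr 4 * e powr (- (real CARD('n) + 4)))) * reg_pow 2 1 x"
    using e by (simp add: powr_realpow powr_numeral)
  also have "e powr real CARD('n) * (e powr 4 * e powr (- (real CARD('n) + 4))) = 1"
    unfolding powr_add[symmetric] using e by simp
  finally show ?thesis by simp
qed

lemma integral_dirac_sequence_eq:
  fixes h :: "real^'n \<Rightarrow> real"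
  assumes h: "continuous_on UNIV h" and e: "e > 0"
  shows "(\<integral>x. h x * (e ^ 4 * reg_pow 2 e x) \<partial>lborel) = (\<integral>x. h (e *\<^sub>R x) * reg_pow 2 1 x \<partial>lborel)"
proof -
  have hb: "h \<in> borel_measurable borel" by (rule borel_measurable_continuous_onI[OF h])
  have m: "(\<lambda>x. h x * (e ^ 4 * reg_pow 2 e x)) \<in> borel_measurable borel"
    by (intro borel_measurable_times hb borel_measurable_const reg_pow_measurable)
  have "(\<integral>x. h x * (e ^ 4 * reg_pow 2 e x) \<partial>lborel) =
      (\<integral>x. e ^ CARD('n) * (h (e *\<^sub>R x) * (e ^ 4 * reg_pow 2 e (e *\<^sub>R x))) \<partial>lborel)"
    using integral_lborel_scale[OF e m] by simp
  also have "\<dots> = (\<integral>x. h (e *\<^sub>R x) * reg_pow 2 1 x \<partial>lborel)"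
    unfolding reg_pow_scale[OF e, symmetric] by (simp add: mult_ac)
  finally show ?thesis .
qed

text \<open>Rescaling by \<^term>\<open>e n\<close> turns the kernel into a fixed integrable function.\<close>
lemma dirac_sequence_tendsto:
  fixes h :: "real^'n \<Rightarrow> real"
  assumes h: "continuous_on UNIV h" and B: "\<And>x. \<bar>h x\<bar> \<le> B" and e: "\<And>n. e n > 0" "e \<longlonglongrightarrow> 0"
  shows "(\<lambda>n. \<integral>x. h x * (e n ^ 4 * reg_pow 2 (e n) x) \<partial>lborel) \<longlonglongrightarrow> h 0 * dirac_mass TYPE('n)"
    "\<bar>\<integral>x. h x * (e n ^ 4 * reg_pow 2 (e n) x) \<partial>lborel\<bar> \<le> B * dirac_mass TYPE('n)"
proof -
  have hb: "h \<in> borel_measurable borel" by (rule borel_measurable_continuous_onI[OF h])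
  have m: "(\<lambda>x. h (c *\<^sub>R x) * reg_pow 2 1 x) \<in> borel_measurable borel" for c
    using hb by (intro borel_measurable_times reg_pow_measurable measurable_compose[OF _ hb]) simp
  have rp: "integrable lborel (reg_pow 2 1 :: real^'n \<Rightarrow> real)" "\<And>x::real^'n. 0 \<le> reg_pow 2 1 x"
    by (rule integrable_reg_pow_2, rule reg_pow_nonneg)
  have bd: "norm (h y * reg_pow 2 1 x) \<le> B * reg_pow 2 1 x" for y and x :: "real^'n"
    unfolding norm_mult using B[of y] reg_pow_nonneg[of 2 1 x] by (simp add: mult_right_mono)
  have "(\<lambda>n. \<integral>x. h (e n *\<^sub>R x) * reg_pow 2 1 x \<partial>lborel) \<longlonglongrightarrow> (\<integral>x. h 0 * (reg_pow 2 1 :: real^'n \<Rightarrow> real) x \<partial>lborel)"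
  proof (rule integral_dominated_convergence[where w = "\<lambda>x::real^'n. B * reg_pow 2 1 x"])
    show "(\<lambda>x. h 0 * (reg_pow 2 1 :: real^'n \<Rightarrow> real) x) \<in> borel_measurable lborel" using m[of 0] by simp
    show "(\<lambda>x. h (e n *\<^sub>R x) * reg_pow 2 1 x) \<in> borel_measurable lborel" for n using m by simp
    show "integrable lborel (\<lambda>x::real^'n. B * reg_pow 2 1 x)" using rp by simp
    show "AE x in lborel. (\<lambda>n. h (e n *\<^sub>R x) * reg_pow 2 1 x) \<longlonglongrightarrow> h 0 * reg_pow 2 1 x"
    proof (rule AE_I2)
      fix x :: "real^'n"
      have "(\<lambda>n. e n *\<^sub>R x) \<longlonglongrightarrow> 0 *\<^sub>R x" by (intro tendsto_intros e)
      then have "(\<lambda>n. h (e n *\<^sub>R x)) \<longlonglongrightarrow> h (0 *\<^sub>R x)"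
        using h by (intro continuous_on_tendsto_compose[OF h]) auto
      then show "(\<lambda>n. h (e n *\<^sub>R x) * reg_pow 2 1 x) \<longlonglongrightarrow> h 0 * reg_pow 2 1 x"
        by (intro tendsto_intros) simp
    qed
    show "AE x in lborel. norm (h (e n *\<^sub>R x) * reg_pow 2 1 x) \<le> B * reg_pow 2 1 x" for n
      by (intro AE_I2 bd)
  qed
  then show "(\<lambda>n. \<integral>x. h x * (e n ^ 4 * reg_pow 2 (e n) x) \<partial>lborel) \<longlonglongrightarrow> h 0 * dirac_mass TYPE('n)"
    unfolding integral_dirac_sequence_eq[OF h e(1)] dirac_mass_def using rp by simp
  have "\<bar>\<integral>x. h (e n *\<^sub>R x) * reg_pow 2 1 x \<partial>lborel\<bar> \<le> (\<integral>x. B * (reg_pow 2 1 :: real^'n \<Rightarrow> real) x \<partial>lborel)"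
  proof -
    have w: "integrable lborel (\<lambda>x::real^'n. B * reg_pow 2 1 x)" using rp by simp
    have i: "integrable lborel (\<lambda>x. h (e n *\<^sub>R x) * reg_pow 2 1 x)"
      by (rule Bochner_Integration.integrable_bound[OF w])
        (use m order_trans[OF bd abs_ge_self] in auto)
    show ?thesis
      using Bochner_Integration.integral_norm_bound_integral[OF i w bd] by simp
  qed
  then show "\<bar>\<integral>x. h x * (e n ^ 4 * reg_pow 2 (e n) x) \<partial>lborel\<bar> \<le> B * dirac_mass TYPE('n)"
    unfolding integral_dirac_sequence_eq[OF h e(1)] dirac_mass_def using rp by simp
qed

section \<open>The point load of the cut off Kelvin matrix\<close>

lemma component_measurable: "(\<lambda>x::real^'n. x $ i) \<in> borel_measurable borel"
  by (intro borel_measurable_continuous_onI smooth_on_imp_continuous_on smooth_on_component)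

lemma kelvin_measurable: "kelvin \<kappa> \<epsilon> i j \<in> borel_measurable borel"
proof -
  have "(\<lambda>x::real^'a. newton_profile CARD('a) (reg_sq \<epsilon> x)) \<in> borel_measurable borel"
    unfolding newton_profile_def reg_sq_def
    by (cases "CARD('a) = 2") (simp_all, measurable)
  then show ?thesis
    unfolding kelvin_def[abs_def]
    by (intro borel_measurable_add borel_measurable_times borel_measurable_const reg_pow_measurable component_measurable)
qed

lemma kelvin_deriv_measurable: "kelvin_deriv \<kappa> \<epsilon> k i j \<in> borel_measurable borel"
  unfolding kelvin_deriv_def[abs_def]
  by (intro borel_measurable_add borel_measurable_times borel_measurable_const reg_pow_measurable component_measurable)

lemma smooth_on_measurable: "smooth_on UNIV f \<Longrightarrow> f \<in> borel_measurable borel"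
  by (intro borel_measurable_continuous_onI smooth_on_imp_continuous_on)

lemma borel_measurable_shift_lebesgue_on:
  fixes f :: "real^'n \<Rightarrow> real"
  assumes "f \<in> borel_measurable borel"
  shows "(\<lambda>x. f (x - y)) \<in> borel_measurable (lebesgue_on \<Omega>)"
proof -
  have "(\<lambda>x. f (x - y)) \<in> borel_measurable borel"
    by (rule measurable_compose[OF _ assms]) simp
  then show ?thesis by (intro measurable_restrict_space1 measurable_completion) simp
qed

lemma parametrix_component_smooth:
  assumes "\<epsilon> \<noteq> 0"
  shows "smooth_on UNIV (\<lambda>x. parametrix \<kappa> r \<epsilon> j x $ i)"
  unfolding parametrix_def vec_lambda_beta
  by (intro smooth_on_mult smooth_on_cutoff smooth_on_kelvin) (use assms in \<open>auto simp: reg_sq_pos\<close>)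

lemma parametrix_test_function:
  assumes \<epsilon>: "\<epsilon> \<noteq> 0" and r: "r > 0" "cball y r \<subseteq> \<Omega>"
  shows "(\<lambda>x. parametrix \<kappa> r \<epsilon> j (x - y)) \<in> vec_test_functions \<Omega>"
  unfolding vec_test_functions_def mem_Collect_eq
proof
  fix i
  show "(\<lambda>x. parametrix \<kappa> r \<epsilon> j (x - y) $ i) \<in> test_functions \<Omega>"
  proof (rule test_functionsI[OF smooth_on_shift[OF parametrix_component_smooth[OF \<epsilon>]] compact_cball r(2)])
    fix x assume "x \<notin> cball y r"
    then have "cutoff r 0 (x - y) = 0" using r by (intro cutoff_eq_0) (auto simp: dist_norm norm_minus_commute)
    then show "parametrix \<kappa> r \<epsilon> j (x - y) $ i = 0" by (simp add: parametrix_def)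
  qed
qed

lemma L2_dominated_tendsto:
  assumes W: "integrable_weight \<Omega> \<omega>" and f: "f \<in> borel_measurable (lebesgue_on \<Omega>)"
    and F: "\<And>n. F n \<in> borel_measurable (lebesgue_on \<Omega>)"
    and h: "integrable (lebesgue_on \<Omega>) (\<lambda>x. \<omega> x * (h x)\<^sup>2)"
    and bd: "\<And>n. AE x in lebesgue_on \<Omega>. \<bar>F n x\<bar> \<le> h x" and bdf: "AE x in lebesgue_on \<Omega>. \<bar>f x\<bar> \<le> h x"
    and lim: "AE x in lebesgue_on \<Omega>. (\<lambda>n. F n x) \<longlonglongrightarrow> f x"
  shows "f \<in> L2 \<omega> \<Omega>" "(\<lambda>n. L2_sqnorm \<omega> \<Omega> (\<lambda>x. f x - F n x)) \<longlonglongrightarrow> 0"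
proof -
  note \<omega> = integrable_weight_nonneg[OF W] integrable_weight_measurable[OF W]
  show "f \<in> L2 \<omega> \<Omega>"
  proof (rule L2_dominated(1)[OF W f h])
    show "AE x in lebesgue_on \<Omega>. \<omega> x * (f x)\<^sup>2 \<le> \<omega> x * (h x)\<^sup>2"
      using bdf by eventually_elim (intro mult_left_mono \<omega>, simp add: abs_le_square_iff[symmetric])
  qed
  have m: "(\<lambda>x. f x - F n x) \<in> borel_measurable (lebesgue_on \<Omega>)" for n
    using f F by (intro borel_measurable_diff)
  have "(\<lambda>n. \<integral>x. \<omega> x * (f x - F n x)\<^sup>2 \<partial>lebesgue_on \<Omega>) \<longlonglongrightarrow> (\<integral>x. 0 \<partial>lebesgue_on \<Omega>)"
  proof (rule integral_dominated_convergence[where w = "\<lambda>x. 4 * (\<omega> x * (h x)\<^sup>2)"])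
    show "(\<lambda>x. \<omega> x * (f x - F n x)\<^sup>2) \<in> borel_measurable (lebesgue_on \<Omega>)" for n
      by (intro borel_measurable_times borel_measurable_power m \<omega>)
    show "integrable (lebesgue_on \<Omega>) (\<lambda>x. 4 * (\<omega> x * (h x)\<^sup>2))" using h by simp
    show "AE x in lebesgue_on \<Omega>. (\<lambda>n. \<omega> x * (f x - F n x)\<^sup>2) \<longlonglongrightarrow> 0"
      using lim
    proof eventually_elim
      case (elim x)
      have "(\<lambda>n. \<omega> x * (f x - F n x)\<^sup>2) \<longlonglongrightarrow> \<omega> x * (f x - f x)\<^sup>2" by (intro tendsto_intros elim)
      then show ?case by simp
    qed
    show "AE x in lebesgue_on \<Omega>. norm (\<omega> x * (f x - F n x)\<^sup>2) \<le> 4 * (\<omega> x * (h x)\<^sup>2)" for n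
      using bd[of n] bdf
    proof eventually_elim
      case (elim x)
      then have "\<bar>f x - F n x\<bar> \<le> \<bar>2 * h x\<bar>" by linarith
      then have "(f x - F n x)\<^sup>2 \<le> (2 * h x)\<^sup>2" by (simp only: abs_le_square_iff)
      then have "\<omega> x * (f x - F n x)\<^sup>2 \<le> \<omega> x * (2 * h x)\<^sup>2" by (rule mult_left_mono[OF _ \<omega>(1)])
      then show ?case using \<omega>(1)[of x] by (simp add: abs_mult power_mult_distrib)
    qed
  qed simp
  then show "(\<lambda>n. L2_sqnorm \<omega> \<Omega> (\<lambda>x. f x - F n x)) \<longlonglongrightarrow> 0"
    unfolding L2_sqnorm_eq[OF W m] by simp
qed

text \<open>For \<^term>\<open>\<epsilon> = (0::real)\<close> the matrix is not differentiable at the origin, hence an explicit formula.\<close>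
definition parametrix_deriv :: "real \<Rightarrow> real \<Rightarrow> real \<Rightarrow> 'n \<Rightarrow> 'n \<Rightarrow> 'n \<Rightarrow> real^'n \<Rightarrow> real" where
  "parametrix_deriv \<kappa> r \<epsilon> j i k x =
     cutoff r 0 x * kelvin_deriv \<kappa> \<epsilon> k i j x + partial_deriv k (cutoff r 0) x * kelvin \<kappa> \<epsilon> i j x"

lemma partial_deriv_parametrix:
  assumes "\<epsilon> \<noteq> 0"
  shows "partial_deriv k (\<lambda>x. parametrix \<kappa> r \<epsilon> j (x - y) $ i) x = parametrix_deriv \<kappa> r \<epsilon> j i k (x - y)"
proof -
  have "partial_deriv k (\<lambda>x. parametrix \<kappa> r \<epsilon> j (x - y) $ i) x = partial_deriv k (\<lambda>x. parametrix \<kappa> r \<epsilon> j x $ i) (x - y)"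
    by (rule partial_deriv_shift) (rule smooth_on_imp_differentiable[OF parametrix_component_smooth[OF assms]], auto)
  then show ?thesis unfolding parametrix_def vec_lambda_beta has_partial2_cutoff_kelvin(1)[OF assms] parametrix_deriv_def .
qed

text \<open>The gradient of the Kelvin matrix is of order $|x|^{1-d}$; its square is integrable against $|x|^\<alpha>$
  near the origin because $\<alpha> > d - 2$.\<close>
lemma parametrix_H10_approximation:
  fixes y :: "real^'n"
  assumes d: "CARD('n) \<ge> 2" and \<Omega>: "open \<Omega>" "bounded \<Omega>" and W: "integrable_weight \<Omega> \<omega>"
    and \<alpha>: "real CARD('n) - 2 < \<alpha>" "\<alpha> < real CARD('n)"
    and le: "\<And>x. \<omega> x \<le> norm (x - y) powr \<alpha>" and r: "r > 0" "cball y r \<subseteq> \<Omega>"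
    and e: "\<And>n. 0 < e n" "\<And>n. e n \<le> 1" "e \<longlonglongrightarrow> 0"
  shows "vec_H10_approximation \<omega> \<Omega> (\<lambda>x. parametrix \<kappa> r 0 j (x - y))
     (\<lambda>i k x. parametrix_deriv \<kappa> r 0 j i k (x - y)) (\<lambda>n x. parametrix \<kappa> r (e n) j (x - y))"
proof -
  define p where "p = 1 - real CARD('n)"
  obtain C where C: "C \<ge> 0"
    "\<And>\<epsilon> i j (x::real^'n). 0 \<le> \<epsilon> \<Longrightarrow> \<epsilon> \<le> 1 \<Longrightarrow> x \<noteq> 0 \<Longrightarrow> norm x \<le> r \<Longrightarrow> \<bar>kelvin \<kappa> \<epsilon> i j x\<bar> \<le> C * norm x powr p"
    "\<And>\<epsilon> k i j (x::real^'n). 0 \<le> \<epsilon> \<Longrightarrow> \<epsilon> \<le> 1 \<Longrightarrow> x \<noteq> 0 \<Longrightarrow> norm x \<le> r \<Longrightarrow> \<bar>kelvin_deriv \<kappa> \<epsilon> k i j x\<bar> \<le> C * norm x powr p"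
    unfolding p_def using kelvin_bound[OF d r(1), of \<kappa>] by metis
  let ?z = "cutoff r (0::real^'n)"
  have z: "?z \<in> test_functions UNIV" by (rule cutoff_test_function[OF r(1)]) simp
  have "\<exists>B. \<forall>x. \<bar>partial_deriv k ?z x\<bar> \<le> B" for k
    using test_functions_bounded[OF test_functions_partial_deriv[OF z]] by metis
  then obtain b where b: "\<And>k x. \<bar>partial_deriv k ?z x\<bar> \<le> b k" by metis
  have b0: "0 \<le> b k" for k using order_trans[OF abs_ge_zero b] .
  have z1: "\<bar>?z x\<bar> \<le> 1" for x using cutoff_bounds[of r 0 x] by simp
  have zero: "?z x = 0" "partial_deriv k ?z x = 0" if "norm x > r" for x k
    using that r(1) cutoff_eq_0[of r x 0] cutoff_derivs_zero(1)[of r x k] by auto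
  have bd0: "\<bar>parametrix \<kappa> r \<epsilon> j x $ i\<bar> \<le> C * norm x powr p" if "0 \<le> \<epsilon>" "\<epsilon> \<le> 1" "x \<noteq> 0" for \<epsilon> i and x :: "real^'n"
  proof (cases "norm x \<le> r")
    case True
    have "\<bar>?z x\<bar> * \<bar>kelvin \<kappa> \<epsilon> i j x\<bar> \<le> 1 * (C * norm x powr p)"
      by (intro mult_mono z1 C(2) that True) auto
    then show ?thesis by (simp add: parametrix_def abs_mult)
  next
    case False
    then show ?thesis using zero C(1) by (simp add: parametrix_def)
  qed
  have bd1: "\<bar>parametrix_deriv \<kappa> r \<epsilon> j i k x\<bar> \<le> (C + b k * C) * norm x powr p" if "0 \<le> \<epsilon>" "\<epsilon> \<le> 1" "x \<noteq> 0" for \<epsilon> i k and x :: "real^'n"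
  proof (cases "norm x \<le> r")
    case True
    have "\<bar>?z x\<bar> * \<bar>kelvin_deriv \<kappa> \<epsilon> k i j x\<bar> \<le> 1 * (C * norm x powr p)"
      by (intro mult_mono z1 C(3) that True) auto
    moreover have "\<bar>partial_deriv k ?z x\<bar> * \<bar>kelvin \<kappa> \<epsilon> i j x\<bar> \<le> b k * (C * norm x powr p)"
      by (intro mult_mono b b0 C(2) that True) auto
    ultimately show ?thesis unfolding parametrix_deriv_def
      using abs_triangle_ineq[of "?z x * kelvin_deriv \<kappa> \<epsilon> k i j x" "partial_deriv k ?z x * kelvin \<kappa> \<epsilon> i j x"]
      unfolding abs_mult by (simp add: distrib_right mult.assoc)
  next
    case False
    then have "parametrix_deriv \<kappa> r \<epsilon> j i k x = 0" using zero by (simp add: parametrix_deriv_def)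
    then show ?thesis using C(1) b0[of k] by simp
  qed
  have hint: "integrable (lebesgue_on \<Omega>) (\<lambda>x. \<omega> x * (A * norm (x - y) powr p)\<^sup>2)" for A
  proof (rule Bochner_Integration.integrable_bound)
    let ?b = "2 * real CARD('n) - 2 - \<alpha>"
    show "integrable (lebesgue_on \<Omega>) (\<lambda>x. A\<^sup>2 * norm (x - y) powr (- ?b))"
      using \<alpha> d by (intro integrable_mult_right integrable_norm_powr \<Omega>) auto
    show "AE x in lebesgue_on \<Omega>. norm (\<omega> x * (A * norm (x - y) powr p)\<^sup>2) \<le> norm (A\<^sup>2 * norm (x - y) powr (- ?b))"
    proof (rule AE_I2)
      fix x
      have "\<omega> x * (A * norm (x - y) powr p)\<^sup>2 \<le> norm (x - y) powr \<alpha> * (A * norm (x - y) powr p)\<^sup>2"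
        by (rule mult_right_mono[OF le]) simp
      also have "\<dots> = A\<^sup>2 * norm (x - y) powr (\<alpha> + (p + p))"
        unfolding powr_add power_mult_distrib power2_eq_square by (simp only: mult_ac)
      also have "\<alpha> + (p + p) = - ?b" unfolding p_def by simp
      finally show "norm (\<omega> x * (A * norm (x - y) powr p)\<^sup>2) \<le> norm (A\<^sup>2 * norm (x - y) powr (- ?b))"
        using mult_nonneg_nonneg[OF integrable_weight_nonneg[OF W, of x] zero_le_power2[of "A * norm (x - y) powr p"]]
        unfolding real_norm_def by linarith
    qed
    have "(\<lambda>x::real^'n. norm x powr p) \<in> borel_measurable borel"
      by (intro powr_real_measurable borel_measurable_norm) simp_all
    from borel_measurable_shift_lebesgue_on[OF this]
    show "(\<lambda>x. \<omega> x * (A * norm (x - y) powr p)\<^sup>2) \<in> borel_measurable (lebesgue_on \<Omega>)"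
      by (intro borel_measurable_times borel_measurable_power borel_measurable_const integrable_weight_measurable[OF W])
  qed
  have ne: "AE x in lebesgue_on \<Omega>. x - y \<noteq> 0"
    using AE_lebesgue_on_finite_complement[OF \<Omega>(1), of "{y}"] by simp
  have zm: "?z \<in> borel_measurable borel" "partial_deriv k ?z \<in> borel_measurable borel" for k
    by (intro smooth_on_measurable smooth_on_partial_deriv smooth_on_cutoff open_UNIV)+
  have m0: "(\<lambda>x. parametrix \<kappa> r \<epsilon> j (x - y) $ i) \<in> borel_measurable (lebesgue_on \<Omega>)" for \<epsilon> i
    unfolding parametrix_def vec_lambda_beta
    by (intro borel_measurable_shift_lebesgue_on[of "\<lambda>x. ?z x * kelvin \<kappa> \<epsilon> i j x"] borel_measurable_times zm kelvin_measurable)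
  have m1: "(\<lambda>x. parametrix_deriv \<kappa> r \<epsilon> j i k (x - y)) \<in> borel_measurable (lebesgue_on \<Omega>)" for \<epsilon> i k
    unfolding parametrix_deriv_def
    by (intro borel_measurable_shift_lebesgue_on[of "\<lambda>x. ?z x * kelvin_deriv \<kappa> \<epsilon> k i j x + partial_deriv k ?z x * kelvin \<kappa> \<epsilon> i j x"]
        borel_measurable_add borel_measurable_times zm kelvin_measurable kelvin_deriv_measurable)
  have en: "e n \<noteq> 0" "0 \<le> e n" "e n \<le> 1" for n using e(1)[of n] e(2)[of n] by auto
  have D0: "(\<lambda>x. parametrix \<kappa> r 0 j (x - y) $ i) \<in> L2 \<omega> \<Omega>"
    "(\<lambda>n. L2_sqnorm \<omega> \<Omega> (\<lambda>x. parametrix \<kappa> r 0 j (x - y) $ i - parametrix \<kappa> r (e n) j (x - y) $ i)) \<longlonglongrightarrow> 0" for i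
  proof -
    have 1: "AE x in lebesgue_on \<Omega>. \<bar>parametrix \<kappa> r (e n) j (x - y) $ i\<bar> \<le> C * norm (x - y) powr p" for n
      using ne by eventually_elim (rule bd0[OF en(2,3)])
    have 2: "AE x in lebesgue_on \<Omega>. \<bar>parametrix \<kappa> r 0 j (x - y) $ i\<bar> \<le> C * norm (x - y) powr p"
      using ne by eventually_elim (rule bd0, auto)
    have 3: "AE x in lebesgue_on \<Omega>. (\<lambda>n. parametrix \<kappa> r (e n) j (x - y) $ i) \<longlonglongrightarrow> parametrix \<kappa> r 0 j (x - y) $ i"
      using ne by eventually_elim (simp only: parametrix_def vec_lambda_beta, intro tendsto_intros tendsto_kelvin e(3))
    note * = L2_dominated_tendsto[OF W m0 m0 hint 1 2 3]
    show "(\<lambda>x. parametrix \<kappa> r 0 j (x - y) $ i) \<in> L2 \<omega> \<Omega>" by (rule *(1))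
    show "(\<lambda>n. L2_sqnorm \<omega> \<Omega> (\<lambda>x. parametrix \<kappa> r 0 j (x - y) $ i - parametrix \<kappa> r (e n) j (x - y) $ i)) \<longlonglongrightarrow> 0" by (rule *(2))
  qed
  have D1: "(\<lambda>x. parametrix_deriv \<kappa> r 0 j i k (x - y)) \<in> L2 \<omega> \<Omega>"
    "(\<lambda>n. L2_sqnorm \<omega> \<Omega> (\<lambda>x. parametrix_deriv \<kappa> r 0 j i k (x - y) - parametrix_deriv \<kappa> r (e n) j i k (x - y))) \<longlonglongrightarrow> 0" for i k
  proof -
    have 1: "AE x in lebesgue_on \<Omega>. \<bar>parametrix_deriv \<kappa> r (e n) j i k (x - y)\<bar> \<le> (C + b k * C) * norm (x - y) powr p" for n
      using ne by eventually_elim (rule bd1[OF en(2,3)])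
    have 2: "AE x in lebesgue_on \<Omega>. \<bar>parametrix_deriv \<kappa> r 0 j i k (x - y)\<bar> \<le> (C + b k * C) * norm (x - y) powr p"
      using ne by eventually_elim (rule bd1, auto)
    have 3: "AE x in lebesgue_on \<Omega>. (\<lambda>n. parametrix_deriv \<kappa> r (e n) j i k (x - y)) \<longlonglongrightarrow> parametrix_deriv \<kappa> r 0 j i k (x - y)"
      using ne by eventually_elim (simp only: parametrix_deriv_def, intro tendsto_intros tendsto_kelvin tendsto_kelvin_deriv e(3))
    note * = L2_dominated_tendsto[OF W m1 m1 hint 1 2 3]
    show "(\<lambda>x. parametrix_deriv \<kappa> r 0 j i k (x - y)) \<in> L2 \<omega> \<Omega>" by (rule *(1))
    show "(\<lambda>n. L2_sqnorm \<omega> \<Omega> (\<lambda>x. parametrix_deriv \<kappa> r 0 j i k (x - y) - parametrix_deriv \<kappa> r (e n) j i k (x - y))) \<longlonglongrightarrow> 0" by (rule *(2))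
  qed
  have T: "(\<lambda>x. parametrix \<kappa> r (e n) j (x - y) $ i) \<in> test_functions \<Omega>" for n i
  proof -
    have "(\<lambda>x. parametrix \<kappa> r (e n) j (x - y)) \<in> vec_test_functions \<Omega>"
      by (rule parametrix_test_function[OF en(1) r])
    then show ?thesis unfolding vec_test_functions_def by simp
  qed
  show ?thesis
    unfolding vec_H10_approximation_def H10_approximation_def partial_deriv_parametrix[OF en(1)]
    using D0 D1 T by simp
qed

lemma lame_operator_shift:
  assumes P: "\<And>i. smooth_on UNIV (\<lambda>x. P x $ i)"
  shows "lame_operator \<mu> lam (\<lambda>x. P (x - y)) i x = lame_operator \<mu> lam P i (x - y)"
proof -
  have 1: "partial_deriv k (\<lambda>x. P (x - y) $ i) = (\<lambda>x. partial_deriv k (\<lambda>x. P x $ i) (x - y))" for k i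
    by (rule ext, rule partial_deriv_shift) (rule smooth_on_imp_differentiable[OF P], auto)
  have 2: "partial_deriv l (\<lambda>x. partial_deriv k (\<lambda>x. P x $ i) (x - y)) x = partial_deriv l (partial_deriv k (\<lambda>x. P x $ i)) (x - y)" for l k i
    by (rule partial_deriv_shift) (rule smooth_on_imp_differentiable[OF smooth_on_partial_deriv[OF P]], auto)
  show ?thesis unfolding lame_operator_def 1 2 ..
qed

text \<open>The approximation of the Dirac mass in \<open>lame_operator_parametrix\<close>.\<close>
definition dirac_kernel :: "real \<Rightarrow> real \<Rightarrow> real^'n \<Rightarrow> real" where
  "dirac_kernel r \<epsilon> x = cutoff r 0 x * (\<epsilon> ^ 4 * reg_pow 2 \<epsilon> x)"

lemma dirac_kernel_test_function:
  assumes "\<epsilon> \<noteq> 0" "r > 0"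
  shows "dirac_kernel r \<epsilon> \<in> test_functions UNIV"
proof -
  have "smooth_on UNIV (\<lambda>x::real^'n. \<epsilon> ^ 4 * reg_pow 2 \<epsilon> x)"
    by (intro smooth_on_cmult smooth_on_reg_pow) (use assms in \<open>auto simp: reg_sq_pos\<close>)
  from test_functions_mult[OF this cutoff_test_function[OF assms(2), of 0 UNIV]]
  show ?thesis unfolding dirac_kernel_def[abs_def] by (simp add: mult.commute)
qed

lemma dirac_kernel_tendsto:
  fixes \<theta> :: "real^'n \<Rightarrow> real"
  assumes \<theta>: "\<theta> \<in> test_functions \<Omega>" and B: "\<And>x. \<bar>\<theta> x\<bar> \<le> B" and e: "\<And>n. e n > 0" "e \<longlonglongrightarrow> 0" and r: "r > 0"
  shows "(\<lambda>n. \<integral>x. \<theta> x * dirac_kernel r (e n) (x - y) \<partial>lborel) \<longlonglongrightarrow> \<theta> y * dirac_mass TYPE('n)"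
    "\<bar>\<integral>x. \<theta> x * dirac_kernel r (e n) (x - y) \<partial>lborel\<bar> \<le> B * dirac_mass TYPE('n)"
proof -
  let ?h = "\<lambda>x. \<theta> (x + y) * cutoff r 0 x"
  have ct: "continuous_on UNIV (\<lambda>x. \<theta> (x + y))"
    by (rule continuous_on_compose2[OF test_functions_continuous_on[OF \<theta>, of UNIV]]) (auto intro!: continuous_intros)
  have ch: "continuous_on UNIV ?h"
    by (intro continuous_on_mult ct smooth_on_imp_continuous_on smooth_on_cutoff open_UNIV)
  have bh: "\<bar>?h x\<bar> \<le> B" for x
  proof -
    have "\<bar>\<theta> (x + y)\<bar> * \<bar>cutoff r 0 x\<bar> \<le> B * 1"
      using order_trans[OF abs_ge_zero B] cutoff_bounds[of r 0 x] by (intro mult_mono B) auto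
    then show ?thesis by (simp add: abs_mult)
  qed
  have eq: "(\<integral>x. \<theta> x * dirac_kernel r (e n) (x - y) \<partial>lborel) = (\<integral>x. ?h x * (e n ^ 4 * reg_pow 2 (e n) x) \<partial>lborel)" for n
  proof -
    have k: "dirac_kernel r (e n) \<in> test_functions UNIV"
      by (rule dirac_kernel_test_function[OF _ r]) (use e(1)[of n] in simp)
    have "(\<lambda>x. \<theta> x * dirac_kernel r (e n) (x - y)) \<in> borel_measurable borel"
      by (intro borel_measurable_times test_functions_borel[OF \<theta>] smooth_on_measurable smooth_on_shift
          test_functions_smooth_on[OF k])
    from integral_lborel_shift[OF this, of y] show ?thesis
      by (simp add: dirac_kernel_def mult.assoc)
  qed
  have "cutoff r 0 (0::real^'n) = 1" using r by (simp add: cutoff_eq_1)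
  then show "(\<lambda>n. \<integral>x. \<theta> x * dirac_kernel r (e n) (x - y) \<partial>lborel) \<longlonglongrightarrow> \<theta> y * dirac_mass TYPE('n)"
    unfolding eq using dirac_sequence_tendsto(1)[OF ch bh e] by simp
  show "\<bar>\<integral>x. \<theta> x * dirac_kernel r (e n) (x - y) \<partial>lborel\<bar> \<le> B * dirac_mass TYPE('n)"
    unfolding eq by (rule dirac_sequence_tendsto(2)[OF ch bh e])
qed

text \<open>The identity behind both existence and interior regularity: tested with the regularised parametrix,
  the Lame form returns the mollified function up to a convolution with a smooth kernel.\<close>
lemma lame_form_with_parametrix:
  fixes y :: "real^'n"
  assumes W: "integrable_weight \<Omega> \<omega>" and u: "vec_H10_approximation \<omega> \<Omega> u G \<Phi>"
    and \<kappa>: "\<kappa> = (\<mu> + lam) / (2 * \<mu> + lam)" and \<mu>: "2 * \<mu> + lam > 0" and \<epsilon>: "\<epsilon> \<noteq> 0" and r: "r > 0" "cball y r \<subseteq> \<Omega>"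
  shows "lame_form \<mu> lam \<Omega> u (\<lambda>x. parametrix \<kappa> r \<epsilon> j (x - y)) =
     (\<mu> * real CARD('n) * (real CARD('n) + 2)) * (\<integral>x. u x $ j * dirac_kernel r \<epsilon> (x - y) \<partial>lebesgue_on \<Omega>)
     - (\<Sum>i\<in>UNIV. \<integral>x. u x $ i * parametrix_error \<mu> lam \<kappa> r \<epsilon> i j (x - y) \<partial>lebesgue_on \<Omega>)"
proof -
  let ?c = "\<mu> * real CARD('n) * (real CARD('n) + 2)"
  note W' = integrable_weight_inverse[OF W]
  have k: "(\<lambda>x. dirac_kernel r \<epsilon> (x - y)) \<in> L2 (\<lambda>x. inverse (\<omega> x)) \<Omega>"
  proof -
    note t = dirac_kernel_test_function[OF \<epsilon> r(1)]
    obtain B where "B > 0" "\<And>x. \<bar>dirac_kernel r \<epsilon> (x::real^'n)\<bar> \<le> B" using test_functions_bounded[OF t] by metis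
    then show ?thesis by (intro L2_bounded[OF W' borel_measurable_shift_lebesgue_on[OF test_functions_borel[OF t]]])
  qed
  have err: "(\<lambda>x. parametrix_error \<mu> lam \<kappa> r \<epsilon> i j (x - y)) \<in> L2 (\<lambda>x. inverse (\<omega> x)) \<Omega>" for i
  proof -
    have t: "parametrix_error \<mu> lam \<kappa> r \<epsilon> i j \<in> test_functions UNIV"
      by (rule test_functionsI[OF smooth_on_parametrix_error_UNIV[OF r(1)] compact_cball[of 0 r]])
        (auto intro!: parametrix_error_zero r)
    obtain B where "B > 0" "\<And>x. \<bar>parametrix_error \<mu> lam \<kappa> r \<epsilon> i j x\<bar> \<le> B" using test_functions_bounded[OF t] by metis
    then show ?thesis by (intro L2_bounded[OF W' borel_measurable_shift_lebesgue_on[OF test_functions_borel[OF t]]])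
  qed
  note int = L2_pairing(1)[OF W vec_H10_approximationD(1)[OF u] k] L2_pairing(1)[OF W vec_H10_approximationD(1)[OF u] err]
  have op: "lame_operator \<mu> lam (\<lambda>x. parametrix \<kappa> r \<epsilon> j (x - y)) i x =
      parametrix_error \<mu> lam \<kappa> r \<epsilon> i j (x - y) - ?c * (kdelta i j * dirac_kernel r \<epsilon> (x - y))" for i x
    unfolding lame_operator_shift[OF parametrix_component_smooth[OF \<epsilon>]] lame_operator_parametrix[OF \<epsilon> \<kappa> \<mu>] dirac_kernel_def ..
  have "lame_form \<mu> lam \<Omega> u (\<lambda>x. parametrix \<kappa> r \<epsilon> j (x - y)) =
      - (\<Sum>i\<in>UNIV. \<integral>x. u x $ i * parametrix_error \<mu> lam \<kappa> r \<epsilon> i j (x - y) - (?c * kdelta i j) * (u x $ i * dirac_kernel r \<epsilon> (x - y)) \<partial>lebesgue_on \<Omega>)"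
    unfolding lame_form_test_function[OF W u parametrix_test_function[OF \<epsilon> r]] op
    by (simp add: algebra_simps)
  also have "\<dots> = - (\<Sum>i\<in>UNIV. (\<integral>x. u x $ i * parametrix_error \<mu> lam \<kappa> r \<epsilon> i j (x - y) \<partial>lebesgue_on \<Omega>)
      - kdelta i j * (?c * (\<integral>x. u x $ i * dirac_kernel r \<epsilon> (x - y) \<partial>lebesgue_on \<Omega>)))"
  proof -
    have "(\<integral>x. u x $ i * parametrix_error \<mu> lam \<kappa> r \<epsilon> i j (x - y) - c * (u x $ i * dirac_kernel r \<epsilon> (x - y)) \<partial>lebesgue_on \<Omega>) =
      (\<integral>x. u x $ i * parametrix_error \<mu> lam \<kappa> r \<epsilon> i j (x - y) \<partial>lebesgue_on \<Omega>) - c * (\<integral>x. u x $ i * dirac_kernel r \<epsilon> (x - y) \<partial>lebesgue_on \<Omega>)" for i c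
      using int by simp
    then show ?thesis by (simp only:) (simp only: mult.assoc mult.left_commute[of _ "kdelta _ j"])
  qed
  also have "\<dots> = ?c * (\<integral>x. u x $ j * dirac_kernel r \<epsilon> (x - y) \<partial>lebesgue_on \<Omega>)
     - (\<Sum>i\<in>UNIV. \<integral>x. u x $ i * parametrix_error \<mu> lam \<kappa> r \<epsilon> i j (x - y) \<partial>lebesgue_on \<Omega>)"
    unfolding sum_subtractf sum_kdelta by simp
  finally show ?thesis .
qed

text \<open>By symmetry of the form the test function takes the place of the solution in the previous identity, and
  the regularisation tends to 0.\<close>
lemma lame_form_parametrix_limit:
  fixes y :: "real^'n"
  assumes d: "CARD('n) \<ge> 2" and \<Omega>: "open \<Omega>" "bounded \<Omega>" and W: "integrable_weight \<Omega> \<omega>"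
    and \<alpha>: "real CARD('n) - 2 < \<alpha>" "\<alpha> < real CARD('n)"
    and le: "\<And>x. \<omega> x \<le> norm (x - y) powr \<alpha>" and r: "r > 0" "cball y r \<subseteq> \<Omega>"
    and \<kappa>: "\<kappa> = (\<mu> + lam) / (2 * \<mu> + lam)" and \<mu>: "2 * \<mu> + lam > 0"
    and \<phi>: "\<phi> \<in> vec_test_functions \<Omega>"
  shows "lame_form \<mu> lam \<Omega> (\<lambda>x. parametrix \<kappa> r 0 j (x - y)) \<phi> =
     (\<mu> * real CARD('n) * (real CARD('n) + 2)) * dirac_mass TYPE('n) * \<phi> y $ j
     - (\<Sum>i\<in>UNIV. \<integral>x. parametrix_error \<mu> lam \<kappa> r 0 i j (x - y) * \<phi> x $ i \<partial>lebesgue_on \<Omega>)"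
proof -
  let ?c = "\<mu> * real CARD('n) * (real CARD('n) + 2)"
  define e where "e n = inverse (real (Suc n))" for n
  have e: "0 < e n" "e n \<le> 1" "e n \<noteq> 0" for n by (auto simp: e_def field_simps)
  have e0: "e \<longlonglongrightarrow> 0" unfolding e_def by (rule LIMSEQ_inverse_real_of_nat)
  note W' = integrable_weight_inverse[OF W]
  let ?D = "\<lambda>u i k. partial_deriv k (\<lambda>x. u x $ i)" and ?P = "\<lambda>n x. parametrix \<kappa> r (e n) j (x - y)"
  note A = parametrix_H10_approximation[where e = e and j = j and \<kappa> = \<kappa>, OF d \<Omega> W \<alpha> le r e(1,2) e0]
  note Pt = parametrix_test_function[OF e(3) r]
  have t: "(\<lambda>x. \<phi> x $ i) \<in> test_functions \<Omega>" for i using \<phi> unfolding vec_test_functions_def by auto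
  have "(\<lambda>n. lame_pairing \<mu> lam \<Omega> (?D (?P n)) (?D \<phi>)) \<longlonglongrightarrow>
      lame_pairing \<mu> lam \<Omega> (\<lambda>i k x. parametrix_deriv \<kappa> r 0 j i k (x - y)) (?D \<phi>)"
    by (rule lame_pairing_tendsto[OF W vec_H10_approximationD(2)[OF A]
          L2_test_function[OF W test_functions_partial_deriv[OF vec_H10_approximationD(3)[OF A]]]
          L2_test_function[OF W' test_functions_partial_deriv[OF t]] vec_H10_approximationD(6)[OF A]])
  then have l1: "(\<lambda>n. lame_pairing \<mu> lam \<Omega> (?D (?P n)) (?D \<phi>)) \<longlonglongrightarrow> lame_form \<mu> lam \<Omega> (\<lambda>x. parametrix \<kappa> r 0 j (x - y)) \<phi>"
    unfolding lame_form_eq_pairing[OF W A vec_H10_approximation_test[OF W' \<phi>]] .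
  have eq: "lame_pairing \<mu> lam \<Omega> (?D (?P n)) (?D \<phi>) =
     ?c * (\<integral>x. \<phi> x $ j * dirac_kernel r (e n) (x - y) \<partial>lborel)
     - (\<Sum>i\<in>UNIV. \<integral>x. \<phi> x $ i * parametrix_error \<mu> lam \<kappa> r (e n) i j (x - y) \<partial>lebesgue_on \<Omega>)" for n
  proof -
    have "lame_pairing \<mu> lam \<Omega> (?D (?P n)) (?D \<phi>) = lame_form \<mu> lam \<Omega> \<phi> (?P n)"
      unfolding lame_pairing_sym[of \<mu> lam \<Omega> "?D (?P n)"]
      by (rule lame_form_eq_pairing[OF W vec_H10_approximation_test[OF W \<phi>] vec_H10_approximation_test[OF W' Pt], symmetric])
    also note lame_form_with_parametrix[OF W vec_H10_approximation_test[OF W \<phi>] \<kappa> \<mu> e(3) r]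
    also have "(\<integral>x. \<phi> x $ j * dirac_kernel r (e n) (x - y) \<partial>lebesgue_on \<Omega>) = (\<integral>x. \<phi> x $ j * dirac_kernel r (e n) (x - y) \<partial>lborel)"
    proof (rule integral_lebesgue_on_test_function[OF \<Omega>(1)])
      show "(\<lambda>x. \<phi> x $ j * dirac_kernel r (e n) (x - y)) \<in> test_functions \<Omega>"
        using test_functions_mult[OF smooth_on_shift[OF test_functions_smooth_on[OF dirac_kernel_test_function[OF e(3) r(1)]]] t]
        by (simp add: mult.commute)
    qed
    finally show ?thesis .
  qed
  obtain B where "B > 0" and B: "\<And>x. \<bar>\<phi> x $ j\<bar> \<le> B" using test_functions_bounded[OF t[of j]] by metis
  obtain M where "M \<ge> 0" and M: "\<And>\<epsilon> i j (x::real^'n). 0 \<le> \<epsilon> \<Longrightarrow> \<epsilon> \<le> 1 \<Longrightarrow> \<bar>parametrix_error \<mu> lam \<kappa> r \<epsilon> i j x\<bar> \<le> M"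
    using parametrix_error_bound[OF d r(1), of \<mu> lam \<kappa>] by metis
  have l3: "(\<lambda>n. \<integral>x. \<phi> x $ i * parametrix_error \<mu> lam \<kappa> r (e n) i j (x - y) \<partial>lebesgue_on \<Omega>)
      \<longlonglongrightarrow> (\<integral>x. \<phi> x $ i * parametrix_error \<mu> lam \<kappa> r 0 i j (x - y) \<partial>lebesgue_on \<Omega>)" for i
  proof (rule integral_dominated_convergence[where w = "\<lambda>x. \<bar>\<phi> x $ i\<bar> * M"])
    have m: "(\<lambda>x. \<phi> x $ i * parametrix_error \<mu> lam \<kappa> r \<epsilon> i j (x - y)) \<in> borel_measurable (lebesgue_on \<Omega>)" for \<epsilon>
      by (intro borel_measurable_times test_functions_measurable[OF t] borel_measurable_shift_lebesgue_on smooth_on_measurable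
          smooth_on_parametrix_error_UNIV r)
    show "(\<lambda>x. \<phi> x $ i * parametrix_error \<mu> lam \<kappa> r 0 i j (x - y)) \<in> borel_measurable (lebesgue_on \<Omega>)"
      "(\<lambda>x. \<phi> x $ i * parametrix_error \<mu> lam \<kappa> r (e n) i j (x - y)) \<in> borel_measurable (lebesgue_on \<Omega>)" for n by (rule m)+
    show "integrable (lebesgue_on \<Omega>) (\<lambda>x. \<bar>\<phi> x $ i\<bar> * M)"
      using L2_imp_integrable[OF W L2_test_function[OF W t[of i]]] by simp
    show "AE x in lebesgue_on \<Omega>. (\<lambda>n. \<phi> x $ i * parametrix_error \<mu> lam \<kappa> r (e n) i j (x - y)) \<longlonglongrightarrow>
        \<phi> x $ i * parametrix_error \<mu> lam \<kappa> r 0 i j (x - y)"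
      by (intro AE_I2 tendsto_mult tendsto_const tendsto_parametrix_error[OF r(1) e0])
    show "AE x in lebesgue_on \<Omega>. norm (\<phi> x $ i * parametrix_error \<mu> lam \<kappa> r (e n) i j (x - y)) \<le> \<bar>\<phi> x $ i\<bar> * M" for n
    proof (rule AE_I2)
      fix x
      have "\<bar>\<phi> x $ i\<bar> * \<bar>parametrix_error \<mu> lam \<kappa> r (e n) i j (x - y)\<bar> \<le> \<bar>\<phi> x $ i\<bar> * M"
        by (intro mult_left_mono M) (use e(1,2)[of n] in auto)
      then show "norm (\<phi> x $ i * parametrix_error \<mu> lam \<kappa> r (e n) i j (x - y)) \<le> \<bar>\<phi> x $ i\<bar> * M"
        by (simp only: real_norm_def abs_mult)
    qed
  qed
  have "(\<lambda>n. lame_pairing \<mu> lam \<Omega> (?D (?P n)) (?D \<phi>)) \<longlonglongrightarrow>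
      ?c * (\<phi> y $ j * dirac_mass TYPE('n)) - (\<Sum>i\<in>UNIV. \<integral>x. \<phi> x $ i * parametrix_error \<mu> lam \<kappa> r 0 i j (x - y) \<partial>lebesgue_on \<Omega>)"
    unfolding eq by (intro tendsto_diff tendsto_mult tendsto_const tendsto_sum l3 dirac_kernel_tendsto(1)[OF t B e(1) e0 r(1)])
  from LIMSEQ_unique[OF l1 this] show ?thesis by (simp add: mult_ac)
qed

section \<open>Convolution with a test function\<close>

lemma frechet_derivative_eq_sum:
  assumes "k differentiable (at z)"
  shows "frechet_derivative k (at z) h = (\<Sum>i\<in>UNIV. h $ i * partial_deriv i k z)"
proof -
  have lin: "linear (frechet_derivative k (at z))"
    using has_derivative_frechet[OF assms] has_derivative_linear by blast
  have "frechet_derivative k (at z) (\<Sum>i\<in>UNIV. h $ i *\<^sub>R axis i 1) = (\<Sum>i\<in>UNIV. h $ i * partial_deriv i k z)"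
    by (simp add: linear_sum[OF lin] linear_scale[OF lin] partial_deriv_def)
  moreover have "(\<Sum>i\<in>UNIV. h $ i *\<^sub>R axis i 1) = h"
    using basis_expansion[of h] by (simp add: scalar_mult_eq_scaleR)
  ultimately show ?thesis by simp
qed

lemma test_function_Lipschitz:
  fixes k :: "real^'n \<Rightarrow> real"
  assumes k: "k \<in> test_functions \<Omega>"
  obtains L where "L \<ge> 0" "\<And>a b. \<bar>k a - k b\<bar> \<le> L * norm (a - b)"
proof -
  have "\<exists>B. \<forall>x. \<bar>partial_deriv i k x\<bar> \<le> B" for i
    using test_functions_bounded[OF test_functions_partial_deriv[OF k]] by metis
  then obtain b where b: "\<And>i x. \<bar>partial_deriv i k x\<bar> \<le> b i" by metis
  note fd = frechet_derivative_eq_sum[OF test_functions_differentiable[OF k]]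
  define L where "L = (\<Sum>i\<in>UNIV. b i)"
  have b0: "0 \<le> b i" for i using order_trans[OF abs_ge_zero b] .
  have bound: "norm (frechet_derivative k (at z) h) \<le> L * norm h" for z h
  proof -
    have "\<bar>\<Sum>i\<in>UNIV. h $ i * partial_deriv i k z\<bar> \<le> (\<Sum>i\<in>UNIV. norm h * b i)"
      by (rule order_trans[OF sum_abs], rule sum_mono) (simp add: abs_mult mult_mono b component_le_norm_cart)
    then show ?thesis unfolding fd L_def by (simp add: sum_distrib_left mult.commute)
  qed
  have "norm (k a - k b) \<le> L * norm (a - b)" for a b
  proof (rule differentiable_bound[of UNIV k "\<lambda>z. frechet_derivative k (at z)"])
    show "onorm (frechet_derivative k (at x)) \<le> L" for x
      using bound by (intro onorm_le) 
  qed (use has_derivative_frechet[OF test_functions_differentiable[OF k]] in auto)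
  then show ?thesis using b0 by (intro that[of L]) (auto simp: L_def sum_nonneg)
qed

text \<open>Uniformity in the base point is what allows differentiation of a convolution with a function that is
  merely integrable.\<close>
lemma test_function_Taylor:
  fixes k :: "real^'n \<Rightarrow> real"
  assumes k: "k \<in> test_functions \<Omega>"
  obtains C where "C \<ge> 0" "\<And>z h. \<bar>k (z + h) - k z - (\<Sum>i\<in>UNIV. h $ i * partial_deriv i k z)\<bar> \<le> C * (norm h)\<^sup>2"
proof -
  have "\<exists>L\<ge>0. \<forall>a b. \<bar>partial_deriv i k a - partial_deriv i k b\<bar> \<le> L * norm (a - b)" for i
    using test_function_Lipschitz[OF test_functions_partial_deriv[OF k]] by metis
  then obtain L where L: "\<And>i. L i \<ge> 0" "\<And>i a b. \<bar>partial_deriv i k a - partial_deriv i k b\<bar> \<le> L i * norm (a - b)" by metis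
  have "\<bar>k (z + h) - k z - (\<Sum>i\<in>UNIV. h $ i * partial_deriv i k z)\<bar> \<le> (\<Sum>i\<in>UNIV. L i) * (norm h)\<^sup>2" for z h
  proof -
    have der: "((\<lambda>t. k (z + t *\<^sub>R h)) has_real_derivative (\<Sum>i\<in>UNIV. h $ i * partial_deriv i k (z + t *\<^sub>R h))) (at t)" for t
    proof -
      have "((\<lambda>t. z + t *\<^sub>R h) has_derivative (\<lambda>s. s *\<^sub>R h)) (at t)"
        by (auto intro!: derivative_eq_intros)
      from has_derivative_compose[OF this has_derivative_frechet[OF test_functions_differentiable[OF k]]]
      have "((\<lambda>t. k (z + t *\<^sub>R h)) has_derivative (\<lambda>s. frechet_derivative k (at (z + t *\<^sub>R h)) (s *\<^sub>R h))) (at t)" .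
      moreover have "frechet_derivative k (at (z + t *\<^sub>R h)) (s *\<^sub>R h) = (\<Sum>i\<in>UNIV. h $ i * partial_deriv i k (z + t *\<^sub>R h)) * s" for s
        unfolding frechet_derivative_eq_sum[OF test_functions_differentiable[OF k]]
        unfolding sum_distrib_right by (intro sum.cong) simp_all
      ultimately show ?thesis unfolding has_field_derivative_def by simp
    qed
    obtain \<xi> where \<xi>: "0 < \<xi>" "\<xi> < 1" "k (z + 1 *\<^sub>R h) - k (z + 0 *\<^sub>R h) = (1 - 0) * (\<Sum>i\<in>UNIV. h $ i * partial_deriv i k (z + \<xi> *\<^sub>R h))"
      using MVT2[of 0 1 "\<lambda>t. k (z + t *\<^sub>R h)" "\<lambda>t. \<Sum>i\<in>UNIV. h $ i * partial_deriv i k (z + t *\<^sub>R h)"] der by auto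
    have "k (z + h) - k z - (\<Sum>i\<in>UNIV. h $ i * partial_deriv i k z) =
        (\<Sum>i\<in>UNIV. h $ i * (partial_deriv i k (z + \<xi> *\<^sub>R h) - partial_deriv i k z))"
      using \<xi>(3) by (simp add: sum_subtractf right_diff_distrib)
    also have "\<bar>\<dots>\<bar> \<le> (\<Sum>i\<in>UNIV. norm h * (L i * norm h))"
    proof (rule order_trans[OF sum_abs], rule sum_mono)
      fix i
      have "\<bar>partial_deriv i k (z + \<xi> *\<^sub>R h) - partial_deriv i k z\<bar> \<le> L i * norm (\<xi> *\<^sub>R h)"
        using L(2)[of i "z + \<xi> *\<^sub>R h" z] by simp
      also have "\<dots> \<le> L i * norm h"
        using \<xi> L(1) by (intro mult_left_mono) (auto simp: mult_left_le_one_le)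
      finally show "\<bar>h $ i * (partial_deriv i k (z + \<xi> *\<^sub>R h) - partial_deriv i k z)\<bar> \<le> norm h * (L i * norm h)"
        unfolding abs_mult by (intro mult_mono component_le_norm_cart) auto
    qed
    also have "\<dots> = (\<Sum>i\<in>UNIV. L i) * (norm h)\<^sup>2"
      unfolding sum_distrib_right power2_eq_square by (simp only: mult_ac)
    finally show ?thesis .
  qed
  then show ?thesis using L(1) by (intro that[of "\<Sum>i\<in>UNIV. L i"]) (auto simp: sum_nonneg)
qed

lemma integrable_mult_bounded_shift:
  fixes v :: "real^'n \<Rightarrow> real"
  assumes v: "integrable lborel v" and k: "k \<in> borel_measurable borel" "\<And>x. \<bar>k x\<bar> \<le> B"
  shows "integrable lborel (\<lambda>x. v x * k (x - y))"
proof (rule Bochner_Integration.integrable_bound[OF integrable_mult_left[where c = B, OF v]])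
  have "(\<lambda>x. k (x - y)) \<in> borel_measurable borel" by (rule measurable_compose[OF _ k(1)]) simp
  then show "(\<lambda>x. v x * k (x - y)) \<in> borel_measurable lborel"
    by (intro borel_measurable_times borel_measurable_integrable[OF v]) simp
  have "0 \<le> B" using order_trans[OF abs_ge_zero k(2)] .
  then show "AE x in lborel. norm (v x * k (x - y)) \<le> norm (v x * B)"
    by (intro AE_I2) (use k(2) in \<open>simp add: abs_mult mult_left_mono\<close>)
qed

lemma convolution_has_derivative:
  fixes v :: "real^'n \<Rightarrow> real"
  assumes v: "integrable lborel v" and k: "k \<in> test_functions \<Omega>"
  shows "((\<lambda>y. \<integral>x. v x * k (x - y) \<partial>lborel) has_derivative
     (\<lambda>h. \<Sum>i\<in>UNIV. h $ i * (- (\<integral>x. v x * partial_deriv i k (x - y) \<partial>lborel)))) (at y)"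
proof -
  let ?W = "\<lambda>y. \<integral>x. v x * k (x - y) \<partial>lborel" and ?I = "\<lambda>i. \<integral>x. v x * partial_deriv i k (x - y) \<partial>lborel"
  obtain B where B: "\<And>x. \<bar>k x\<bar> \<le> B" using test_functions_bounded[OF k] by metis
  have "\<exists>B. \<forall>x. \<bar>partial_deriv i k x\<bar> \<le> B" for i
    using test_functions_bounded[OF test_functions_partial_deriv[OF k]] by metis
  then obtain b where b: "\<And>i x. \<bar>partial_deriv i k x\<bar> \<le> b i" by metis
  obtain C where C: "C \<ge> 0" "\<And>z h. \<bar>k (z + h) - k z - (\<Sum>i\<in>UNIV. h $ i * partial_deriv i k z)\<bar> \<le> C * (norm h)\<^sup>2"
    using test_function_Taylor[OF k] by metis
  have ik: "integrable lborel (\<lambda>x. v x * k (x - y))" for y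
    by (rule integrable_mult_bounded_shift[OF v test_functions_borel[OF k] B])
  have ip: "integrable lborel (\<lambda>x. v x * partial_deriv i k (x - y))" for i
    by (rule integrable_mult_bounded_shift[OF v test_functions_borel[OF test_functions_partial_deriv[OF k]] b])
  define N where "N = (\<integral>x. \<bar>v x\<bar> \<partial>lborel)"
  have N: "N \<ge> 0" unfolding N_def by simp
  have est: "\<bar>?W y' - ?W y - (\<Sum>i\<in>UNIV. (y' - y) $ i * (- ?I i))\<bar> \<le> C * N * (norm (y' - y))\<^sup>2" for y'
  proof -
    define h where "h = y - y'"
    let ?R = "\<lambda>x. v x * (k (x - y + h) - k (x - y) - (\<Sum>i\<in>UNIV. h $ i * partial_deriv i k (x - y)))"
    have sum_i: "integrable lborel (\<lambda>x. \<Sum>i\<in>UNIV. h $ i * (v x * partial_deriv i k (x - y)))"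
      using ip by simp
    have i1: "integrable lborel (\<lambda>x. v x * k (x - y + h))" using ik[of y'] by (simp add: h_def)
    have eqR: "?R = (\<lambda>x. v x * k (x - y + h) - v x * k (x - y) - (\<Sum>i\<in>UNIV. h $ i * (v x * partial_deriv i k (x - y))))"
      by (simp add: fun_eq_iff right_diff_distrib sum_distrib_left mult_ac)
    have iR: "integrable lborel ?R"
      unfolding eqR by (intro Bochner_Integration.integrable_diff i1 ik sum_i)
    have "(\<integral>x. ?R x \<partial>lborel) = ?W y' - ?W y - (\<Sum>i\<in>UNIV. h $ i * ?I i)"
      unfolding eqR using i1 ik[of y] ip sum_i by (simp add: h_def)
    also have "(\<Sum>i\<in>UNIV. h $ i * ?I i) = (\<Sum>i\<in>UNIV. (y' - y) $ i * (- ?I i))"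
      by (rule sum.cong) (auto simp: h_def algebra_simps)
    finally have eq: "?W y' - ?W y - (\<Sum>i\<in>UNIV. (y' - y) $ i * (- ?I i)) = (\<integral>x. ?R x \<partial>lborel)" by simp
    have iv: "integrable lborel (\<lambda>x. \<bar>v x\<bar> * (C * (norm h)\<^sup>2))" using v by simp
    have "\<bar>\<integral>x. ?R x \<partial>lborel\<bar> \<le> (\<integral>x. \<bar>v x\<bar> * (C * (norm h)\<^sup>2) \<partial>lborel)"
      using Bochner_Integration.integral_norm_bound_integral[OF iR iv]
        mult_left_mono[OF C(2) abs_ge_zero] by (simp add: abs_mult)
    also have "\<dots> = C * N * (norm (y' - y))\<^sup>2"
      unfolding N_def h_def by (simp add: norm_minus_commute)
    finally show ?thesis unfolding eq .
  qed
  show ?thesis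
  proof (rule has_derivativeI_sandwich[where e = 1 and H = "\<lambda>y'. C * N * norm (y' - y)"])
    show "bounded_linear (\<lambda>h. \<Sum>i\<in>UNIV. h $ i * (- ?I i))"
      by (intro bounded_linear_sum bounded_linear_mult_const bounded_linear_vec_nth)
    have "((\<lambda>y'. C * N * norm (y' - y)) \<longlongrightarrow> C * N * norm (y - y)) (at y)" by (intro tendsto_intros)
    then show "((\<lambda>y'. C * N * norm (y' - y)) \<longlongrightarrow> 0) (at y)" by simp
    fix y' assume "y' \<noteq> y"
    then have pos: "norm (y' - y) > 0" by simp
    have "norm (?W y' - ?W y - (\<Sum>i\<in>UNIV. (y' - y) $ i * (- ?I i))) / norm (y' - y) \<le> C * N * (norm (y' - y))\<^sup>2 / norm (y' - y)"
      unfolding real_norm_def using pos by (intro divide_right_mono est) simp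
    also have "\<dots> = C * N * norm (y' - y)" using pos by (simp add: power2_eq_square)
    finally show "norm (?W y' - ?W y - (\<Sum>i\<in>UNIV. (y' - y) $ i * (- ?I i))) / norm (y' - y) \<le> C * N * norm (y' - y)" .
  qed simp
qed

lemma smooth_on_convolution:
  fixes v :: "real^'n \<Rightarrow> real"
  assumes v: "integrable lborel v" and k: "k \<in> test_functions \<Omega>"
  shows "smooth_on UNIV (\<lambda>y. \<integral>x. v x * k (x - y) \<partial>lborel)"
proof -
  have "times_differentiable_on n UNIV (\<lambda>y. c * (\<integral>x. v x * k (x - y) \<partial>lborel))"
    if "k \<in> test_functions \<Omega>" for n c k
    using that
  proof (induction n arbitrary: k c)
    case 0
    have "(\<lambda>y. c * (\<integral>x. v x * k (x - y) \<partial>lborel)) differentiable (at y)" for y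
      unfolding differentiable_def
      by (rule exI, rule has_derivative_mult_right, rule convolution_has_derivative[OF v 0])
    then show ?case by (simp add: differentiable_on_eq_differentiable_at)
  next
    case (Suc n)
    have d: "(\<lambda>y. c * (\<integral>x. v x * k (x - y) \<partial>lborel)) differentiable (at y)" for y
      unfolding differentiable_def
      by (rule exI, rule has_derivative_mult_right, rule convolution_has_derivative[OF v Suc.prems])
    have "partial_deriv i (\<lambda>y. c * (\<integral>x. v x * k (x - y) \<partial>lborel)) = (\<lambda>y. (- c) * (\<integral>x. v x * partial_deriv i k (x - y) \<partial>lborel))" for i
    proof
      fix y
      have "((\<lambda>y. c * (\<integral>x. v x * k (x - y) \<partial>lborel)) has_derivative
         (\<lambda>h. c * (\<Sum>j\<in>UNIV. h $ j * (- (\<integral>x. v x * partial_deriv j k (x - y) \<partial>lborel))))) (at y)"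
        by (rule has_derivative_mult_right[OF convolution_has_derivative[OF v Suc.prems]])
      from partial_deriv_eq[OF this, of i]
      show "partial_deriv i (\<lambda>y. c * (\<integral>x. v x * k (x - y) \<partial>lborel)) y = (- c) * (\<integral>x. v x * partial_deriv i k (x - y) \<partial>lborel)"
        by (simp add: axis_def sum_negf if_distrib[of "\<lambda>c. c * _"] cong: if_cong)
    qed
    then have "times_differentiable_on n UNIV (partial_deriv i (\<lambda>y. c * (\<integral>x. v x * k (x - y) \<partial>lborel)))" for i
      using Suc.IH[OF test_functions_partial_deriv[OF Suc.prems], of "- c" i] by (simp only:)
    then show ?case
      unfolding times_differentiable_on.simps using d by (auto simp only: differentiable_on_eq_differentiable_at[OF open_UNIV])
  qed
  from this[OF k, of _ 1] show ?thesis unfolding smooth_on_def by simp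
qed

lemma Fubini_convolution:
  fixes v \<theta> :: "real^'n \<Rightarrow> real"
  assumes v: "integrable lborel v" and \<theta>: "integrable lborel \<theta>" and k: "k \<in> borel_measurable borel" "\<And>x. \<bar>k x\<bar> \<le> B"
  shows "(\<integral>y. \<theta> y * (\<integral>x. v x * k (x - y) \<partial>lborel) \<partial>lborel) = (\<integral>x. v x * (\<integral>y. \<theta> y * k (x - y) \<partial>lborel) \<partial>lborel)"
proof -
  have [measurable]: "v \<in> borel_measurable borel" "\<theta> \<in> borel_measurable borel" "k \<in> borel_measurable borel"
    using v \<theta> k by auto
  have i1: "integrable (lborel \<Otimes>\<^sub>M lborel) (\<lambda>p. v (fst p) * \<theta> (snd p))"
  proof (rule lborel_pair.Fubini_integrable)
    show "(\<lambda>p. v (fst p) * \<theta> (snd p)) \<in> borel_measurable (lborel \<Otimes>\<^sub>M lborel)" by measurable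
    show "integrable lborel (\<lambda>x. \<integral>y. norm (v (fst (x, y)) * \<theta> (snd (x, y))) \<partial>lborel)"
      using v by (simp add: abs_mult)
    show "AE x in lborel. integrable lborel (\<lambda>y. v (fst (x, y)) * \<theta> (snd (x, y)))"
      using \<theta> by simp
  qed
  have i2: "integrable (lborel \<Otimes>\<^sub>M lborel) (\<lambda>p. (v (fst p) * \<theta> (snd p)) * k (fst p - snd p))"
  proof (rule Bochner_Integration.integrable_bound[OF integrable_mult_left[where c = B, OF i1]])
    show "(\<lambda>p. (v (fst p) * \<theta> (snd p)) * k (fst p - snd p)) \<in> borel_measurable (lborel \<Otimes>\<^sub>M lborel)" by measurable
    have "0 \<le> B" using order_trans[OF abs_ge_zero k(2)] .
    then show "AE p in lborel \<Otimes>\<^sub>M lborel. norm ((v (fst p) * \<theta> (snd p)) * k (fst p - snd p)) \<le> norm ((v (fst p) * \<theta> (snd p)) * B)"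
      by (intro AE_I2) (use k(2) in \<open>simp add: abs_mult mult_left_mono\<close>)
  qed
  have i3: "integrable (lborel \<Otimes>\<^sub>M lborel) (\<lambda>(x, y). (v x * \<theta> y) * k (x - y))"
    using i2 unfolding case_prod_unfold .
  have "(\<integral>y. (\<integral>x. (v x * \<theta> y) * k (x - y) \<partial>lborel) \<partial>lborel) = (\<integral>x. (\<integral>y. (v x * \<theta> y) * k (x - y) \<partial>lborel) \<partial>lborel)"
    using lborel_pair.Fubini_integral[OF i3] by simp
  moreover have "(\<integral>x. (v x * \<theta> y) * k (x - y) \<partial>lborel) = \<theta> y * (\<integral>x. v x * k (x - y) \<partial>lborel)" for y
    by (subst integral_mult_right_zero[symmetric]) (simp add: mult_ac)
  moreover have "(\<integral>y. (v x * \<theta> y) * k (x - y) \<partial>lborel) = v x * (\<integral>y. \<theta> y * k (x - y) \<partial>lborel)" for x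
    by (subst integral_mult_right_zero[symmetric]) (simp add: mult_ac)
  ultimately show ?thesis by simp
qed

text \<open>Fubini on the product of two Lebesgue measures needs Borel functions, not merely Lebesgue measurable
  ones.\<close>
lemma borel_version:
  fixes w :: "real^'n \<Rightarrow> real"
  assumes \<Omega>: "open \<Omega>" and w: "integrable (lebesgue_on \<Omega>) w"
  shows "\<exists>v. integrable lborel v \<and>
    (\<forall>g\<in>borel_measurable borel. (\<integral>x. w x * g x \<partial>lebesgue_on \<Omega>) = (\<integral>x. v x * g x \<partial>lborel))"
proof -
  have i: "integrable lebesgue (\<lambda>x. indicator \<Omega> x * w x)"
    using w \<Omega> by (simp add: integrable_lebesgue_on)
  from completion_ex_borel_measurable_real[OF borel_measurable_integrable[OF i]]
  obtain v where v: "v \<in> borel_measurable lborel" and ae: "AE x in lborel. indicator \<Omega> x * w x = v x" by blast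
  note ae' = AE_completion[OF ae]
  have vl: "v \<in> borel_measurable lebesgue" by (rule measurable_completion[OF v])
  have vi: "integrable lborel v"
    using i integrable_cong_AE[OF borel_measurable_integrable[OF i] vl ae'] integrable_completion[OF v] by simp
  show ?thesis
  proof (intro exI conjI ballI)
    show "integrable lborel v" by (rule vi)
    fix g :: "real^'n \<Rightarrow> real" assume g: "g \<in> borel_measurable borel"
    have m: "(\<lambda>x. v x * g x) \<in> borel_measurable lborel" using v g by (intro borel_measurable_times) auto
    have "(\<integral>x. w x * g x \<partial>lebesgue_on \<Omega>) = (\<integral>x. indicator \<Omega> x * (w x * g x) \<partial>lebesgue)"
      using \<Omega> by (simp add: integral_lebesgue_on)
    also have "\<dots> = (\<integral>x. v x * g x \<partial>lebesgue)"
    proof (rule integral_cong_AE)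
      show eq: "AE x in lebesgue. indicator \<Omega> x * (w x * g x) = v x * g x"
        using ae' by eventually_elim (simp add: mult.assoc[symmetric])
      then have "AE x in lebesgue. v x * g x = indicator \<Omega> x * (w x * g x)" by (auto elim!: eventually_mono)
      then show "(\<lambda>x. indicator \<Omega> x * (w x * g x)) \<in> borel_measurable lebesgue"
        by (rule borel_measurable_AE[OF measurable_completion[OF m]])
      show "(\<lambda>x. v x * g x) \<in> borel_measurable lebesgue" by (rule measurable_completion[OF m])
    qed
    also have "\<dots> = (\<integral>x. v x * g x \<partial>lborel)" by (rule integral_completion[OF m])
    finally show "(\<integral>x. w x * g x \<partial>lebesgue_on \<Omega>) = (\<integral>x. v x * g x \<partial>lborel)" .
  qed
qed

section \<open>Interior regularity of homogeneous solutions\<close>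

lemma dirac_kernel_commute: "dirac_kernel r \<epsilon> (x - y) = dirac_kernel r \<epsilon> (y - x)"
  unfolding dirac_kernel_def cutoff_def reg_pow_def reg_sq_def by (simp add: norm_minus_commute)

text \<open>Weyl's lemma. Testing with the regularised parametrix centred at \<^term>\<open>y\<close> equates a mollification of
  the solution with a convolution whose kernels converge to a smooth one; letting the regularisation
  tend to 0 in the sense of distributions identifies the solution with that smooth convolution.\<close>
lemma lame_homogeneous_smooth:
  fixes w :: "real^'n \<Rightarrow> real^'n"
  assumes d: "CARD('n) \<ge> 2" and W: "integrable_weight \<Omega> \<omega>" and w: "vec_H10_approximation \<omega> \<Omega> w G \<Phi>"
    and zero: "\<And>\<phi>. \<phi> \<in> vec_test_functions \<Omega> \<Longrightarrow> lame_form \<mu> lam \<Omega> w \<phi> = 0"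
    and \<mu>: "\<mu> > 0" "2 * \<mu> + lam > 0" and r: "r > 0"
    and U: "open U" "U \<subseteq> \<Omega>" "\<And>y. y \<in> U \<Longrightarrow> cball y r \<subseteq> \<Omega>"
  shows "\<exists>S. (\<forall>j. smooth_on UNIV (S j)) \<and> (AE x in lebesgue_on U. \<forall>j. w x $ j = S j x)"
proof -
  note \<Omega> = integrable_weight_open[OF W]
  define \<kappa> where "\<kappa> = (\<mu> + lam) / (2 * \<mu> + lam)"
  define c where "c = \<mu> * real CARD('n) * (real CARD('n) + 2)"
  define m where "m = dirac_mass TYPE('n)"
  have cm: "c * m > 0" using \<mu>(1) d dirac_mass_pos[where ?'n = 'n] by (simp add: c_def m_def)
  define e where "e n = inverse (real (Suc n))" for n
  have e: "0 < e n" "e n \<le> 1" "0 \<le> e n" "e n \<noteq> 0" for n by (auto simp: e_def field_simps)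
  have e0: "e \<longlonglongrightarrow> 0" unfolding e_def by (rule LIMSEQ_inverse_real_of_nat)
  let ?E = "\<lambda>\<epsilon> i j. parametrix_error \<mu> lam \<kappa> r \<epsilon> i j"
  obtain M where M: "M \<ge> 0" "\<And>\<epsilon> i j (x::real^'n). 0 \<le> \<epsilon> \<Longrightarrow> \<epsilon> \<le> 1 \<Longrightarrow> \<bar>?E \<epsilon> i j x\<bar> \<le> M"
    using parametrix_error_bound[OF d r, of \<mu> lam \<kappa>] by metis
  have Et: "?E \<epsilon> i j \<in> test_functions UNIV" for \<epsilon> i j
    by (rule test_functionsI[OF smooth_on_parametrix_error_UNIV[OF r] compact_cball[of 0 r]])
      (auto intro!: parametrix_error_zero r)
  have wi: "integrable (lebesgue_on \<Omega>) (\<lambda>x. w x $ i)" for i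
    by (rule L2_imp_integrable[OF W vec_H10_approximationD(1)[OF w]])
  have "\<exists>v. integrable lborel v \<and> (\<forall>g\<in>borel_measurable borel. (\<integral>x. w x $ i * g x \<partial>lebesgue_on \<Omega>) = (\<integral>x. v x * g x \<partial>lborel))" for i
    by (rule borel_version[OF \<Omega> wi[of i]])
  then have "\<forall>i. \<exists>v. integrable lborel v \<and> (\<forall>g\<in>borel_measurable borel. (\<integral>x. w x $ i * g x \<partial>lebesgue_on \<Omega>) = (\<integral>x. v x * g x \<partial>lborel))"
    by (rule allI)
  then obtain v where V: "\<forall>i. integrable lborel (v i) \<and> (\<forall>g\<in>borel_measurable borel. (\<integral>x. w x $ i * g x \<partial>lebesgue_on \<Omega>) = (\<integral>x. v i x * g x \<partial>lborel))"
    by (rule choice[THEN exE])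
  have v: "integrable lborel (v i)" for i using V by simp
  have vw: "(\<integral>x. w x $ i * g x \<partial>lebesgue_on \<Omega>) = (\<integral>x. v i x * g x \<partial>lborel)" if "g \<in> borel_measurable borel" for i g
    using V that by blast
  define S where "S j y = (\<Sum>i\<in>UNIV. \<integral>x. v i x * ?E 0 i j (x - y) \<partial>lborel) / (c * m)" for j y
  have Ssm: "smooth_on UNIV (S j)" for j
    unfolding S_def divide_inverse
    by (intro smooth_on_mult smooth_on_sum smooth_on_const open_UNIV smooth_on_convolution[OF v Et])
  have shiftm: "(\<lambda>x. f (x - y)) \<in> borel_measurable borel" if "f \<in> borel_measurable borel" for f :: "real^'n \<Rightarrow> real" and y
    by (rule measurable_compose[OF _ that]) simp
  have kt: "dirac_kernel r (e n) \<in> test_functions UNIV" for n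
    by (rule dirac_kernel_test_function[OF e(4) r])
  have identity: "c * (\<integral>x. v j x * dirac_kernel r (e n) (x - y) \<partial>lborel) = (\<Sum>i\<in>UNIV. \<integral>x. v i x * ?E (e n) i j (x - y) \<partial>lborel)"
    if y: "y \<in> U" for y j n
  proof -
    have "lame_form \<mu> lam \<Omega> w (\<lambda>x. parametrix \<kappa> r (e n) j (x - y)) = 0"
      by (rule zero[OF parametrix_test_function[OF e(4) r U(3)[OF y]]])
    then show ?thesis
      unfolding lame_form_with_parametrix[OF W w \<kappa>_def \<mu>(2) e(4) r U(3)[OF y]]
        vw[OF shiftm[OF test_functions_borel[OF kt]]] vw[OF shiftm[OF test_functions_borel[OF Et]]] c_def by simp
  qed
  have ae: "AE x in lebesgue_on U. w x $ j - S j x = 0" for j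
  proof (rule fundamental_lemma[OF U(1)])
    have liw: "locally_integrable U (\<lambda>x. w x $ j)"
      using integrable_imp_locally_integrable[OF \<Omega> wi[of j]] U(2) unfolding locally_integrable_def by auto
    have liS: "locally_integrable U (S j)"
      by (rule continuous_on_imp_locally_integrable[OF smooth_on_imp_continuous_on[OF Ssm]])
    show "locally_integrable U (\<lambda>x. w x $ j - S j x)" by (rule locally_integrable_diff[OF liw liS])
    fix \<theta> assume \<theta>: "\<theta> \<in> test_functions U"
    obtain B where B: "\<And>x. \<bar>\<theta> x\<bar> \<le> B" using test_functions_bounded[OF \<theta>] by metis
    note \<theta>i = test_functions_integrable[OF \<theta>] and \<theta>b = test_functions_borel[OF \<theta>]
    let ?k = "\<lambda>n. dirac_kernel r (e n)"
    \<comment> \<open>Both sides of the identity, integrated against the test function.\<close>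
    have lhs: "(\<lambda>n. \<integral>y. \<theta> y * (\<integral>x. v j x * ?k n (x - y) \<partial>lborel) \<partial>lborel) \<longlonglongrightarrow> (\<integral>x. v j x * (\<theta> x * m) \<partial>lborel)"
    proof -
      have eq: "(\<integral>y. \<theta> y * (\<integral>x. v j x * ?k n (x - y) \<partial>lborel) \<partial>lborel) = (\<integral>x. v j x * (\<integral>y. \<theta> y * ?k n (y - x) \<partial>lborel) \<partial>lborel)" for n
      proof -
        obtain b where "\<And>x. \<bar>dirac_kernel r (e n) (x::real^'n)\<bar> \<le> b" using test_functions_bounded[OF kt] by metis
        from Fubini_convolution[OF v \<theta>i test_functions_borel[OF kt] this]
        show ?thesis by (simp only: dirac_kernel_commute[of r "e n"])
      qed
      show ?thesis unfolding eq
      proof (rule integral_dominated_convergence[where w = "\<lambda>x. \<bar>v j x\<bar> * (B * m)"])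
        show "(\<lambda>x. v j x * (\<theta> x * m)) \<in> borel_measurable lborel"
          using v \<theta>b by (intro borel_measurable_times borel_measurable_const borel_measurable_integrable[OF v]) auto
        have "(\<lambda>x. \<integral>y. \<theta> y * ?k n (y - x) \<partial>lborel) \<in> borel_measurable borel" for n
          by (rule smooth_on_measurable[OF smooth_on_convolution[OF \<theta>i kt]])
        then show "(\<lambda>x. v j x * (\<integral>y. \<theta> y * ?k n (y - x) \<partial>lborel)) \<in> borel_measurable lborel" for n
          by (intro borel_measurable_times borel_measurable_integrable[OF v]) simp
        show "integrable lborel (\<lambda>x. \<bar>v j x\<bar> * (B * m))" using v by simp
        show "AE x in lborel. (\<lambda>n. v j x * (\<integral>y. \<theta> y * ?k n (y - x) \<partial>lborel)) \<longlonglongrightarrow> v j x * (\<theta> x * m)"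
          unfolding m_def by (intro AE_I2 tendsto_mult tendsto_const dirac_kernel_tendsto(1)[OF \<theta> B e(1) e0 r])
        show "AE x in lborel. norm (v j x * (\<integral>y. \<theta> y * ?k n (y - x) \<partial>lborel)) \<le> \<bar>v j x\<bar> * (B * m)" for n
          unfolding m_def
          by (rule AE_I2, unfold real_norm_def abs_mult)
            (intro mult_left_mono dirac_kernel_tendsto(2)[OF \<theta> B e(1) e0 r] abs_ge_zero)
      qed
    qed
    have rhs: "(\<lambda>n. \<integral>y. \<theta> y * (\<Sum>i\<in>UNIV. \<integral>x. v i x * ?E (e n) i j (x - y) \<partial>lborel) \<partial>lborel) \<longlonglongrightarrow> (\<integral>y. \<theta> y * (c * m * S j y) \<partial>lborel)"
    proof (rule integral_dominated_convergence[where w = "\<lambda>y. \<bar>\<theta> y\<bar> * (\<Sum>i\<in>UNIV. M * (\<integral>x. \<bar>v i x\<bar> \<partial>lborel))"])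
      have iE: "integrable lborel (\<lambda>x. v i x * ?E \<epsilon> i j (x - y))" if "0 \<le> \<epsilon>" "\<epsilon> \<le> 1" for \<epsilon> i y
        by (rule integrable_mult_bounded_shift[OF v test_functions_borel[OF Et] M(2)[OF that]])
      have cE: "(\<lambda>y. \<Sum>i\<in>UNIV. \<integral>x. v i x * ?E \<epsilon> i j (x - y) \<partial>lborel) \<in> borel_measurable borel" for \<epsilon>
        by (intro smooth_on_measurable smooth_on_sum open_UNIV smooth_on_convolution[OF v Et])
      show "(\<lambda>y. \<theta> y * (\<Sum>i\<in>UNIV. \<integral>x. v i x * ?E (e n) i j (x - y) \<partial>lborel)) \<in> borel_measurable lborel" for n
        using \<theta>b cE by (intro borel_measurable_times) auto
      show "(\<lambda>y. \<theta> y * (c * m * S j y)) \<in> borel_measurable lborel"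
        using \<theta>b smooth_on_measurable[OF Ssm] by (intro borel_measurable_times borel_measurable_const) auto
      show "integrable lborel (\<lambda>y. \<bar>\<theta> y\<bar> * (\<Sum>i\<in>UNIV. M * (\<integral>x. \<bar>v i x\<bar> \<partial>lborel)))" using \<theta>i by simp
      have lim: "(\<lambda>n. \<integral>x. v i x * ?E (e n) i j (x - y) \<partial>lborel) \<longlonglongrightarrow> (\<integral>x. v i x * ?E 0 i j (x - y) \<partial>lborel)" for i y
      proof (rule integral_dominated_convergence[where w = "\<lambda>x. \<bar>v i x\<bar> * M"])
        show "(\<lambda>x. v i x * ?E 0 i j (x - y)) \<in> borel_measurable lborel"
          "(\<lambda>x. v i x * ?E (e n) i j (x - y)) \<in> borel_measurable lborel" for n
          using borel_measurable_integrable[OF iE[OF order_refl zero_le_one]]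
            borel_measurable_integrable[OF iE[OF e(3,2)]] by auto
        show "integrable lborel (\<lambda>x. \<bar>v i x\<bar> * M)" using v by simp
        show "AE x in lborel. (\<lambda>n. v i x * ?E (e n) i j (x - y)) \<longlonglongrightarrow> v i x * ?E 0 i j (x - y)"
          by (intro AE_I2 tendsto_mult tendsto_const tendsto_parametrix_error[OF r e0])
        show "AE x in lborel. norm (v i x * ?E (e n) i j (x - y)) \<le> \<bar>v i x\<bar> * M" for n
          by (rule AE_I2, unfold real_norm_def abs_mult) (intro mult_left_mono M(2) e abs_ge_zero)
      qed
      have "c * m * S j y = (\<Sum>i\<in>UNIV. \<integral>x. v i x * ?E 0 i j (x - y) \<partial>lborel)" for y
        unfolding S_def times_divide_eq_right by (rule nonzero_mult_div_cancel_left[OF less_imp_neq[OF cm, symmetric]])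
      then show "AE y in lborel. (\<lambda>n. \<theta> y * (\<Sum>i\<in>UNIV. \<integral>x. v i x * ?E (e n) i j (x - y) \<partial>lborel)) \<longlonglongrightarrow> \<theta> y * (c * m * S j y)"
        by (simp only:) (intro AE_I2 tendsto_mult tendsto_const tendsto_sum lim)
      show "AE y in lborel. norm (\<theta> y * (\<Sum>i\<in>UNIV. \<integral>x. v i x * ?E (e n) i j (x - y) \<partial>lborel)) \<le> \<bar>\<theta> y\<bar> * (\<Sum>i\<in>UNIV. M * (\<integral>x. \<bar>v i x\<bar> \<partial>lborel))" for n
      proof (rule AE_I2)
        fix y
        have "\<bar>\<integral>x. v i x * ?E (e n) i j (x - y) \<partial>lborel\<bar> \<le> M * (\<integral>x. \<bar>v i x\<bar> \<partial>lborel)" for i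
        proof -
          have iv: "integrable lborel (\<lambda>x. \<bar>v i x\<bar> * M)" using v by simp
          have "norm (v i x * ?E (e n) i j (x - y)) \<le> \<bar>v i x\<bar> * M" for x
            unfolding real_norm_def abs_mult by (intro mult_left_mono M(2) e abs_ge_zero)
          from Bochner_Integration.integral_norm_bound_integral[OF iE[OF e(3,2)] iv this]
          show ?thesis by (simp add: mult.commute)
        qed
        then have "\<bar>\<Sum>i\<in>UNIV. \<integral>x. v i x * ?E (e n) i j (x - y) \<partial>lborel\<bar> \<le> (\<Sum>i\<in>UNIV. M * (\<integral>x. \<bar>v i x\<bar> \<partial>lborel))"
          by (intro order_trans[OF sum_abs] sum_mono)
        then show "norm (\<theta> y * (\<Sum>i\<in>UNIV. \<integral>x. v i x * ?E (e n) i j (x - y) \<partial>lborel)) \<le> \<bar>\<theta> y\<bar> * (\<Sum>i\<in>UNIV. M * (\<integral>x. \<bar>v i x\<bar> \<partial>lborel))"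
          unfolding real_norm_def abs_mult by (rule mult_left_mono) simp
      qed
    qed
    have "c * (\<integral>y. \<theta> y * (\<integral>x. v j x * ?k n (x - y) \<partial>lborel) \<partial>lborel) = (\<integral>y. \<theta> y * (\<Sum>i\<in>UNIV. \<integral>x. v i x * ?E (e n) i j (x - y) \<partial>lborel) \<partial>lborel)" for n
    proof -
      have "c * (\<integral>y. \<theta> y * (\<integral>x. v j x * ?k n (x - y) \<partial>lborel) \<partial>lborel) = (\<integral>y. \<theta> y * (c * (\<integral>x. v j x * ?k n (x - y) \<partial>lborel)) \<partial>lborel)"
        by (subst integral_mult_right_zero[symmetric]) (simp only: mult.left_commute)
      also have "\<dots> = (\<integral>y. \<theta> y * (\<Sum>i\<in>UNIV. \<integral>x. v i x * ?E (e n) i j (x - y) \<partial>lborel) \<partial>lborel)"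
      proof (rule Bochner_Integration.integral_cong[OF refl])
        fix y
        show "\<theta> y * (c * (\<integral>x. v j x * ?k n (x - y) \<partial>lborel)) = \<theta> y * (\<Sum>i\<in>UNIV. \<integral>x. v i x * ?E (e n) i j (x - y) \<partial>lborel)"
        proof (cases "y \<in> U")
          case True
          then show ?thesis by (simp only: identity)
        next
          case False
          from test_functions_zero_outside[OF \<theta> False] show ?thesis by simp
        qed
      qed
      finally show ?thesis .
    qed
    then have lim_eq: "c * (\<integral>x. v j x * (\<theta> x * m) \<partial>lborel) = (\<integral>y. \<theta> y * (c * m * S j y) \<partial>lborel)"
      using LIMSEQ_unique[OF tendsto_mult_left[OF lhs, of c]] rhs by simp
    have vt: "(\<integral>x. v j x * \<theta> x \<partial>lborel) = (\<integral>x. w x $ j * \<theta> x \<partial>lebesgue_on U)"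
    proof -
      have "(\<integral>x. w x $ j * \<theta> x \<partial>lebesgue_on U) = (\<integral>x. w x $ j * \<theta> x \<partial>lebesgue_on \<Omega>)"
      proof -
        have "(\<lambda>x. indicator U x * (w x $ j * \<theta> x)) = (\<lambda>x. indicator \<Omega> x * (w x $ j * \<theta> x))"
          using test_functions_zero_outside[OF \<theta>] U(2) by (auto simp: indicator_def fun_eq_iff)
        then show ?thesis using U(1) \<Omega> by (simp add: integral_lebesgue_on)
      qed
      then show ?thesis using vw[OF \<theta>b] by simp
    qed
    have St: "(\<integral>x. S j x * \<theta> x \<partial>lebesgue_on U) = (\<integral>x. S j x * \<theta> x \<partial>lborel)"
      by (rule integral_lebesgue_on_test_function[OF U(1) test_functions_mult[OF Ssm \<theta>]])
    have "(c * m) * (\<integral>x. v j x * \<theta> x \<partial>lborel) = (c * m) * (\<integral>x. S j x * \<theta> x \<partial>lborel)"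
    proof -
      have "(\<integral>x. v j x * (\<theta> x * m) \<partial>lborel) = m * (\<integral>x. v j x * \<theta> x \<partial>lborel)"
        by (subst integral_mult_right_zero[symmetric]) (simp add: mult_ac)
      moreover have "(\<integral>y. \<theta> y * (c * m * S j y) \<partial>lborel) = (c * m) * (\<integral>x. S j x * \<theta> x \<partial>lborel)"
        by (subst integral_mult_right_zero[symmetric]) (simp add: mult_ac)
      ultimately show ?thesis using lim_eq by (simp add: mult.assoc)
    qed
    then have "(\<integral>x. v j x * \<theta> x \<partial>lborel) = (\<integral>x. S j x * \<theta> x \<partial>lborel)"
      using mult_left_cancel[OF less_imp_neq[OF cm, symmetric]] by (simp only:)
    then show "(\<integral>x. (w x $ j - S j x) * \<theta> x \<partial>lebesgue_on U) = 0"
      using vt St integrable_mult_test_function[OF liw U(1) \<theta>] integrable_mult_test_function[OF liS U(1) \<theta>]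
      by (simp add: left_diff_distrib)
  qed
  have "AE x in lebesgue_on U. \<forall>j. w x $ j - S j x = 0" using ae by (simp add: AE_all_countable)
  then have "AE x in lebesgue_on U. \<forall>j. w x $ j = S j x" by simp
  then show ?thesis using Ssm by blast
qed

section \<open>Uniqueness\<close>

lemma lame_form_add_scaleR:
  assumes W: "integrable_weight \<Omega> \<omega>" and u: "vec_H10_approximation \<omega> \<Omega> u G \<Phi>" and v: "vec_H10_approximation \<omega> \<Omega> v H \<Psi>"
    and w: "w \<in> vec_H10 (\<lambda>x. inverse (\<omega> x)) \<Omega>"
  shows "lame_form \<mu> lam \<Omega> (\<lambda>x. c *\<^sub>R u x + v x) w = c * lame_form \<mu> lam \<Omega> u w + lame_form \<mu> lam \<Omega> v w"
proof -
  let ?D = "\<lambda>i j. weak_partial \<Omega> j (\<lambda>x. w x $ i)"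
  obtain \<Theta> where \<Theta>: "vec_H10_approximation (\<lambda>x. inverse (\<omega> x)) \<Omega> w ?D \<Theta>"
    using vec_H10_imp_approximation[OF integrable_weight_inverse[OF W] w] by blast
  show ?thesis
    unfolding lame_form_eq_pairing[OF W vec_H10_approximation_add[OF W vec_H10_approximation_scaleR[OF W u] v] \<Theta>]
      lame_form_eq_pairing[OF W u \<Theta>] lame_form_eq_pairing[OF W v \<Theta>]
    by (rule lame_pairing_lin[OF W vec_H10_approximationD(2)[OF u] vec_H10_approximationD(2)[OF v] vec_H10_approximationD(2)[OF \<Theta>]])
qed

lemma test_subset_vec_H10:
  "integrable_weight \<Omega> \<omega> \<Longrightarrow> \<phi> \<in> vec_test_functions \<Omega> \<Longrightarrow> \<phi> \<in> vec_H10 \<omega> \<Omega>"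
  by (rule vec_H10_approximation_imp_vec_H10[OF _ vec_H10_approximation_test])

lemma exists_cutoff_away_from_points:
  fixes x :: "nat \<Rightarrow> real^'n"
  assumes r: "r > 0" and \<Omega>: "\<And>k. k \<in> {1..K} \<Longrightarrow> cball (x k) (r / 2) \<subseteq> \<Omega>"
  shows "\<exists>\<eta>. smooth_on UNIV \<eta> \<and> (\<lambda>y. 1 - \<eta> y) \<in> test_functions \<Omega> \<and>
    (\<forall>k\<in>{1..K}. \<forall>y. norm (y - x k) < r / 4 \<longrightarrow> \<eta> y = 0)"
proof -
  define \<eta> where "\<eta> y = (\<Prod>k\<in>{1..K}. 1 - cutoff (r / 2) (x k) y)" for y
  have s: "smooth_on UNIV \<eta>"
    unfolding \<eta>_def by (intro smooth_on_prod smooth_on_diff smooth_on_const smooth_on_cutoff open_UNIV)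
  have one: "\<eta> y = 1" if "\<And>k. k \<in> {1..K} \<Longrightarrow> r / 2 < norm (y - x k)" for y
    unfolding \<eta>_def using r that by (intro prod.neutral ballI) (simp add: cutoff_eq_0 less_imp_le)
  show ?thesis
  proof (intro exI conjI ballI allI impI)
    show "smooth_on UNIV \<eta>" by (rule s)
    show "(\<lambda>y. 1 - \<eta> y) \<in> test_functions \<Omega>"
    proof (rule test_functionsI[where C = "\<Union>k\<in>{1..K}. cball (x k) (r / 2)"])
      show "smooth_on UNIV (\<lambda>y. 1 - \<eta> y)" by (intro smooth_on_diff smooth_on_const s open_UNIV)
      show "1 - \<eta> y = 0" if "y \<notin> (\<Union>k\<in>{1..K}. cball (x k) (r / 2))" for y
        using one[of y] that by (auto simp: dist_norm norm_minus_commute not_le)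
      show "(\<Union>k\<in>{1..K}. cball (x k) (r / 2)) \<subseteq> \<Omega>" using \<Omega> by (rule UN_least)
    qed (auto intro!: compact_UN)
    show "\<eta> y = 0" if k: "k \<in> {1..K}" "norm (y - x k) < r / 4" for k y
      unfolding \<eta>_def using r k by (intro prod_zero) (auto simp: cutoff_eq_1 intro!: bexI[of _ k])
  qed
qed

text \<open>A homogeneous solution is smooth near the points, so that it can be cut into a test function near
  the points and a remainder that lives where the weight is bounded above and below.  Hence it lies in
  the space with the inverse weight too, and may be used as a test function in its own equation.\<close>
lemma lame_homogeneous_zero:
  fixes x :: "nat \<Rightarrow> real^'n" and w :: "real^'n \<Rightarrow> real^'n"
  assumes d: "CARD('n) \<ge> 2" and \<Omega>: "open \<Omega>" "bounded \<Omega>" and \<mu>: "\<mu> > 0" "\<mu> + lam \<ge> 0"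
    and \<alpha>: "0 < \<alpha>" "\<alpha> < real CARD('n)" and K: "K \<ge> 1" and x: "\<And>k. k \<in> {1..K} \<Longrightarrow> x k \<in> \<Omega>"
    and w: "w \<in> vec_H10 (dist_weight K x \<alpha>) \<Omega>"
    and zero: "\<And>v. v \<in> vec_H10 (\<lambda>y. inverse (dist_weight K x \<alpha> y)) \<Omega> \<Longrightarrow> lame_form \<mu> lam \<Omega> w v = 0"
  shows "AE y in lebesgue_on \<Omega>. w y = 0"
proof -
  let ?\<rho> = "dist_weight K x \<alpha>" and ?M = "lebesgue_on \<Omega>"
  let ?\<rho>' = "\<lambda>y. inverse (?\<rho> y)"
  have W: "integrable_weight \<Omega> ?\<rho>" by (rule integrable_weight_dist_weight[OF \<Omega> \<alpha> K])
  note W' = integrable_weight_inverse[OF W] and W1 = integrable_weight_one[OF \<Omega>]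
  have pos: "AE y in ?M. 0 < ?\<rho> y" using W unfolding integrable_weight_def by simp
  obtain \<Phi> where app: "vec_H10_approximation ?\<rho> \<Omega> w (\<lambda>i j. weak_partial \<Omega> j (\<lambda>x. w x $ i)) \<Phi>"
    using vec_H10_imp_approximation[OF W w] by blast
  have zt: "lame_form \<mu> lam \<Omega> w \<phi> = 0" if "\<phi> \<in> vec_test_functions \<Omega>" for \<phi>
    by (rule zero[OF test_subset_vec_H10[OF W' that]])
  \<comment> \<open>A radius that works for all points at once.\<close>
  obtain r where r: "r > 0" "\<And>k. k \<in> {1..K} \<Longrightarrow> cball (x k) (2 * r) \<subseteq> \<Omega>"
  proof -
    have "\<forall>k\<in>{1..K}. \<exists>s>0. cball (x k) s \<subseteq> \<Omega>" using x \<Omega>(1) open_contains_cball by blast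
    then obtain s where s: "\<And>k. k \<in> {1..K} \<Longrightarrow> s k > 0 \<and> cball (x k) (s k) \<subseteq> \<Omega>" by metis
    define r where "r = Min (s ` {1..K}) / 2"
    have "r > 0" unfolding r_def using s K by (subst divide_pos_pos) (auto simp: Min_gr_iff)
    moreover have "cball (x k) (2 * r) \<subseteq> \<Omega>" if "k \<in> {1..K}" for k
    proof -
      have "2 * r \<le> s k" unfolding r_def using that by simp
      then show ?thesis using s[OF that] subset_cball by blast
    qed
    ultimately show ?thesis using that by blast
  qed
  define U where "U = (\<Union>k\<in>{1..K}. ball (x k) r)"
  have U: "open U" "U \<subseteq> \<Omega>" "cball y r \<subseteq> \<Omega>" if "y \<in> U" for y
  proof -
    have sub: "cball y r \<subseteq> \<Omega>" if "y \<in> U" for y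
    proof -
      obtain k where k: "k \<in> {1..K}" "dist (x k) y < r" using \<open>y \<in> U\<close> unfolding U_def by auto
      have "cball y r \<subseteq> cball (x k) (2 * r)"
      proof
        fix z assume "z \<in> cball y r"
        then show "z \<in> cball (x k) (2 * r)" using k(2) dist_triangle[of "x k" z y] by simp
      qed
      then show ?thesis using r(2)[OF k(1)] by blast
    qed
    show "open U" unfolding U_def by auto
    show "U \<subseteq> \<Omega>" using sub r(1) by (auto simp: subset_iff)
    show "cball y r \<subseteq> \<Omega>" using sub that by blast
  qed
  have U': "open U" "U \<subseteq> \<Omega>"
  proof -
    have "x 1 \<in> U" unfolding U_def using K r(1) by (auto intro!: bexI[of _ 1])
    from U[OF this] show "open U" "U \<subseteq> \<Omega>" by auto
  qed
  have \<mu>2: "2 * \<mu> + lam > 0" using \<mu> by simp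
  obtain S where S: "\<And>j. smooth_on UNIV (S j)" and Sw: "AE y in lebesgue_on U. \<forall>j. w y $ j = S j y"
    using lame_homogeneous_smooth[OF d W app zt \<mu>(1) \<mu>2 r(1) U' U(3)] by blast
  have SwM: "AE y in ?M. y \<in> U \<longrightarrow> (\<forall>j. w y $ j = S j y)"
    using Sw U' \<Omega>(1) by (auto simp: AE_lebesgue_on elim!: eventually_mono)
  have rU: "cball (x k) (r / 2) \<subseteq> U" if "k \<in> {1..K}" for k
    unfolding U_def using that r(1) by force
  obtain \<eta> where \<eta>: "smooth_on UNIV \<eta>" "(\<lambda>y. 1 - \<eta> y) \<in> test_functions U"
    "\<And>k y. k \<in> {1..K} \<Longrightarrow> norm (y - x k) < r / 4 \<Longrightarrow> \<eta> y = 0"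
    using exists_cutoff_away_from_points[of r K x U, OF r(1) rU] by blast
  define \<delta> where "\<delta> = (r / 4) powr \<alpha>"
  have \<delta>: "\<delta> > 0" unfolding \<delta>_def using r(1) by simp
  have far: "?\<rho>' y * t\<^sup>2 \<le> (B\<^sup>2 / \<delta>\<^sup>2) * ?\<rho> y"
    if t: "\<bar>t\<bar> \<le> B" and near: "\<And>k. k \<in> {1..K} \<Longrightarrow> norm (y - x k) < r / 4 \<Longrightarrow> t = 0" for y t B
  proof (cases "t = 0")
    case True
    then show ?thesis using integrable_weight_nonneg[OF W, of y] by simp
  next
    case False
    then have "r / 4 \<le> norm (y - x k)" if "k \<in> {1..K}" for k using near[OF that] by force
    then have \<rho>: "\<delta> \<le> ?\<rho> y" unfolding \<delta>_def using r(1) by (intro dist_weight_ge[OF \<alpha>(1) K]) auto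
    have "?\<rho>' y \<le> ?\<rho> y / \<delta>\<^sup>2"
    proof -
      have "\<delta>\<^sup>2 \<le> (?\<rho> y)\<^sup>2" using \<rho> \<delta> by (intro power_mono) auto
      then show ?thesis using \<rho> \<delta> by (simp add: field_simps power2_eq_square)
    qed
    moreover have "t\<^sup>2 \<le> B\<^sup>2" using t abs_le_square_iff[of t B] by simp
    ultimately have "?\<rho>' y * t\<^sup>2 \<le> (?\<rho> y / \<delta>\<^sup>2) * B\<^sup>2"
      using \<rho> \<delta> by (intro mult_mono) auto
    then show ?thesis by (simp add: mult.commute)
  qed
  obtain B0 where B0: "\<And>y. \<bar>1 - \<eta> y\<bar> \<le> B0" using test_functions_bounded[OF \<eta>(2)] by metis
  have d\<eta>: "partial_deriv i \<eta> y = - partial_deriv i (\<lambda>y. 1 - \<eta> y) y" for i y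
    using partial_deriv_diff[of "\<lambda>_. 1" y \<eta> i] smooth_on_imp_differentiable[OF \<eta>(1), of y] by (simp add: partial_deriv_const)
  have "\<exists>B. \<forall>y. \<bar>partial_deriv i (\<lambda>y. 1 - \<eta> y) y\<bar> \<le> B" for i
    using test_functions_bounded[OF test_functions_partial_deriv[OF \<eta>(2)]] by metis
  then obtain b where b: "\<And>i y. \<bar>partial_deriv i (\<lambda>y. 1 - \<eta> y) y\<bar> \<le> b i" by metis
  have b0: "0 \<le> b i" for i using order_trans[OF abs_ge_zero b] .
  define B where "B = B0 + 1 + (\<Sum>i\<in>UNIV. b i)"
  have B00: "0 \<le> B0" using order_trans[OF abs_ge_zero B0] .
  have bB: "b i \<le> B" for i
  proof -
    have "b i \<le> (\<Sum>i\<in>UNIV. b i)" by (rule member_le_sum) (use b0 in auto)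
    then show ?thesis using B00 unfolding B_def by linarith
  qed
  have \<eta>B: "\<bar>\<eta> y\<bar> \<le> B" for y
  proof -
    have "0 \<le> (\<Sum>i\<in>UNIV. b i)" using b0 by (simp add: sum_nonneg)
    then show ?thesis using B0[of y] unfolding B_def by linarith
  qed
  have c0: "AE y in ?M. ?\<rho>' y * (\<eta> y)\<^sup>2 \<le> (B\<^sup>2 / \<delta>\<^sup>2) * ?\<rho> y"
    by (intro AE_I2 far \<eta>B \<eta>(3))
  have c1: "AE y in ?M. ?\<rho>' y * (partial_deriv i \<eta> y)\<^sup>2 \<le> (B\<^sup>2 / \<delta>\<^sup>2) * ?\<rho> y" for i
  proof (intro AE_I2 far)
    fix y
    show "\<bar>partial_deriv i \<eta> y\<bar> \<le> B" unfolding d\<eta> using order_trans[OF b bB] by simp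
    fix k assume k: "k \<in> {1..K}" "norm (y - x k) < r / 4"
    show "partial_deriv i \<eta> y = 0"
      by (rule partial_deriv_locally_const[of "ball (x k) (r / 4)"])
        (use k \<eta>(3)[OF k(1)] in \<open>auto simp: dist_norm norm_minus_commute\<close>)
  qed
  have "\<exists>G \<phi>. H10_approximation ?\<rho>' \<Omega> (\<lambda>y. w y $ i) G \<phi>" for i
  proof -
    have a: "H10_approximation ?\<rho> \<Omega> (\<lambda>y. w y $ i) (\<lambda>j. weak_partial \<Omega> j (\<lambda>x. w x $ i)) (\<lambda>n y. \<Phi> n y $ i)"
      using app unfolding vec_H10_approximation_def by simp
    have t: "(\<lambda>y. S i y * (1 - \<eta> y)) \<in> test_functions \<Omega>"
      using test_functions_mult[OF S \<eta>(2)] test_functions_mono[OF U'(2)] by blast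
    note sum = H10_approximation_add[OF W' H10_approximation_mult[OF W W' a \<eta>(1) c0 c1] H10_approximation_test_function[OF W' t]]
    have "AE y in ?M. \<eta> y * w y $ i + S i y * (1 - \<eta> y) = w y $ i"
      using SwM
    proof eventually_elim
      case (elim y)
      show ?case
      proof (cases "y \<in> U")
        case True
        then show ?thesis using elim by (simp add: algebra_simps)
      next
        case False
        then have "1 - \<eta> y = 0" by (rule test_functions_zero_outside[OF \<eta>(2)])
        then have "\<eta> y = 1" by simp
        then show ?thesis by simp
      qed
    qed
    from H10_approximation_cong_AE[OF W' sum this] show ?thesis by blast
  qed
  then have wH: "w \<in> vec_H10 ?\<rho>' \<Omega>"
    unfolding vec_H10_def using H10_approximation_imp_H10[OF W'] by blast
  obtain \<Psi> where app': "vec_H10_approximation ?\<rho>' \<Omega> w (\<lambda>i j. weak_partial \<Omega> j (\<lambda>x. w x $ i)) \<Psi>"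
    using vec_H10_imp_approximation[OF W' wH] by blast
  obtain R where R: "R > 0" "\<And>y. y \<in> \<Omega> \<Longrightarrow> ?\<rho> y \<le> R"
    using dist_weight_bounded[OF \<Omega>(2) \<alpha>(1) K, of x] by metis
  have "AE y in ?M. 1 \<le> R * ?\<rho>' y"
    using pos AE_space
  proof eventually_elim
    case (elim y)
    then have "?\<rho> y \<le> R" using R(2) by simp
    then show ?case using elim(1) by (simp add: field_simps)
  qed
  then have "vec_H10_approximation (\<lambda>_. 1) \<Omega> w (\<lambda>i j. weak_partial \<Omega> j (\<lambda>x. w x $ i)) \<Psi>"
    using R(1) by (intro vec_H10_approximation_mono[OF W' W1 app', of R]) auto
  from lame_form_self_zero[OF \<Omega> \<mu> this zero[OF wH]] show ?thesis .
qed

section \<open>Existence\<close>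

lemma vec_H10_approximation_sum:
  assumes W: "integrable_weight \<Omega> \<omega>" and S: "finite S"
    and u: "\<And>s. s \<in> S \<Longrightarrow> \<exists>G \<Phi>. vec_H10_approximation \<omega> \<Omega> (u s) G \<Phi>"
  shows "\<exists>G \<Phi>. vec_H10_approximation \<omega> \<Omega> (\<lambda>x. \<Sum>s\<in>S. c s *\<^sub>R u s x) G \<Phi> \<and>
     (\<forall>\<phi>\<in>vec_test_functions \<Omega>. lame_form \<mu> lam \<Omega> (\<lambda>x. \<Sum>s\<in>S. c s *\<^sub>R u s x) \<phi> = (\<Sum>s\<in>S. c s * lame_form \<mu> lam \<Omega> (u s) \<phi>))"
  using S u
proof (induction S)
  case empty
  have z: "(\<lambda>x. 0) \<in> vec_test_functions \<Omega>" unfolding vec_test_functions_def using test_functions_zero by simp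
  note a = vec_H10_approximation_test[OF W z]
  have "lame_form \<mu> lam \<Omega> (\<lambda>x. 0) \<phi> = 0" if "\<phi> \<in> vec_test_functions \<Omega>" for \<phi>
    using lame_form_add_scaleR[OF W a a test_subset_vec_H10[OF integrable_weight_inverse[OF W] that], of \<mu> lam 1] by simp
  then show ?case using a by auto
next
  case (insert s S)
  obtain G \<Phi> where G: "vec_H10_approximation \<omega> \<Omega> (\<lambda>x. \<Sum>s\<in>S. c s *\<^sub>R u s x) G \<Phi>"
    and f: "\<And>\<phi>. \<phi> \<in> vec_test_functions \<Omega> \<Longrightarrow> lame_form \<mu> lam \<Omega> (\<lambda>x. \<Sum>s\<in>S. c s *\<^sub>R u s x) \<phi> = (\<Sum>s\<in>S. c s * lame_form \<mu> lam \<Omega> (u s) \<phi>)"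
    using insert by auto
  obtain H \<Psi> where H: "vec_H10_approximation \<omega> \<Omega> (u s) H \<Psi>" using insert.prems by blast
  have eq: "(\<lambda>x. \<Sum>s\<in>insert s S. c s *\<^sub>R u s x) = (\<lambda>x. c s *\<^sub>R u s x + (\<Sum>s\<in>S. c s *\<^sub>R u s x))"
    using insert by simp
  have "lame_form \<mu> lam \<Omega> (\<lambda>x. \<Sum>s\<in>insert s S. c s *\<^sub>R u s x) \<phi> = (\<Sum>s\<in>insert s S. c s * lame_form \<mu> lam \<Omega> (u s) \<phi>)"
    if "\<phi> \<in> vec_test_functions \<Omega>" for \<phi>
    unfolding eq lame_form_add_scaleR[OF W H G test_subset_vec_H10[OF integrable_weight_inverse[OF W] that]] f[OF that]
    using insert by simp
  moreover have "vec_H10_approximation \<omega> \<Omega> (\<lambda>x. \<Sum>s\<in>insert s S. c s *\<^sub>R u s x) (\<lambda>i j x. c s * H i j x + G i j x) (\<lambda>n x. c s *\<^sub>R \<Psi> n x + \<Phi> n x)"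
    unfolding eq by (rule vec_H10_approximation_add[OF W vec_H10_approximation_scaleR[OF W H] G])
  ultimately show ?case by blast
qed

text \<open>The sum of the cut off Kelvin columns produces the point loads up to bounded functions, which are
  removed by a solution with finite energy.\<close>
lemma lame_point_loads_solvable:
  fixes x f :: "nat \<Rightarrow> real^'n"
  assumes d: "CARD('n) \<ge> 2" and \<Omega>: "open \<Omega>" "bounded \<Omega>" and \<mu>: "\<mu> > 0" "\<mu> + lam \<ge> 0"
    and \<alpha>: "real CARD('n) - 2 < \<alpha>" "0 < \<alpha>" "\<alpha> < real CARD('n)" and K: "K \<ge> 1" and x: "\<And>k. k \<in> {1..K} \<Longrightarrow> x k \<in> \<Omega>"
  shows "\<exists>u G \<Phi>. vec_H10_approximation (dist_weight K x \<alpha>) \<Omega> u G \<Phi> \<and>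
    (\<forall>\<phi>\<in>vec_test_functions \<Omega>. lame_form \<mu> lam \<Omega> u \<phi> = (\<Sum>k=1..K. f k \<bullet> \<phi> (x k)))"
proof -
  let ?\<rho> = "dist_weight K x \<alpha>" and ?M = "lebesgue_on \<Omega>"
  define \<kappa> where "\<kappa> = (\<mu> + lam) / (2 * \<mu> + lam)"
  define c where "c = \<mu> * real CARD('n) * (real CARD('n) + 2) * dirac_mass TYPE('n)"
  have c: "c > 0" using \<mu>(1) d dirac_mass_pos[where ?'n = 'n] by (simp add: c_def)
  have \<mu>2: "2 * \<mu> + lam > 0" using \<mu> by simp
  have W: "integrable_weight \<Omega> ?\<rho>" by (rule integrable_weight_dist_weight[OF \<Omega> \<alpha>(2,3) K])
  note W' = integrable_weight_inverse[OF W] and W1 = integrable_weight_one[OF \<Omega>]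
  have "\<forall>k\<in>{1..K}. \<exists>s>0. cball (x k) s \<subseteq> \<Omega>" using x \<Omega>(1) open_contains_cball by blast
  then obtain r where r: "\<And>k. k \<in> {1..K} \<Longrightarrow> r k > 0" "\<And>k. k \<in> {1..K} \<Longrightarrow> cball (x k) (r k) \<subseteq> \<Omega>" by metis
  let ?S = "{1..K} \<times> (UNIV :: 'n set)"
  define P where "P s y = parametrix \<kappa> (r (fst s)) 0 (snd s) (y - x (fst s))" for s y
  define E where "E s i y = parametrix_error \<mu> lam \<kappa> (r (fst s)) 0 i (snd s) (y - x (fst s))" for s i y
  define a where "a s = f (fst s) $ snd s / c" for s
  have le: "?\<rho> y \<le> norm (y - x k) powr \<alpha>" if "k \<in> {1..K}" for k y
    by (rule dist_weight_le[OF \<alpha>(2) that])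
  define e where "e n = inverse (real (Suc n))" for n
  have e: "0 < e n" "e n \<le> 1" for n by (auto simp: e_def field_simps)
  have e0: "e \<longlonglongrightarrow> 0" unfolding e_def by (rule LIMSEQ_inverse_real_of_nat)
  have Papp: "\<exists>G \<Phi>. vec_H10_approximation ?\<rho> \<Omega> (P s) G \<Phi>" if "s \<in> ?S" for s
  proof -
    have k: "fst s \<in> {1..K}" using that by auto
    from parametrix_H10_approximation[OF d \<Omega> W \<alpha>(1,3) le[OF k] r(1)[OF k] r(2)[OF k] e e0, of \<kappa> "snd s"]
    show ?thesis unfolding P_def by blast
  qed
  have Pform: "lame_form \<mu> lam \<Omega> (P s) \<phi> = c * \<phi> (x (fst s)) $ snd s - (\<Sum>i\<in>UNIV. \<integral>y. E s i y * \<phi> y $ i \<partial>?M)"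
    if s: "s \<in> ?S" and \<phi>: "\<phi> \<in> vec_test_functions \<Omega>" for s \<phi>
  proof -
    have k: "fst s \<in> {1..K}" using s by auto
    from lame_form_parametrix_limit[OF d \<Omega> W \<alpha>(1,3) le[OF k] r(1)[OF k] r(2)[OF k] \<kappa>_def \<mu>2 \<phi>, of "snd s"]
    show ?thesis unfolding P_def E_def c_def .
  qed
  have EL: "E s i \<in> L2 (\<lambda>_. 1) \<Omega>" if "s \<in> ?S" for s i
  proof -
    have k: "r (fst s) > 0" using that r(1) by auto
    have t: "parametrix_error \<mu> lam \<kappa> (r (fst s)) 0 i (snd s) \<in> test_functions UNIV"
      by (rule test_functionsI[OF smooth_on_parametrix_error_UNIV[OF k] compact_cball[of 0 "r (fst s)"]])
        (auto intro!: parametrix_error_zero k)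
    obtain B where "\<And>x. \<bar>parametrix_error \<mu> lam \<kappa> (r (fst s)) 0 i (snd s) x\<bar> \<le> B"
      using test_functions_bounded[OF t] by metis
    then show ?thesis unfolding E_def
      by (intro L2_bounded[OF W1 borel_measurable_shift_lebesgue_on[OF test_functions_borel[OF t]]])
  qed
  have fin: "finite ?S" by simp
  have "\<exists>G \<Phi>. vec_H10_approximation ?\<rho> \<Omega> (\<lambda>y. \<Sum>s\<in>?S. a s *\<^sub>R P s y) G \<Phi> \<and>
     (\<forall>\<phi>\<in>vec_test_functions \<Omega>. lame_form \<mu> lam \<Omega> (\<lambda>y. \<Sum>s\<in>?S. a s *\<^sub>R P s y) \<phi> = (\<Sum>s\<in>?S. a s * lame_form \<mu> lam \<Omega> (P s) \<phi>))"
    by (rule vec_H10_approximation_sum[OF W fin Papp])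
  then obtain G1 \<Phi>1 where *: "vec_H10_approximation ?\<rho> \<Omega> (\<lambda>y. \<Sum>s\<in>?S. a s *\<^sub>R P s y) G1 \<Phi>1 \<and>
     (\<forall>\<phi>\<in>vec_test_functions \<Omega>. lame_form \<mu> lam \<Omega> (\<lambda>y. \<Sum>s\<in>?S. a s *\<^sub>R P s y) \<phi> = (\<Sum>s\<in>?S. a s * lame_form \<mu> lam \<Omega> (P s) \<phi>))"
    by (elim exE)
  note u1 = *[THEN conjunct1] and f1 = *[THEN conjunct2, rule_format]
  define g where "g i y = (\<Sum>s\<in>?S. a s * E s i y)" for i y
  have gL: "g i \<in> L2 (\<lambda>_. 1) \<Omega>" for i
    unfolding g_def by (intro L2_sum[OF W1] L2_cmult(1)[OF W1] EL)
  obtain z G2 \<Phi>2 where z: "vec_H10_approximation (\<lambda>_. 1) \<Omega> z G2 \<Phi>2"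
    and f2: "\<And>\<phi>. \<phi> \<in> vec_test_functions \<Omega> \<Longrightarrow> lame_form \<mu> lam \<Omega> z \<phi> = (\<Sum>i\<in>UNIV. \<integral>y. g i y * \<phi> y $ i \<partial>?M)"
  proof (rule lame_bounded_load_solvable[OF \<Omega> \<mu> gL])
    fix z G \<Phi>
    assume "vec_H10_approximation (\<lambda>_. 1) \<Omega> z G \<Phi>"
      "\<And>\<phi>. \<phi> \<in> vec_test_functions \<Omega> \<Longrightarrow> lame_form \<mu> lam \<Omega> z \<phi> = (\<Sum>i\<in>UNIV. \<integral>y. g i y * \<phi> y $ i \<partial>?M)"
    then show thesis by (rule that)
  qed
  obtain R where R: "R > 0" "\<And>y. y \<in> \<Omega> \<Longrightarrow> ?\<rho> y \<le> R"
    using dist_weight_bounded[OF \<Omega>(2) \<alpha>(2) K, of x] by metis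
  have "AE y in ?M. ?\<rho> y \<le> R * 1" using R(2) by (intro AE_I2) simp
  then have u2: "vec_H10_approximation ?\<rho> \<Omega> z G2 \<Phi>2"
    using R(1) by (intro vec_H10_approximation_mono[OF W1 W z, of R]) auto
  let ?u = "\<lambda>y. 1 *\<^sub>R (\<Sum>s\<in>?S. a s *\<^sub>R P s y) + z y"
  have app: "vec_H10_approximation ?\<rho> \<Omega> ?u (\<lambda>i j y. 1 * G1 i j y + G2 i j y) (\<lambda>n y. 1 *\<^sub>R \<Phi>1 n y + \<Phi>2 n y)"
    by (rule vec_H10_approximation_add[OF W vec_H10_approximation_scaleR[OF W u1] u2])
  have "lame_form \<mu> lam \<Omega> ?u \<phi> = (\<Sum>k=1..K. f k \<bullet> \<phi> (x k))" if \<phi>: "\<phi> \<in> vec_test_functions \<Omega>" for \<phi>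
  proof -
    have t: "(\<lambda>y. \<phi> y $ i) \<in> L2 (\<lambda>_. 1) \<Omega>" for i
      using \<phi> L2_test_function[OF W1] unfolding vec_test_functions_def by blast
    have ii: "integrable ?M (\<lambda>y. E s i y * \<phi> y $ i)" if "s \<in> ?S" for s i
      using L2_pairing(1)[OF W1 EL[OF that]] t by simp
    have g: "(\<integral>y. g i y * \<phi> y $ i \<partial>?M) = (\<Sum>s\<in>?S. a s * (\<integral>y. E s i y * \<phi> y $ i \<partial>?M))" for i
    proof -
      have "(\<integral>y. g i y * \<phi> y $ i \<partial>?M) = (\<integral>y. (\<Sum>s\<in>?S. a s * (E s i y * \<phi> y $ i)) \<partial>?M)"
        unfolding g_def sum_distrib_right by (simp add: mult_ac)
      also have "\<dots> = (\<Sum>s\<in>?S. \<integral>y. a s * (E s i y * \<phi> y $ i) \<partial>?M)"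
        by (rule Bochner_Integration.integral_sum) (use ii in simp)
      finally show ?thesis by simp
    qed
    have "lame_form \<mu> lam \<Omega> ?u \<phi> = (\<Sum>s\<in>?S. a s * lame_form \<mu> lam \<Omega> (P s) \<phi>) + (\<Sum>i\<in>UNIV. \<integral>y. g i y * \<phi> y $ i \<partial>?M)"
      unfolding lame_form_add_scaleR[OF W u1 u2 test_subset_vec_H10[OF W' \<phi>]] f1[OF \<phi>] f2[OF \<phi>] by simp
    also have "(\<Sum>s\<in>?S. a s * lame_form \<mu> lam \<Omega> (P s) \<phi>) =
        (\<Sum>s\<in>?S. a s * (c * \<phi> (x (fst s)) $ snd s) - a s * (\<Sum>i\<in>UNIV. \<integral>y. E s i y * \<phi> y $ i \<partial>?M))"
      by (intro sum.cong refl) (simp add: Pform[OF _ \<phi>] right_diff_distrib)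
    also have "(\<Sum>i\<in>UNIV. \<integral>y. g i y * \<phi> y $ i \<partial>?M) = (\<Sum>s\<in>?S. a s * (\<Sum>i\<in>UNIV. \<integral>y. E s i y * \<phi> y $ i \<partial>?M))"
      unfolding g sum_distrib_left by (rule sum.swap)
    finally have "lame_form \<mu> lam \<Omega> ?u \<phi> = (\<Sum>s\<in>?S. a s * (c * \<phi> (x (fst s)) $ snd s))"
      unfolding sum_subtractf by simp
    also have "\<dots> = (\<Sum>s\<in>?S. f (fst s) $ snd s * \<phi> (x (fst s)) $ snd s)"
      using c unfolding a_def by (intro sum.cong) auto
    also have "\<dots> = (\<Sum>k=1..K. \<Sum>j\<in>UNIV. f k $ j * \<phi> (x k) $ j)"
      by (simp add: sum.cartesian_product case_prod_beta)
    finally show ?thesis by (simp add: inner_vec_def)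
  qed
  then show ?thesis using app by blast
qed

theorem corollary1:
  fixes \<Omega> :: "(real^'n) set" and \<mu> lam \<alpha> :: real
    and K :: nat and x f :: "nat \<Rightarrow> real^'n"
  assumes "CARD('n) \<in> {2, 3}"
    and "bounded_lipschitz_domain \<Omega>"
    and "\<mu> > 0" and "lam > 0"
    and "real CARD('n) - 2 < \<alpha>" and "\<alpha> < real CARD('n)"
    and "K \<ge> 1" and "\<forall>k\<in>{1..K}. x k \<in> \<Omega>"
  defines "\<rho> \<equiv> dist_weight K x \<alpha>"
  defines "\<rho>inv \<equiv> (\<lambda>y. inverse (\<rho> y))"
  shows "\<exists>u\<in>vec_H10 \<rho> \<Omega>.
           (\<forall>v\<in>vec_H10 \<rho>inv \<Omega>. lame_form \<mu> lam \<Omega> u v = dirac_load \<rho>inv \<Omega> K f x v) \<and>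
           (\<forall>w\<in>vec_H10 \<rho> \<Omega>.
              (\<forall>v\<in>vec_H10 \<rho>inv \<Omega>. lame_form \<mu> lam \<Omega> w v = dirac_load \<rho>inv \<Omega> K f x v)
              \<longrightarrow> (AE y in lebesgue_on \<Omega>. w y = u y))"
proof -
  have d: "CARD('n) \<ge> 2" and \<Omega>: "open \<Omega>" "bounded \<Omega>" and \<alpha>0: "0 < \<alpha>" and \<mu>: "\<mu> > 0" "\<mu> + lam \<ge> 0"
    and x: "\<And>k. k \<in> {1..K} \<Longrightarrow> x k \<in> \<Omega>"
    using assms unfolding bounded_lipschitz_domain_def by auto
  have W: "integrable_weight \<Omega> \<rho>" unfolding \<rho>_def by (rule integrable_weight_dist_weight[OF \<Omega> \<alpha>0 assms(6,7)])
  have "\<exists>u G \<Phi>. vec_H10_approximation \<rho> \<Omega> u G \<Phi> \<and>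
      (\<forall>\<phi>\<in>vec_test_functions \<Omega>. lame_form \<mu> lam \<Omega> u \<phi> = (\<Sum>k=1..K. f k \<bullet> \<phi> (x k)))"
    unfolding \<rho>_def by (rule lame_point_loads_solvable[OF d \<Omega> \<mu> assms(5) \<alpha>0 assms(6,7) x])
  then obtain u G \<Phi> where *: "vec_H10_approximation \<rho> \<Omega> u G \<Phi> \<and>
      (\<forall>\<phi>\<in>vec_test_functions \<Omega>. lame_form \<mu> lam \<Omega> u \<phi> = (\<Sum>k=1..K. f k \<bullet> \<phi> (x k)))"
    by (elim exE)
  note u = *[THEN conjunct1] and test = *[THEN conjunct2, rule_format]
  have load: "dirac_load \<rho>inv \<Omega> K f x v = lame_form \<mu> lam \<Omega> u v" if "v \<in> vec_H10 \<rho>inv \<Omega>" for v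
    unfolding \<rho>inv_def by (rule dirac_load_eq_lame_form[OF W u test that[unfolded \<rho>inv_def]])
  have uH: "u \<in> vec_H10 \<rho> \<Omega>" by (rule vec_H10_approximation_imp_vec_H10[OF W u])
  have unique: "AE y in lebesgue_on \<Omega>. w y = u y"
    if w: "w \<in> vec_H10 \<rho> \<Omega>" and sol: "\<forall>v\<in>vec_H10 \<rho>inv \<Omega>. lame_form \<mu> lam \<Omega> w v = dirac_load \<rho>inv \<Omega> K f x v" for w
  proof -
    obtain \<Psi> where \<Psi>: "vec_H10_approximation \<rho> \<Omega> w (\<lambda>i j. weak_partial \<Omega> j (\<lambda>x. w x $ i)) \<Psi>"
      using vec_H10_imp_approximation[OF W w] by blast
    have "AE y in lebesgue_on \<Omega>. (-1) *\<^sub>R u y + w y = 0"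
    proof (rule lame_homogeneous_zero[OF d \<Omega> \<mu> \<alpha>0 assms(6,7) x])
      show "(\<lambda>y. (-1) *\<^sub>R u y + w y) \<in> vec_H10 (dist_weight K x \<alpha>) \<Omega>"
        using vec_H10_add_scaleR[OF W uH w, of "-1"] unfolding \<rho>_def .
      show "lame_form \<mu> lam \<Omega> (\<lambda>y. (-1) *\<^sub>R u y + w y) v = 0"
        if "v \<in> vec_H10 (\<lambda>y. inverse (dist_weight K x \<alpha> y)) \<Omega>" for v
      proof -
        have v: "v \<in> vec_H10 \<rho>inv \<Omega>" using that unfolding \<rho>inv_def \<rho>_def .
        show ?thesis
          using lame_form_add_scaleR[OF W u \<Psi> v[unfolded \<rho>inv_def], of \<mu> lam "-1"] sol v load[OF v] by simp
      qed
    qed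
    then show ?thesis by eventually_elim simp
  qed
  show ?thesis using uH load unique by (intro bexI[of _ u]) auto
qed

end
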